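(* Let $X$ be a topological space admitting an amenable open cover $\mathcal{U}$ of multiplicity $k$. Then for every $n\geq k$ and every $\alpha\in H_n(X;\mathbb{R})$, the class $\alpha$ is $\ell^1$-invisible, i.e. $\iota_n(\alpha)=0$ in $H_n^{\ell^1}(X;\mathbb{R})$.
   Context: A subset $U\subseteq X$ (not necessarily path connected) is amenable in $X$ if for every $x_0\in U$ the image of $\pi_1(U,x_0)\to\pi_1(X,x_0)$ induced by inclusion is an amenable group. A cover $\mathcal{U}=\{U_i\}_{i\in I}$ of $X$ is open if each $U_i$ is open, amenable if each $U_i$ is amenable in $X$, and its multiplicity is $\sup\{\#J : J\subseteq I,\ \bigcap_{i\in J}U_i\neq\emptyset\}$. $H_*(X;\mathbb{R})$ is real singular homology. $C_n(X)$ denotes real singular $n$-chains with the $\ell^1$-norm $\|\sum a_\sigma\sigma\|_1=\sum|a_\sigma|$ (over singular simplices $\sigma$); $C_n^{\ell^1}(X)$ is its metric completion (possibly infinite combinations $\sum a_\sigma\sigma$ with $\sum|a_\sigma|<\infty$), with the boundary operator extended by continuity, and $H_*^{\ell^1}(X;\mathbb{R})$ is the homology of this complex ($\ell^1$-homology). $\iota_*\colon H_*(X;\mathbb{R})\to H_*^{\ell^1}(X;\mathbb{R})$ is induced by the inclusion $C_*(X)\hookrightarrow C_*^{\ell^1}(X)$. A class $\alpha$ is called $\ell^1$-invisible if $\iota_n(\alpha)=0$. *)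

theory Defs
  imports "HOL-Analysis.Analysis" "HOL-Homology.Homology"
begin

definition loops :: "'a topology \<Rightarrow> 'a \<Rightarrow> (real \<Rightarrow> 'a) set" where
  "loops X x0 = {p. continuous_map (top_of_set {0..1}) X p \<and> p 0 = x0 \<and> p 1 = x0}"

definition loop_homotopic :: "'a topology \<Rightarrow> 'a \<Rightarrow> (real \<Rightarrow> 'a) \<Rightarrow> (real \<Rightarrow> 'a) \<Rightarrow> bool" where
  "loop_homotopic X x0 p q =
     homotopic_with (\<lambda>h. h 0 = x0 \<and> h 1 = x0) (top_of_set {0..1}) X p q"

definition loop_class :: "'a topology \<Rightarrow> 'a \<Rightarrow> (real \<Rightarrow> 'a) \<Rightarrow> (real \<Rightarrow> 'a) set" where
  "loop_class X x0 p = {q \<in> loops X x0. loop_homotopic X x0 p q}"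

definition loop_concat :: "(real \<Rightarrow> 'a) \<Rightarrow> (real \<Rightarrow> 'a) \<Rightarrow> real \<Rightarrow> 'a" where
  "loop_concat p q = (\<lambda>t. if t \<le> 1/2 then p (2 * t) else q (2 * t - 1))"

definition fundamental_group :: "'a topology \<Rightarrow> 'a \<Rightarrow> (real \<Rightarrow> 'a) set monoid" where
  "fundamental_group X x0 =
     \<lparr>carrier = loop_class X x0 ` loops X x0,
      mult = (\<lambda>A B. {q \<in> loops X x0. \<exists>p\<in>A. \<exists>p'\<in>B. loop_homotopic X x0 (loop_concat p p') q}),
      one = loop_class X x0 (\<lambda>t. x0)\<rparr>"

definition fundamental_group_image :: "'a topology \<Rightarrow> 'a set \<Rightarrow> 'a \<Rightarrow> (real \<Rightarrow> 'a) set monoid" where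
  "fundamental_group_image X U x0 =
     (fundamental_group X x0)\<lparr>carrier := loop_class X x0 ` loops (subtopology X U) x0\<rparr>"

definition amenable_group :: "('g, 'b) monoid_scheme \<Rightarrow> bool" where
  "amenable_group G \<longleftrightarrow> group G \<and>
     (\<exists>\<mu> :: 'g set \<Rightarrow> real.
        (\<forall>A. A \<subseteq> carrier G \<longrightarrow> 0 \<le> \<mu> A) \<and>
        \<mu> (carrier G) = 1 \<and>
        (\<forall>A B. A \<subseteq> carrier G \<longrightarrow> B \<subseteq> carrier G \<longrightarrow> A \<inter> B = {} \<longrightarrow> \<mu> (A \<union> B) = \<mu> A + \<mu> B) \<and>
        (\<forall>g\<in>carrier G. \<forall>A. A \<subseteq> carrier G \<longrightarrow> \<mu> ((\<lambda>x. g \<otimes>\<^bsub>G\<^esub> x) ` A) = \<mu> A))"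

definition amenable_in :: "'a topology \<Rightarrow> 'a set \<Rightarrow> bool" where
  "amenable_in X U \<longleftrightarrow> (\<forall>x0\<in>U. amenable_group (fundamental_group_image X U x0))"

definition cover_multiplicity :: "'a topology \<Rightarrow> 'i set \<Rightarrow> ('i \<Rightarrow> 'a set) \<Rightarrow> nat \<Rightarrow> bool" where
  "cover_multiplicity X I U k \<longleftrightarrow>
     (\<forall>J. J \<subseteq> I \<longrightarrow> topspace X \<inter> \<Inter>(U ` J) \<noteq> {} \<longrightarrow> finite J \<and> card J \<le> k) \<and>
     (\<exists>J. J \<subseteq> I \<and> finite J \<and> card J = k \<and> topspace X \<inter> \<Inter>(U ` J) \<noteq> {})"

type_synonym 'a rchain = "((nat \<Rightarrow> real) \<Rightarrow> 'a) \<Rightarrow> real"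

definition real_chain :: "nat \<Rightarrow> 'a topology \<Rightarrow> 'a rchain \<Rightarrow> bool" where
  "real_chain p X c \<longleftrightarrow> finite {s. c s \<noteq> 0} \<and> (\<forall>s. c s \<noteq> 0 \<longrightarrow> singular_simplex p X s)"

text \<open>Element of the completion: possibly infinite combination with finite l1-norm.\<close>
definition l1_chain :: "nat \<Rightarrow> 'a topology \<Rightarrow> 'a rchain \<Rightarrow> bool" where
  "l1_chain p X c \<longleftrightarrow> (\<lambda>s. norm (c s)) summable_on UNIV \<and> (\<forall>s. c s \<noteq> 0 \<longrightarrow> singular_simplex p X s)"

text \<open>Boundary operator (on finite chains the usual one; on l1-chains its continuous extension).\<close>
definition rchain_boundary :: "nat \<Rightarrow> 'a rchain \<Rightarrow> 'a rchain" where
  "rchain_boundary p c = (\<lambda>t. if p = 0 then 0 else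
      (\<Sum>k\<le>p. (-1) ^ k * (\<Sum>\<^sub>\<infinity>s\<in>{s. singular_face p k s = t}. c s)))"

end

theory Submission
  imports Defs
begin

text \<open>For a subset \<open>V\<close> of a member of the cover let \<open>K\<^sub>V\<close> consist of the simplices of \<open>X\<close> with vertices in \<open>V\<close>
  and edges homotopic, relative to their end points, to paths in \<open>V\<close>. This is a Kan complex whose
  fundamental groups are subgroups of amenable groups and whose higher homotopy groups are abelian.
  Averaging over the fillers of horns therefore yields for every simplex \<open>\<sigma>\<close> a mean on the cones over
  \<open>\<sigma>\<close> that is compatible with faces. Dually this is a contraction of norm one of the bounded cochains
  in positive degrees, and by Hahn--Banach every \<open>\<ell>\<^sup>1\<close>-cycle of positive degree on \<open>K\<^sub>V\<close> is an
  \<open>\<ell>\<^sup>1\<close>-boundary.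

  A cycle on \<open>X\<close> is subdivided until each of its simplices lies in a member of the cover, and is then
  pushed through the Cech double complex of the cover. The zigzag dies in column \<open>k\<close>, and on the way
  back only cycles of degree at least \<open>n - k + 1 \<ge> 1\<close> on the complexes \<open>K\<^sub>V\<close>, with \<open>V\<close> an intersection
  of members of the cover, have to be filled.\<close>

section \<open>Kan complexes\<close>

definition pos :: "nat set => nat => nat" where
  "pos B v = card {b \<in> B. b < v}"

lemma pos_less_card: "finite B ==> v \<in> B ==> pos B v < card B"
  unfolding pos_def by (rule psubset_card_mono) auto

lemma pos_strict_mono: "finite B ==> v \<in> B ==> v < w ==> pos B v < pos B w"
  unfolding pos_def by (rule psubset_card_mono) auto

lemma pos_eq_iff: "finite B ==> v \<in> B ==> w \<in> B ==> pos B v = pos B w \<longleftrightarrow> v = w"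
  by (metis linorder_neqE_nat order_less_irrefl pos_strict_mono)

lemma pos_Diff:
  assumes "finite B" "w \<in> B"
  shows "pos (B - {w}) v = pos B v - (if w < v then 1 else 0)"
proof -
  have "{b \<in> B - {w}. b < v} = (if w < v then {b \<in> B. b < v} - {w} else {b \<in> B. b < v})" by auto
  then show ?thesis using assms by (simp add: pos_def)
qed

lemma pos_surj:
  assumes "finite B" "i < card B"
  obtains b where "b \<in> B" "pos B b = i"
proof -
  have "inj_on (pos B) B" using assms by (auto simp: inj_on_def pos_eq_iff)
  then have "card (pos B ` B) = card B" by (rule card_image)
  moreover have "pos B ` B \<subseteq> {..<card B}" using assms pos_less_card by auto
  ultimately have "pos B ` B = {..<card B}" by (simp add: card_subset_eq)
  then show thesis using assms that by (metis imageE lessThan_iff)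
qed

lemma pos_image:
  assumes "strict_mono_on B f" "v \<in> B"
  shows "pos (f ` B) (f v) = pos B v"
proof -
  have "{b \<in> f ` B. b < f v} = f ` {b \<in> B. b < v}" using assms by (auto simp: strict_mono_on_less)
  moreover have "inj_on f {b \<in> B. b < v}"
    using assms(1) by (metis (no_types, lifting) inj_on_subset mem_Collect_eq strict_mono_on_imp_inj_on subsetI)
  ultimately show ?thesis by (simp add: pos_def card_image)
qed

lemma pos_atMost: "i \<le> m ==> pos {..m} i = i"
proof -
  assume "i \<le> m"
  then have "{b \<in> {..m}. b < i} = {..<i}" by auto
  then show ?thesis by (simp add: pos_def)
qed

lemma pos_doubleton:
  assumes "a < b"
  shows "pos {a, b} a = 0" "pos {a, b} b = 1"
proof -
  have "{x \<in> {a, b}. x < a} = {}" "{x \<in> {a, b}. x < b} = {a}" using assms by auto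
  then show "pos {a, b} a = 0" "pos {a, b} b = 1" by (simp_all add: pos_def)
qed

lemma Diff_singleton_nonempty: "2 \<le> card B ==> B - {v} \<noteq> {}"
  using card_mono[of "{v}" B] by auto

definition skip :: "nat => nat => nat" where
  "skip v x = (if x < v then x else Suc x)"

lemma strict_mono_skip: "strict_mono (skip v)"
  by (auto simp: strict_mono_def skip_def)

locale kan_complex =
  fixes K :: "nat => 's set" and d :: "nat => nat => 's => 's"
  assumes face_in: "\<And>p k x. x \<in> K (Suc p) ==> k \<le> Suc p ==> d (Suc p) k x \<in> K p"
    and face_face: "\<And>p i k x. x \<in> K (Suc (Suc p)) ==> i < k ==> k \<le> Suc (Suc p) ==>
      d (Suc p) i (d (Suc (Suc p)) k x) = d (Suc p) (k - 1) (d (Suc (Suc p)) i x)"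
    and horn: "\<And>p j x. j \<le> Suc (Suc p) ==>
      (\<And>i. i \<le> Suc (Suc p) ==> i \<noteq> j ==> x i \<in> K (Suc p)) ==>
      (\<And>i k. i < k ==> k \<le> Suc (Suc p) ==> i \<noteq> j ==> k \<noteq> j ==>
        d (Suc p) i (x k) = d (Suc p) (k - 1) (x i)) ==>
      \<exists>t\<in>K (Suc (Suc p)). \<forall>i\<le>Suc (Suc p). i \<noteq> j --> d (Suc (Suc p)) i t = x i"
begin

subsection \<open>Labelled simplices\<close>

text \<open>A simplex of dimension \<open>card B - 1\<close> is thought of as having the vertex set \<open>B\<close>, in increasing order;
  \<open>lface B v t\<close> is its face opposite to \<open>v\<close>.\<close>

definition lface :: "nat set => nat => 's => 's" where
  "lface B v t = d (card B - 1) (pos B v) t"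

lemma lface_in:
  assumes "finite B" "2 \<le> card B" "v \<in> B" "t \<in> K (card B - 1)"
  shows "lface B v t \<in> K (card (B - {v}) - 1)"
proof -
  obtain p where "card B = Suc (Suc p)" using assms(2) that[of "card B - 2"] by simp
  then show ?thesis using assms face_in[of t p "pos B v"] pos_less_card[of B v] by (simp add: lface_def)
qed

lemma lface_commute:
  assumes "finite B" "3 \<le> card B" "v \<in> B" "w \<in> B" "v \<noteq> w" "t \<in> K (card B - 1)"
  shows "lface (B - {w}) v (lface B w t) = lface (B - {v}) w (lface B v t)"
proof -
  obtain p where p: "card B = Suc (Suc (Suc p))" using assms(2) that[of "card B - 3"] by simp
  have less: "lface (B - {w}) v (lface B w t) = lface (B - {v}) w (lface B v t)"
    if "v \<in> B" "w \<in> B" "v < w" for v w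
  proof -
    have "pos B v < pos B w" "pos B w \<le> Suc (Suc p)"
      using that assms p pos_strict_mono[of B v w] pos_less_card[of B w] by auto
    then show ?thesis using that assms p face_face[of t p "pos B v" "pos B w"] by (simp add: lface_def pos_Diff)
  qed
  show ?thesis using less[of v w] less[of w v] assms(3-5) by (cases v w rule: linorder_cases) auto
qed

lemma lface_atMost: "i \<le> m ==> lface {..m} i t = d m i t"
  by (simp add: lface_def pos_atMost)

lemma lface_doubleton: "a < b ==> lface {a, b} a e = d 1 0 e" "a < b ==> lface {a, b} b e = d 1 1 e"
  by (simp_all add: lface_def pos_doubleton)

lemma horn_labelled:
  assumes fin: "finite A" and card: "3 \<le> card A" and v: "v \<in> A"
    and x: "\<And>b. b \<in> A ==> b \<noteq> v ==> x b \<in> K (card A - 2)"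
    and compat: "\<And>b c. b \<in> A ==> c \<in> A ==> b \<noteq> v ==> c \<noteq> v ==> b \<noteq> c ==>
      lface (A - {b}) c (x b) = lface (A - {c}) b (x c)"
  shows "\<exists>t\<in>K (card A - 1). \<forall>b\<in>A. b \<noteq> v --> lface A b t = x b"
proof -
  obtain p where p: "card A = Suc (Suc (Suc p))" using card that[of "card A - 3"] by simp
  have "\<exists>b. b \<in> A \<and> pos A b = i" if "i \<le> Suc (Suc p)" for i
    using pos_surj[OF fin, of i] that p by auto
  then obtain e where e: "\<And>i. i \<le> Suc (Suc p) ==> e i \<in> A \<and> pos A (e i) = i" by metis
  have e_pos: "e (pos A b) = b" if "b \<in> A" for b
    using e[of "pos A b"] that pos_less_card[OF fin that] p pos_eq_iff[OF fin, of "e (pos A b)" b] by simp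
  have "\<exists>t\<in>K (Suc (Suc p)). \<forall>i\<le>Suc (Suc p). i \<noteq> pos A v --> d (Suc (Suc p)) i t = x (e i)"
  proof (rule horn)
    show "pos A v \<le> Suc (Suc p)" using pos_less_card[OF fin v] p by simp
    show "x (e i) \<in> K (Suc p)" if "i \<le> Suc (Suc p)" "i \<noteq> pos A v" for i
      using x[of "e i"] e[of i] that p by (cases "e i = v") auto
    show "d (Suc p) i (x (e k)) = d (Suc p) (k - 1) (x (e i))"
      if "i < k" "k \<le> Suc (Suc p)" "i \<noteq> pos A v" "k \<noteq> pos A v" for i k
    proof -
      have "e i < e k"
        using e[of i] e[of k] that pos_strict_mono[OF fin, of "e k" "e i"]
        by (cases "e i" "e k" rule: linorder_cases) auto
      moreover have "e i \<noteq> v" "e k \<noteq> v" "e i \<in> A" "e k \<in> A"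
        using e[of i] e[of k] that by auto
      ultimately show ?thesis
        using compat[of "e k" "e i"] e[of i] e[of k] that fin p by (simp add: lface_def pos_Diff)
    qed
  qed
  then obtain t where t: "t \<in> K (Suc (Suc p))"
    "\<And>i. i \<le> Suc (Suc p) ==> i \<noteq> pos A v ==> d (Suc (Suc p)) i t = x (e i)"
    by blast
  have "lface A b t = x b" if "b \<in> A" "b \<noteq> v" for b
    using t(2)[of "pos A b"] that pos_less_card[OF fin, of b] p e_pos pos_eq_iff[OF fin, of b v] v
    by (simp add: lface_def)
  then show ?thesis using t(1) p by auto
qed

definition coherent :: "nat set set => (nat set => 's) => bool" where
  "coherent F s \<longleftrightarrow> (\<forall>B\<in>F. finite B \<and> B \<noteq> {} \<and> s B \<in> K (card B - 1) \<and>
    (2 \<le> card B --> (\<forall>v\<in>B. B - {v} \<in> F \<and> lface B v (s B) = s (B - {v}))))"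

lemma coherentD:
  assumes "coherent F s" "B \<in> F"
  shows "finite B" "B \<noteq> {}" "s B \<in> K (card B - 1)"
    "2 \<le> card B ==> v \<in> B ==> B - {v} \<in> F"
    "2 \<le> card B ==> v \<in> B ==> lface B v (s B) = s (B - {v})"
  using assms by (auto simp: coherent_def)

lemma coherent_cong: "coherent F s ==> (\<And>B. B \<in> F ==> s' B = s B) ==> coherent F s'"
  by (auto simp: coherent_def)

lemma coherent_subset:
  assumes "coherent F s" "G \<subseteq> F" "\<And>B v. B \<in> G ==> v \<in> B ==> 2 \<le> card B ==> B - {v} \<in> G"
  shows "coherent G s"
  using assms unfolding coherent_def by blast

lemma coherent_Un: "coherent F s ==> coherent G s ==> coherent (F \<union> G) s"
  unfolding coherent_def by blast

lemma coherent_remove: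
  assumes "coherent F s" "B \<in> F" "v \<in> B" "2 \<le> card (B - {v})"
  shows "B - {v} \<in> F"
  using coherentD(4)[OF assms(1,2) _ assms(3)] card_Diff1_le[of B v] assms(4) by linarith

lemma coherent_fun_upd:
  assumes "coherent F s" "finite A" "A \<noteq> {}" "y \<in> K (card A - 1)"
    and "\<And>v. v \<in> A ==> 2 \<le> card A ==> A - {v} \<in> F \<and> lface A v y = s (A - {v})"
    and "\<And>B v. B \<in> F ==> v \<in> B ==> B \<noteq> A ==> B - {v} = A ==> lface B v (s B) = y"
  shows "coherent (insert A F) (s(A := y))"
  unfolding coherent_def
proof (intro ballI conjI impI)
  fix B assume B: "B \<in> insert A F"
  show "finite B" "B \<noteq> {}" "(s(A := y)) B \<in> K (card B - 1)"
    using B assms coherentD[OF assms(1), of B] by auto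
  fix v assume v: "2 \<le> card B" "v \<in> B"
  show "B - {v} \<in> insert A F" using B v assms(5) coherentD(4)[OF assms(1), of B v] by blast
  show "lface B v ((s(A := y)) B) = (s(A := y)) (B - {v})"
  proof (cases "B = A")
    case True
    then have "B - {v} \<noteq> A" using v by auto
    then show ?thesis using True v assms(5)[of v] by simp
  next
    case False
    then show ?thesis using B v assms(6)[of B v] coherentD(5)[OF assms(1), of B v] by auto
  qed
qed

lemma coherent_cone_horn:
  assumes F: "coherent F s" and B: "finite B" "a \<notin> B" "2 \<le> card B"
    and sides: "\<And>b. b \<in> B ==> insert a (B - {b}) \<in> F"
  shows "\<exists>t\<in>K (card B). \<forall>b\<in>B. lface (insert a B) b t = s (insert a (B - {b}))"
proof -
  let ?A = "insert a B"
  have card: "card ?A = Suc (card B)" using B by simp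
  have remove: "?A - {b} = insert a (B - {b})" if "b \<in> B" for b
    using that B by auto
  have "\<exists>t\<in>K (card ?A - 1). \<forall>b\<in>?A. b \<noteq> a --> lface ?A b t = s (?A - {b})"
  proof (rule horn_labelled)
    show "finite ?A" "3 \<le> card ?A" "a \<in> ?A" using B card by auto
    show "s (?A - {b}) \<in> K (card ?A - 2)" if "b \<in> ?A" "b \<noteq> a" for b
      using coherentD(3)[OF F sides[of b]] that B card remove[of b] by (simp add: numeral_2_eq_2)
    show "lface (?A - {b}) c (s (?A - {b})) = lface (?A - {c}) b (s (?A - {c}))"
      if "b \<in> ?A" "c \<in> ?A" "b \<noteq> a" "c \<noteq> a" "b \<noteq> c" for b c
    proof -
      have face: "lface (?A - {b}) c (s (?A - {b})) = s (?A - {b} - {c})"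
        if "b \<in> B" "c \<in> B" "b \<noteq> c" for b c
        using coherentD(5)[OF F sides[of b], of c] that B card remove[of b] by auto
      have "?A - {b} - {c} = ?A - {c} - {b}" by auto
      then show ?thesis using face[of b c] face[of c b] that by simp
    qed
  qed
  then obtain t where "t \<in> K (card ?A - 1)" "\<And>b. b \<in> B ==> lface ?A b t = s (?A - {b})"
    using B(2) by fastforce
  then show ?thesis using card remove by auto
qed

lemma coherent_add_cone_pair:
  assumes F: "coherent F s" and B: "finite B" "a \<notin> B" "2 \<le> card B" "B \<notin> F"
    and faces: "\<And>b. b \<in> B ==> B - {b} \<in> F" "\<And>b. b \<in> B ==> insert a (B - {b}) \<in> F"
  shows "\<exists>s'. coherent (insert (insert a B) (insert B F)) s' \<and> (\<forall>X\<in>F. s' X = s X)"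
proof -
  let ?A = "insert a B"
  obtain t where t: "t \<in> K (card B)" "\<And>b. b \<in> B ==> lface ?A b t = s (insert a (B - {b}))"
    using coherent_cone_horn[OF F B(1-3) faces(2)] by blast
  have A: "finite ?A" "card ?A = Suc (card B)" "?A - {a} = B" using B by auto
  have remove: "?A - {b} = insert a (B - {b})" if "b \<in> B" for b
    using that B by auto
  have A_notin: "?A \<notin> F" using coherentD(4)[OF F, of ?A a] A B by auto
  define y where "y = lface ?A a t"
  have y_in: "y \<in> K (card B - 1)" using lface_in[of ?A a t] A t(1) B by (simp add: y_def)
  have y_face: "lface B v y = s (B - {v})" if v: "v \<in> B" for v
  proof -
    have "lface (?A - {a}) v (lface ?A a t) = lface (?A - {v}) a (lface ?A v t)"
      using v A t(1) B by (intro lface_commute) auto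
    also have "... = s (insert a (B - {v}) - {a})"
      using coherentD(5)[OF F faces(2)[OF v], of a] v t(2) A B by (auto simp: remove)
    also have "insert a (B - {v}) - {a} = B - {v}" using B by auto
    finally show ?thesis using A(3) by (simp add: y_def)
  qed
  have "coherent (insert B F) (s(B := y))"
  proof (rule coherent_fun_upd[OF F B(1) _ y_in])
    show "lface X v (s X) = y" if "X \<in> F" "v \<in> X" "X \<noteq> B" "X - {v} = B" for X v
      using coherent_remove[OF F that(1,2)] that(4) B by auto
  qed (use B faces y_face in auto)
  then have "coherent (insert ?A (insert B F)) ((s(B := y))(?A := t))"
  proof (rule coherent_fun_upd[OF _ A(1)])
    show "t \<in> K (card ?A - 1)" using t(1) A by simp
    show "?A - {v} \<in> insert B F \<and> lface ?A v t = (s(B := y)) (?A - {v})" if "v \<in> ?A" for v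
      using that A(3) faces(2) t(2) B(2) by (cases "v = a") (auto simp: y_def remove)
    show "lface X v ((s(B := y)) X) = t" if "X \<in> insert B F" "v \<in> X" "X \<noteq> ?A" "X - {v} = ?A" for X v
      using coherent_remove[OF F, of X v] that A_notin A B by auto
  qed simp
  moreover have "((s(B := y))(?A := t)) X = s X" if "X \<in> F" for X
    using that B A_notin by auto
  ultimately show ?thesis by blast
qed

lemma minimal_missing_face:
  assumes "finite V" "F \<noteq> Pow V - {{}}" "F \<subseteq> Pow V - {{}}" "\<And>v. v \<in> V ==> {v} \<in> F"
    and cone: "\<And>B. B \<in> F ==> insert a B \<in> F"
  obtains B where "B \<subseteq> V" "2 \<le> card B" "B \<notin> F" "a \<notin> B" "\<And>b. b \<in> B ==> B - {b} \<in> F"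
proof -
  define M where "M = {B \<in> Pow V - {{}} - F. a \<notin> B}"
  obtain C where C: "C \<subseteq> V" "C \<noteq> {}" "C \<notin> F" using assms(2,3) by blast
  have "C - {a} \<in> M"
  proof -
    have "C - {a} \<notin> F" using cone[of "C - {a}"] C(3) by (metis Diff_empty Diff_insert0 insert_Diff)
    moreover have "C - {a} \<noteq> {}"
      using C assms(4)[of a] by (metis Diff_eq_empty_iff insert_subset subset_singletonD)
    ultimately show ?thesis using C by (auto simp: M_def)
  qed
  then obtain B where B: "B \<in> M" "\<And>B'. B' \<in> M ==> card B \<le> card B'"
    using arg_min_nat_lemma[of "\<lambda>x. x \<in> M" _ card] by blast
  have BV: "B \<subseteq> V" "B \<noteq> {}" "B \<notin> F" "a \<notin> B" "finite B"
    using B(1) assms(1) by (auto simp: M_def intro: finite_subset)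
  have "card B \<noteq> 1" using BV assms(4) by (auto simp: card_1_singleton_iff)
  then have card_B: "2 \<le> card B" using BV(2,5) by (metis One_nat_def card_0_eq less_2_cases not_le)
  have "B - {b} \<in> F" if "b \<in> B" for b
  proof (rule ccontr)
    assume "B - {b} \<notin> F"
    then have "B - {b} \<in> M" using BV Diff_singleton_nonempty[OF card_B] by (auto simp: M_def)
    then show False
      using B(2)[of "B - {b}"] that BV by (metis card_Diff1_less not_le)
  qed
  then show thesis using that BV card_B by blast
qed

text \<open>The faces missing from a family over a cone with apex \<open>a\<close> come in pairs \<open>B\<close>, \<open>insert a B\<close>, and filling
  in order of size only ever uses horns.\<close>

lemma coherent_extend:
  assumes "finite V" "coherent F s" "F \<subseteq> Pow V" "\<And>v. v \<in> V ==> {v} \<in> F" "a \<in> V"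
    and "\<And>B. B \<in> F ==> insert a B \<in> F"
  shows "\<exists>s'. coherent (Pow V - {{}}) s' \<and> (\<forall>B\<in>F. s' B = s B)"
  using assms(2-6)
proof (induction "card (Pow V - {{}} - F)" arbitrary: F s rule: less_induct)
  case less
  show ?case
  proof (cases "F = Pow V - {{}}")
    case True
    then show ?thesis using less.prems(1) by blast
  next
    case False
    have "F \<subseteq> Pow V - {{}}" using less.prems(1,2) coherentD(2) by fastforce
    then obtain B where B: "B \<subseteq> V" "2 \<le> card B" "B \<notin> F" "a \<notin> B" "\<And>b. b \<in> B ==> B - {b} \<in> F"
      using minimal_missing_face[OF assms(1) False _ less.prems(3,5)] by blast
    have fin: "finite B" using B(1) assms(1) finite_subset by blast
    let ?F = "insert (insert a B) (insert B F)"
    obtain s' where s': "coherent ?F s'" "\<forall>X\<in>F. s' X = s X"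
      using coherent_add_cone_pair[OF less.prems(1) fin B(4,2,3,5)] B(5) less.prems(5) by blast
    have "card (Pow V - {{}} - ?F) < card (Pow V - {{}} - F)" using B assms(1) by (intro psubset_card_mono) auto
    moreover have "?F \<subseteq> Pow V" "\<And>v. v \<in> V ==> {v} \<in> ?F" "\<And>X. X \<in> ?F ==> insert a X \<in> ?F"
      using less.prems B by auto
    ultimately obtain s'' where "coherent (Pow V - {{}}) s''" "\<forall>X\<in>?F. s'' X = s' X"
      using less.hyps[of ?F s'] s'(1) less.prems(4) by blast
    then show ?thesis using s'(2) by auto
  qed
qed

lemma coherent_Pow_lface:
  assumes "coherent (Pow V - {{}}) W" "B \<subseteq> V" "2 \<le> card B" "v \<in> B"
  shows "lface B v (W B) = W (B - {v})"
  using coherentD(5)[OF assms(1) _ assms(3,4)] assms(2,4) by blast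

lemma coherent_Pow_in:
  assumes "coherent (Pow V - {{}}) W" "B \<subseteq> V" "B \<noteq> {}"
  shows "W B \<in> K (card B - 1)"
  using coherentD(3)[OF assms(1), of B] assms(2,3) by blast

subsection \<open>Iterated faces and gluing\<close>

function subface :: "nat set => 's => nat set => 's" where
  "subface Z t B =
    (if finite Z \<and> B \<subset> Z then subface (Z - {Max (Z - B)}) (lface Z (Max (Z - B)) t) B else t)"
  by auto
termination
proof (relation "Wellfounded.measure (\<lambda>(Z, t, B). card Z)", goal_cases)
  case (2 Z t B)
  then have "Max (Z - B) \<in> Z - B" by (intro Max_in) auto
  then show ?case
    using 2 card_Diff1_less[of Z "Max (Z - B)"] by auto
qed simp

declare subface.simps[simp del]

lemma subface_self [simp]: "subface Z t Z = t"
  by (subst subface.simps) simp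

lemma subface_remove:
  assumes "finite Z" "B \<subseteq> Z" "B \<noteq> {}" "w \<in> Z - B" "t \<in> K (card Z - 1)"
  shows "subface Z t B = subface (Z - {w}) (lface Z w t) B"
  using assms
proof (induction "card (Z - B)" arbitrary: Z t w rule: less_induct)
  case less
  define v where "v = Max (Z - B)"
  have v: "v \<in> Z - B" unfolding v_def using less.prems by (intro Max_in) auto
  have remove_Max: "subface Z t B = subface (Z - {v}) (lface Z v t) B"
    using less.prems by (subst subface.simps) (auto simp: v_def)
  show ?case
  proof (cases "w = v")
    case False
    have "card (insert v (insert w B)) \<le> card Z" "finite B"
      using less.prems v by (auto intro!: card_mono intro: finite_subset)
    then have card: "3 \<le> card Z" using less.prems v False card_gt_0_iff[of B] by simp
    have "card (Z - {v} - B) < card (Z - B)" using less.prems v by (intro psubset_card_mono) auto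
    then have "subface (Z - {v}) (lface Z v t) B
        = subface (Z - {v} - {w}) (lface (Z - {v}) w (lface Z v t)) B"
      using less.prems v False card lface_in[of Z v t] by (intro less.hyps) auto
    also have "... = subface (Z - {w} - {v}) (lface (Z - {w}) v (lface Z w t)) B"
      using lface_commute[of Z w v t] less.prems v False card by (simp add: Diff_insert2[symmetric] insert_commute)
    also have "... = subface (Z - {w}) (lface Z w t) B"
    proof -
      have "Max (Z - {w} - B) = v" unfolding v_def using less.prems v False by (intro Max_eqI) (auto simp: v_def)
      moreover have "finite (Z - {w})" "B \<subset> Z - {w}" using less.prems v False by blast+
      ultimately show ?thesis using subface.simps[of "Z - {w}" "lface Z w t" B] by (simp only: if_True simp_thms)
    qed
    finally show ?thesis using remove_Max by simp
  qed (use remove_Max in simp)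
qed

lemma subface_in:
  assumes "finite Z" "B \<subseteq> Z" "B \<noteq> {}" "t \<in> K (card Z - 1)"
  shows "subface Z t B \<in> K (card B - 1)"
  using assms
proof (induction "card (Z - B)" arbitrary: Z t rule: less_induct)
  case less
  show ?case
  proof (cases "B = Z")
    case False
    then obtain w where w: "w \<in> Z - B" using less.prems by blast
    have "B \<subseteq> Z - {w}" "card B > 0" using less.prems w by (auto simp: card_gt_0_iff intro: finite_subset)
    then have "2 \<le> card Z" using card_mono[of "Z - {w}" B] less.prems w by (simp add: card_Diff_singleton)
    moreover have "card (Z - {w} - B) < card (Z - B)" using less.prems w by (intro psubset_card_mono) auto
    ultimately show ?thesis
      using less.prems w subface_remove[of Z B w t] lface_in[of Z w t] less.hyps[of "Z - {w}" "lface Z w t"]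
      by auto
  qed (use less in simp)
qed

lemma lface_subface:
  assumes "finite Z" "B \<subseteq> Z" "v \<in> B" "2 \<le> card B" "t \<in> K (card Z - 1)"
  shows "lface B v (subface Z t B) = subface Z t (B - {v})"
  using assms
proof (induction "card (Z - B)" arbitrary: Z t rule: less_induct)
  case less
  have nonempty: "B - {v} \<noteq> {}" using less.prems by (intro Diff_singleton_nonempty)
  show ?case
  proof (cases "B = Z")
    case True
    then show ?thesis using less.prems nonempty subface_remove[of Z "Z - {v}" v t] by auto
  next
    case False
    then obtain w where w: "w \<in> Z - B" using less.prems by blast
    have card: "card B \<le> card Z" using less.prems by (intro card_mono) auto
    have "card (Z - {w} - B) < card (Z - B)" using less.prems w by (intro psubset_card_mono) auto
    moreover have "B \<noteq> {}" "B - {v} \<subseteq> Z" "w \<in> Z - (B - {v})" "B \<subseteq> Z - {w}"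
      using less.prems w by auto
    moreover have "lface Z w t \<in> K (card (Z - {w}) - 1)" using less.prems w card by (intro lface_in) auto
    ultimately show ?thesis
      using less.prems w nonempty subface_remove[of Z B w t] subface_remove[of Z "B - {v}" w t]
        less.hyps[of "Z - {w}" "lface Z w t"] by simp
  qed
qed

lemma subface_Diff_singleton:
  assumes "finite Z" "v \<in> Z" "2 \<le> card Z" "t \<in> K (card Z - 1)"
  shows "subface Z t (Z - {v}) = lface Z v t"
  using lface_subface[of Z Z v t] assms by simp

lemma coherent_subface:
  assumes "finite Z" "t \<in> K (card Z - 1)"
  shows "coherent (Pow Z - {{}}) (subface Z t)"
  unfolding coherent_def
proof (intro ballI conjI impI)
  fix B assume B: "B \<in> Pow Z - {{}}"
  show "finite B" "B \<noteq> {}" "subface Z t B \<in> K (card B - 1)"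
    using B assms subface_in[of Z B t] by (auto intro: finite_subset)
  fix v assume v: "2 \<le> card B" "v \<in> B"
  show "B - {v} \<in> Pow Z - {{}}" using B Diff_singleton_nonempty[OF v(1), of v] by blast
  show "lface B v (subface Z t B) = subface Z t (B - {v})" using B v assms by (intro lface_subface) auto
qed

lemma coherent_eq_subface:
  assumes "coherent F s" "Z \<in> F" "B \<subseteq> Z" "B \<noteq> {}"
  shows "s B = subface Z (s Z) B"
  using assms(2,3)
proof (induction "card (Z - B)" arbitrary: Z rule: less_induct)
  case less
  show ?case
  proof (cases "B = Z")
    case False
    have fin: "finite Z" using coherentD(1)[OF assms(1)] less.prems by blast
    obtain w where w: "w \<in> Z - B" using False less.prems by blast
    have "B \<subseteq> Z - {w}" "card B > 0"
      using less.prems w assms(4) fin by (auto simp: card_gt_0_iff intro: finite_subset)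
    then have card: "2 \<le> card Z" using card_mono[of "Z - {w}" B] fin w by (simp add: card_Diff_singleton)
    have "card (Z - {w} - B) < card (Z - B)" using fin w by (intro psubset_card_mono) auto
    then have "s B = subface (Z - {w}) (s (Z - {w})) B"
      using less.prems w coherentD(4)[OF assms(1) less.prems(1) card] by (intro less.hyps) auto
    moreover have "s (Z - {w}) = lface Z w (s Z)"
      using coherentD(5)[OF assms(1) less.prems(1) card, of w] w by simp
    ultimately show ?thesis
      using subface_remove[OF fin less.prems(2) assms(4) w coherentD(3)[OF assms(1) less.prems(1)]] by simp
  qed simp
qed

lemma subface_subface:
  assumes "finite P" "t \<in> K (card P - 1)" "Z \<subseteq> P" "B \<subseteq> Z" "B \<noteq> {}"
  shows "subface Z (subface P t Z) B = subface P t B"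
  using coherent_eq_subface[OF coherent_subface[of P t], of Z B] assms by fastforce

lemma subface_eq_on_Int:
  assumes "finite P" "finite Q" "t \<in> K (card P - 1)" "u \<in> K (card Q - 1)"
    and "subface P t (P \<inter> Q) = subface Q u (P \<inter> Q)" "B \<subseteq> P" "B \<subseteq> Q" "B \<noteq> {}"
  shows "subface P t B = subface Q u B"
  using assms subface_subface[of P t "P \<inter> Q" B] subface_subface[of Q u "P \<inter> Q" B] by simp

lemma glue3:
  assumes fin: "finite P" "finite Q" "finite R"
    and t: "t \<in> K (card P - 1)" "u \<in> K (card Q - 1)" "w \<in> K (card R - 1)"
    and b: "b \<in> P" "b \<in> Q" "b \<in> R"
    and agree: "subface P t (P \<inter> Q) = subface Q u (P \<inter> Q)" "subface P t (P \<inter> R) = subface R w (P \<inter> R)"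
      "subface Q u (Q \<inter> R) = subface R w (Q \<inter> R)"
  shows "\<exists>s. coherent (Pow (P \<union> Q \<union> R) - {{}}) s \<and> s P = t \<and> s Q = u \<and> s R = w"
proof -
  define s where
    "s B = (if B \<subseteq> P then subface P t B else if B \<subseteq> Q then subface Q u B else subface R w B)" for B
  let ?F = "(Pow P - {{}}) \<union> (Pow Q - {{}}) \<union> (Pow R - {{}})"
  have sP: "s B = subface P t B" if "B \<subseteq> P" for B
    using that by (simp add: s_def)
  have sQ: "s B = subface Q u B" if "B \<subseteq> Q" "B \<noteq> {}" for B
    using that subface_eq_on_Int[OF fin(1,2) t(1,2) agree(1)] by (simp add: s_def)
  have sR: "s B = subface R w B" if "B \<subseteq> R" "B \<noteq> {}" for B
    using that subface_eq_on_Int[OF fin(1,3) t(1,3) agree(2)] subface_eq_on_Int[OF fin(2,3) t(2,3) agree(3)]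
    by (simp add: s_def)
  have "coherent ?F s"
    using coherent_cong[OF coherent_subface[OF fin(1) t(1)], of s]
      coherent_cong[OF coherent_subface[OF fin(2) t(2)], of s]
      coherent_cong[OF coherent_subface[OF fin(3) t(3)], of s]
    by (intro coherent_Un) (simp_all add: sP sQ sR)
  moreover have "?F \<subseteq> Pow (P \<union> Q \<union> R)" "\<And>v. v \<in> P \<union> Q \<union> R ==> {v} \<in> ?F" "b \<in> P \<union> Q \<union> R"
    "\<And>B. B \<in> ?F ==> insert b B \<in> ?F"
    using b by auto
  ultimately obtain s' where "coherent (Pow (P \<union> Q \<union> R) - {{}}) s'" "\<forall>B\<in>?F. s' B = s B"
    using coherent_extend[of "P \<union> Q \<union> R" ?F s b] fin by auto
  then show ?thesis using sP[of P] sQ[of Q] sR[of R] b by (intro exI[of _ s']) auto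
qed

lemma glue2:
  assumes "finite P" "finite Q" "t \<in> K (card P - 1)" "u \<in> K (card Q - 1)" "b \<in> P" "b \<in> Q"
    and "subface P t (P \<inter> Q) = subface Q u (P \<inter> Q)"
  shows "\<exists>s. coherent (Pow (P \<union> Q) - {{}}) s \<and> s P = t \<and> s Q = u"
  using glue3[of P Q Q t u u b] assms by auto

lemma glue_facets:
  assumes A: "finite A" "A \<noteq> {}" "u \<notin> A" "v \<notin> A"
    and t: "t \<in> K (card A)" "r \<in> K (card A)" and common_face: "lface (insert v A) v t = lface (insert u A) u r"
    and uv: "u \<noteq> v"
  shows "\<exists>W. coherent (Pow (insert u (insert v A)) - {{}}) W \<and> W (insert v A) = t \<and> W (insert u A) = r"
proof -
  have card: "card (insert w A) = Suc (card A)" "2 \<le> card (insert w A)" if "w \<notin> A" for w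
    using that A(1,2) by (simp_all add: card_gt_0_iff Suc_le_eq numeral_2_eq_2)
  obtain b where b: "b \<in> A" using A(2) by blast
  have subface: "subface (insert w A) x A = lface (insert w A) w x" if "w \<notin> A" "x \<in> K (card A)" for w x
    using subface_Diff_singleton[of "insert w A" w x] card[OF that(1)] that A(1) by simp
  have "insert v A \<inter> insert u A = A" "insert v A \<union> insert u A = insert u (insert v A)"
    using A(3,4) uv by auto
  then show ?thesis
    using glue2[of "insert v A" "insert u A" t r b] subface[OF A(4) t(1)] subface[OF A(3) t(2)] common_face card A t b
    by auto
qed

subsection \<open>Fillings of boundaries\<close>

definition fillable :: "(nat set => 's) => nat set => bool" where
  "fillable s A \<longleftrightarrow> (\<exists>t\<in>K (card A - 1). \<forall>v\<in>A. lface A v t = s (A - {v}))"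

definition skeleton :: "nat set => nat set set" where
  "skeleton V = {B. B \<subseteq> V \<and> B \<noteq> {} \<and> card B \<le> card V - 2}"

lemma fillable_cong: "fillable s A ==> (\<And>v. v \<in> A ==> s' (A - {v}) = s (A - {v})) ==> fillable s' A"
  unfolding fillable_def by auto

lemma fillable_coherent:
  assumes "coherent F s" "A \<in> F" "2 \<le> card A"
  shows "fillable s A"
  unfolding fillable_def using coherentD(3,5)[OF assms(1,2)] assms(3) by blast

lemma skeleton_down: "B \<in> skeleton V ==> 2 \<le> card B ==> B - {v} \<in> skeleton V"
  using Diff_singleton_nonempty[of B v] card_Diff1_le[of B v] by (auto simp: skeleton_def)

lemma coherent_skeleton: "coherent (Pow V - {{}}) s ==> coherent (skeleton V) s"
  by (rule coherent_subset) (auto simp: skeleton_down, auto simp: skeleton_def)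

lemma Diff_pair_in_skeleton:
  assumes "finite V" "3 \<le> card V" "b \<in> V" "c \<in> V" "b \<noteq> c"
  shows "card (V - {b} - {c}) = card V - 2" "V - {b} - {c} \<in> skeleton V"
proof -
  show card: "card (V - {b} - {c}) = card V - 2" using assms by (simp add: numeral_2_eq_2)
  show "V - {b} - {c} \<in> skeleton V"
    using Diff_singleton_nonempty[of "V - {b}" c] assms card by (auto simp: skeleton_def)
qed

lemma coherent_add_facets:
  assumes V: "finite V" "3 \<le> card V" and C: "C \<subseteq> V" and s: "coherent (skeleton V) s"
    and fillable: "\<And>b. b \<in> C ==> fillable s (V - {b})"
  shows "\<exists>s'. coherent (skeleton V \<union> (\<lambda>b. V - {b}) ` C) s' \<and> (\<forall>B\<in>skeleton V. s' B = s B)"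
proof -
  have "\<forall>b\<in>C. \<exists>t. t \<in> K (card (V - {b}) - 1) \<and> (\<forall>v\<in>V - {b}. lface (V - {b}) v t = s (V - {b} - {v}))"
    using fillable unfolding fillable_def by blast
  from bchoice[OF this] obtain g where g: "\<And>b. b \<in> C ==> g b \<in> K (card (V - {b}) - 1)"
    "\<And>b v. b \<in> C ==> v \<in> V - {b} ==> lface (V - {b}) v (g b) = s (V - {b} - {v})"
    by blast
  define s' where "s' B = (if B \<in> skeleton V then s B else g (the_elem (V - B)))" for B
  have facet: "V - {b} \<notin> skeleton V" "s' (V - {b}) = g b" if "b \<in> C" for b
  proof -
    have "card (V - {b}) = card V - 1" using subsetD[OF C that] V(1) by simp
    then have "\<not> card (V - {b}) \<le> card V - 2" using V(2) by linarith
    then show not_in: "V - {b} \<notin> skeleton V" unfolding skeleton_def by blast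
    have "V - (V - {b}) = {b}" using that C by auto
    then show "s' (V - {b}) = g b" using not_in by (simp add: s'_def)
  qed
  have "finite B \<and> B \<noteq> {} \<and> s' B \<in> K (card B - 1) \<and> (2 \<le> card B -->
      (\<forall>v\<in>B. B - {v} \<in> skeleton V \<and> lface B v (s' B) = s' (B - {v})))"
    if "B \<in> skeleton V \<union> (\<lambda>b. V - {b}) ` C" for B
    using that
  proof
    assume B: "B \<in> skeleton V"
    then have "s' B = s B" "\<And>v. v \<in> B ==> 2 \<le> card B ==> s' (B - {v}) = s (B - {v})"
      using skeleton_down by (simp_all add: s'_def)
    then show ?thesis using coherentD(1-3)[OF s B] coherentD(5)[OF s B] skeleton_down[OF B] by simp
  next
    assume "B \<in> (\<lambda>b. V - {b}) ` C"
    then obtain b where b: "b \<in> C" "B = V - {b}" by blast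
    have "B \<noteq> {}" unfolding b(2) using V by (intro Diff_singleton_nonempty) simp
    moreover have "B - {v} \<in> skeleton V" "s' (B - {v}) = s (B - {v})" if "v \<in> B" for v
      using Diff_pair_in_skeleton(2)[OF V, of b v] that b C by (auto simp: s'_def)
    ultimately show ?thesis using g(1)[OF b(1)] g(2)[OF b(1)] facet(2)[OF b(1)] V(1) unfolding b(2) by simp
  qed
  then have "coherent (skeleton V \<union> (\<lambda>b. V - {b}) ` C) s'" unfolding coherent_def by blast
  then show ?thesis by (intro exI[of _ s'] conjI ballI) (simp_all add: s'_def)
qed

lemma insert_skeleton:
  assumes V: "finite V" "3 \<le> card V" "e \<in> V" and B: "B \<in> skeleton V"
  shows "insert e B \<in> skeleton V \<union> (\<lambda>b. V - {b}) ` (V - {e})"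
proof (cases "card (insert e B) \<le> card V - 2")
  case False
  have sub: "insert e B \<subseteq> V" and card: "card B \<le> card V - 2"
    using B V(3) by (simp_all add: skeleton_def)
  have fin: "finite (insert e B)" using sub V(1) by (rule finite_subset)
  have "card (insert e B) \<le> Suc (card B)" using fin by (simp add: card_insert_if)
  then have "card (V - insert e B) = 1" unfolding card_Diff_subset[OF fin sub] using False card V(2) by linarith
  then obtain b where "V - insert e B = {b}" by (auto simp: card_1_singleton_iff)
  then have "insert e B = V - {b}" "b \<in> V - {e}" using B V by (auto simp: skeleton_def)
  then show ?thesis by blast
qed (use B V in \<open>auto simp: skeleton_def\<close>)

lemma fillable_last_facet:
  assumes V: "finite V" "3 \<le> card V" "e \<in> V" and s: "coherent (skeleton V) s"
    and fillable: "\<And>b. b \<in> V ==> b \<noteq> e ==> fillable s (V - {b})"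
  shows "fillable s (V - {e})"
proof -
  let ?F = "skeleton V \<union> (\<lambda>b. V - {b}) ` (V - {e})"
  obtain s' where s': "coherent ?F s'" "\<forall>B\<in>skeleton V. s' B = s B"
    using coherent_add_facets[OF V(1,2) _ s, of "V - {e}"] fillable by auto
  have "\<exists>s''. coherent (Pow V - {{}}) s'' \<and> (\<forall>B\<in>?F. s'' B = s' B)"
  proof (rule coherent_extend[OF V(1) s'(1) _ _ V(3)])
    have "1 \<le> card V - 2" using V(2) by linarith
    then show "{v} \<in> ?F" if "v \<in> V" for v
      using that by (simp add: skeleton_def)
    show "insert e B \<in> ?F" if "B \<in> ?F" for B
      using that insert_skeleton[OF V, of B] V(3) by (auto simp: insert_absorb)
  qed (auto simp: skeleton_def)
  then obtain s'' where s'': "coherent (Pow V - {{}}) s''" "\<And>B. B \<in> skeleton V ==> s'' B = s B"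
    using s'(2) by auto
  have "fillable s'' (V - {e})"
    using Diff_singleton_nonempty[of V e] V by (intro fillable_coherent[OF s''(1)]) auto
  then show ?thesis by (rule fillable_cong) (use s''(2) Diff_pair_in_skeleton(2)[OF V(1,2,3)] in auto)
qed

subsection \<open>Homotopy relative to the boundary\<close>

definition parallel :: "nat => 's => 's => bool" where
  "parallel m x y \<longleftrightarrow> x \<in> K m \<and> y \<in> K m \<and> (\<forall>i\<le>m. d m i x = d m i y)"

lemma parallel_refl: "x \<in> K m ==> parallel m x x"
  by (simp add: parallel_def)

lemma parallel_sym: "parallel m x y ==> parallel m y x"
  by (simp add: parallel_def)

lemma parallel_trans [trans]: "parallel m x y ==> parallel m y z ==> parallel m x z"
  by (simp add: parallel_def)

lemma parallel_lface:
  assumes "finite A" "card A = Suc m"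
  shows "parallel m x y \<longleftrightarrow> x \<in> K m \<and> y \<in> K m \<and> (\<forall>b\<in>A. lface A b x = lface A b y)"
proof
  assume "parallel m x y"
  then show "x \<in> K m \<and> y \<in> K m \<and> (\<forall>b\<in>A. lface A b x = lface A b y)"
    using assms pos_less_card[OF assms(1)] by (auto simp: parallel_def lface_def less_Suc_eq_le)
next
  assume lfaces: "x \<in> K m \<and> y \<in> K m \<and> (\<forall>b\<in>A. lface A b x = lface A b y)"
  have "d m i x = d m i y" if i: "i \<le> m" for i
  proof -
    obtain b where "b \<in> A" "pos A b = i" using pos_surj[OF assms(1), of i] assms i by auto
    then show ?thesis using lfaces assms by (auto simp: lface_def)
  qed
  then show "parallel m x y" using lfaces by (simp add: parallel_def)
qed

lemma parallel_last_face:
  assumes m: "1 \<le> m" "p \<le> Suc m" "q \<le> Suc m" "p \<noteq> q" and D: "D \<in> K (Suc m)" "D' \<in> K (Suc m)"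
    and other_faces: "\<And>k. k \<le> Suc m ==> k \<noteq> p ==> k \<noteq> q ==> d (Suc m) k D = d (Suc m) k D'"
    and p: "parallel m (d (Suc m) p D) (d (Suc m) p D')"
  shows "parallel m (d (Suc m) q D) (d (Suc m) q D')"
proof -
  let ?V = "{..Suc m}"
  have face: "lface ?V k E = d (Suc m) k E" if "k \<le> Suc m" for k E
    using that by (rule lface_atMost)
  have facet: "finite (?V - {k})" "card (?V - {k}) = Suc m" if "k \<le> Suc m" for k
    using that by auto
  have "lface (?V - {q}) b (d (Suc m) q D) = lface (?V - {q}) b (d (Suc m) q D')" if b: "b \<in> ?V - {q}" for b
  proof -
    have swap: "lface (?V - {q}) b (d (Suc m) q E) = lface (?V - {b}) q (d (Suc m) b E)" if "E \<in> K (Suc m)" for E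
      using lface_commute[of ?V b q E] that b m face by auto
    show ?thesis
    proof (cases "b = p")
      case True
      then have "lface (?V - {p}) q (d (Suc m) p D) = lface (?V - {p}) q (d (Suc m) p D')"
        using p m by (auto simp: parallel_lface[OF facet[OF m(2)]])
      then show ?thesis using swap D True by simp
    qed (use swap D other_faces b in auto)
  qed
  then show ?thesis using face_in[OF D(1)] face_in[OF D(2)] m by (simp add: parallel_lface[OF facet[OF m(3)]])
qed

text \<open>\<open>homotopic m x y\<close> says that \<open>x\<close> and \<open>y\<close> complete the same horn.\<close>

definition homotopic :: "nat => 's => 's => bool" where
  "homotopic m x y \<longleftrightarrow> (\<exists>t\<in>K (Suc m). \<exists>t'\<in>K (Suc m). \<exists>j\<le>Suc m. d (Suc m) j t = x \<and> d (Suc m) j t' = y \<and>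
    (\<forall>i\<le>Suc m. i \<noteq> j --> d (Suc m) i t = d (Suc m) i t'))"

lemma homotopicI:
  assumes "t \<in> K (Suc m)" "t' \<in> K (Suc m)" "j \<le> Suc m"
    "\<And>k. k \<le> Suc m ==> k \<noteq> j ==> d (Suc m) k t = d (Suc m) k t'"
  shows "homotopic m (d (Suc m) j t) (d (Suc m) j t')"
  unfolding homotopic_def using assms by blast

lemma homotopic_lfaceI:
  assumes "finite Z" "card Z = Suc (Suc m)" "v \<in> Z" "t \<in> K (Suc m)" "t' \<in> K (Suc m)"
    and "\<And>w. w \<in> Z ==> w \<noteq> v ==> lface Z w t = lface Z w t'"
  shows "homotopic m (lface Z v t) (lface Z v t')"
proof -
  have "d (Suc m) i t = d (Suc m) i t'" if i: "i \<le> Suc m" "i \<noteq> pos Z v" for i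
  proof -
    obtain b where "b \<in> Z" "pos Z b = i" using pos_surj[OF assms(1), of i] assms(2) i by auto
    then show ?thesis using assms(6)[of b] i assms(2) by (auto simp: lface_def)
  qed
  moreover have "pos Z v \<le> Suc m" using pos_less_card[OF assms(1,3)] assms(2) by simp
  ultimately show ?thesis using homotopicI[OF assms(4,5)] assms(2) by (simp add: lface_def)
qed

lemma homotopic_sym: "homotopic m x y ==> homotopic m y x"
  unfolding homotopic_def by metis

lemma homotopic_parallel:
  assumes "homotopic m x y" "1 \<le> m"
  shows "parallel m x y"
proof -
  obtain t t' j where t: "t \<in> K (Suc m)" "t' \<in> K (Suc m)" "j \<le> Suc m" "d (Suc m) j t = x" "d (Suc m) j t' = y"
    "\<And>i. i \<le> Suc m ==> i \<noteq> j ==> d (Suc m) i t = d (Suc m) i t'"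
    using assms unfolding homotopic_def by blast
  obtain p where p: "p \<le> Suc m" "p \<noteq> j" using that[of 0] that[of 1] by (cases "j = 0") auto
  have "parallel m (d (Suc m) j t) (d (Suc m) j t')"
    by (rule parallel_last_face[of m p]) (use assms t p face_in[of t m p] in \<open>auto intro: parallel_refl\<close>)
  then show ?thesis using t by simp
qed

lemma homotopic_in: "homotopic m x y ==> 1 \<le> m ==> x \<in> K m \<and> y \<in> K m"
  using homotopic_parallel by (auto simp: parallel_def)

lemma coherent_skeleton_fun_upd:
  assumes V: "finite V" "card V = Suc (Suc (Suc m))" and s: "coherent (skeleton V) s"
    and bc: "b \<in> V" "c \<in> V" "b \<noteq> c" and y: "parallel m y (s (V - {b, c}))"
  shows "coherent (skeleton V) (s(V - {b, c} := y))"
proof -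
  have Z: "finite (V - {b, c})" "card (V - {b, c}) = Suc m" "V - {b, c} \<in> skeleton V"
    using Diff_pair_in_skeleton[of V b c] V bc by (auto simp: Diff_insert2[symmetric] insert_commute)
  have "coherent (insert (V - {b, c}) (skeleton V)) (s(V - {b, c} := y))"
  proof (rule coherent_fun_upd[OF s Z(1)])
    show "V - {b, c} \<noteq> {}" "y \<in> K (card (V - {b, c}) - 1)"
      using coherentD(2)[OF s Z(3)] y Z(2) by (simp_all add: parallel_def)
    show "V - {b, c} - {v} \<in> skeleton V \<and> lface (V - {b, c}) v y = s (V - {b, c} - {v})"
      if "v \<in> V - {b, c}" "2 \<le> card (V - {b, c})" for v
      using coherentD(4,5)[OF s Z(3) that(2,1)] y that by (simp add: parallel_lface[OF Z(1,2)])
    show "lface B v (s B) = y" if "B \<in> skeleton V" "v \<in> B" "B \<noteq> V - {b, c}" "B - {v} = V - {b, c}" for B v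
    proof -
      have "card B \<le> Suc m" "finite B" using that(1) V finite_subset by (auto simp: skeleton_def)
      then have "card (B - {v}) < Suc m" using card_Diff1_less[of B v] that(2) by simp
      then show ?thesis using that(4) Z(2) by simp
    qed
  qed
  then show ?thesis by (simp only: insert_absorb[OF Z(3)])
qed

lemma fillable_replace_facet:
  assumes V: "finite V" "u \<in> V" "v \<in> V" "u \<noteq> v" and t: "t \<in> K (card V - 2)"
    and faces: "\<And>b. b \<in> V - {u, v} ==> lface (V - {u}) b t = s (V - {u} - {b})"
  shows "fillable (s(V - {u, v} := lface (V - {u}) v t)) (V - {u})"
proof -
  have "lface (V - {u}) k t = (s(V - {u, v} := lface (V - {u}) v t)) (V - {u} - {k})" if "k \<in> V - {u}" for k
  proof (cases "k = v")
    case True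
    then have "V - {u} - {k} = V - {u, v}" by blast
    then show ?thesis using True by simp
  next
    case False
    then have "V - {u} - {k} \<noteq> V - {u, v}" using that by blast
    then show ?thesis using False that faces[of k] by simp
  qed
  then show ?thesis unfolding fillable_def using t V by (intro bexI[of _ t]) (simp_all add: numeral_2_eq_2)
qed

lemma homotopic_replace_labelled:
  assumes A: "finite A" "card A = Suc m" "1 \<le> m" "u \<notin> A" "v \<notin> A" "u \<noteq> v"
    and K: "t \<in> K (Suc m)" "t' \<in> K (Suc m)" "r \<in> K (Suc m)"
    and faces: "\<And>b. b \<in> A ==> lface (insert v A) b t = lface (insert v A) b t'"
    and common_face: "lface (insert v A) v t = lface (insert u A) u r"
  shows "\<exists>r'\<in>K (Suc m). lface (insert u A) u r' = lface (insert v A) v t' \<and>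
    (\<forall>b\<in>A. lface (insert u A) b r' = lface (insert u A) b r)"
proof -
  define V where "V = insert u (insert v A)"
  have V: "finite V" "card V = Suc (Suc (Suc m))" "V - {u} = insert v A" "V - {v} = insert u A" "V - {u, v} = A"
    "u \<in> V" "v \<in> V"
    using A by (auto simp: V_def)
  have "A \<noteq> {}" using A by auto
  then obtain W where W: "coherent (Pow V - {{}}) W" "W (V - {u}) = t" "W (V - {v}) = r"
    using glue_facets[OF A(1) _ A(4,5), of t r] A K common_face unfolding V(3,4) unfolding V_def by auto
  have W_face: "lface (V - {b}) k (W (V - {b})) = W (V - {b} - {k})" if "b \<in> V" "k \<in> V - {b}" for b k
    using that V by (intro coherent_Pow_lface[OF W(1)]) auto
  define y where "y = lface (insert v A) v t'"
  have WA: "W A = lface (insert v A) v t" using W_face[of u v] W(2) V A by auto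
  have "parallel m (lface (insert v A) v t) y"
    unfolding y_def by (intro homotopic_parallel homotopic_lfaceI) (use A K faces in auto)
  then have s: "coherent (skeleton V) (W(A := y))"
    using coherent_skeleton_fun_upd[OF V(1,2) coherent_skeleton[OF W(1)] V(6,7) A(6), of y] WA
    unfolding V(5) by (simp add: parallel_sym)
  have "fillable (W(A := y)) (V - {v})"
  proof (rule fillable_last_facet[OF V(1) _ V(7) s])
    fix b assume b: "b \<in> V" "b \<noteq> v"
    show "fillable (W(A := y)) (V - {b})"
    proof (cases "b = u")
      case True
      show ?thesis
        using fillable_replace_facet[OF V(1,6,7) A(6), of t' W] K(2) V faces W_face[of u] W(2) True
        by (simp add: y_def)
    next
      case False
      then have "b \<in> A" using b by (auto simp: V_def)
      moreover have "fillable W (V - {b})"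
        using V b Diff_singleton_nonempty[of V b] by (intro fillable_coherent[OF W(1)]) auto
      ultimately show ?thesis by (elim fillable_cong) auto
    qed
  qed (use V in simp)
  then obtain r' where r': "r' \<in> K (Suc m)" "\<forall>k\<in>insert u A. lface (insert u A) k r' = (W(A := y)) (insert u A - {k})"
    unfolding fillable_def V(4) using A by auto
  have "lface (insert u A) b r' = lface (insert u A) b r" if "b \<in> A" for b
  proof -
    have "insert u A - {b} \<noteq> A" using that A by auto
    then show ?thesis using r'(2) W_face[of v b] W(3) V that A by simp
  qed
  moreover have "lface (insert u A) u r' = y" using r'(2) A by simp
  ultimately show ?thesis using r'(1) by (auto simp: y_def)
qed

text \<open>The labels \<open>3 i + 2\<close> of the common face leave room for \<open>3 j\<close> and \<open>3 l + 1\<close> at the positions \<open>j\<close> and \<open>l\<close>.\<close>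

lemma homotopic_replace:
  assumes m: "1 \<le> m" and h: "homotopic m x y" and r: "r \<in> K (Suc m)" "l \<le> Suc m" "d (Suc m) l r = x"
  shows "\<exists>r'\<in>K (Suc m). d (Suc m) l r' = y \<and> (\<forall>i\<le>Suc m. i \<noteq> l --> d (Suc m) i r' = d (Suc m) i r)"
proof -
  obtain t t' j where t: "t \<in> K (Suc m)" "t' \<in> K (Suc m)" "j \<le> Suc m" "d (Suc m) j t = x" "d (Suc m) j t' = y"
    "\<And>i. i \<le> Suc m ==> i \<noteq> j ==> d (Suc m) i t = d (Suc m) i t'"
    using h unfolding homotopic_def by blast
  define A where "A = (\<lambda>i. 3 * i + 2) ` {..m}"
  define v where "v = 3 * j"
  define u where "u = 3 * l + 1"
  have A: "finite A" "card A = Suc m" "u \<notin> A" "v \<notin> A" "u \<noteq> v"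
    unfolding A_def u_def v_def by (simp_all add: card_image inj_on_def) (auto, presburger+)
  have "{b \<in> insert v A. b < v} = (\<lambda>i. 3 * i + 2) ` {..<j}" "{b \<in> insert u A. b < u} = (\<lambda>i. 3 * i + 2) ` {..<l}"
    using t(3) r(2) by (auto simp: A_def u_def v_def)
  then have "pos (insert v A) v = j" "pos (insert u A) u = l" by (simp_all add: pos_def card_image inj_on_def)
  then have apex: "lface (insert v A) v e = d (Suc m) j e" "lface (insert u A) u e = d (Suc m) l e" for e
    using A by (simp_all add: lface_def)
  have "lface (insert v A) b t = lface (insert v A) b t'" if "b \<in> A" for b
    using t(6)[of "pos (insert v A) b"] pos_less_card[of "insert v A" b] pos_eq_iff[of "insert v A" b v] that A
      \<open>pos (insert v A) v = j\<close> by (auto simp: lface_def)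
  then obtain r' where r': "r' \<in> K (Suc m)" "d (Suc m) l r' = y"
    "\<And>b. b \<in> A ==> lface (insert u A) b r' = lface (insert u A) b r"
    using homotopic_replace_labelled[OF A(1,2) m A(3-5) t(1,2) r(1), unfolded apex t(4,5) r(3)] by blast
  have "d (Suc m) i r' = d (Suc m) i r" if i: "i \<le> Suc m" "i \<noteq> l" for i
  proof -
    obtain b where "b \<in> insert u A" "pos (insert u A) b = i" using pos_surj[of "insert u A" i] A i by auto
    then show ?thesis using r'(3)[of b] i A \<open>pos (insert u A) u = l\<close> by (auto simp: lface_def)
  qed
  then show ?thesis using r' by blast
qed

lemma homotopic_replace_lface:
  assumes Z: "finite Z" "card Z = Suc (Suc m)" "v \<in> Z" and m: "1 \<le> m"
    and h: "homotopic m x y" and r: "r \<in> K (Suc m)" "lface Z v r = x"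
  shows "\<exists>r'\<in>K (Suc m). lface Z v r' = y \<and> (\<forall>w\<in>Z. w \<noteq> v --> lface Z w r' = lface Z w r)"
proof -
  have "pos Z v \<le> Suc m" using pos_less_card[OF Z(1,3)] Z by simp
  then obtain r' where r': "r' \<in> K (Suc m)" "d (Suc m) (pos Z v) r' = y"
    "\<And>i. i \<le> Suc m ==> i \<noteq> pos Z v ==> d (Suc m) i r' = d (Suc m) i r"
    using homotopic_replace[OF m h r(1)] r(2) Z(2) by (auto simp: lface_def)
  have "lface Z w r' = lface Z w r" if "w \<in> Z" "w \<noteq> v" for w
    using r'(3)[of "pos Z w"] that pos_less_card[OF Z(1), of w] pos_eq_iff[OF Z(1), of w v] Z
    by (simp add: lface_def)
  then show ?thesis using r' Z(2) by (intro bexI[of _ r']) (auto simp: lface_def)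
qed

text \<open>A simplex with vertex set \<open>A\<close> is extended to the new vertex \<open>v\<close> by gluing on a copy of one of its edges.\<close>

lemma extend_simplex:
  assumes A: "finite A" "card A = Suc m" "1 \<le> m" and x: "x \<in> K m" and v: "v \<notin> A"
  shows "\<exists>t\<in>K (Suc m). lface (insert v A) v t = x"
proof -
  have "\<exists>a b. a \<in> A \<and> b \<in> A \<and> a \<noteq> b" using A card_le_Suc0_iff_eq[of A] by auto
  then obtain a b where ab: "a \<in> A" "b \<in> A" "a < b" by (metis linorder_neqE_nat)
  define e where "e = subface A x {a, b}"
  have e: "e \<in> K 1" using subface_in[of A "{a, b}" x] A x ab by (auto simp: e_def)
  have "{a, b} - {a} = {b}" "{a, b} - {b} = {a}" using ab(3) by auto
  then have e_faces: "d 1 1 e = subface A x {a}" "d 1 0 e = subface A x {b}"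
    using lface_subface[of A "{a, b}" b x] lface_subface[of A "{a, b}" a x] A x ab
    by (simp_all add: lface_doubleton e_def)
  define c where "c = (if a < v then a else b)"
  have c: "c \<in> A" "c \<noteq> v" "A \<inter> {c, v} = {c}" "A \<union> {c, v} = insert v A"
    using ab v by (auto simp: c_def)
  have "subface {c, v} e ({c, v} - {v}) = lface {c, v} v e" using c e by (intro subface_Diff_singleton) auto
  moreover have "{c, v} - {v} = {c}" using c by auto
  moreover have "lface {c, v} v e = subface A x {c}"
  proof (cases "a < v")
    case False
    then have "v < b" "c = b" using ab v by (auto simp: c_def)
    then show ?thesis using e_faces lface_doubleton(1)[of v b e] by (simp add: insert_commute)
  qed (use e_faces in \<open>simp add: c_def lface_doubleton\<close>)
  ultimately have agree: "subface A x (A \<inter> {c, v}) = subface {c, v} e (A \<inter> {c, v})"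
    unfolding c(3) by simp
  have "card {c, v} = 2" using c(2) by simp
  then obtain s where s: "coherent (Pow (insert v A) - {{}}) s" "s A = x"
    using glue2[OF A(1) _ _ _ c(1) _ agree] A(2) x e unfolding c(4) by auto
  have "lface (insert v A) v (s (insert v A)) = s (insert v A - {v})"
    using A v by (intro coherent_Pow_lface[OF s(1)]) auto
  moreover have "s (insert v A) \<in> K (Suc m)" using coherent_Pow_in[OF s(1), of "insert v A"] A v by simp
  ultimately show ?thesis using s(2) v by (intro bexI[of _ "s (insert v A)"]) simp_all
qed

lemma homotopic_refl:
  assumes "x \<in> K m" "1 \<le> m"
  shows "homotopic m x x"
proof -
  obtain t where t: "t \<in> K (Suc m)" "lface (insert (Suc m) {..m}) (Suc m) t = x"
    using extend_simplex[of "{..m}" m x "Suc m"] assms by auto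
  have "homotopic m (lface (insert (Suc m) {..m}) (Suc m) t) (lface (insert (Suc m) {..m}) (Suc m) t)"
    using t by (intro homotopic_lfaceI) auto
  then show ?thesis using t by simp
qed

lemma homotopic_trans:
  assumes "homotopic m x y" "homotopic m y z" "1 \<le> m"
  shows "homotopic m x z"
proof -
  obtain t t' j where t: "t \<in> K (Suc m)" "t' \<in> K (Suc m)" "j \<le> Suc m" "d (Suc m) j t = x" "d (Suc m) j t' = y"
    "\<And>i. i \<le> Suc m ==> i \<noteq> j ==> d (Suc m) i t = d (Suc m) i t'"
    using assms unfolding homotopic_def by blast
  obtain r where r: "r \<in> K (Suc m)" "d (Suc m) j r = z"
    "\<And>i. i \<le> Suc m ==> i \<noteq> j ==> d (Suc m) i r = d (Suc m) i t'"
    using homotopic_replace[OF assms(3,2) t(2,3,5)] by blast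
  show ?thesis using homotopicI[OF t(1) r(1) t(3)] t r by simp
qed

definition class_rep :: "nat => 's => 's" where
  "class_rep m x = (SOME y. homotopic m x y)"

lemma homotopic_class_rep: "x \<in> K m ==> 1 \<le> m ==> homotopic m x (class_rep m x)"
  unfolding class_rep_def by (rule someI) (rule homotopic_refl)

lemma class_rep_eq:
  assumes "homotopic m x y" "1 \<le> m"
  shows "class_rep m x = class_rep m y"
proof -
  have "homotopic m x z \<longleftrightarrow> homotopic m y z" for z
    using homotopic_trans[OF assms(1) _ assms(2)] homotopic_trans[OF homotopic_sym[OF assms(1)] _ assms(2)] by blast
  then show ?thesis by (simp add: class_rep_def)
qed

lemma class_rep_idem: "x \<in> K m ==> 1 \<le> m ==> class_rep m (class_rep m x) = class_rep m x"
  using class_rep_eq[OF homotopic_class_rep] by simp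

lemma parallel_class_rep: "x \<in> K m ==> 1 \<le> m ==> parallel m x (class_rep m x)"
  using homotopic_parallel homotopic_class_rep by blast

definition class_reps :: "nat => 's => 's set" where
  "class_reps m x = class_rep m ` {z. parallel m z x}"

lemma class_repsD:
  assumes "z \<in> class_reps m x" "1 \<le> m"
  shows "parallel m z x" "class_rep m z = z" "z \<in> K m"
proof -
  obtain y where y: "z = class_rep m y" "parallel m y x" using assms by (auto simp: class_reps_def)
  then have yK: "y \<in> K m" by (auto simp: parallel_def)
  show "parallel m z x" "class_rep m z = z"
    using parallel_trans[OF parallel_sym[OF parallel_class_rep[OF yK assms(2)]] y(2)]
      class_rep_idem[OF yK assms(2)] y(1) by simp_all
  then show "z \<in> K m" by (simp add: parallel_def)
qed

lemma class_repsI: "parallel m z x ==> class_rep m z \<in> class_reps m x"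
  by (auto simp: class_reps_def)

lemma class_reps_cong:
  assumes "parallel m x y"
  shows "class_reps m x = class_reps m y"
proof -
  have "parallel m z x \<longleftrightarrow> parallel m z y" for z
    using parallel_trans[OF _ assms] parallel_trans[OF _ parallel_sym[OF assms]] by blast
  then show ?thesis by (simp add: class_reps_def)
qed

lemma class_reps_eqI:
  assumes "z \<in> class_reps m x" "w \<in> class_reps m y" "homotopic m z w" "1 \<le> m"
  shows "z = w"
  using class_rep_eq[OF assms(3,4)] class_repsD(2)[OF assms(1,4)] class_repsD(2)[OF assms(2,4)] by simp

subsection \<open>Transport along simplices\<close>

definition transports :: "nat => nat => nat => 's => 's => 's => bool" where
  "transports m p q E z u \<longleftrightarrow> (\<exists>F\<in>K (Suc m). d (Suc m) p F = z \<and> d (Suc m) q F = u \<and>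
    (\<forall>k\<le>Suc m. k \<noteq> p --> k \<noteq> q --> d (Suc m) k F = d (Suc m) k E))"

lemma transports_self: "E \<in> K (Suc m) ==> transports m p q E (d (Suc m) p E) (d (Suc m) q E)"
  unfolding transports_def by blast

lemma transports_sym: "transports m p q E z u ==> transports m q p E u z"
  unfolding transports_def by blast

lemma transports_cong:
  assumes "\<And>k. k \<le> Suc m ==> k \<noteq> p ==> k \<noteq> q ==> d (Suc m) k E = d (Suc m) k E'"
  shows "transports m p q E = transports m p q E'"
  unfolding transports_def fun_eq_iff using assms by simp

lemma transportsE:
  assumes "transports m p q E z u"
  obtains F where "F \<in> K (Suc m)" "d (Suc m) p F = z" "d (Suc m) q F = u"
    "\<And>k. k \<le> Suc m ==> k \<noteq> p ==> k \<noteq> q ==> d (Suc m) k F = d (Suc m) k E"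
    "transports m p q F = transports m p q E"
proof -
  obtain F where F: "F \<in> K (Suc m)" "d (Suc m) p F = z" "d (Suc m) q F = u"
    "\<And>k. k \<le> Suc m ==> k \<noteq> p ==> k \<noteq> q ==> d (Suc m) k F = d (Suc m) k E"
    using assms unfolding transports_def by blast
  show thesis
    using that[OF F transports_cong[OF F(4)]] .
qed

lemma transports_total:
  assumes m: "1 \<le> m" "p \<le> Suc m" "q \<le> Suc m" "p \<noteq> q" and E: "E \<in> K (Suc m)" "parallel m z (d (Suc m) p E)"
  obtains u where "transports m p q E z u"
proof -
  let ?V = "{..Suc m}"
  define x where "x b = (if b = p then z else lface ?V b E)" for b
  have "\<exists>t\<in>K (card ?V - 1). \<forall>b\<in>?V. b \<noteq> q --> lface ?V b t = x b"
  proof (rule horn_labelled)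
    show "finite ?V" "3 \<le> card ?V" "q \<in> ?V" using m by auto
    show "x b \<in> K (card ?V - 2)" if "b \<in> ?V" "b \<noteq> q" for b
      using that E face_in[OF E(1), of b] by (auto simp: x_def parallel_def lface_atMost)
    have z: "lface (?V - {p}) c z = lface (?V - {p}) c (lface ?V p E)" if "c \<in> ?V" "c \<noteq> p" for c
      using E(2) parallel_lface[of "?V - {p}" m z "d (Suc m) p E"] m that by (simp add: lface_atMost)
    have "lface (?V - {b}) c (lface ?V b E) = lface (?V - {c}) b (lface ?V c E)"
      if "b \<in> ?V" "c \<in> ?V" "b \<noteq> c" for b c
      using that m E by (intro lface_commute) auto
    then show "lface (?V - {b}) c (x b) = lface (?V - {c}) b (x c)"
      if "b \<in> ?V" "c \<in> ?V" "b \<noteq> q" "c \<noteq> q" "b \<noteq> c" for b c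
      using that z m by (simp add: x_def)
  qed
  then obtain t where t: "t \<in> K (Suc m)" "\<And>b. b \<le> Suc m ==> b \<noteq> q ==> d (Suc m) b t = x b"
    by (auto simp: lface_atMost)
  have "transports m p q E z (d (Suc m) q t)"
    unfolding transports_def using t m by (intro bexI[of _ t]) (auto simp: x_def lface_atMost)
  then show thesis by (rule that)
qed

lemma transports_parallel:
  assumes "1 \<le> m" "p \<le> Suc m" "q \<le> Suc m" "p \<noteq> q" "E \<in> K (Suc m)"
    and "transports m p q E z u" "parallel m z (d (Suc m) p E)"
  shows "parallel m u (d (Suc m) q E)"
proof -
  obtain F where F: "F \<in> K (Suc m)" "d (Suc m) p F = z" "d (Suc m) q F = u"
    "\<And>k. k \<le> Suc m ==> k \<noteq> p ==> k \<noteq> q ==> d (Suc m) k F = d (Suc m) k E"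
    using transportsE[OF assms(6)] by blast
  then show ?thesis using parallel_last_face[OF assms(1-4) F(1) assms(5) F(4)] assms(7) by simp
qed

lemma transports_unique_homotopic:
  assumes "q \<le> Suc m" "transports m p q E z u" "transports m p q E z u'"
  shows "homotopic m u u'"
proof -
  obtain F where F: "F \<in> K (Suc m)" "d (Suc m) p F = z" "d (Suc m) q F = u"
    "\<And>k. k \<le> Suc m ==> k \<noteq> p ==> k \<noteq> q ==> d (Suc m) k F = d (Suc m) k E"
    using transportsE[OF assms(2)] by blast
  obtain F' where F': "F' \<in> K (Suc m)" "d (Suc m) p F' = z" "d (Suc m) q F' = u'"
    "\<And>k. k \<le> Suc m ==> k \<noteq> p ==> k \<noteq> q ==> d (Suc m) k F' = d (Suc m) k E"
    using transportsE[OF assms(3)] by blast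
  have "d (Suc m) k F = d (Suc m) k F'" if "k \<le> Suc m" "k \<noteq> q" for k
    using F(2,4) F'(2,4) that by (cases "k = p") auto
  then show ?thesis using homotopicI[OF F(1) F'(1) assms(1)] F(3) F'(3) by simp
qed

lemma transports_homotopic:
  assumes "1 \<le> m" "p \<noteq> q" "q \<le> Suc m" "p \<le> Suc m" "transports m p q E z u" "homotopic m u u'"
  shows "transports m p q E z u'"
proof -
  obtain F where F: "F \<in> K (Suc m)" "d (Suc m) p F = z" "d (Suc m) q F = u"
    "\<And>k. k \<le> Suc m ==> k \<noteq> p ==> k \<noteq> q ==> d (Suc m) k F = d (Suc m) k E"
    using transportsE[OF assms(5)] by blast
  obtain F' where F': "F' \<in> K (Suc m)" "d (Suc m) q F' = u'"
    "\<And>k. k \<le> Suc m ==> k \<noteq> q ==> d (Suc m) k F' = d (Suc m) k F"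
    using homotopic_replace[OF assms(1,6) F(1) assms(3) F(3)] by blast
  then show ?thesis unfolding transports_def using F assms(2,4) by (intro bexI[of _ F']) auto
qed

lemma transports_pos:
  assumes Q: "finite Q" "card Q = Suc (Suc m)" "p \<in> Q" "q \<in> Q"
  shows "transports m (pos Q p) (pos Q q) E z u \<longleftrightarrow> (\<exists>F\<in>K (Suc m). lface Q p F = z \<and> lface Q q F = u \<and>
    (\<forall>b\<in>Q. b \<noteq> p --> b \<noteq> q --> lface Q b F = lface Q b E))"
proof -
  have "(\<forall>k\<le>Suc m. k \<noteq> pos Q p --> k \<noteq> pos Q q --> f k) \<longleftrightarrow> (\<forall>b\<in>Q. b \<noteq> p --> b \<noteq> q --> f (pos Q b))" for f
  proof (intro iffI allI ballI impI)
    fix b assume "\<forall>k\<le>Suc m. k \<noteq> pos Q p --> k \<noteq> pos Q q --> f k" "b \<in> Q" "b \<noteq> p" "b \<noteq> q"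
    then show "f (pos Q b)" using pos_less_card[OF Q(1), of b] Q by (simp add: pos_eq_iff)
  next
    fix k assume "\<forall>b\<in>Q. b \<noteq> p --> b \<noteq> q --> f (pos Q b)" "k \<le> Suc m" "k \<noteq> pos Q p" "k \<noteq> pos Q q"
    moreover obtain b where "b \<in> Q" "pos Q b = k"
      using pos_surj[OF Q(1), of k] Q(2) \<open>k \<le> Suc m\<close> by auto
    ultimately show "f k" by auto
  qed
  then show ?thesis using Q(2) by (simp add: transports_def lface_def)
qed

lemma fillable_iff_transports:
  assumes V: "finite V" "card V = Suc (Suc (Suc m))" and abc: "a \<in> V" "b \<in> V" "c \<in> V" "distinct [a, b, c]"
    and W: "coherent (Pow V - {{}}) W"
    and s: "\<And>k. k \<in> V ==> k \<notin> {a, b, c} ==> s (V - {c} - {k}) = W (V - {c} - {k})"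
  shows "fillable s (V - {c}) \<longleftrightarrow> transports m (pos (V - {c}) b) (pos (V - {c}) a) (W (V - {c}))
    (s (V - {c} - {b})) (s (V - {c} - {a}))"
proof -
  let ?Q = "V - {c}"
  have Q: "finite ?Q" "card ?Q = Suc (Suc m)" "b \<in> ?Q" "a \<in> ?Q" using V abc by auto
  have face: "lface ?Q k (W ?Q) = s (?Q - {k})" if "k \<in> ?Q" "k \<noteq> b" "k \<noteq> a" for k
    using coherent_Pow_lface[OF W, of ?Q k] Q s[of k] that by simp
  have split: "(\<forall>k\<in>?Q. P k) \<longleftrightarrow> P b \<and> P a \<and> (\<forall>k\<in>?Q. k \<noteq> b --> k \<noteq> a --> P k)" for P
    using Q(3,4) by metis
  have "(\<forall>k\<in>?Q. lface ?Q k F = s (?Q - {k})) \<longleftrightarrow> lface ?Q b F = s (?Q - {b}) \<and> lface ?Q a F = s (?Q - {a}) \<and>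
      (\<forall>k\<in>?Q. k \<noteq> b --> k \<noteq> a --> lface ?Q k F = lface ?Q k (W ?Q))" for F
    by (subst split) (simp add: face)
  then show ?thesis unfolding transports_pos[OF Q] fillable_def by (simp add: Q(2))
qed

definition replace_corners :: "nat set => nat => nat => nat => 's => 's => 's => (nat set => 's) => nat set => 's" where
  "replace_corners V a b c x u w W = W(V - {b, c} := x, V - {a, c} := u, V - {a, b} := w)"

lemma replace_corners_eq:
  fixes x u w :: 's and W :: "nat set => 's"
  assumes "a \<in> V" "b \<in> V" "c \<in> V" "distinct [a, b, c]"
  defines "s \<equiv> replace_corners V a b c x u w W"
  shows "s (V - {c} - {b}) = x" "s (V - {b} - {c}) = x" "s (V - {c} - {a}) = u" "s (V - {a} - {c}) = u"
    "s (V - {a} - {b}) = w" "s (V - {b} - {a}) = w"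
proof -
  have "V - {a, c} \<noteq> V - {b, c}" "V - {a, b} \<noteq> V - {b, c}" "V - {a, b} \<noteq> V - {a, c}"
    using assms by auto
  then show "s (V - {c} - {b}) = x" "s (V - {b} - {c}) = x" "s (V - {c} - {a}) = u" "s (V - {a} - {c}) = u"
    "s (V - {a} - {b}) = w" "s (V - {b} - {a}) = w"
    by (simp_all add: s_def replace_corners_def Diff_insert2[symmetric] insert_commute)
qed

lemma replace_corners_other:
  assumes "k \<in> V" "k \<notin> {a, b, c}"
  shows "replace_corners V a b c x u w W (V - {e} - {k}) = W (V - {e} - {k})"
proof -
  have "V - {e} - {k} \<noteq> V - {b, c}" "V - {e} - {k} \<noteq> V - {a, c}" "V - {e} - {k} \<noteq> V - {a, b}"
    using assms by blast+
  then show ?thesis by (simp add: replace_corners_def)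
qed

lemma transports_facet_parallel:
  assumes V: "finite V" "card V = Suc (Suc (Suc m))" "1 \<le> m"
    and ebc: "e \<in> V" "b \<in> V" "c \<in> V" "distinct [e, b, c]"
    and W: "coherent (Pow V - {{}}) W" and x: "parallel m x (W (V - {e} - {b}))"
    and xu: "transports m (pos (V - {e}) b) (pos (V - {e}) c) (W (V - {e})) x u"
  shows "parallel m u (W (V - {e} - {c}))"
proof -
  have V': "finite (V - {e})" "card (V - {e}) = Suc (Suc m)" using V ebc by auto
  have face: "d (Suc m) (pos (V - {e}) k) (W (V - {e})) = W (V - {e} - {k})" if "k \<in> V" "k \<noteq> e" for k
    using coherent_Pow_lface[OF W, of "V - {e}" k] V' that by (simp add: lface_def)
  have "pos (V - {e}) b \<le> Suc m" "pos (V - {e}) c \<le> Suc m" "pos (V - {e}) b \<noteq> pos (V - {e}) c"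
    using pos_less_card[OF V'(1), of b] pos_less_card[OF V'(1), of c] pos_eq_iff[OF V'(1), of b c] V'(2) ebc by auto
  moreover have "W (V - {e}) \<in> K (Suc m)" using coherent_Pow_in[OF W, of "V - {e}"] V' by fastforce
  ultimately show ?thesis using transports_parallel[OF V(3) _ _ _ _ xu] face[of b] face[of c] ebc x by simp
qed

text \<open>Three transports along the facets of a simplex opposite \<open>a\<close>, \<open>b\<close> and \<open>c\<close>; any two of them determine the third.\<close>

lemma transports_triangle:
  assumes V: "finite V" "card V = Suc (Suc (Suc m))" "1 \<le> m"
    and abc: "a \<in> V" "b \<in> V" "c \<in> V" "distinct [a, b, c]"
    and W: "coherent (Pow V - {{}}) W" and x: "parallel m x (W (V - {c} - {b}))"
    and xu: "transports m (pos (V - {c}) b) (pos (V - {c}) a) (W (V - {c})) x u"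
    and xw: "transports m (pos (V - {b}) c) (pos (V - {b}) a) (W (V - {b})) x w"
  shows "transports m (pos (V - {a}) c) (pos (V - {a}) b) (W (V - {a})) u w"
proof -
  define s where "s = replace_corners V a b c x u w W"
  note s_abc = replace_corners_eq[OF abc, of x u w W, folded s_def]
  note s_other = replace_corners_other[of _ V a b c x u w W, folded s_def]
  have pair: "V - {p, q} = V - {q} - {p}" "V - {p} - {q} = V - {q} - {p}" for p q
    by blast+
  have "parallel m u (W (V - {a, c}))"
    unfolding pair(1) using abc xu by (intro transports_facet_parallel[OF V abc(3,2,1) _ W x]) auto
  moreover have "parallel m w (W (V - {a, b}))"
    unfolding pair(1) using abc xw x[unfolded pair(2)[of c b]]
    by (intro transports_facet_parallel[OF V abc(2,3,1) _ W]) auto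
  ultimately have "coherent (skeleton V) s"
    unfolding s_def replace_corners_def
    using abc x pair(1)[of b c] by (intro coherent_skeleton_fun_upd[OF V(1,2)] coherent_skeleton[OF W]) auto
  then have "fillable s (V - {a})"
  proof (rule fillable_last_facet[OF V(1) _ abc(1), rotated])
    fix e assume e: "e \<in> V" "e \<noteq> a"
    consider "e = b" | "e = c" | "e \<notin> {a, b, c}"
      using e by blast
    then show "fillable s (V - {e})"
    proof cases
      case 1
      then show ?thesis using fillable_iff_transports[OF V(1,2), of a c b W s] abc W s_other xw s_abc by auto
    next
      case 2
      then show ?thesis using fillable_iff_transports[OF V(1,2), of a b c W s] abc W s_other xu s_abc by auto
    next
      case 3
      have "V - {e} \<noteq> {}" "card (V - {e}) = Suc (Suc m)"
        using Diff_singleton_nonempty[of V e] V e(1) by simp_all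
      then have "fillable W (V - {e})" using V(1) by (intro fillable_coherent[OF W]) auto
      then show ?thesis using s_other[OF e(1) 3] pair(2)[of e] by (elim fillable_cong) simp
    qed
  qed (use V in simp)
  then show ?thesis using fillable_iff_transports[OF V(1,2), of b c a W s] abc W s_other s_abc by auto
qed

subsection \<open>Round trips\<close>

definition round_trip :: "nat => nat => 's => 's => 's => 's => bool" where
  "round_trip m i D1 D2 z w \<longleftrightarrow> (\<exists>u. transports m (Suc i) i D1 z u \<and> transports m (Suc i) i D2 w u)"

definition round_trip_data :: "nat => 's => nat => 's => 's => bool" where
  "round_trip_data m x i D1 D2 \<longleftrightarrow> i \<le> m \<and> D1 \<in> K (Suc m) \<and> D2 \<in> K (Suc m) \<and>
    parallel m (d (Suc m) (Suc i) D1) x \<and> parallel m (d (Suc m) (Suc i) D2) x \<and>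
    parallel m (d (Suc m) i D1) (d (Suc m) i D2)"

definition round_trip_data_along :: "nat => 's => nat => nat => 's => 's => bool" where
  "round_trip_data_along m x e a E1 E2 \<longleftrightarrow> round_trip_data m x e E1 E2 \<and> a \<le> m \<and> a \<noteq> e \<and>
    (\<forall>k\<le>Suc m. k \<notin> {e, Suc e, skip (Suc e) a} --> d (Suc m) k E1 = d (Suc m) k E2)"

lemma round_trip_dataD:
  assumes "round_trip_data m x i D1 D2"
  shows "i \<le> m" "i \<le> Suc m" "Suc i \<le> Suc m" "D1 \<in> K (Suc m)" "D2 \<in> K (Suc m)"
    "parallel m (d (Suc m) (Suc i) D1) x" "parallel m (d (Suc m) (Suc i) D2) x"
    "parallel m (d (Suc m) i D1) (d (Suc m) i D2)"
  using assms by (auto simp: round_trip_data_def)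

lemma round_trip_parallel:
  assumes m: "1 \<le> m" and data: "round_trip_data m x i D1 D2" and z: "parallel m z x"
    and trip: "round_trip m i D1 D2 z w"
  shows "parallel m w x"
proof -
  note D = round_trip_dataD[OF data]
  obtain u where u: "transports m (Suc i) i D1 z u" "transports m (Suc i) i D2 w u"
    using trip unfolding round_trip_def by blast
  have "parallel m u (d (Suc m) i D1)"
    using transports_parallel[OF m D(3,2) _ D(4) u(1)] parallel_trans[OF z parallel_sym[OF D(6)]] by simp
  then have "parallel m w (d (Suc m) (Suc i) D2)"
    using transports_parallel[OF m D(2,3) _ D(5) transports_sym[OF u(2)]] parallel_trans[OF _ D(8)] by simp
  then show ?thesis using parallel_trans[OF _ D(7)] by blast
qed

lemma round_trip_total:
  assumes m: "1 \<le> m" and data: "round_trip_data m x i D1 D2" and z: "parallel m z x"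
  shows "\<exists>w. round_trip m i D1 D2 z w"
proof -
  note D = round_trip_dataD[OF data]
  have z': "parallel m z (d (Suc m) (Suc i) D1)"
    using parallel_trans[OF z parallel_sym[OF D(6)]] .
  obtain u where u: "transports m (Suc i) i D1 z u" using transports_total[OF m D(3,2) _ D(4) z'] by auto
  have "parallel m u (d (Suc m) i D1)" using transports_parallel[OF m D(3,2) _ D(4) u z'] by simp
  then obtain w where "transports m i (Suc i) D2 u w"
    using transports_total[OF m D(2,3) _ D(5)] parallel_trans[OF _ D(8)] by (metis n_not_Suc_n)
  then show ?thesis using u transports_sym unfolding round_trip_def by blast
qed

lemma round_trip_unique:
  assumes m: "1 \<le> m" "i \<le> m" and trips: "round_trip m i D1 D2 z w" "round_trip m i D1 D2 z w'"
  shows "homotopic m w w'"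
proof -
  obtain u where u: "transports m (Suc i) i D1 z u" "transports m (Suc i) i D2 w u"
    using trips(1) unfolding round_trip_def by blast
  obtain u' where u': "transports m (Suc i) i D1 z u'" "transports m (Suc i) i D2 w' u'"
    using trips(2) unfolding round_trip_def by blast
  have "homotopic m u' u" using transports_unique_homotopic[OF _ u'(1) u(1)] m by simp
  then have "transports m (Suc i) i D2 w' u" using transports_homotopic[OF m(1) _ _ _ u'(2)] m by simp
  then show ?thesis using transports_unique_homotopic[of "Suc i" m i D2 u w w'] transports_sym u(2) m by simp
qed

lemma round_trip_homotopic:
  assumes m: "1 \<le> m" "i \<le> m" and "round_trip m i D1 D2 z w" "homotopic m w w'"
  shows "round_trip m i D1 D2 z w'"
proof -
  obtain u where u: "transports m (Suc i) i D1 z u" "transports m (Suc i) i D2 w u"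
    using assms(3) unfolding round_trip_def by blast
  have "transports m i (Suc i) D2 u w'"
    using transports_homotopic[OF m(1) _ _ _ transports_sym[OF u(2)] assms(4)] m(2) by simp
  then show ?thesis using u(1) transports_sym unfolding round_trip_def by blast
qed

lemma glue_two_cylinders:
  assumes A: "finite A" "card A = Suc m" "1 \<le> m"
    and labels: "a \<in> A" "e \<in> A" "a \<noteq> e" "a' \<notin> A" "e' \<notin> A" "a' \<noteq> e'"
    and P_def: "P = insert a' A" and Q_def: "Q = insert e' A"
    and K: "D1 \<in> K (Suc m)" "D2 \<in> K (Suc m)" "E \<in> K (Suc m)" "F \<in> K (Suc m)"
    and common_faces: "lface P a' D1 = lface Q e' E" "lface P a' D2 = lface Q e' F"
      "lface P a D1 = lface P a D2" "lface Q a E = lface Q a F"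
  obtains W1 W2 where "coherent (Pow (P \<union> Q) - {{}}) W1" "W1 P = D1" "W1 Q = E"
    "coherent (Pow (P \<union> Q) - {{}}) W2" "W2 P = D2" "W2 Q = F" "W1 (P \<union> Q - {a}) = W2 (P \<union> Q - {a})"
proof -
  define R where "R = P \<union> Q - {a}"
  have P: "finite P" "card P = Suc (Suc m)" "P - {a'} = A" "a \<in> P" "a' \<in> P" "e \<in> P"
    and Q: "finite Q" "card Q = Suc (Suc m)" "Q - {e'} = A" "a \<in> Q" "e' \<in> Q" "e \<in> Q"
    using A labels by (auto simp: P_def Q_def)
  have union: "P \<union> Q = insert e' (insert a' A)" "P \<union> Q \<union> R = P \<union> Q"
    and int: "P \<inter> Q = A" "P \<inter> R = P - {a}" "Q \<inter> R = Q - {a}"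
    using labels by (auto simp: R_def P_def Q_def)
  have R: "finite R" "card R = Suc (Suc m)" "e \<in> R" "R \<subseteq> P \<union> Q"
    using A labels by (auto simp: R_def P_def Q_def card_insert_if)
  have nonempty: "P - {a} \<noteq> {}" "Q - {a} \<noteq> {}" and sub: "P - {a} \<subseteq> R" "Q - {a} \<subseteq> R"
    using labels P(6) Q(6) by (auto simp: R_def)
  have "A \<noteq> {}" using labels(1) by blast
  then obtain W1 where W1: "coherent (Pow (P \<union> Q) - {{}}) W1" "W1 P = D1" "W1 Q = E"
    using glue_facets[OF A(1) _ labels(5,4), of D1 E] A(2) K(1,3) common_faces(1) labels(6) unfolding union(1)
    unfolding P_def Q_def by auto
  have W1_face: "W1 (P - {a}) = lface P a D1" "W1 (Q - {a}) = lface Q a E"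
    using coherent_Pow_lface[OF W1(1), of P a] coherent_Pow_lface[OF W1(1), of Q a] P Q W1(2,3) by simp_all
  have W1_R: "W1 R \<in> K (Suc m)" using coherent_Pow_in[OF W1(1), of R] R by auto
  have "R \<in> Pow (P \<union> Q) - {{}}" using R(3,4) by blast
  then have W1_subface: "subface R (W1 R) B = W1 B" if "B \<subseteq> R" "B \<noteq> {}" for B
    using coherent_eq_subface[OF W1(1) _ that] by simp
  have face_P: "subface P X A = lface P a' X" "subface P X (P - {a}) = lface P a X" if "X \<in> K (Suc m)" for X
    using subface_Diff_singleton[of P a' X] subface_Diff_singleton[of P a X] P that by simp_all
  have face_Q: "subface Q X A = lface Q e' X" "subface Q X (Q - {a}) = lface Q a X" if "X \<in> K (Suc m)" for X
    using subface_Diff_singleton[of Q e' X] subface_Diff_singleton[of Q a X] Q that by simp_all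
  have "\<exists>s. coherent (Pow (P \<union> Q \<union> R) - {{}}) s \<and> s P = D2 \<and> s Q = F \<and> s R = W1 R"
  proof (rule glue3[where b = e])
    show "subface P D2 (P \<inter> Q) = subface Q F (P \<inter> Q)"
      unfolding int using face_P face_Q K common_faces(2) by simp
    show "subface P D2 (P \<inter> R) = subface R (W1 R) (P \<inter> R)"
      unfolding int using face_P K common_faces(3) W1_face(1) W1_subface[OF sub(1) nonempty(1)] by simp
    show "subface Q F (Q \<inter> R) = subface R (W1 R) (Q \<inter> R)"
      unfolding int using face_Q K common_faces(4) W1_face(2) W1_subface[OF sub(2) nonempty(2)] by simp
  qed (use P Q R K W1_R in simp_all)
  then obtain W2 where "coherent (Pow (P \<union> Q) - {{}}) W2" "W2 P = D2" "W2 Q = F" "W1 R = W2 R"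
    unfolding union(2) by metis
  then show thesis using that[OF W1] unfolding R_def by blast
qed

lemma transports_cylinder:
  assumes V: "finite V" "card V = Suc (Suc (Suc m))" "1 \<le> m"
    and abe: "a \<in> V" "b \<in> V" "e \<in> V" "distinct [a, b, e]"
    and W: "coherent (Pow V - {{}}) W1" "coherent (Pow V - {{}}) W2" "W1 (V - {a}) = W2 (V - {a})"
    and y: "parallel m y (W1 (V - {e} - {b}))"
    and c: "transports m (pos (V - {e}) b) (pos (V - {e}) a) (W1 (V - {e})) y c"
      "transports m (pos (V - {e}) b) (pos (V - {e}) a) (W2 (V - {e})) y' c"
    and w: "transports m (pos (V - {b}) e) (pos (V - {b}) a) (W1 (V - {b})) y w"
  shows "transports m (pos (V - {b}) e) (pos (V - {b}) a) (W2 (V - {b})) y' w"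
proof (rule transports_triangle[OF V abe(2,1,3) _ W(2)])
  have "W1 (V - {a} - {e}) = W2 (V - {a} - {e})"
    using coherent_Pow_lface[OF W(1), of "V - {a}" e] coherent_Pow_lface[OF W(2), of "V - {a}" e] W(3) V abe by simp
  moreover have "V - {e} - {a} = V - {a} - {e}" by blast
  moreover have "parallel m c (W1 (V - {e} - {a}))"
    using abe by (intro transports_facet_parallel[OF V abe(3,2,1) _ W(1) y c(1)]) auto
  ultimately show "parallel m c (W2 (V - {e} - {a}))" by simp
  show "transports m (pos (V - {e}) a) (pos (V - {e}) b) (W2 (V - {e})) c y'" by (rule transports_sym[OF c(2)])
  show "transports m (pos (V - {a}) e) (pos (V - {a}) b) (W2 (V - {a})) c w"
    using transports_triangle[OF V abe W(1) y c(1) w] unfolding W(3) .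
qed (use abe in auto)

lemma cylinders_over_round_trip:
  assumes A: "finite A" "card A = Suc m" "1 \<le> m"
    and labels: "a \<in> A" "e \<in> A" "a \<noteq> e" "a' \<notin> A" "e' \<notin> A" "a' \<noteq> e'"
    and P_def: "P = insert a' A" and Q_def: "Q = insert e' A"
    and zw: "transports m (pos P a') (pos P a) D1 z c" "transports m (pos P a') (pos P a) D2 w c"
    and E: "E \<in> K (Suc m)" "lface Q e' E = z" and w: "parallel m w z"
  obtains F W1 W2 where "F \<in> K (Suc m)" "lface Q e' F = w" "\<And>b. b \<in> A ==> b \<noteq> e ==> lface Q b F = lface Q b E"
    "coherent (Pow (P \<union> Q) - {{}}) W1" "W1 Q = E" "W1 A = z"
    "coherent (Pow (P \<union> Q) - {{}}) W2" "W2 Q = F" "W1 (P \<union> Q - {a}) = W2 (P \<union> Q - {a})"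
    "transports m (pos P a') (pos P a) (W1 P) = transports m (pos P a') (pos P a) D1"
    "transports m (pos P a') (pos P a) (W2 P) = transports m (pos P a') (pos P a) D2"
proof -
  have P: "card P = Suc (Suc m)" and Q: "finite Q" "card Q = Suc (Suc m)" "Q - {e'} = A" "e' \<in> Q" "e \<in> Q"
    using A labels by (auto simp: P_def Q_def)
  have pos_Q: "pos Q e' \<le> Suc m" "pos Q e \<le> Suc m" "pos Q e' \<noteq> pos Q e"
    using pos_less_card[OF Q(1)] Q labels by (auto simp: pos_eq_iff less_Suc_eq_le)
  obtain D1' where D1: "D1' \<in> K (Suc m)" "lface P a' D1' = z" "lface P a D1' = c"
    "transports m (pos P a') (pos P a) D1' = transports m (pos P a') (pos P a) D1"
    using transportsE[OF zw(1)] P unfolding lface_def by (metis diff_Suc_1)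
  obtain D2' where D2: "D2' \<in> K (Suc m)" "lface P a' D2' = w" "lface P a D2' = c"
    "transports m (pos P a') (pos P a) D2' = transports m (pos P a') (pos P a) D2"
    using transportsE[OF zw(2)] P unfolding lface_def by (metis diff_Suc_1)
  have "parallel m w (d (Suc m) (pos Q e') E)" using w E(2) Q(2) by (simp add: lface_def)
  then obtain f where "transports m (pos Q e') (pos Q e) E w f" using transports_total[OF A(3) pos_Q E(1)] by blast
  then obtain F where F: "F \<in> K (Suc m)" "lface Q e' F = w"
    "\<And>b. b \<in> Q ==> b \<noteq> e' ==> b \<noteq> e ==> lface Q b F = lface Q b E"
    unfolding transports_pos[OF Q(1,2,4,5)] by blast
  have F_face: "lface Q b F = lface Q b E" if "b \<in> A" "b \<noteq> e" for b
    using F(3)[of b] that labels(5) by (auto simp: Q_def)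
  then obtain W1 W2 where W: "coherent (Pow (P \<union> Q) - {{}}) W1" "W1 P = D1'" "W1 Q = E"
    "coherent (Pow (P \<union> Q) - {{}}) W2" "W2 P = D2'" "W2 Q = F" "W1 (P \<union> Q - {a}) = W2 (P \<union> Q - {a})"
    using glue_two_cylinders[OF A labels P_def Q_def D1(1) D2(1) E(1) F(1)] D1(2,3) D2(2,3) E(2) F(2) labels(1,3) by metis
  have "W1 A = z" using coherent_Pow_lface[OF W(1), of Q e'] Q W(3) E(2) by simp
  then show thesis using that[OF F(1,2) F_face W(1,3) _ W(4,6,7)] D1(4) D2(4) W(2,5) by blast
qed

lemma round_trips_commute_labelled:
  assumes A: "finite A" "card A = Suc m" "1 \<le> m"
    and labels: "a \<in> A" "e \<in> A" "a \<noteq> e" "a' \<notin> A" "e' \<notin> A" "a' \<noteq> e'"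
    and P_def: "P = insert a' A" and Q_def: "Q = insert e' A"
    and agree: "\<And>b. b \<in> A ==> b \<noteq> a ==> b \<noteq> e ==> lface Q b E1 = lface Q b E2"
    and zw: "transports m (pos P a') (pos P a) D1 z c" "transports m (pos P a') (pos P a) D2 w c"
    and yy: "transports m (pos P a') (pos P a) D1 y c'" "transports m (pos P a') (pos P a) D2 y2 c'"
    and zy: "transports m (pos Q e') (pos Q e) E1 z v" "transports m (pos Q e') (pos Q e) E2 y v"
    and par: "parallel m y z" "parallel m w z"
  obtains u where "transports m (pos Q e') (pos Q e) E1 w u" "transports m (pos Q e') (pos Q e) E2 y2 u"
proof -
  have V: "finite (P \<union> Q)" "card (P \<union> Q) = Suc (Suc (Suc m))" "a \<in> P \<union> Q" "a' \<in> P \<union> Q" "e' \<in> P \<union> Q"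
    "P \<union> Q - {e'} = P" "P \<union> Q - {a'} = Q" "distinct [a, a', e']" "P - {a'} = A"
    using A labels by (auto simp: P_def Q_def)
  have Q: "finite Q" "card Q = Suc (Suc m)" "a \<in> Q" "e' \<in> Q" "e \<in> Q" and Q_iff: "b \<in> Q \<longleftrightarrow> b = e' \<or> b \<in> A" for b
    using A labels by (auto simp: Q_def)
  obtain E1' where E1: "E1' \<in> K (Suc m)" "lface Q e' E1' = z" "lface Q e E1' = v"
    "\<And>b. b \<in> Q ==> b \<noteq> e' ==> b \<noteq> e ==> lface Q b E1' = lface Q b E1"
    using zy(1) unfolding transports_pos[OF Q(1,2,4,5)] by blast
  obtain E2' where E2: "E2' \<in> K (Suc m)" "lface Q e' E2' = y" "lface Q e E2' = v"
    "\<And>b. b \<in> Q ==> b \<noteq> e' ==> b \<noteq> e ==> lface Q b E2' = lface Q b E2"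
    using zy(2) unfolding transports_pos[OF Q(1,2,4,5)] by blast
  obtain F1 W1 W2 where F1: "F1 \<in> K (Suc m)" "lface Q e' F1 = w" "\<And>b. b \<in> A ==> b \<noteq> e ==> lface Q b F1 = lface Q b E1'"
    and W: "coherent (Pow (P \<union> Q) - {{}}) W1" "coherent (Pow (P \<union> Q) - {{}}) W2" "W1 (P \<union> Q - {a}) = W2 (P \<union> Q - {a})"
    and W_eq: "W1 Q = E1'" "W2 Q = F1" "W1 A = z" "transports m (pos P a') (pos P a) (W1 P) = transports m (pos P a') (pos P a) D1"
      "transports m (pos P a') (pos P a) (W2 P) = transports m (pos P a') (pos P a) D2"
    by (rule cylinders_over_round_trip[OF A labels P_def Q_def zw E1(1,2) par(2)]) (rule that)
  have "lface Q b E2' = lface Q b E1'" if "b \<in> Q" "b \<noteq> e'" "b \<noteq> a" for b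
    using that E1(3) E2(3) E1(4)[of b] E2(4)[of b] agree[of b] Q_iff by (cases "b = e") auto
  then have "transports m (pos Q e') (pos Q a) E1' y (lface Q a E2')"
    unfolding transports_pos[OF Q(1,2,4,3)] using E2(1,2) by blast
  then have "transports m (pos Q e') (pos Q a) F1 y2 (lface Q a E2')"
    using transports_cylinder[OF V(1,2) A(3) V(3-5,8) W, of y c' y2] yy par(1) by (simp add: V(6,7,9) W_eq)
  then obtain F2 where F2: "F2 \<in> K (Suc m)" "lface Q e' F2 = y2" "lface Q a F2 = lface Q a E2'"
    "\<And>b. b \<in> Q ==> b \<noteq> e' ==> b \<noteq> a ==> lface Q b F2 = lface Q b F1"
    unfolding transports_pos[OF Q(1,2,4,3)] by blast
  show thesis
  proof (rule that)
    show "transports m (pos Q e') (pos Q e) E1 w (lface Q e F1)"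
      unfolding transports_pos[OF Q(1,2,4,5)] using F1 E1(4) Q_iff by (intro bexI[of _ F1]) auto
    have "lface Q b F2 = lface Q b E2" if "b \<in> Q" "b \<noteq> e'" "b \<noteq> e" for b
      using F2(3) E2(4)[of b] F2(4)[of b] F1(3)[of b] E1(4)[of b] agree[of b] that Q_iff by (cases "b = a") auto
    then show "transports m (pos Q e') (pos Q e) E2 y2 (lface Q e F1)"
      unfolding transports_pos[OF Q(1,2,4,5)] using F2(1,2) F2(4)[of e] Q(5) labels by (intro bexI[of _ F2]) auto
  qed
qed

lemma pos_insert_odd:
  assumes "i \<le> m"
  defines "A \<equiv> (\<lambda>j. 2 * j) ` {..m}"
  shows "pos (insert (Suc (2 * i)) A) (Suc (2 * i)) = Suc i"
    "k \<le> m ==> pos (insert (Suc (2 * i)) A) (2 * k) = skip (Suc i) k"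
proof -
  let ?P = "insert (Suc (2 * i)) A"
  have "{b \<in> ?P. b < Suc (2 * i)} = (\<lambda>j. 2 * j) ` {..i}" using assms by auto
  then show "pos ?P (Suc (2 * i)) = Suc i" by (simp add: pos_def card_image inj_on_def)
  assume k: "k \<le> m"
  show "pos ?P (2 * k) = skip (Suc i) k"
  proof (cases "k \<le> i")
    case True
    then have "{b \<in> ?P. b < 2 * k} = (\<lambda>j. 2 * j) ` {..<k}" using k by (auto simp: A_def)
    then show ?thesis using True by (simp add: pos_def card_image inj_on_def skip_def)
  next
    case False
    then have "{b \<in> ?P. b < 2 * k} = insert (Suc (2 * i)) ((\<lambda>j. 2 * j) ` {..<k})"
      using k by (auto simp: A_def)
    moreover have "Suc (2 * i) \<notin> (\<lambda>j. 2 * j) ` {..<k}" by (auto; presburger)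
    ultimately show ?thesis using False by (simp add: pos_def card_image inj_on_def skip_def)
  qed
qed

lemma round_trips_commute:
  assumes m: "1 \<le> m" and D: "round_trip_data m x a D1 D2" and E: "round_trip_data_along m x e a E1 E2"
    and zw: "round_trip m a D1 D2 z w" and zy: "round_trip m e E1 E2 z y" and yy: "round_trip m a D1 D2 y y2"
    and par: "parallel m y z" "parallel m w z"
  shows "round_trip m e E1 E2 w y2"
proof -
  have ae: "a \<le> m" "e \<le> m" "a \<noteq> e"
    using D E by (auto simp: round_trip_data_def round_trip_data_along_def)
  define A where "A = (\<lambda>j. 2 * j) ` {..m}"
  have A: "finite A" "card A = Suc m" "2 * a \<in> A" "2 * e \<in> A" "2 * a \<noteq> 2 * e"
    using ae by (auto simp: A_def card_image inj_on_def)
  have odd: "Suc (2 * i) \<notin> A" for i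
    by (auto simp: A_def; presburger)
  define P where "P = insert (Suc (2 * a)) A"
  define Q where "Q = insert (Suc (2 * e)) A"
  have pos: "pos P (Suc (2 * a)) = Suc a" "pos P (2 * a) = a" "pos Q (Suc (2 * e)) = Suc e" "pos Q (2 * e) = e"
    using pos_insert_odd(1)[of a m] pos_insert_odd(2)[of a m a] pos_insert_odd(1)[of e m] pos_insert_odd(2)[of e m e] ae
    by (simp_all add: P_def Q_def A_def skip_def)
  have agree: "lface Q b E1 = lface Q b E2" if b: "b \<in> A" "b \<noteq> 2 * a" "b \<noteq> 2 * e" for b
  proof -
    obtain k where k: "b = 2 * k" "k \<le> m" using b by (auto simp: A_def)
    then have "skip (Suc e) k \<le> Suc m" "skip (Suc e) k \<notin> {e, Suc e, skip (Suc e) a}"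
      using b by (auto simp: skip_def)
    then have "d (Suc m) (skip (Suc e) k) E1 = d (Suc m) (skip (Suc e) k) E2"
      using E unfolding round_trip_data_along_def by blast
    then show ?thesis
      using pos_insert_odd(2)[of e m k] ae(2) k(2) A odd[of e] k(1) by (simp add: lface_def Q_def flip: A_def)
  qed
  obtain c c' v where "transports m (Suc a) a D1 z c" "transports m (Suc a) a D2 w c"
    "transports m (Suc a) a D1 y c'" "transports m (Suc a) a D2 y2 c'"
    "transports m (Suc e) e E1 z v" "transports m (Suc e) e E2 y v"
    using zw zy yy unfolding round_trip_def by blast
  then obtain u where "transports m (Suc e) e E1 w u" "transports m (Suc e) e E2 y2 u"
    using round_trips_commute_labelled[OF A(1,2) m A(3-5) odd odd _ P_def Q_def agree, unfolded pos] ae(3) par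
    by (metis Suc_inject mult_cancel1 zero_neq_numeral)
  then show ?thesis unfolding round_trip_def by blast
qed

definition round_trips :: "nat => 's => nat => ('s => 's) set" where
  "round_trips m x i = {f. \<exists>D1 D2. round_trip_data m x i D1 D2 \<and>
    (\<forall>z\<in>class_reps m x. f z \<in> class_reps m x \<and> round_trip m i D1 D2 z (f z))}"

definition round_trips_along :: "nat => 's => nat => nat => ('s => 's) set" where
  "round_trips_along m x e a = {f. \<exists>D1 D2. round_trip_data_along m x e a D1 D2 \<and>
    (\<forall>z\<in>class_reps m x. f z \<in> class_reps m x \<and> round_trip m e D1 D2 z (f z))}"

lemma round_trips_along_subset: "round_trips_along m x e a \<subseteq> round_trips m x e"
  by (auto simp: round_trips_along_def round_trips_def round_trip_data_along_def)

lemma round_trip_function: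
  assumes m: "1 \<le> m" and data: "round_trip_data m x i D1 D2"
  shows "\<exists>f. \<forall>z\<in>class_reps m x. f z \<in> class_reps m x \<and> round_trip m i D1 D2 z (f z)"
proof -
  have "\<exists>w. w \<in> class_reps m x \<and> round_trip m i D1 D2 z w" if "z \<in> class_reps m x" for z
  proof -
    have z: "parallel m z x"
      using class_repsD(1)[OF that m] .
    obtain w where w: "round_trip m i D1 D2 z w" using round_trip_total[OF m data z] by blast
    then have w': "parallel m w x" using round_trip_parallel[OF m data z] by blast
    then have "homotopic m w (class_rep m w)" using m by (auto simp: parallel_def intro: homotopic_class_rep)
    then have "round_trip m i D1 D2 z (class_rep m w)"
      using round_trip_homotopic[OF m round_trip_dataD(1)[OF data] w] by blast
    then show ?thesis using class_repsI[OF w'] by blast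
  qed
  then show ?thesis by metis
qed

lemma round_trips_closed: "f \<in> round_trips m x i ==> z \<in> class_reps m x ==> f z \<in> class_reps m x"
  by (auto simp: round_trips_def)

lemma round_trips_along_closed: "f \<in> round_trips_along m x e a ==> z \<in> class_reps m x ==> f z \<in> class_reps m x"
  by (auto simp: round_trips_along_def)

lemma round_trips_commute_along:
  assumes m: "1 \<le> m" and f: "f \<in> round_trips m x a" and g: "g \<in> round_trips_along m x e a"
    and z: "z \<in> class_reps m x"
  shows "f (g z) = g (f z)"
proof -
  obtain D1 D2 where D: "round_trip_data m x a D1 D2"
    "\<And>z. z \<in> class_reps m x ==> f z \<in> class_reps m x \<and> round_trip m a D1 D2 z (f z)"
    using f by (auto simp: round_trips_def)
  obtain E1 E2 where E: "round_trip_data_along m x e a E1 E2"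
    "\<And>z. z \<in> class_reps m x ==> g z \<in> class_reps m x \<and> round_trip m e E1 E2 z (g z)"
    using g by (auto simp: round_trips_along_def)
  have fz: "f z \<in> class_reps m x" and gz: "g z \<in> class_reps m x" using D(2)[OF z] E(2)[OF z] by blast+
  have par: "parallel m y z" if "y \<in> class_reps m x" for y
    using parallel_trans[OF class_repsD(1)[OF that m] parallel_sym[OF class_repsD(1)[OF z m]]] .
  have "round_trip m e E1 E2 (f z) (f (g z))"
    using round_trips_commute[OF m D(1) E(1) _ _ _ par[OF gz] par[OF fz]] D(2)[OF z] E(2)[OF z] D(2)[OF gz] by blast
  moreover have "e \<le> m" using E(1) by (simp add: round_trip_data_along_def round_trip_data_def)
  ultimately have "homotopic m (f (g z)) (g (f z))" using round_trip_unique[OF m] E(2)[OF fz] by blast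
  then show ?thesis using class_reps_eqI[OF _ _ _ m] D(2)[OF gz] E(2)[OF fz] by blast
qed

lemma round_trips_along_transitive:
  assumes m: "1 \<le> m" and ae: "e \<le> m" "a \<le> m" "e \<noteq> a" and z: "z \<in> class_reps m x" and y: "y \<in> class_reps m x"
  obtains g where "g \<in> round_trips_along m x e a" "g z = y"
proof -
  have "insert (Suc e) ({..Suc m} - {Suc e}) = {..Suc m}" using ae by auto
  then obtain E1 where E1: "E1 \<in> K (Suc m)" "d (Suc m) (Suc e) E1 = z"
    using extend_simplex[of "{..Suc m} - {Suc e}" m z "Suc e"] class_repsD(3)[OF z m] m ae by (auto simp: lface_atMost)
  have par: "parallel m z x" "parallel m y x" using class_repsD(1)[OF _ m] z y by blast+
  have skip: "skip (Suc e) a \<le> Suc m" "Suc e \<noteq> skip (Suc e) a" "e \<noteq> skip (Suc e) a"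
    using ae by (auto simp: skip_def)
  have "parallel m y (d (Suc m) (Suc e) E1)" using parallel_trans[OF par(2) parallel_sym[OF par(1)]] E1(2) by simp
  then obtain f where "transports m (Suc e) (skip (Suc e) a) E1 y f"
    using transports_total[OF m _ skip(1,2) E1(1)] ae by auto
  then obtain E2 where E2: "E2 \<in> K (Suc m)" "d (Suc m) (Suc e) E2 = y"
    "\<And>k. k \<le> Suc m ==> k \<noteq> Suc e ==> k \<noteq> skip (Suc e) a ==> d (Suc m) k E2 = d (Suc m) k E1"
    unfolding transports_def by blast
  have e: "d (Suc m) e E2 = d (Suc m) e E1" using E2(3)[of e] ae skip by simp
  then have data: "round_trip_data_along m x e a E1 E2"
    using E1 E2 par ae face_in[OF E1(1), of e]
    by (auto simp: round_trip_data_along_def round_trip_data_def intro: parallel_refl)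
  then obtain g where g: "\<forall>z\<in>class_reps m x. g z \<in> class_reps m x \<and> round_trip m e E1 E2 z (g z)"
    using round_trip_function[OF m, of x e E1 E2] by (auto simp: round_trip_data_along_def)
  have "round_trip m e E1 E2 z y"
    unfolding round_trip_def
    using transports_self[OF E1(1), of "Suc e" e] transports_self[OF E2(1), of "Suc e" e] E1(2) E2(2) e by auto
  then have "homotopic m (g z) y" using round_trip_unique[OF m ae(1)] g z by blast
  then have "g z = y" using class_reps_eqI[OF _ y _ m] g z by blast
  then show thesis using that[of g] data g by (auto simp: round_trips_along_def)
qed

text \<open>Round trips along three different vertices commute pairwise, and each kind acts transitively, so the three kinds
  coincide and form an abelian group (Eckmann--Hilton).\<close>

lemma round_trips_along_commute:
  assumes m: "2 \<le> m" and g: "g \<in> round_trips_along m x 0 1" and h: "h \<in> round_trips_along m x 0 1"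
    and y: "y \<in> class_reps m x"
  shows "g (h y) = h (g y)"
proof -
  note along = subsetD[OF round_trips_along_subset]
  have m': "1 \<le> m" "0 \<le> m" "1 \<noteq> (2::nat)" "2 \<noteq> (0::nat)" using m by simp_all
  obtain k where k: "k \<in> round_trips_along m x 1 2" "k y = g y"
    using round_trips_along_transitive[OF m'(1,1) m m'(3) y round_trips_along_closed[OF g y]] .
  have g_eq_k: "g u = k u" if u: "u \<in> class_reps m x" for u
  proof -
    obtain l where l: "l \<in> round_trips_along m x 2 0" "l y = u"
      using round_trips_along_transitive[OF m'(1) m m'(2,4) y u] .
    have "g u = l (g y)" using round_trips_commute_along[OF m'(1) along[OF g] l(1) y] l(2) by simp
    also have "... = k (l y)" using round_trips_commute_along[OF m'(1) along[OF l(1)] k(1) y] k(2) by simp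
    finally show ?thesis using l(2) by simp
  qed
  have "k (h y) = h (k y)"
    using round_trips_commute_along[OF m'(1) along[OF k(1)] h y] .
  then show ?thesis using g_eq_k[OF round_trips_along_closed[OF h y]] g_eq_k[OF y] by simp
qed

lemma round_trips_commute_pointwise:
  assumes m: "2 \<le> m" and f: "f \<in> round_trips m x 1" "f' \<in> round_trips m x 1" and z: "z \<in> class_reps m x"
  shows "f (f' z) = f' (f z)"
proof -
  have m': "1 \<le> m" "0 \<le> m" "0 \<noteq> (1::nat)" using m by simp_all
  have along: "\<exists>g\<in>round_trips_along m x 0 1. \<forall>u\<in>class_reps m x. f u = g u" if f: "f \<in> round_trips m x 1" for f
  proof -
    obtain g where g: "g \<in> round_trips_along m x 0 1" "g z = f z"
      using round_trips_along_transitive[OF m'(1,2,1,3) z round_trips_closed[OF f z]] .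
    have "f u = g u" if u: "u \<in> class_reps m x" for u
    proof -
      obtain l where l: "l \<in> round_trips_along m x 0 1" "l z = u"
        using round_trips_along_transitive[OF m'(1,2,1,3) z u] .
      have "f u = l (f z)" using round_trips_commute_along[OF m'(1) f l(1) z] l(2) by simp
      also have "... = g u" using round_trips_along_commute[OF m g(1) l(1) z] g(2) l(2) by simp
      finally show ?thesis .
    qed
    then show ?thesis using g(1) by blast
  qed
  obtain g where g: "g \<in> round_trips_along m x 0 1" "\<forall>u\<in>class_reps m x. f u = g u"
    using along[OF f(1)] by blast
  obtain g' where g': "g' \<in> round_trips_along m x 0 1" "\<forall>u\<in>class_reps m x. f' u = g' u"
    using along[OF f(2)] by blast
  show ?thesis using round_trips_along_commute[OF m g(1) g'(1) z] g g' z round_trips_along_closed by metis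
qed

end

context kan_complex begin

subsection \<open>Transport of homotopy classes\<close>

definition transport :: "nat => 's => 's => 's" where
  "transport m D z = class_rep m (SOME u. transports m 2 1 D z u)"

lemma transport_eq:
  assumes "1 \<le> m" "transports m 2 1 D z u"
  shows "transport m D z = class_rep m u"
proof -
  have "transports m 2 1 D z (SOME u. transports m 2 1 D z u)" using assms(2) by (rule someI)
  then show ?thesis
    unfolding transport_def using transports_unique_homotopic[OF _ _ assms(2)] assms(1) by (intro class_rep_eq) auto
qed

lemma transport_total:
  assumes m: "1 \<le> m" and D: "D \<in> K (Suc m)" and z: "parallel m z (d (Suc m) 2 D)"
  obtains u where "transports m 2 1 D z u" "transport m D z = class_rep m u" "parallel m u (d (Suc m) 1 D)"
proof -
  have positions: "2 \<le> Suc m" "1 \<le> Suc m" "2 \<noteq> (1::nat)" using m by simp_all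
  obtain u where u: "transports m 2 1 D z u"
    using transports_total[OF m positions D z] .
  show thesis
    using that[OF u transport_eq[OF m u] transports_parallel[OF m positions D u z]] .
qed

lemma transport_in_class_reps:
  assumes "1 \<le> m" "D \<in> K (Suc m)" "parallel m z (d (Suc m) 2 D)"
  shows "transport m D z \<in> class_reps m (d (Suc m) 1 D)"
  using transport_total[OF assms] class_repsI by metis

lemma glue_facets_Diff:
  assumes V: "finite V" "card V = Suc (Suc m)" "1 \<le> m" and uv: "u \<in> V" "v \<in> V" "u \<noteq> v"
    and t: "t \<in> K m" "r \<in> K m" and common_face: "lface (V - {v}) u t = lface (V - {u}) v r"
  obtains W where "coherent (Pow V - {{}}) W" "W (V - {v}) = t" "W (V - {u}) = r"
proof -
  let ?A = "V - {u} - {v}"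
  have A: "finite ?A" "card ?A = m" "insert v ?A = V - {u}" "insert u ?A = V - {v}" "insert u (V - {u}) = V"
    using V uv by auto
  then have "?A \<noteq> {}" using V(3) by (metis card.empty not_one_le_zero)
  then show thesis using glue_facets[of ?A u v r t] A t common_face uv(3) that by auto
qed

lemma compose_transports:
  assumes m: "1 \<le> m" and D: "D1 \<in> K (Suc m)" "D \<in> K (Suc m)" and composable: "d (Suc m) 1 D1 = d (Suc m) 2 D"
  obtains D3 where "D3 \<in> K (Suc m)" "d (Suc m) 2 D3 = d (Suc m) 2 D1" "d (Suc m) 1 D3 = d (Suc m) 1 D"
    "\<And>z u w. parallel m z (d (Suc m) 2 D1) ==> transports m 2 1 D1 z u ==> transports m 2 1 D u w ==>
      transports m 2 1 D3 z w"
proof -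
  define V where "V = {..Suc (Suc m)}"
  have V: "finite V" "card V = Suc (Suc (Suc m))" "1 \<in> V" "2 \<in> V" "3 \<in> V" "distinct [2, 1, 3::nat]"
    using m by (auto simp: V_def)
  have facet: "finite (V - {b})" "card (V - {b}) = Suc (Suc m)" if "b \<in> V" for b
    using that V by auto
  have face: "lface (V - {b}) k t = d (Suc m) (if b < k then k - 1 else k) t" if "b \<in> V" "k \<in> V" for b k t
    using pos_Diff[of V b k] pos_atMost[of k "Suc (Suc m)"] V that facet by (simp add: lface_def V_def)
  have pos: "pos (V - {b}) k = (if b < k then k - 1 else k)" if "b \<in> V" "k \<in> V" for b k
    using pos_Diff[of V b k] pos_atMost[of k "Suc (Suc m)"] V that by (simp add: V_def)
  have "lface (V - {3}) 1 D1 = lface (V - {1}) 3 D" using composable face V by simp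
  then obtain W where W: "coherent (Pow V - {{}}) W" "W (V - {3}) = D1" "W (V - {1}) = D"
    using V D by (elim glue_facets_Diff[rotated 8]) auto
  have W_face: "lface (V - {b}) k (W (V - {b})) = W (V - {b} - {k})" if "b \<in> V" "k \<in> V" "k \<noteq> b" for b k
    using facet[OF that(1)] that by (intro coherent_Pow_lface[OF W(1)]) auto
  define D3 where "D3 = W (V - {2})"
  have D3: "D3 \<in> K (Suc m)"
    using coherent_Pow_in[OF W(1), of "V - {2}"] facet[OF V(4)] by (cases "V - {2} = {}") (auto simp: D3_def)
  have swap: "V - {2} - {3} = V - {3} - {2}" "V - {2} - {1} = V - {1} - {2}" by blast+
  have "d (Suc m) 2 D3 = W (V - {2} - {3})" "W (V - {3} - {2}) = d (Suc m) 2 D1"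
    "d (Suc m) 1 D3 = W (V - {2} - {1})" "W (V - {1} - {2}) = d (Suc m) 1 D" "W (V - {3} - {1}) = d (Suc m) 1 D1"
    using W_face[of 2 3] W_face[of 3 2] W_face[of 2 1] W_face[of 1 2] W_face[of 3 1] V(3-5) W(2,3)
    by (simp_all add: face D3_def)
  then have faces: "d (Suc m) 2 D3 = d (Suc m) 2 D1" "d (Suc m) 1 D3 = d (Suc m) 1 D" "W (V - {3} - {1}) = d (Suc m) 2 D"
    using composable by (simp_all only: swap)
  show thesis
  proof (rule that[OF D3 faces(1,2)])
    fix z u w assume z: "parallel m z (d (Suc m) 2 D1)" and u: "transports m 2 1 D1 z u" "transports m 2 1 D u w"
    have "parallel m u (W (V - {3} - {1}))"
      using transports_parallel[OF m _ _ _ D(1) u(1) z] m composable faces(3) by simp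
    moreover have "transports m (pos (V - {3}) 1) (pos (V - {3}) 2) (W (V - {3})) u z"
      "transports m (pos (V - {1}) 3) (pos (V - {1}) 2) (W (V - {1})) u w"
      using transports_sym[OF u(1)] u(2) V(3-5) W(2,3) by (simp_all add: pos)
    ultimately have "transports m (pos (V - {2}) 3) (pos (V - {2}) 1) (W (V - {2})) z w"
      by (rule transports_triangle[OF V(1,2) m V(4,3,5,6) W(1)])
    then show "transports m 2 1 D3 z w" using V(3-5) by (simp add: pos D3_def)
  qed
qed

lemma transport_compose:
  assumes m: "1 \<le> m" and D: "D1 \<in> K (Suc m)" "D \<in> K (Suc m)"
    and par: "parallel m (d (Suc m) 1 D1) (d (Suc m) 2 D)"
  obtains D3 where "D3 \<in> K (Suc m)" "parallel m (d (Suc m) 2 D3) (d (Suc m) 2 D1)"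
    "parallel m (d (Suc m) 1 D3) (d (Suc m) 1 D)"
    "\<And>z. parallel m z (d (Suc m) 2 D1) ==> transport m D3 z = transport m D (transport m D1 z)"
proof -
  have positions: "1 \<le> Suc m" "2 \<le> Suc m" "1 \<noteq> (2::nat)" using m by simp_all
  obtain f where f: "transports m 1 2 D1 (d (Suc m) 2 D) f"
    using transports_total[OF m positions D(1) parallel_sym[OF par]] .
  obtain D1' where D1': "D1' \<in> K (Suc m)" "d (Suc m) 1 D1' = d (Suc m) 2 D" "d (Suc m) 2 D1' = f"
    "\<And>k. k \<le> Suc m ==> k \<noteq> 1 ==> k \<noteq> 2 ==> d (Suc m) k D1' = d (Suc m) k D1"
    using f unfolding transports_def by blast
  have same: "transports m 2 1 D1' = transports m 2 1 D1" using D1'(4) by (intro transports_cong) auto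
  have f_par: "parallel m f (d (Suc m) 2 D1)"
    using transports_parallel[OF m positions D(1) f parallel_sym[OF par]] .
  obtain D3 where D3: "D3 \<in> K (Suc m)" "d (Suc m) 2 D3 = f" "d (Suc m) 1 D3 = d (Suc m) 1 D"
    "\<And>z u w. parallel m z f ==> transports m 2 1 D1 z u ==> transports m 2 1 D u w ==> transports m 2 1 D3 z w"
    using compose_transports[OF m D1'(1) D(2) D1'(2)] unfolding same D1'(3) by metis
  have "transport m D3 z = transport m D (transport m D1 z)" if z: "parallel m z (d (Suc m) 2 D1)" for z
  proof -
    obtain u where u: "transports m 2 1 D1 z u" "transport m D1 z = class_rep m u" "parallel m u (d (Suc m) 1 D1)"
      using transport_total[OF m D(1) z] .
    have uK: "u \<in> K m" using u(3) by (simp add: parallel_def)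
    have "parallel m (class_rep m u) (d (Suc m) 2 D)"
      using parallel_trans[OF parallel_sym[OF parallel_class_rep[OF uK m]] parallel_trans[OF u(3) par]] .
    then obtain w where w: "transports m 2 1 D (class_rep m u) w" "transport m D (class_rep m u) = class_rep m w"
      using transport_total[OF m D(2)] by metis
    have "transports m 1 2 D w u"
      using transports_homotopic[OF m _ _ _ transports_sym[OF w(1)] homotopic_sym[OF homotopic_class_rep[OF uK m]]] m
      by simp
    then have "transports m 2 1 D3 z w"
      using D3(4)[OF parallel_trans[OF z parallel_sym[OF f_par]] u(1)] transports_sym by blast
    then show ?thesis using transport_eq[OF m] u(2) w(2) by simp
  qed
  then show thesis using that[OF D3(1)] D3(2,3) f_par face_in[OF D(2), of 1] by (simp add: parallel_refl)
qed

lemma join_along_last_faces: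
  assumes m: "1 \<le> m" and x: "x \<in> K m" "x' \<in> K m" "d m 1 x = d m 1 x'"
  obtains D where "D \<in> K (Suc m)" "d (Suc m) 2 D = x" "d (Suc m) 1 D = x'"
proof -
  define V where "V = {..Suc m}"
  have V: "finite V" "card V = Suc (Suc m)" "0 \<in> V" "1 \<in> V" "2 \<in> V" using m by (auto simp: V_def)
  have "pos (V - {2}) 1 = 1" "pos (V - {1}) 2 = 1"
    using pos_Diff[of V 2 1] pos_Diff[of V 1 2] V pos_atMost[of 1 "Suc m"] pos_atMost[of 2 "Suc m"] m
    by (simp_all add: V_def)
  then have "lface (V - {2}) 1 x = lface (V - {1}) 2 x'" using x(3) V by (simp add: lface_def)
  then obtain W where W: "coherent (Pow V - {{}}) W" "W (V - {2}) = x" "W (V - {1}) = x'"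
    using V m x by (elim glue_facets_Diff[rotated 8]) auto
  have "d (Suc m) 2 (W V) = x" "d (Suc m) 1 (W V) = x'"
    using coherent_Pow_lface[OF W(1), of V 2] coherent_Pow_lface[OF W(1), of V 1] W V m
    by (simp_all add: lface_atMost V_def)
  moreover have "W V \<in> K (Suc m)" using coherent_Pow_in[OF W(1), of V] V by auto
  ultimately show thesis using that by blast
qed

end

section \<open>Means of bounded functions\<close>

definition bdd_fun :: "('x => real) => bool" where
  "bdd_fun f \<longleftrightarrow> bounded (range f)"

lemma bdd_funI: "(\<And>x. \<bar>f x\<bar> \<le> B) ==> bdd_fun f"
  unfolding bdd_fun_def bounded_iff by auto

lemma bdd_funE:
  assumes "bdd_fun f"
  obtains B where "0 \<le> B" "\<And>x. \<bar>f x\<bar> \<le> B"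
proof -
  obtain B where B: "\<And>x. \<bar>f x\<bar> \<le> B" using assms unfolding bdd_fun_def bounded_iff by auto
  show thesis using that[OF _ B] B[of undefined] by linarith
qed

lemma bdd_fun_add: "bdd_fun f ==> bdd_fun g ==> bdd_fun (\<lambda>x. f x + g x)"
  unfolding bdd_fun_def by (rule bounded_plus_comp)

lemma bdd_fun_diff: "bdd_fun f ==> bdd_fun g ==> bdd_fun (\<lambda>x. f x - g x)"
  unfolding bdd_fun_def by (rule bounded_minus_comp)

lemma bdd_fun_scale: "bdd_fun f ==> bdd_fun (\<lambda>x. c * f x)"
  unfolding bdd_fun_def using bounded_scaleR_comp[of f UNIV c] by simp

lemma bdd_fun_const [simp]: "bdd_fun (\<lambda>x. c)"
  by (rule bdd_funI[of _ "\<bar>c\<bar>"]) simp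

lemma bdd_fun_compose: "bdd_fun f ==> bdd_fun (\<lambda>x. f (h x))"
  unfolding bdd_fun_def by (rule bounded_subset) auto

lemma bdd_fun_sum: "(\<And>i. i \<in> I ==> bdd_fun (f i)) ==> bdd_fun (\<lambda>x. \<Sum>i\<in>I. f i x)"
  by (induction I rule: infinite_finite_induct) (auto intro: bdd_fun_add)

subsection \<open>The Hahn--Banach theorem\<close>

definition fun_subspace :: "('x => real) set => bool" where
  "fun_subspace V \<longleftrightarrow> (\<lambda>_. 0) \<in> V \<and> (\<forall>f\<in>V. \<forall>g\<in>V. (\<lambda>x. f x + g x) \<in> V) \<and> (\<forall>c. \<forall>f\<in>V. (\<lambda>x. c * f x) \<in> V)"

definition linear_functional :: "('x => real) set => (('x => real) => real) => bool" where
  "linear_functional V L \<longleftrightarrow> (\<forall>f\<in>V. \<forall>g\<in>V. L (\<lambda>x. f x + g x) = L f + L g) \<and>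
    (\<forall>c. \<forall>f\<in>V. L (\<lambda>x. c * f x) = c * L f)"

definition sublinear_on :: "('x => real) set => (('x => real) => real) => bool" where
  "sublinear_on V q \<longleftrightarrow> (\<forall>f\<in>V. \<forall>g\<in>V. q (\<lambda>x. f x + g x) \<le> q f + q g) \<and>
    (\<forall>c>0. \<forall>f\<in>V. q (\<lambda>x. c * f x) \<le> c * q f)"

lemma fun_subspaceD:
  assumes "fun_subspace V"
  shows "(\<lambda>_. 0) \<in> V" "f \<in> V ==> g \<in> V ==> (\<lambda>x. f x + g x) \<in> V" "f \<in> V ==> (\<lambda>x. c * f x) \<in> V"
  using assms by (auto simp: fun_subspace_def)

lemma linear_functionalD:
  assumes "linear_functional V L" "f \<in> V"
  shows "g \<in> V ==> L (\<lambda>x. f x + g x) = L f + L g" "L (\<lambda>x. c * f x) = c * L f"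
  using assms by (auto simp: linear_functional_def)

lemma sublinear_on_cong: "sublinear_on V q ==> fun_subspace V ==> (\<And>f. f \<in> V ==> r f = q f) ==> sublinear_on V r"
  by (simp add: sublinear_on_def fun_subspace_def)

lemma sublinear_on_add: "sublinear_on V q ==> f \<in> V ==> g \<in> V ==> q (\<lambda>x. f x + g x) \<le> q f + q g"
  by (simp add: sublinear_on_def)

lemma sublinear_on_scale:
  assumes V: "fun_subspace V" and q: "sublinear_on V q" and f: "f \<in> V" and c: "0 \<le> c"
  shows "q (\<lambda>x. c * f x) = c * q f"
proof -
  have scale: "q (\<lambda>x. c * f x) = c * q f" if f: "f \<in> V" and c: "0 < c" for f c
  proof (rule antisym)
    show "q (\<lambda>x. c * f x) \<le> c * q f" using q f c by (auto simp: sublinear_on_def)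
    have "q (\<lambda>x. (1 / c) * (c * f x)) \<le> (1 / c) * q (\<lambda>x. c * f x)"
      using q fun_subspaceD(3)[OF V f] c unfolding sublinear_on_def by (metis zero_less_divide_1_iff)
    then show "c * q f \<le> q (\<lambda>x. c * f x)" using c by (simp add: field_simps)
  qed
  have "q (\<lambda>_. 0) = 0" using scale[OF fun_subspaceD(1)[OF V], of 2] by simp
  then show ?thesis using scale[OF f] c by (cases "c = 0") auto
qed

lemma sublinear_on_zero: "fun_subspace V ==> sublinear_on V q ==> q (\<lambda>_. 0) = 0"
  using sublinear_on_scale[of V q "\<lambda>_. 0" 0] fun_subspaceD(1) by auto

lemma sublinear_on_neg_le:
  assumes V: "fun_subspace V" and q: "sublinear_on V q" and f: "f \<in> V"
  shows "- q (\<lambda>x. - 1 * f x) \<le> q f"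
  using sublinear_on_add[OF q f fun_subspaceD(3)[OF V f, of "-1"]] sublinear_on_zero[OF V q] by simp

lemma sublinear_INF:
  assumes V: "fun_subspace V" and I: "I \<noteq> {}" and bdd: "\<And>f. f \<in> V ==> bdd_below ((\<lambda>i. F i f) ` I)"
    and add: "\<And>i j f g. i \<in> I ==> j \<in> I ==> f \<in> V ==> g \<in> V ==> \<exists>k\<in>I. F k (\<lambda>x. f x + g x) \<le> F i f + F j g"
    and scale: "\<And>i c f. i \<in> I ==> 0 < c ==> f \<in> V ==> \<exists>k\<in>I. F k (\<lambda>x. c * f x) \<le> c * F i f"
  shows "sublinear_on V (\<lambda>f. INF i\<in>I. F i f)"
  unfolding sublinear_on_def
proof (intro conjI ballI allI impI)
  have lower: "(INF i\<in>I. F i f) \<le> B" if "f \<in> V" "k \<in> I" "F k f \<le> B" for f k B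
    using cINF_lower[OF bdd[OF that(1)] that(2)] that(3) by simp
  fix f assume f: "f \<in> V"
  show "(INF i\<in>I. F i (\<lambda>x. f x + g x)) \<le> (INF i\<in>I. F i f) + (INF i\<in>I. F i g)" if g: "g \<in> V" for g
  proof -
    have "(INF i\<in>I. F i (\<lambda>x. f x + g x)) \<le> F i f + F j g" if "i \<in> I" "j \<in> I" for i j
      using add[OF that f g] lower[OF fun_subspaceD(2)[OF V f g]] by blast
    then have "(INF i\<in>I. F i (\<lambda>x. f x + g x)) - F i f \<le> F j g" if "i \<in> I" "j \<in> I" for i j
      using that by (simp add: le_diff_eq diff_le_eq add.commute)
    then have "(INF i\<in>I. F i (\<lambda>x. f x + g x)) - F i f \<le> (INF j\<in>I. F j g)" if "i \<in> I" for i
      using that by (intro cINF_greatest[OF I])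
    then have "(INF i\<in>I. F i (\<lambda>x. f x + g x)) - (INF j\<in>I. F j g) \<le> F i f" if "i \<in> I" for i
      using that by (simp add: le_diff_eq diff_le_eq add.commute)
    then have "(INF i\<in>I. F i (\<lambda>x. f x + g x)) - (INF j\<in>I. F j g) \<le> (INF i\<in>I. F i f)"
      by (intro cINF_greatest[OF I])
    then show ?thesis by simp
  qed
  show "(INF i\<in>I. F i (\<lambda>x. c * f x)) \<le> c * (INF i\<in>I. F i f)" if c: "0 < c" for c
  proof -
    have "(INF i\<in>I. F i (\<lambda>x. c * f x)) \<le> c * F i f" if "i \<in> I" for i
      using scale[OF that c f] lower[OF fun_subspaceD(3)[OF V f]] by blast
    then have "(INF i\<in>I. F i (\<lambda>x. c * f x)) / c \<le> (INF i\<in>I. F i f)"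
      using c by (intro cINF_greatest[OF I]) (simp add: divide_le_eq mult.commute)
    then show ?thesis using c by (simp add: divide_le_eq mult.commute)
  qed
qed

definition shift :: "(('x => real) => real) => ('x => real) => ('x => real) => real" where
  "shift q y f = (INF t\<in>{0..}. q (\<lambda>x. f x + t * y x) - t * q y)"

lemma
  assumes V: "fun_subspace V" and q: "sublinear_on V q" and y: "y \<in> V"
  shows shift_le: "f \<in> V ==> 0 \<le> t ==> shift q y f \<le> q (\<lambda>x. f x + t * y x) - t * q y"
    and sublinear_shift: "sublinear_on V (shift q y)"
proof -
  note add = fun_subspaceD(2)[OF V] and scale = fun_subspaceD(3)[OF V]
  have bdd: "bdd_below ((\<lambda>t. q (\<lambda>x. f x + t * y x) - t * q y) ` {0..})" if f: "f \<in> V" for f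
  proof (rule bdd_belowI2)
    fix t :: real assume "t \<in> {0..}"
    then have "q (\<lambda>x. (f x + t * y x) + - 1 * f x) = t * q y"
      using sublinear_on_scale[OF V q y, of t] by (simp add: algebra_simps)
    moreover have "q (\<lambda>x. (f x + t * y x) + - 1 * f x) \<le> q (\<lambda>x. f x + t * y x) + q (\<lambda>x. - 1 * f x)"
      using f y by (intro sublinear_on_add[OF q] add scale)
    ultimately show "- q (\<lambda>x. - 1 * f x) \<le> q (\<lambda>x. f x + t * y x) - t * q y" by simp
  qed
  show "shift q y f \<le> q (\<lambda>x. f x + t * y x) - t * q y" if "f \<in> V" "0 \<le> t" for f t
    unfolding shift_def using that by (intro cINF_lower[OF bdd]) auto
  show "sublinear_on V (shift q y)"
    unfolding shift_def[abs_def]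
  proof (rule sublinear_INF[OF V _ bdd])
    fix f g and s t :: real assume f: "f \<in> V" and g: "g \<in> V" and st: "s \<in> {0..}" "t \<in> {0..}"
    have "q (\<lambda>x. (f x + s * y x) + (g x + t * y x)) \<le> q (\<lambda>x. f x + s * y x) + q (\<lambda>x. g x + t * y x)"
      using f g y by (intro sublinear_on_add[OF q] add scale)
    also have "(\<lambda>x. (f x + s * y x) + (g x + t * y x)) = (\<lambda>x. f x + g x + (s + t) * y x)"
      by (auto simp: algebra_simps)
    finally show "\<exists>k\<in>{0..}. q (\<lambda>x. f x + g x + k * y x) - k * q y \<le>
        q (\<lambda>x. f x + s * y x) - s * q y + (q (\<lambda>x. g x + t * y x) - t * q y)"
      using st by (intro bexI[of _ "s + t"]) (auto simp: algebra_simps)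
  next
    fix f and s c :: real assume f: "f \<in> V" and s: "s \<in> {0..}" and c: "0 < c"
    have "q (\<lambda>x. c * (f x + s * y x)) = c * q (\<lambda>x. f x + s * y x)"
      using f y c by (intro sublinear_on_scale[OF V q] add scale) auto
    then have "q (\<lambda>x. c * f x + (c * s) * y x) - (c * s) * q y \<le> c * (q (\<lambda>x. f x + s * y x) - s * q y)"
      by (simp add: algebra_simps)
    then show "\<exists>k\<in>{0..}. q (\<lambda>x. c * f x + k * y x) - k * q y \<le> c * (q (\<lambda>x. f x + s * y x) - s * q y)"
      using s c by (intro bexI[of _ "c * s"]) auto
  qed auto
qed

lemma sublinear_chain_INF:
  assumes V: "fun_subspace V" and C: "C \<noteq> {}" "\<And>q. q \<in> C ==> sublinear_on V q"
    and chain: "\<And>q r. q \<in> C ==> r \<in> C ==> q \<le> r \<or> r \<le> q"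
    and le_p: "\<And>q f. q \<in> C ==> f \<in> V ==> q f \<le> p f"
  shows "f \<in> V ==> bdd_below ((\<lambda>q. q f) ` C)" "sublinear_on V (\<lambda>f. INF q\<in>C. q f)"
proof -
  show bdd: "bdd_below ((\<lambda>q. q f) ` C)" if "f \<in> V" for f
  proof (rule bdd_belowI2)
    fix q assume "q \<in> C"
    then show "- p (\<lambda>x. - 1 * f x) \<le> q f"
      using sublinear_on_neg_le[OF V C(2) that] le_p[OF _ fun_subspaceD(3)[OF V that], of q "-1"] by fastforce
  qed
  show "sublinear_on V (\<lambda>f. INF q\<in>C. q f)"
  proof (rule sublinear_INF[OF V C(1) bdd])
    fix q r f g assume q: "q \<in> C" and r: "r \<in> C" and fg: "f \<in> V" "g \<in> V"
    obtain s where s: "s \<in> C" "s f \<le> q f" "s g \<le> r g"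
      using chain[OF q r] q r by (metis le_fun_def order_refl)
    have "s (\<lambda>x. f x + g x) \<le> q f + r g" using sublinear_on_add[OF C(2)[OF s(1)] fg] s(2,3) by simp
    then show "\<exists>s\<in>C. s (\<lambda>x. f x + g x) \<le> q f + r g" using s(1) by blast
  next
    fix q f and c :: real assume "q \<in> C" "0 < c" "f \<in> V"
    then show "\<exists>r\<in>C. r (\<lambda>x. c * f x) \<le> c * q f"
      using C(2) unfolding sublinear_on_def by blast
  qed
qed

lemma minimal_sublinear_exists:
  assumes V: "fun_subspace V" and p: "sublinear_on V p"
  obtains m where "sublinear_on V m" "\<And>f. f \<in> V ==> m f \<le> p f"
    "\<And>q f. sublinear_on V q ==> (\<And>f. f \<in> V ==> q f \<le> m f) ==> f \<in> V ==> q f = m f"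
proof -
  define S where "S = {q. sublinear_on V q \<and> (\<forall>f\<in>V. q f \<le> p f) \<and> (\<forall>f. f \<notin> V --> q f = 0)}"
  define ge :: "(('a => real) => real) => (('a => real) => real) => bool" where "ge q r \<longleftrightarrow> r \<le> q" for q r
  have restrict: "(\<lambda>f. if f \<in> V then q f else 0) \<in> S" if "sublinear_on V q" "\<And>f. f \<in> V ==> q f \<le> p f" for q
    using sublinear_on_cong[OF that(1) V] that(2) by (auto simp: S_def)
  have "\<exists>m\<in>S. \<forall>a\<in>S. ge m a --> a = m"
  proof (rule predicate_Zorn)
    show "partial_order_on S (relation_of ge S)" by (rule partial_order_on_relation_ofI) (auto simp: ge_def)
    fix C assume "C \<in> Chains (relation_of ge S)"
    then have C: "C \<subseteq> S" "\<And>q r. q \<in> C ==> r \<in> C ==> q \<le> r \<or> r \<le> q"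
      by (auto simp: Chains_def relation_of_def ge_def)
    show "\<exists>u\<in>S. \<forall>a\<in>C. ge a u"
    proof (cases "C = {}")
      case False
      have CS: "sublinear_on V q" "f \<in> V ==> q f \<le> p f" "f \<notin> V ==> q f = 0" if "q \<in> C" for q f
        using C(1) that by (auto simp: S_def)
      have inf: "f \<in> V ==> bdd_below ((\<lambda>q. q f) ` C)" "sublinear_on V (\<lambda>f. INF q\<in>C. q f)" for f
        by (rule sublinear_chain_INF[where p = p]; use V False CS C(2) in blast)+
      define u where "u f = (if f \<in> V then INF q\<in>C. q f else 0)" for f
      have u_le: "u f \<le> q f" if "q \<in> C" for q f
        unfolding u_def using that inf(1)[of f] CS(3)[OF that, of f] by (auto intro: cINF_lower)
      have "u \<in> S"
        unfolding u_def[abs_def]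
      proof (rule restrict[OF inf(2)])
        fix f assume f: "f \<in> V"
        obtain q where q: "q \<in> C" using False by blast
        show "(INF q\<in>C. q f) \<le> p f" using cINF_lower[OF inf(1)[OF f] q] CS(2)[OF q f] by simp
      qed
      then show ?thesis using u_le by (auto simp: ge_def le_fun_def)
    qed (use restrict[OF p] in auto)
  qed
  then obtain m where m: "m \<in> S" and min: "\<And>a. a \<in> S ==> a \<le> m ==> a = m" by (auto simp: ge_def)
  show thesis
  proof (rule that[of m])
    show "sublinear_on V m" "\<And>f. f \<in> V ==> m f \<le> p f" using m by (auto simp: S_def)
    fix q f assume q: "sublinear_on V q" "\<And>f. f \<in> V ==> q f \<le> m f" and f: "f \<in> V"
    have "(\<lambda>f. if f \<in> V then q f else 0) = m"
      using q(2) m by (intro min restrict[OF q(1)]) (fastforce simp: S_def le_fun_def)+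
    then show "q f = m f" using fun_cong[of _ _ f] f by fastforce
  qed
qed

lemma minimal_sublinear_linear:
  assumes V: "fun_subspace V" and m: "sublinear_on V m"
    and min: "\<And>q f. sublinear_on V q ==> (\<And>f. f \<in> V ==> q f \<le> m f) ==> f \<in> V ==> q f = m f"
  shows "linear_functional V m"
proof -
  have add: "m (\<lambda>x. f x + y x) = m f + m y" if f: "f \<in> V" and y: "y \<in> V" for f y
  proof (rule antisym)
    have "shift m y f = m f" using shift_le[OF V m y, of _ 0] by (intro min[OF sublinear_shift[OF V m y] _ f]) simp
    then show "m f + m y \<le> m (\<lambda>x. f x + y x)" using shift_le[OF V m y f, of 1] by simp
  qed (rule sublinear_on_add[OF m f y])
  have neg: "m (\<lambda>x. - 1 * f x) = - m f" if "f \<in> V" for f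
    using add[OF that fun_subspaceD(3)[OF V that, of "-1"]] sublinear_on_zero[OF V m] by simp
  have "m (\<lambda>x. c * f x) = c * m f" if f: "f \<in> V" for c f
  proof (cases "0 \<le> c")
    case False
    then have "m (\<lambda>x. (- c) * (- 1 * f x)) = (- c) * m (\<lambda>x. - 1 * f x)"
      by (intro sublinear_on_scale[OF V m fun_subspaceD(3)[OF V f]]) simp
    then show ?thesis using neg[OF f] by simp
  qed (rule sublinear_on_scale[OF V m f])
  then show ?thesis using add unfolding linear_functional_def by blast
qed

lemma hahn_banach:
  assumes V: "fun_subspace V" and p: "sublinear_on V p" and z: "z \<in> V"
  obtains L where "linear_functional V L" "\<And>f. f \<in> V ==> L f \<le> p f" "L z = p z"
proof -
  obtain m where m: "sublinear_on V m" "\<And>f. f \<in> V ==> m f \<le> shift p z f"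
    "\<And>q f. sublinear_on V q ==> (\<And>f. f \<in> V ==> q f \<le> m f) ==> f \<in> V ==> q f = m f"
    using minimal_sublinear_exists[OF V sublinear_shift[OF V p z]] by blast
  have lin: "linear_functional V m" using m(3) by (rule minimal_sublinear_linear[OF V m(1)])
  have m_le_p: "m f \<le> p f" if "f \<in> V" for f
    using m(2)[OF that] shift_le[OF V p z that, of 0] by simp
  have nz: "(\<lambda>x. - 1 * z x) \<in> V"
    using fun_subspaceD(3)[OF V z] .
  have "m (\<lambda>x. - 1 * z x) \<le> p (\<lambda>x. - 1 * z x + 1 * z x) - 1 * p z"
    using m(2)[OF nz] shift_le[OF V p z nz, of 1] by simp
  then have "p z \<le> m z" using linear_functionalD(2)[OF lin z, of "-1"] sublinear_on_zero[OF V p] by simp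
  then show thesis using that[OF lin m_le_p] m_le_p[OF z] by simp
qed

subsection \<open>Mean functionals\<close>

definition mean :: "'x set => (('x => real) => real) => bool" where
  "mean R m \<longleftrightarrow> linear_functional {f. bdd_fun f} m \<and>
    (\<forall>f. bdd_fun f --> (\<forall>x\<in>R. 0 \<le> f x) --> 0 \<le> m f) \<and> m (\<lambda>x. 1) = 1"

lemma
  assumes "mean R m"
  shows mean_add: "bdd_fun f ==> bdd_fun g ==> m (\<lambda>x. f x + g x) = m f + m g"
    and mean_scale: "bdd_fun f ==> m (\<lambda>x. c * f x) = c * m f"
    and mean_nonneg: "bdd_fun f ==> (\<And>x. x \<in> R ==> 0 \<le> f x) ==> 0 \<le> m f"
    and mean_one: "m (\<lambda>x. 1) = 1"
  using assms by (auto simp: mean_def linear_functional_def)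

lemma meanI:
  assumes "\<And>f g. bdd_fun f ==> bdd_fun g ==> m (\<lambda>x. f x + g x) = m f + m g"
    and "\<And>c f. bdd_fun f ==> m (\<lambda>x. c * f x) = c * m f"
    and "\<And>f. bdd_fun f ==> (\<And>x. x \<in> R ==> 0 \<le> f x) ==> 0 \<le> m f" "m (\<lambda>x. 1) = 1"
  shows "mean R m"
  using assms by (auto simp: mean_def linear_functional_def)

lemma mean_diff: "mean R m ==> bdd_fun f ==> bdd_fun g ==> m (\<lambda>x. f x - g x) = m f - m g"
  using mean_add[of R m f "\<lambda>x. - 1 * g x"] mean_scale[of R m g "-1"] bdd_fun_scale[of g "-1"] by simp

lemma mean_mono:
  "mean R m ==> bdd_fun f ==> bdd_fun g ==> (\<And>x. x \<in> R ==> f x \<le> g x) ==> m f \<le> m g"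
  using mean_nonneg[of R m "\<lambda>x. g x - f x"] mean_diff[of R m g f] bdd_fun_diff[of g f] by simp

lemma mean_cong:
  "mean R m ==> bdd_fun f ==> bdd_fun g ==> (\<And>x. x \<in> R ==> f x = g x) ==> m f = m g"
  using mean_mono[of R m f g] mean_mono[of R m g f] by (simp add: order_antisym)

lemma mean_const: "mean R m ==> m (\<lambda>x. c) = c"
  using mean_scale[of R m "\<lambda>x. 1" c] mean_one[of R m] by simp

lemma mean_bound:
  assumes "mean R m" "bdd_fun f" "\<And>x. x \<in> R ==> \<bar>f x\<bar> \<le> B"
  shows "\<bar>m f\<bar> \<le> B"
proof -
  have "m f \<le> m (\<lambda>x. B)" "m (\<lambda>x. - B) \<le> m f"
    using assms(3) by (intro mean_mono[OF assms(1)]; auto simp: assms(2) abs_le_iff; fastforce)+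
  then show ?thesis using mean_const[OF assms(1)] by (auto simp: abs_le_iff)
qed

lemma mean_sum:
  assumes "mean R m" "\<And>i. i \<in> I ==> bdd_fun (f i)"
  shows "m (\<lambda>x. \<Sum>i\<in>I. f i x) = (\<Sum>i\<in>I. m (f i))"
  using assms(2)
proof (induction I rule: infinite_finite_induct)
  case (insert i I)
  then have "m (\<lambda>x. f i x + (\<Sum>i\<in>I. f i x)) = m (f i) + m (\<lambda>x. \<Sum>i\<in>I. f i x)"
    by (intro mean_add[OF assms(1)] bdd_fun_sum) auto
  then show ?case
    using insert by simp
qed (use mean_const[OF assms(1), of 0] in auto)

lemma mean_map:
  assumes "mean R m" "\<And>x. x \<in> R ==> h x \<in> R'"
  shows "mean R' (\<lambda>f. m (\<lambda>x. f (h x)))"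
  using assms(2) mean_add[OF assms(1)] mean_scale[OF assms(1)] mean_nonneg[OF assms(1)] mean_one[OF assms(1)]
  by (intro meanI) (auto simp: bdd_fun_compose)

lemma mean_point: "x \<in> R ==> mean R (\<lambda>f. f x)"
  by (rule meanI) auto

lemma mean_if_eq:
  assumes m: "mean R m" and agree: "\<And>f. bdd_fun f ==> m f = m' f"
  shows "mean R m'"
  using mean_add[OF m] mean_scale[OF m] mean_nonneg[OF m] mean_one[OF m]
  by (intro meanI) (simp_all add: bdd_fun_add bdd_fun_scale flip: agree)

lemma mean_bind:
  assumes m: "mean R m" and k: "\<And>y. y \<in> R ==> mean R' (k y)"
    and bounded: "\<And>f. bdd_fun f ==> bdd_fun (\<lambda>y. k y f)"
  shows "mean R' (\<lambda>f. m (\<lambda>y. k y f))"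
proof (rule meanI)
  fix f g :: "'b => real" assume f: "bdd_fun f" and g: "bdd_fun g"
  have "m (\<lambda>y. k y (\<lambda>x. f x + g x)) = m (\<lambda>y. k y f + k y g)"
    using mean_add[OF k f g] by (intro mean_cong[OF m] bounded bdd_fun_add f g)
  then show "m (\<lambda>y. k y (\<lambda>x. f x + g x)) = m (\<lambda>y. k y f) + m (\<lambda>y. k y g)"
    using mean_add[OF m bounded[OF f] bounded[OF g]] by simp
next
  fix c :: real and f :: "'b => real" assume f: "bdd_fun f"
  have "m (\<lambda>y. k y (\<lambda>x. c * f x)) = m (\<lambda>y. c * k y f)"
    using mean_scale[OF k f] by (intro mean_cong[OF m] bounded bdd_fun_scale f)
  then show "m (\<lambda>y. k y (\<lambda>x. c * f x)) = c * m (\<lambda>y. k y f)"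
    using mean_scale[OF m bounded[OF f]] by simp
next
  fix f :: "'b => real" assume "bdd_fun f" "\<And>x. x \<in> R' ==> 0 \<le> f x"
  then show "0 \<le> m (\<lambda>y. k y f)" using mean_nonneg[OF k] by (intro mean_nonneg[OF m] bounded) auto
next
  have "m (\<lambda>y. k y (\<lambda>x. 1)) = m (\<lambda>y. 1)"
    using mean_one[OF k] by (intro mean_cong[OF m] bounded) auto
  then show "m (\<lambda>y. k y (\<lambda>x. 1)) = 1" using mean_one[OF m] by simp
qed

lemma mean_of_sublinear:
  assumes p: "sublinear_on {f. bdd_fun f} p"
    and p_le: "\<And>f B. bdd_fun f ==> (\<And>x. x \<in> R ==> f x \<le> B) ==> p f \<le> B"
  obtains m where "mean R m" "\<And>f. bdd_fun f ==> m f \<le> p f"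
proof -
  have V: "fun_subspace {f :: 'a => real. bdd_fun f}" by (auto simp: fun_subspace_def bdd_fun_add bdd_fun_scale)
  obtain m where m: "linear_functional {f. bdd_fun f} m" "\<And>f. bdd_fun f ==> m f \<le> p f"
    using hahn_banach[OF V p fun_subspaceD(1)[OF V]] by auto
  have m_le: "m f \<le> B" if "bdd_fun f" "\<And>x. x \<in> R ==> f x \<le> B" for f and B :: real
    using m(2)[OF that(1)] p_le[OF that] by simp
  have neg: "m (\<lambda>x. - 1 * f x) = - m f" if "bdd_fun f" for f
    using linear_functionalD(2)[OF m(1), of f "-1"] that by simp
  have "0 \<le> m f" if f: "bdd_fun f" "\<forall>x\<in>R. 0 \<le> f x" for f
    using m_le[of "\<lambda>x. - 1 * f x" 0] neg[OF f(1)] bdd_fun_scale[OF f(1), of "-1"] f(2) by simp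
  moreover have "m (\<lambda>x. 1) = 1"
    using m_le[of "\<lambda>x. 1" 1] m_le[of "\<lambda>x. - 1" "-1"] neg[of "\<lambda>x. 1"] by simp
  ultimately have "mean R m" using m(1) unfolding mean_def by blast
  then show thesis using that m(2) by blast
qed

subsection \<open>Iterated products of means\<close>

primrec prod_mean :: "'g list => ('g => ('x => real) => real) => (('g => 'x) => real) => real" where
  "prod_mean [] \<mu> f = f (\<lambda>_. undefined)"
| "prod_mean (g # gs) \<mu> f = \<mu> g (\<lambda>x. prod_mean gs \<mu> (\<lambda>c. f (c(g := x))))"

lemma prod_mean_bound:
  assumes "\<And>g. g \<in> set gs ==> mean (R g) (\<mu> g)" "\<And>c. \<bar>f c\<bar> \<le> B"
  shows "\<bar>prod_mean gs \<mu> f\<bar> \<le> B"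
  using assms
proof (induction gs arbitrary: f)
  case (Cons g gs)
  have "\<bar>prod_mean gs \<mu> (\<lambda>c. f (c(g := x)))\<bar> \<le> B" for x
    using Cons.prems by (intro Cons.IH) auto
  then show ?case
    using Cons.prems(1)[of g] bdd_funI[of "\<lambda>x. prod_mean gs \<mu> (\<lambda>c. f (c(g := x)))" B] by (simp add: mean_bound)
qed auto

lemma bdd_fun_prod_mean:
  assumes "\<And>g. g \<in> set gs ==> mean (R g) (\<mu> g)" "bdd_fun f"
  shows "bdd_fun (\<lambda>x. prod_mean gs \<mu> (\<lambda>c. f (h x c)))"
proof -
  obtain B where "0 \<le> B" "\<And>c. \<bar>f c\<bar> \<le> B" using bdd_funE[OF assms(2)] by blast
  then show ?thesis using assms(1) by (intro bdd_funI[of _ B] prod_mean_bound)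
qed

lemma mean_prod_mean:
  assumes "\<And>g. g \<in> set gs ==> mean (R g) (\<mu> g)"
  shows "mean (Pi\<^sub>E (set gs) R) (prod_mean gs \<mu>)"
  using assms
proof (induction gs)
  case Nil
  show ?case
    by (rule mean_if_eq[OF mean_point[of "\<lambda>_. undefined"]]) auto
next
  case (Cons g gs)
  have "mean (Pi\<^sub>E (set (g # gs)) R) (\<lambda>f. \<mu> g (\<lambda>x. prod_mean gs \<mu> (\<lambda>c. f (c(g := x)))))"
  proof (rule mean_bind[where m = "\<mu> g"])
    show "mean (R g) (\<mu> g)" using Cons.prems by simp
    have "mean (Pi\<^sub>E (set gs) R) (prod_mean gs \<mu>)" using Cons by simp
    then show "mean (Pi\<^sub>E (set (g # gs)) R) (\<lambda>f. prod_mean gs \<mu> (\<lambda>c. f (c(g := x))))" if "x \<in> R g" for x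
      by (rule mean_map) (use that in \<open>auto simp: PiE_def extensional_def\<close>)
    show "bdd_fun (\<lambda>x. prod_mean gs \<mu> (\<lambda>c. f (c(g := x))))" if "bdd_fun f" for f
      using Cons.prems that by (intro bdd_fun_prod_mean[of gs R \<mu> f]) auto
  qed
  then show ?case
    by simp
qed

lemma prod_mean_append:
  assumes "\<And>g. g \<in> set (xs @ ys) ==> mean (R g) (\<mu> g)" "bdd_fun f" "distinct (xs @ ys)"
  shows "prod_mean (xs @ ys) \<mu> f = prod_mean xs \<mu> (\<lambda>c. prod_mean ys \<mu> (\<lambda>c'. f (override_on c c' (set ys))))"
  using assms
proof (induction xs arbitrary: f)
  case Nil
  have "override_on (\<lambda>_. undefined) c (set ys) = c" if "c \<in> Pi\<^sub>E (set ys) R" for c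
    using that by (auto simp: override_on_def fun_eq_iff PiE_def extensional_def)
  then have "prod_mean ys \<mu> f = prod_mean ys \<mu> (\<lambda>c. f (override_on (\<lambda>_. undefined) c (set ys)))"
    using Nil bdd_fun_compose[OF Nil(2), of "\<lambda>c. override_on (\<lambda>_. undefined) c (set ys)"]
    by (intro mean_cong[OF mean_prod_mean]) auto
  then show ?case
    by simp
next
  case (Cons x xs)
  have "f ((override_on c c' (set ys))(x := v)) = f (override_on (c(x := v)) c' (set ys))" for c c' v
    using Cons.prems(3) by (intro arg_cong[where f = f]) (auto simp: override_on_def)
  then have "prod_mean (xs @ ys) \<mu> (\<lambda>c. f (c(x := v))) =
      prod_mean xs \<mu> (\<lambda>c. prod_mean ys \<mu> (\<lambda>c'. f (override_on (c(x := v)) c' (set ys))))" for v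
    using Cons.IH[of "\<lambda>c. f (c(x := v))"] Cons.prems bdd_fun_compose[of f "\<lambda>c. c(x := v)"] by simp
  then show ?case
    by simp
qed

lemma restrict_fun_upd_notin: "g \<notin> j ` A ==> (\<lambda>k\<in>A. (c(g := x)) (j k)) = (\<lambda>k\<in>A. c (j k))"
  by (rule restrict_ext) auto

lemma prod_mean_reindex:
  assumes "\<And>g. g \<in> set gs ==> mean (R g) (\<mu> g)" "bdd_fun F" "distinct gs" "map j hs = filter Q gs"
  shows "prod_mean gs \<mu> (\<lambda>c. F (\<lambda>h\<in>set hs. c (j h))) = prod_mean hs (\<lambda>h. \<mu> (j h)) F"
  using assms
proof (induction gs arbitrary: hs F)
  case (Cons g gs)
  have notin: "g \<notin> j ` set hs'" if "map j hs' = filter Q gs" for hs'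
    using arg_cong[OF that, of set] Cons.prems(3) by auto
  show ?case
  proof (cases "Q g")
    case True
    then obtain h hs' where hs: "hs = h # hs'" "j h = g" "map j hs' = filter Q gs"
      using Cons.prems(4) by (cases hs) auto
    have upd: "F (\<lambda>k\<in>set hs. (c(g := x)) (j k)) = F ((\<lambda>k\<in>set hs'. c (j k))(h := x))" for c x
      using hs notin[OF hs(3)] by (intro arg_cong[where f = F]) (force simp: fun_eq_iff image_iff)
    have inner: "prod_mean gs \<mu> (\<lambda>c. F (\<lambda>k\<in>set hs. (c(g := x)) (j k))) =
        prod_mean hs' (\<lambda>h. \<mu> (j h)) (\<lambda>c. F (c(h := x)))" for x
      unfolding upd using Cons.prems hs(3) bdd_fun_compose[of F "\<lambda>c. c(h := x)"]
      by (intro Cons.IH[of "\<lambda>c. F (c(h := x))"]) auto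
    show ?thesis unfolding prod_mean.simps inner by (simp add: hs)
  next
    case False
    then have filter: "map j hs = filter Q gs" using Cons.prems(4) by simp
    have "prod_mean gs \<mu> (\<lambda>c. F (\<lambda>k\<in>set hs. c (j k))) = prod_mean hs (\<lambda>h. \<mu> (j h)) F"
      using Cons.prems by (intro Cons.IH[OF _ Cons.prems(2) _ filter]) auto
    then show ?thesis
      unfolding prod_mean.simps restrict_fun_upd_notin[OF notin[OF filter]]
      using mean_const[OF Cons.prems(1)[of g]] by simp
  qed
qed (simp add: restrict_def)

lemma prod_mean_transport:
  assumes "\<And>h. h \<in> set hs ==> mean (R h) (\<mu> h)" "\<And>h. h \<in> set hs ==> mean (R' h) (\<mu>' h)"
    "bdd_fun F" "distinct hs" "\<And>h f. h \<in> set hs ==> bdd_fun f ==> \<mu>' h f = \<mu> h (\<lambda>x. f (t h x))"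
  shows "prod_mean hs \<mu> (\<lambda>c. F (\<lambda>h\<in>set hs. t h (c h))) = prod_mean hs \<mu>' F"
  using assms
proof (induction hs arbitrary: F)
  case (Cons g hs)
  have upd: "F (\<lambda>h\<in>set (g # hs). t h ((c(g := x)) h)) = F ((\<lambda>h\<in>set hs. t h (c h))(g := t g x))" for c x
    using Cons.prems(4) by (intro arg_cong[where f = F]) (auto simp: fun_eq_iff)
  have inner: "prod_mean hs \<mu> (\<lambda>c. F (\<lambda>h\<in>set (g # hs). t h ((c(g := x)) h))) =
      prod_mean hs \<mu>' (\<lambda>c. F (c(g := t g x)))" for x
    unfolding upd using Cons.prems bdd_fun_compose[of F "\<lambda>c. c(g := t g x)"]
    by (intro Cons.IH[of "\<lambda>c. F (c(g := t g x))"]) auto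
  have "\<mu>' g (\<lambda>y. prod_mean hs \<mu>' (\<lambda>c. F (c(g := y)))) =
      \<mu> g (\<lambda>x. prod_mean hs \<mu>' (\<lambda>c. F (c(g := t g x))))"
    using Cons.prems bdd_fun_prod_mean[of hs R' \<mu>' F "\<lambda>y c. c(g := y)"] by simp
  then show ?case
    unfolding prod_mean.simps inner by simp
qed (simp add: restrict_def)

lemma prod_mean_transport_tail:
  assumes mean: "\<And>g. g \<in> set (xs @ map j hs) ==> mean (R g) (\<mu> g)" "\<And>h. h \<in> set hs ==> mean (R' h) (\<mu>' h)"
    and F: "bdd_fun F" and distinct: "distinct (xs @ map j hs)"
    and cong: "\<And>c c'. (\<And>g. g \<in> set xs ==> c g = c' g) ==> T c = T c'"
    and transport: "\<And>c h f. (\<And>g. g \<in> set xs ==> c g \<in> R g) ==> h \<in> set hs ==> bdd_fun f ==>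
      \<mu>' h f = \<mu> (j h) (\<lambda>x. f (T c h x))"
  shows "prod_mean (xs @ map j hs) \<mu> (\<lambda>c. F (\<lambda>h\<in>set hs. T c h (c (j h)))) = prod_mean hs \<mu>' F"
proof -
  define G where "G c = (\<lambda>h\<in>set hs. T c h (c (j h)))" for c
  let ?ys = "map j hs"
  have "prod_mean (xs @ ?ys) \<mu> (\<lambda>c. F (G c)) =
      prod_mean xs \<mu> (\<lambda>c. prod_mean ?ys \<mu> (\<lambda>c'. F (G (override_on c c' (set ?ys)))))"
    by (rule prod_mean_append[OF mean(1) bdd_fun_compose[OF F] distinct])
  also have "... = prod_mean xs \<mu> (\<lambda>c. prod_mean hs \<mu>' F)"
  proof (rule mean_cong[OF mean_prod_mean])
    fix c assume "c \<in> Pi\<^sub>E (set xs) R"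
    then have c: "\<And>g. g \<in> set xs ==> c g \<in> R g" by auto
    have "T (override_on c c' (set ?ys)) = T c" for c'
      using distinct by (intro cong override_on_apply_notin) auto
    then have "prod_mean ?ys \<mu> (\<lambda>c'. F (G (override_on c c' (set ?ys)))) =
        prod_mean ?ys \<mu> (\<lambda>c'. F (\<lambda>h\<in>set hs. T c h ((\<lambda>h\<in>set hs. c' (j h)) h)))"
      by (intro arg_cong[where f = "prod_mean ?ys \<mu>"] ext arg_cong[where f = F]) (auto simp: G_def intro!: restrict_ext)
    also have "... = prod_mean hs (\<lambda>h. \<mu> (j h)) (\<lambda>c'. F (\<lambda>h\<in>set hs. T c h (c' h)))"
      using mean(1) distinct by (intro prod_mean_reindex[where Q = "\<lambda>_. True" and R = R] bdd_fun_compose[OF F]) auto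
    also have "... = prod_mean hs \<mu>' F"
      using mean(1) distinct transport[OF c]
      by (intro prod_mean_transport[where R = "\<lambda>h. R (j h)", OF _ mean(2) F]) (auto simp: distinct_map)
    finally show "prod_mean ?ys \<mu> (\<lambda>c'. F (G (override_on c c' (set ?ys)))) = prod_mean hs \<mu>' F" .
  next
    show "bdd_fun (\<lambda>c. prod_mean ?ys \<mu> (\<lambda>c'. F (G (override_on c c' (set ?ys)))))"
      using mean(1) F by (intro bdd_fun_prod_mean[where R = R and f = F and h = "\<lambda>c c'. G (override_on c c' (set ?ys))"]) auto
  qed (use mean(1) in auto)
  also have "... = prod_mean hs \<mu>' F" using mean_const[OF mean_prod_mean] mean(1) by (metis Un_iff set_append)
  finally show ?thesis by (simp only: G_def)
qed

lemma prod_mean_cong: "(\<And>g. g \<in> set gs ==> \<mu> g = \<mu>' g) ==> prod_mean gs \<mu> f = prod_mean gs \<mu>' f"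
  by (induction gs arbitrary: f) auto

subsection \<open>Invariant means for commuting maps\<close>

definition orbit_average :: "('x => 'x) => nat => ('x => real) => 'x => real" where
  "orbit_average h n f x = (\<Sum>k\<le>n. f ((h ^^ k) x)) / Suc n"

inductive_set averages :: "('x => 'x) set => (('x => real) => 'x => real) set" for H where
  averages_id: "(\<lambda>f. f) \<in> averages H"
| averages_step: "A \<in> averages H ==> h \<in> H ==> (\<lambda>f. orbit_average h n (A f)) \<in> averages H"

lemma averages_add: "A \<in> averages H ==> A (\<lambda>x. f x + g x) = (\<lambda>x. A f x + A g x)"
  by (induction rule: averages.induct) (auto simp: orbit_average_def sum.distrib add_divide_distrib)

lemma averages_scale: "A \<in> averages H ==> A (\<lambda>x. c * f x) = (\<lambda>x. c * A f x)"
  by (induction rule: averages.induct) (auto simp: orbit_average_def sum_distrib_left)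

lemma averages_compose: "A \<in> averages H ==> B \<in> averages H ==> (\<lambda>f. A (B f)) \<in> averages H"
  by (induction rule: averages.induct) (auto intro: averages.intros)

lemma orbit_average_telescope: "orbit_average h n (\<lambda>x. f x - f (h x)) x = (f x - f ((h ^^ Suc n) x)) / Suc n"
  using sum_telescope[of "\<lambda>k. f ((h ^^ k) x)" n] by (simp add: orbit_average_def)

locale commuting_maps =
  fixes R :: "'x set" and H :: "('x => 'x) set"
  assumes nonempty: "R \<noteq> {}" and maps_to: "\<And>h x. h \<in> H ==> x \<in> R ==> h x \<in> R"
    and commute: "\<And>h g x. h \<in> H ==> g \<in> H ==> x \<in> R ==> h (g x) = g (h x)"
begin

lemma funpow_maps_to: "h \<in> H ==> x \<in> R ==> (h ^^ k) x \<in> R"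
  by (induction k) (auto intro: maps_to)

lemma funpow_commute:
  assumes "h \<in> H" "g \<in> H" "x \<in> R"
  shows "(h ^^ k) ((g ^^ l) x) = (g ^^ l) ((h ^^ k) x)"
proof -
  have "(h ^^ k) (g x) = g ((h ^^ k) x)" if "x \<in> R" for x
    using assms that by (induction k) (auto simp: commute funpow_maps_to)
  then show ?thesis using assms by (induction l) (auto simp: funpow_maps_to)
qed

lemma averages_le:
  assumes "A \<in> averages H" "\<And>x. x \<in> R ==> f x \<le> B" "x \<in> R"
  shows "A f x \<le> B"
  using assms(1,3)
proof (induction arbitrary: x)
  case (averages_step A h n)
  have "(\<Sum>k\<le>n. A f ((h ^^ k) x)) \<le> (\<Sum>k\<le>n. B)"
    using averages_step by (intro sum_mono) (auto intro: funpow_maps_to)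
  then show ?case
    by (simp add: orbit_average_def divide_le_eq mult.commute)
qed (use assms in auto)

lemma orbit_average_commute:
  assumes "B \<in> averages H" "h \<in> H" "x \<in> R"
  shows "orbit_average h n (B f) x = B (orbit_average h n f) x"
  using assms(1,3)
proof (induction arbitrary: x)
  case (averages_step B g l)
  have "orbit_average h n (orbit_average g l (B f)) x
      = (\<Sum>k\<le>n. \<Sum>j\<le>l. B f ((g ^^ j) ((h ^^ k) x))) / (Suc n * Suc l)"
    by (simp add: orbit_average_def sum_divide_distrib algebra_simps)
  also have "... = (\<Sum>j\<le>l. \<Sum>k\<le>n. B f ((h ^^ k) ((g ^^ j) x))) / (Suc n * Suc l)"
    using averages_step assms(2) by (subst sum.swap) (simp add: funpow_commute)
  also have "... = orbit_average g l (orbit_average h n (B f)) x"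
    by (simp add: orbit_average_def sum_divide_distrib algebra_simps)
  also have "... = orbit_average g l (B (orbit_average h n f)) x"
    using averages_step funpow_maps_to by (simp add: orbit_average_def[of g])
  finally show ?case .
qed simp

lemma averages_commute:
  assumes "A \<in> averages H" "B \<in> averages H" "x \<in> R"
  shows "A (B f) x = B (A f) x"
  using assms(1,3)
proof (induction arbitrary: x)
  case (averages_step A h n)
  have "orbit_average h n (A (B f)) x = orbit_average h n (B (A f)) x"
    using averages_step funpow_maps_to by (simp add: orbit_average_def)
  then show ?case
    using orbit_average_commute[OF assms(2) averages_step(2,4)] by simp
qed simp

definition upper_mean :: "('x => real) => real" where
  "upper_mean f = (INF A\<in>averages H. SUP x\<in>R. A f x)"

lemma averages_bdd_above:
  assumes "A \<in> averages H" "bdd_fun f"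
  shows "bdd_above ((\<lambda>x. A f x) ` R)"
proof -
  obtain B where "\<And>x. f x \<le> B" using bdd_funE[OF assms(2)] abs_le_D1 by metis
  then show ?thesis using averages_le[OF assms(1)] by (intro bdd_aboveI2[where M = B]) simp
qed

lemma sup_averages_bdd_below:
  assumes f: "bdd_fun f"
  shows "bdd_below ((\<lambda>A. SUP x\<in>R. A f x) ` averages H)"
proof -
  obtain B where B: "\<And>x. - 1 * f x \<le> B" using bdd_funE[OF f] by (metis abs_le_D2 mult_minus1)
  obtain x where x: "x \<in> R" using nonempty by blast
  have "- B \<le> (SUP x\<in>R. A f x)" if A: "A \<in> averages H" for A
  proof -
    have "- A f x \<le> B"
      using averages_le[OF A, of "\<lambda>x. - 1 * f x" B x] B x averages_scale[OF A, of "-1" f] by simp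
    moreover have "A f x \<le> (SUP x\<in>R. A f x)" using x by (intro cSUP_upper averages_bdd_above A f)
    ultimately show ?thesis by simp
  qed
  then show ?thesis by (intro bdd_belowI2) auto
qed

lemma upper_mean_le:
  assumes "A \<in> averages H" "\<And>x. x \<in> R ==> A f x \<le> B" "bdd_fun f"
  shows "upper_mean f \<le> B"
proof -
  have "upper_mean f \<le> (SUP x\<in>R. A f x)"
    unfolding upper_mean_def using assms by (intro cINF_lower sup_averages_bdd_below)
  also have "... \<le> B" using nonempty assms by (intro cSUP_least) auto
  finally show ?thesis .
qed

lemma sublinear_upper_mean: "sublinear_on {f. bdd_fun f} upper_mean"
  unfolding upper_mean_def[abs_def]
proof (rule sublinear_INF)
  show "fun_subspace {f :: 'x => real. bdd_fun f}" by (auto simp: fun_subspace_def bdd_fun_add bdd_fun_scale)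
  show "averages H \<noteq> {}" using averages_id by blast
  have upper: "A f x \<le> (SUP x\<in>R. A f x)" if "A \<in> averages H" "bdd_fun f" "x \<in> R" for A f x
    using that by (intro cSUP_upper averages_bdd_above)
  show "\<exists>C\<in>averages H. (SUP x\<in>R. C (\<lambda>x. f x + g x) x) \<le> (SUP x\<in>R. A f x) + (SUP x\<in>R. B g x)"
    if A: "A \<in> averages H" and B: "B \<in> averages H" and f: "f \<in> {f. bdd_fun f}" and g: "g \<in> {f. bdd_fun f}"
    for A B f g
  proof (intro bexI[OF _ averages_compose[OF A B]] cSUP_least nonempty)
    fix x assume x: "x \<in> R"
    have "A (B (\<lambda>x. f x + g x)) x = B (A f) x + A (B g) x"
      using averages_commute[OF A B x, of f] by (simp add: averages_add[OF A] averages_add[OF B])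
    moreover have "B (A f) x \<le> (SUP x\<in>R. A f x)" "A (B g) x \<le> (SUP x\<in>R. B g x)"
      using upper[OF A] upper[OF B] f g by (auto intro!: averages_le[OF B _ x] averages_le[OF A _ x])
    ultimately show "A (B (\<lambda>x. f x + g x)) x \<le> (SUP x\<in>R. A f x) + (SUP x\<in>R. B g x)" by simp
  qed
  show "\<exists>B\<in>averages H. (SUP x\<in>R. B (\<lambda>x. c * f x) x) \<le> c * (SUP x\<in>R. A f x)"
    if "A \<in> averages H" "0 < c" "f \<in> {f. bdd_fun f}" for A c f
    using that upper[OF that(1)] averages_scale[OF that(1)] by (intro bexI[OF _ that(1)] cSUP_least nonempty) auto
qed (use sup_averages_bdd_below in auto)

lemma upper_mean_coboundary_le:
  assumes h: "h \<in> H" and f: "bdd_fun f"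
  shows "upper_mean (\<lambda>x. f x - f (h x)) \<le> 0"
proof (rule field_le_epsilon)
  fix e :: real assume e: "0 < e"
  obtain B where B: "0 \<le> B" "\<And>x. \<bar>f x\<bar> \<le> B" using bdd_funE[OF f] by blast
  obtain n :: nat where n: "2 * B / e < n" using reals_Archimedean2 by blast
  have "0 < real n" using le_less_trans[OF _ n, of 0] B(1) e by simp
  have "upper_mean (\<lambda>x. f x - f (h x)) \<le> e"
  proof (rule upper_mean_le[OF averages_step[OF averages_id h, of n]])
    fix x
    have "orbit_average h n (\<lambda>x. f x - f (h x)) x \<le> 2 * B / Suc n"
      using B(2)[of x] B(2)[of "(h ^^ Suc n) x"] unfolding orbit_average_telescope by (intro divide_right_mono) auto
    also have "... \<le> 2 * B / n" using B(1) \<open>0 < real n\<close> by (intro divide_left_mono) auto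
    also have "... \<le> e" using n e \<open>0 < real n\<close> by (simp add: field_simps)
    finally show "orbit_average h n (\<lambda>x. f x - f (h x)) x \<le> e" .
  qed (intro bdd_fun_diff bdd_fun_compose[OF f] f)
  then show "upper_mean (\<lambda>x. f x - f (h x)) \<le> 0 + e" by simp
qed

lemma invariant_mean_exists:
  obtains m where "mean R m" "\<And>h f. h \<in> H ==> bdd_fun f ==> m (\<lambda>x. f (h x)) = m f"
proof -
  obtain m where m: "mean R m" "\<And>f. bdd_fun f ==> m f \<le> upper_mean f"
    using mean_of_sublinear[OF sublinear_upper_mean] upper_mean_le[OF averages_id] by metis
  have m_le: "m f \<le> m (\<lambda>x. f (h x))" if h: "h \<in> H" and f: "bdd_fun f" for h f
  proof -
    have fh: "bdd_fun (\<lambda>x. f (h x))"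
      using bdd_fun_compose[OF f] .
    have "m f - m (\<lambda>x. f (h x)) \<le> upper_mean (\<lambda>x. f x - f (h x))"
      using m(2)[OF bdd_fun_diff[OF f fh]] mean_diff[OF m(1) f fh] by simp
    then show ?thesis using upper_mean_coboundary_le[OF h f] by simp
  qed
  have "m (\<lambda>x. f (h x)) = m f" if h: "h \<in> H" and f: "bdd_fun f" for h f
    using m_le[OF h f] m_le[OF h bdd_fun_scale[OF f, of "-1"]] mean_scale[OF m(1), of _ "-1"]
      bdd_fun_compose[OF f, of h] f by simp
  then show thesis using that m(1) by blast
qed

end

subsection \<open>Means from finitely additive measures\<close>

locale fa_probability =
  fixes G :: "'x set" and \<mu> :: "'x set => real"
  assumes nonneg: "\<And>A. A \<subseteq> G ==> 0 \<le> \<mu> A" and total: "\<mu> G = 1"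
    and additive: "\<And>A B. A \<subseteq> G ==> B \<subseteq> G ==> A \<inter> B = {} ==> \<mu> (A \<union> B) = \<mu> A + \<mu> B"
begin

lemma measure_empty: "\<mu> {} = 0"
  using additive[of "{}" "{}"] by simp

lemma nonempty: "G \<noteq> {}"
  using measure_empty total by auto

lemma measure_UNION:
  assumes "finite T" "\<And>c. c \<in> T ==> A c \<subseteq> G" "\<And>c c'. c \<in> T ==> c' \<in> T ==> c \<noteq> c' ==> A c \<inter> A c' = {}"
  shows "\<mu> (\<Union>c\<in>T. A c) = (\<Sum>c\<in>T. \<mu> (A c))"
  using assms
proof (induction T rule: finite_induct)
  case (insert c T)
  have "\<mu> (A c \<union> (\<Union>c\<in>T. A c)) = \<mu> (A c) + \<mu> (\<Union>c\<in>T. A c)"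
    using insert.prems insert.hyps(2) by (intro additive) fastforce+
  then show ?case
    using insert by simp
qed (simp add: measure_empty)

definition simple_integral :: "('x => real) => real" where
  "simple_integral s = (\<Sum>a\<in>s ` G. a * \<mu> {x \<in> G. s x = a})"

lemma simple_integral_compose:
  fixes k :: "'x => 'b" and \<phi> :: "'b => real"
  assumes fin: "finite (k ` G)"
  shows "simple_integral (\<lambda>x. \<phi> (k x)) = (\<Sum>c\<in>k ` G. \<phi> c * \<mu> {x \<in> G. k x = c})"
proof -
  have "\<mu> {x \<in> G. \<phi> (k x) = a} = (\<Sum>c\<in>{c \<in> k ` G. \<phi> c = a}. \<mu> {x \<in> G. k x = c})" for a
  proof -
    have "{x \<in> G. \<phi> (k x) = a} = (\<Union>c\<in>{c \<in> k ` G. \<phi> c = a}. {x \<in> G. k x = c})" by auto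
    then show ?thesis
      using measure_UNION[of "{c \<in> k ` G. \<phi> c = a}" "\<lambda>c. {x \<in> G. k x = c}"] fin by auto
  qed
  then have "simple_integral (\<lambda>x. \<phi> (k x))
      = (\<Sum>a\<in>\<phi> ` k ` G. \<Sum>c\<in>{c \<in> k ` G. \<phi> c = a}. \<phi> c * \<mu> {x \<in> G. k x = c})"
    by (simp add: simple_integral_def image_image sum_distrib_left)
  also have "... = (\<Sum>c\<in>k ` G. \<phi> c * \<mu> {x \<in> G. k x = c})" using fin by (intro sum.group) auto
  finally show ?thesis .
qed

lemma finite_image_pair: "finite (s ` G) ==> finite (t ` G) ==> finite ((\<lambda>x. (s x, t x)) ` G)"
  by (rule finite_subset[of _ "s ` G \<times> t ` G"]) auto

lemma finite_image_add: "finite (s ` G) ==> finite (t ` G) ==> finite ((\<lambda>x. s x + t x :: real) ` G)"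
  using finite_imageI[OF finite_image_pair[of s t], of "\<lambda>(a, b). a + b"] by (simp add: image_image)

lemma finite_image_scale: "finite (s ` G) ==> finite ((\<lambda>x. c * s x :: real) ` G)"
  using finite_imageI[of "s ` G" "\<lambda>a. c * a"] by (simp add: image_image)

lemma simple_integral_add:
  assumes "finite (s ` G)" "finite (t ` G)"
  shows "simple_integral (\<lambda>x. s x + t x) = simple_integral s + simple_integral t"
  using simple_integral_compose[OF finite_image_pair[OF assms], of "\<lambda>(a, b). a + b"]
    simple_integral_compose[OF finite_image_pair[OF assms], of fst]
    simple_integral_compose[OF finite_image_pair[OF assms], of snd]
  by (simp add: case_prod_beta sum.distrib algebra_simps)

lemma simple_integral_scale: "finite (s ` G) ==> simple_integral (\<lambda>x. c * s x) = c * simple_integral s"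
  using simple_integral_compose[of s "\<lambda>a. c * a"]
  by (simp add: simple_integral_def sum_distrib_left algebra_simps)

lemma simple_integral_const: "simple_integral (\<lambda>x. c) = c"
  using total nonempty by (simp add: simple_integral_def image_constant_conv)

lemma simple_integral_ge:
  assumes "finite (s ` G)" "\<And>x. x \<in> G ==> c \<le> s x"
  shows "c \<le> simple_integral s"
proof -
  have "(\<Sum>a\<in>s ` G. c * \<mu> {x \<in> G. s x = a}) \<le> simple_integral s"
    unfolding simple_integral_def using assms by (intro sum_mono mult_right_mono nonneg) auto
  then show ?thesis
    using simple_integral_compose[OF assms(1), of "\<lambda>_. c"] simple_integral_const[of c] by simp
qed

lemma simple_integral_invariant:
  assumes h: "h ` G = G" "inj_on h G" and inv: "\<And>A. A \<subseteq> G ==> \<mu> (h ` A) = \<mu> A"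
  shows "simple_integral (\<lambda>x. s (h x)) = simple_integral s"
proof -
  have "h ` {x \<in> G. s (h x) = a} = {x \<in> G. s x = a}" for a
    using h(1) by force
  then have "\<mu> {x \<in> G. s (h x) = a} = \<mu> {x \<in> G. s x = a}" for a
    using inv[of "{x \<in> G. s (h x) = a}"] by auto
  moreover have "(\<lambda>x. s (h x)) ` G = s ` G" using h(1) by (metis image_image)
  ultimately show ?thesis by (simp add: simple_integral_def)
qed

definition upper_integral :: "('x => real) => real" where
  "upper_integral f = (INF s\<in>{s. finite (s ` G)}. simple_integral s + (SUP x\<in>G. f x - s x))"

lemma diff_simple_bdd_above:
  assumes "bdd_fun f" "finite (s ` G)"
  shows "bdd_above ((\<lambda>x. f x - s x) ` G)"
proof -
  obtain B where B: "\<And>x. \<bar>f x\<bar> \<le> B" using bdd_funE[OF assms(1)] by blast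
  have "f x - s x \<le> B - Min (s ` G)" if "x \<in> G" for x
    using B[of x] Min_le[OF assms(2), of "s x"] that by auto
  then show ?thesis by (rule bdd_aboveI2)
qed

lemma upper_sums_bdd_below:
  assumes f: "bdd_fun f"
  shows "bdd_below ((\<lambda>s. simple_integral s + (SUP x\<in>G. f x - s x)) ` {s. finite (s ` G)})"
proof -
  obtain B where B: "\<And>x. \<bar>f x\<bar> \<le> B" using bdd_funE[OF f] by blast
  have "- B \<le> simple_integral s + (SUP x\<in>G. f x - s x)" if s: "finite (s ` G)" for s
  proof -
    have "- B - (SUP x\<in>G. f x - s x) \<le> s x" if "x \<in> G" for x
      using cSUP_upper[OF that diff_simple_bdd_above[OF f s]] B[of x] by auto
    then show ?thesis using simple_integral_ge[OF s, of "- B - (SUP x\<in>G. f x - s x)"] by simp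
  qed
  then show ?thesis by (intro bdd_belowI2) auto
qed

lemma upper_integral_le:
  assumes "bdd_fun f" "finite (s ` G)" "\<And>x. x \<in> G ==> f x - s x \<le> e"
  shows "upper_integral f \<le> simple_integral s + e"
proof -
  have "upper_integral f \<le> simple_integral s + (SUP x\<in>G. f x - s x)"
    unfolding upper_integral_def using assms by (intro cINF_lower upper_sums_bdd_below) auto
  also have "... \<le> simple_integral s + e" using nonempty assms(3) by (intro add_left_mono cSUP_least) auto
  finally show ?thesis .
qed

lemma sublinear_upper_integral: "sublinear_on {f. bdd_fun f} upper_integral"
  unfolding upper_integral_def[abs_def]
proof (rule sublinear_INF)
  show "fun_subspace {f :: 'x => real. bdd_fun f}" by (auto simp: fun_subspace_def bdd_fun_add bdd_fun_scale)
  have "finite ((\<lambda>_. 0 :: real) ` G)" by (rule finite_subset[of _ "{0}"]) auto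
  then show "{s :: 'x => real. finite (s ` G)} \<noteq> {}" by blast
  have upper: "f x - s x \<le> (SUP x\<in>G. f x - s x)" if "bdd_fun f" "finite (s ` G)" "x \<in> G" for f s x
    using that by (intro cSUP_upper diff_simple_bdd_above)
  show "\<exists>r\<in>{s. finite (s ` G)}. simple_integral r + (SUP x\<in>G. f x + g x - r x) \<le>
      simple_integral s + (SUP x\<in>G. f x - s x) + (simple_integral t + (SUP x\<in>G. g x - t x))"
    if "s \<in> {s. finite (s ` G)}" "t \<in> {s. finite (s ` G)}" "f \<in> {f. bdd_fun f}" "g \<in> {f. bdd_fun f}" for s t f g
  proof -
    have "(SUP x\<in>G. f x + g x - (s x + t x)) \<le> (SUP x\<in>G. f x - s x) + (SUP x\<in>G. g x - t x)"
      using upper[of f s] upper[of g t] that by (intro cSUP_least nonempty) fastforce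
    then show ?thesis
      using that simple_integral_add[of s t] finite_image_add[of s t] by (intro bexI[of _ "\<lambda>x. s x + t x"]) auto
  qed
  show "\<exists>r\<in>{s. finite (s ` G)}. simple_integral r + (SUP x\<in>G. c * f x - r x) \<le>
      c * (simple_integral s + (SUP x\<in>G. f x - s x))"
    if "s \<in> {s. finite (s ` G)}" "0 < c" "f \<in> {f. bdd_fun f}" for s c f
  proof -
    have "(SUP x\<in>G. c * f x - c * s x) \<le> c * (SUP x\<in>G. f x - s x)"
      using upper[of f s] that by (intro cSUP_least nonempty) (simp flip: right_diff_distrib)
    then show ?thesis
      using that simple_integral_scale[of s c] finite_image_scale[of s c]
      by (intro bexI[of _ "\<lambda>x. c * s x"]) (auto simp: algebra_simps)
  qed
qed (use upper_sums_bdd_below in auto)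

lemma simple_approximation:
  assumes "bdd_fun f" "0 < e"
  obtains s where "bdd_fun s" "finite (s ` G)" "\<And>x. \<bar>f x - s x\<bar> \<le> e"
proof -
  obtain B where B: "\<And>x. \<bar>f x\<bar> \<le> B" using bdd_funE[OF assms(1)] by blast
  define s where "s x = e * of_int \<lfloor>f x / e\<rfloor>" for x
  have near: "\<bar>f x - s x\<bar> \<le> e" for x
  proof -
    have "of_int \<lfloor>f x / e\<rfloor> * e \<le> f x" "f x \<le> (of_int \<lfloor>f x / e\<rfloor> + 1) * e"
      using assms(2) floor_divide_lower[of e "f x"] less_imp_le[OF floor_divide_upper[of e "f x"]] by simp_all
    then show ?thesis by (simp add: s_def abs_le_iff algebra_simps)
  qed
  have "\<lfloor>f x / e\<rfloor> \<in> {\<lfloor>- B / e\<rfloor>..\<lfloor>B / e\<rfloor>}" for x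
    using B[of x] assms(2) by (auto simp: abs_le_iff intro!: floor_mono divide_right_mono simp del: divide_minus_left)
  then have "s ` G \<subseteq> (\<lambda>j. e * of_int j) ` {\<lfloor>- B / e\<rfloor>..\<lfloor>B / e\<rfloor>}"
    by (auto simp: s_def)
  then have "finite (s ` G)" by (rule finite_subset) simp
  moreover have "bdd_fun (\<lambda>x. f x - (f x - s x))" by (rule bdd_fun_diff[OF assms(1) bdd_funI[OF near]])
  ultimately show thesis using that[of s] near by simp
qed

lemma mean_extending_measure:
  obtains m where "mean G m" "\<And>s. bdd_fun s ==> finite (s ` G) ==> m s = simple_integral s"
proof -
  have "upper_integral f \<le> B" if "bdd_fun f" "\<And>x. x \<in> G ==> f x \<le> B" for f B
    using upper_integral_le[OF that(1), of "\<lambda>_. 0" B] that(2) simple_integral_const[of 0]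
    by (simp add: image_constant_conv)
  then obtain m where m: "mean G m" "\<And>f. bdd_fun f ==> m f \<le> upper_integral f"
    using mean_of_sublinear[OF sublinear_upper_integral] by metis
  have m_le: "m s \<le> simple_integral s" if "bdd_fun s" "finite (s ` G)" for s
    using m(2)[OF that(1)] upper_integral_le[OF that, of 0] by simp
  have "m s = simple_integral s" if "bdd_fun s" "finite (s ` G)" for s
    using m_le[OF that] m_le[OF bdd_fun_scale[OF that(1), of "-1"] finite_image_scale[OF that(2)]]
      mean_scale[OF m(1) that(1), of "-1"] simple_integral_scale[OF that(2), of "-1"] by simp
  then show thesis using that m(1) by blast
qed

lemma invariant_mean_of_measure:
  obtains m where "mean G m"
    "\<And>h f. bij_betw h G G ==> (\<And>A. A \<subseteq> G ==> \<mu> (h ` A) = \<mu> A) ==> bdd_fun f ==> m (\<lambda>x. f (h x)) = m f"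
proof -
  obtain m where m: "mean G m" "\<And>s. bdd_fun s ==> finite (s ` G) ==> m s = simple_integral s"
    using mean_extending_measure by blast
  have "m (\<lambda>x. f (h x)) = m f"
    if h: "bij_betw h G G" and inv: "\<And>A. A \<subseteq> G ==> \<mu> (h ` A) = \<mu> A" and f: "bdd_fun f" for h f
  proof -
    have hG: "h ` G = G" "inj_on h G" using h by (auto simp: bij_betw_def)
    have "\<bar>m (\<lambda>x. f (h x)) - m f\<bar> \<le> 0 + e" if "0 < e" for e
    proof -
      obtain s where s: "bdd_fun s" "finite (s ` G)" "\<And>x. \<bar>f x - s x\<bar> \<le> e / 2"
        using simple_approximation[OF f, of "e / 2"] \<open>0 < e\<close> by auto
      have fh: "bdd_fun (\<lambda>x. f (h x))" and sh: "bdd_fun (\<lambda>x. s (h x))" "finite ((\<lambda>x. s (h x)) ` G)"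
        using bdd_fun_compose f s(1,2) hG(1) by (auto simp: image_image[of s h, symmetric])
      have "m (\<lambda>x. s (h x)) = m s"
        using m(2)[OF s(1,2)] m(2)[OF sh] simple_integral_invariant[OF hG inv] by simp
      moreover have "\<bar>m (\<lambda>x. f x - s x)\<bar> \<le> e / 2" "\<bar>m (\<lambda>x. f (h x) - s (h x))\<bar> \<le> e / 2"
        using s(3) f fh s(1) sh by (intro mean_bound[OF m(1)] bdd_fun_diff; simp)+
      ultimately show ?thesis using mean_diff[OF m(1) f s(1)] mean_diff[OF m(1) fh sh(1)] by linarith
    qed
    then have "\<bar>m (\<lambda>x. f (h x)) - m f\<bar> \<le> 0" by (rule field_le_epsilon)
    then show ?thesis by simp
  qed
  then show thesis using that m(1) by blast
qed

end

section \<open>Random cones\<close>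

subsection \<open>Subsets of a given size\<close>

definition k_subsets :: "nat => 'a list => 'a set list" where
  "k_subsets r xs = filter (\<lambda>H. card H = r) (map set (subseqs xs))"

lemma set_k_subsets: "set (k_subsets r xs) = {H. H \<subseteq> set xs \<and> card H = r}"
  using subseqs_powset[of xs] by (auto simp: k_subsets_def)

lemma distinct_k_subsets: "distinct xs ==> distinct (k_subsets r xs)"
  by (simp add: k_subsets_def distinct_set_subseqs)

lemma k_subsets_Cons:
  obtains ys where "k_subsets r (x # xs) = ys @ k_subsets r xs"
  by (simp add: k_subsets_def Let_def)

lemma map_k_subsets:
  assumes "inj f"
  shows "map ((`) f) (k_subsets r xs) = k_subsets r (map f xs)"
proof -
  have "map set (subseqs (map f xs)) = map ((`) f) (map set (subseqs xs))"
  proof (induction xs)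
    case (Cons x xs)
    have "map set (subseqs (map f (x # xs))) =
        map (insert (f x)) (map set (subseqs (map f xs))) @ map set (subseqs (map f xs))"
      by (simp add: Let_def comp_def)
    then show ?case
      unfolding Cons by (simp add: Let_def comp_def)
  qed simp
  moreover have "card (f ` H) = card H" for H
    using assms by (intro card_image inj_on_subset[OF assms]) simp
  ultimately show ?thesis unfolding k_subsets_def by (simp add: filter_map comp_def)
qed

lemma filter_k_subsets: "filter (\<lambda>H. v \<notin> H) (k_subsets r xs) = k_subsets r (filter (\<lambda>x. x \<noteq> v) xs)"
proof -
  have "filter (\<lambda>H. v \<notin> H) (map set (subseqs xs)) = map set (subseqs (filter (\<lambda>x. x \<noteq> v) xs))"
  proof (induction xs)
    case (Cons x xs)
    have "filter (\<lambda>H. v \<notin> H) (map set (map ((#) x) yss)) =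
        (if x = v then [] else map (insert x) (filter (\<lambda>H. v \<notin> H) (map set yss)))" for yss
      by (induction yss) auto
    moreover have "map (insert x) (map set yss) = map set (map ((#) x) yss)" for yss by simp
    ultimately show ?case
      using Cons by (simp add: Let_def del: map_map)
  qed simp
  from this[symmetric] show ?thesis
    unfolding k_subsets_def by (simp only: filter_filter conj_commute)
qed

lemma inj_skip: "inj (skip v)"
  using strict_mono_skip by (rule strict_mono_imp_inj_on)

lemma skip_image_atLeastAtMost:
  assumes v: "1 \<le> v" "v \<le> Suc N"
  shows "skip v ` {1..N} = {1..Suc N} - {v}"
proof
  show "{1..Suc N} - {v} \<subseteq> skip v ` {1..N}"
  proof
    fix x assume "x \<in> {1..Suc N} - {v}"
    then show "x \<in> skip v ` {1..N}"
      using v by (intro image_eqI[of _ _ "if x < v then x else x - 1"]) (auto simp: skip_def)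
  qed
qed (use v in \<open>auto simp: skip_def\<close>)

lemma skip_image_atMost:
  assumes "1 \<le> v" "v \<le> Suc N"
  shows "skip v ` {..N} = {..Suc N} - {v}"
proof -
  have "{..k} = insert 0 {1..k}" for k :: nat
    by auto
  moreover have "skip v 0 = 0" using assms by (simp add: skip_def)
  ultimately show ?thesis using skip_image_atLeastAtMost[OF assms] assms(1) by (simp add: insert_Diff_if)
qed

lemma map_skip_upt:
  assumes "2 \<le> v" "v \<le> Suc N"
  shows "map (skip v) [2..<Suc N] = filter (\<lambda>x. x \<noteq> v) [2..<Suc (Suc N)]"
proof -
  have "[2..<Suc N] = [2..<v] @ [v..<Suc N]" using upt_add_eq_append[of 2 v "Suc N - v"] assms by simp
  moreover have "[2..<Suc (Suc N)] = [2..<v] @ v # [Suc v..<Suc (Suc N)]"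
    using upt_add_eq_append[of 2 v "Suc (Suc N) - v"] upt_conv_Cons[of v "Suc (Suc N)"] assms by simp
  moreover have "map (skip v) [2..<v] = [2..<v]" by (rule map_idI) (simp add: skip_def)
  moreover have "map (skip v) [v..<Suc N] = map Suc [v..<Suc N]"
    by (rule map_cong) (simp_all add: skip_def del: upt_Suc)
  moreover have "filter (\<lambda>x. x \<noteq> v) [2..<v] = [2..<v]"
    "filter (\<lambda>x. x \<noteq> v) [Suc v..<Suc (Suc N)] = [Suc v..<Suc (Suc N)]"
    by (auto simp: filter_id_conv simp del: upt_Suc)
  ultimately show ?thesis by (simp add: map_Suc_upt del: upt_Suc)
qed

lemma image_Diff_singleton: "inj f ==> f ` (B - {v}) = f ` B - {f v}"
  by (simp add: image_set_diff)

context kan_complex begin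

lemma lface_image:
  assumes "strict_mono f" "v \<in> B"
  shows "lface (f ` B) (f v) t = lface B v t"
proof -
  have "strict_mono_on B f" using assms(1) by (simp add: strict_mono_on_def strict_mono_def)
  moreover have "card (f ` B) = card B" using strict_mono_imp_inj_on[OF assms(1)] by (intro card_image)
  ultimately show ?thesis using pos_image[of B f v] assms(2) by (simp add: lface_def)
qed

lemma coherent_image:
  assumes f: "strict_mono f" and s: "coherent F' s" and F: "\<And>B. B \<in> F ==> f ` B \<in> F'"
    and down: "\<And>B v. B \<in> F ==> v \<in> B ==> 2 \<le> card B ==> B - {v} \<in> F"
  shows "coherent F (\<lambda>B. s (f ` B))"
  unfolding coherent_def
proof (intro ballI conjI impI)
  fix B assume B: "B \<in> F"
  have inj: "inj f" "card (f ` B) = card B" using strict_mono_imp_inj_on[OF f] card_image by blast+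
  note fB = coherentD[OF s F[OF B]]
  show "finite B" "B \<noteq> {}" using fB(1,2) finite_image_iff[OF strict_mono_imp_inj_on[OF f]] by auto
  show "s (f ` B) \<in> K (card B - 1)" using fB(3) inj(2) by simp
  fix v assume v: "2 \<le> card B" "v \<in> B"
  show "B - {v} \<in> F" using down B v by blast
  show "lface B v (s (f ` B)) = s (f ` (B - {v}))"
    using fB(5)[of "f v"] v inj lface_image[OF f v(2)] by (simp add: image_Diff_singleton)
qed

lemma fillable_image:
  assumes f: "strict_mono f" and fill: "fillable s (f ` B)"
  shows "fillable (\<lambda>B. s (f ` B)) B"
proof -
  have "inj f" "card (f ` B) = card B" using strict_mono_imp_inj_on[OF f] card_image by blast+
  then show ?thesis using fill lface_image[OF f] unfolding fillable_def by (auto simp: image_Diff_singleton)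
qed

end

subsection \<open>Faces of a cone\<close>

definition cone_faces :: "nat => nat => nat set set" where
  "cone_faces r N = {B. B \<subseteq> {..N} \<and> B \<noteq> {} \<and> (0 \<in> B --> card B \<le> Suc r)}"

definition spine :: "nat set => nat set" where
  "spine G = insert 0 (insert 1 G)"

lemma mem_spine: "v \<in> spine G \<longleftrightarrow> v = 0 \<or> v = 1 \<or> v \<in> G"
  by (simp add: spine_def)

lemma
  assumes G: "G \<subseteq> {2..N}"
  shows finite_spine: "finite (spine G)" and card_spine: "card (spine G) = Suc (Suc (card G))"
    and spine_Diff_0: "spine G - {0} = insert 1 G" and spine_Diff_1: "spine G - {1} = insert 0 G"
    and spine_Diff: "b \<in> G ==> spine G - {b} = spine (G - {b})"
    and card_insert_0: "card (insert 0 G) = Suc (card G)" and card_insert_1: "card (insert 1 G) = Suc (card G)"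
    and pos_spine: "pos (spine G) 1 = 1" "2 \<in> G ==> pos (spine G) 2 = 2"
proof -
  have G': "finite G" "0 \<notin> G" "1 \<notin> G" using G finite_subset by auto
  then show "finite (spine G)" "card (spine G) = Suc (Suc (card G))" "card (insert 0 G) = Suc (card G)"
    "card (insert 1 G) = Suc (card G)" "spine G - {0} = insert 1 G" "spine G - {1} = insert 0 G" "b \<in> G ==> spine G - {b} = spine (G - {b})"
    by (auto simp: spine_def)
  have "{b \<in> spine G. b < 1} = {0}" "{b \<in> spine G. b < 2} = {0, 1}" using G by (auto simp: spine_def)
  then show "pos (spine G) 1 = 1" "2 \<in> G ==> pos (spine G) 2 = 2" by (simp_all add: pos_def)
qed

lemma finite_cone_face: "B \<in> cone_faces r N ==> finite B"
  by (auto simp: cone_faces_def intro: finite_subset)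

lemma cone_face_Diff: "B \<in> cone_faces r N ==> 2 \<le> card B ==> B - {v} \<in> cone_faces r N"
  using Diff_singleton_nonempty[of B v] card_Diff1_le[of B v] by (auto simp: cone_faces_def)

lemma cone_faces_mono: "r \<le> r' ==> cone_faces r N \<subseteq> cone_faces r' N"
  by (auto simp: cone_faces_def)

lemma new_cone_face:
  assumes "B \<in> cone_faces (Suc r) N" "B \<notin> cone_faces r N"
  shows "0 \<in> B" "card B = Suc (Suc r)" "finite B" "B \<subseteq> {..N}"
  using assms by (auto simp: cone_faces_def intro: finite_subset)

lemma new_cone_face_cases:
  assumes "B \<in> cone_faces (Suc r) N" "B \<notin> cone_faces r N"
  obtains (spine) H where "H \<subseteq> {2..N}" "card H = r" "B = spine H"
  | (facet) G where "G \<subseteq> {2..N}" "card G = Suc r" "B = insert 0 G"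
proof (cases "1 \<in> B")
  note B = new_cone_face[OF assms]
  have "{..N} - {0, 1} = {2..N}" by auto
  then have sub: "B - {0, 1} \<subseteq> {2..N}" using B(4) by blast
  {
    case True
    then have "B = spine (B - {0, 1})" "card (B - {0, 1}) = r" using B by (auto simp: spine_def card_Diff_subset)
    then show thesis using spine sub by blast
  next
    case False
    then have "B = insert 0 (B - {0, 1})" "B - {0, 1} = B - {0}" using B(1) by auto
    then show thesis using facet[OF sub] B(1-3) by simp
  }
qed

lemma cone_face_new_Diff:
  assumes "B \<in> cone_faces (Suc r) N" "B \<notin> cone_faces r N" "v \<in> B"
  shows "B - {v} \<in> cone_faces r N"
proof -
  note B = new_cone_face[OF assms(1,2)]
  have "card (B - {v}) = Suc r" "B - {v} \<subseteq> {..N}" using B assms(3) by auto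
  moreover have "B - {v} \<noteq> {}" using Diff_singleton_nonempty[of B v] B(2) by simp
  ultimately show ?thesis by (simp add: cone_faces_def)
qed

lemma spine_new_cone_face:
  assumes "H \<subseteq> {2..N}" "card H = r" "1 \<le> N"
  shows "spine H \<in> cone_faces (Suc r) N" "spine H \<notin> cone_faces r N"
  using card_spine[OF assms(1)] assms by (auto simp: cone_faces_def spine_def)

lemma insert_0_new_cone_face:
  assumes "G \<subseteq> {2..N}" "card G = Suc r"
  shows "insert 0 G \<in> cone_faces (Suc r) N" "insert 0 G \<notin> cone_faces r N"
  using card_insert_0[OF assms(1)] assms by (auto simp: cone_faces_def)

lemma spine_Diff_in_cone_faces:
  assumes "G \<subseteq> {2..N}" "card G \<le> r" "1 \<le> N" "v \<in> spine G"
  shows "spine G - {v} \<in> cone_faces r N"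
proof -
  have "spine G \<in> cone_faces (Suc (card G)) N" "spine G \<notin> cone_faces (card G) N"
    using spine_new_cone_face[OF assms(1) refl assms(3)] .
  then have "spine G - {v} \<in> cone_faces (card G) N" using assms(4) by (rule cone_face_new_Diff)
  then show ?thesis using cone_faces_mono[OF assms(2)] by blast
qed

lemma cone_faces_avoiding_0: "B \<subseteq> {1..N} ==> B \<noteq> {} ==> B \<in> cone_faces r N"
  by (fastforce simp: cone_faces_def)

lemma insert_1_in_cone_faces: "G \<subseteq> {2..N} ==> 1 \<le> N ==> insert 1 G \<in> cone_faces r N"
  by (rule cone_faces_avoiding_0) auto

lemma skip_image_in_cone_faces:
  assumes "1 \<le> v" "v \<le> Suc N"
  shows "skip v ` B \<in> cone_faces r (Suc N) \<longleftrightarrow> B \<in> cone_faces r N"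
proof -
  have "card (skip v ` B) = card B" using inj_skip inj_on_subset by (intro card_image) blast
  moreover have "0 \<in> skip v ` B \<longleftrightarrow> 0 \<in> B"
    using assms by (force simp: skip_def split: if_splits)
  moreover have "skip v x \<le> Suc N \<longleftrightarrow> x \<le> N" for x
    using assms by (auto simp: skip_def)
  ultimately show ?thesis by (auto simp: cone_faces_def)
qed

lemma skip_image_spine:
  assumes "G \<subseteq> {2..N}"
  shows "2 \<le> v ==> skip v ` spine G = spine (skip v ` G)" "2 \<le> v ==> skip v ` G \<subseteq> {2..Suc N}"
    "skip 1 ` spine G = insert 0 (insert 2 (skip 1 ` G))" "skip 1 ` G \<subseteq> {3..Suc N}"
    "card (skip v ` G) = card G"
proof -
  show "card (skip v ` G) = card G" using inj_skip inj_on_subset by (intro card_image) blast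
qed (use assms in \<open>auto simp: spine_def skip_def\<close>)

lemma cone_faces_0: "B \<in> cone_faces 0 N \<longleftrightarrow> B = {0} \<or> B \<subseteq> {1..N} \<and> B \<noteq> {}"
proof
  assume B: "B \<in> cone_faces 0 N"
  show "B = {0} \<or> B \<subseteq> {1..N} \<and> B \<noteq> {}"
  proof (cases "0 \<in> B")
    case True
    then have "card B \<le> 1" "finite B" using B finite_cone_face[OF B] by (simp_all add: cone_faces_def)
    then show ?thesis using True card_le_Suc0_iff_eq[of B] by auto
  next
    case False
    have "{..N} - {0} = {1..N}" by auto
    then show ?thesis using B False by (auto simp: cone_faces_def)
  qed
qed (auto simp: cone_faces_def)

locale kan_mean = kan_complex K d for K :: "nat => 's set" and d :: "nat => nat => 's => 's" +
  fixes base :: "'s => 's" and mu :: "nat => 's => ('s => real) => real"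
  assumes base_edge: "x \<in> K 0 ==> \<exists>e\<in>K 1. d 1 1 e = base x \<and> d 1 0 e = x"
    and base_const: "e \<in> K 1 ==> base (d 1 1 e) = base (d 1 0 e)"
    and mu_mean: "1 \<le> m ==> x \<in> K m ==> (m = 1 ==> base (d 1 1 x) = d 1 1 x) ==> mean (class_reps m x) (mu m x)"
    and mu_parallel: "1 \<le> m ==> parallel m x x' ==> mu m x = mu m x'"
    and mu_transport: "1 \<le> m ==> D \<in> K (Suc m) ==> (m = 1 ==> base (d 1 1 (d 2 2 D)) = d 1 1 (d 2 2 D)) ==>
      bdd_fun f ==> mu m (d (Suc m) 1 D) f = mu m (d (Suc m) 2 D) (\<lambda>z. f (transport m D z))"
begin

definition partial_cone :: "nat => nat => (nat set => 's) => bool" where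
  "partial_cone r N y \<longleftrightarrow> 1 \<le> N \<and> coherent (cone_faces r N) y \<and> (\<forall>B. B \<notin> cone_faces r N --> y B = undefined) \<and>
    base (y {1}) = y {0} \<and> (\<forall>G. G \<subseteq> {2..N} --> card G \<le> r --> fillable y (spine G))"

lemma partial_coneD:
  assumes "partial_cone r N y"
  shows "1 \<le> N" "coherent (cone_faces r N) y" "B \<notin> cone_faces r N ==> y B = undefined" "base (y {1}) = y {0}"
    "G \<subseteq> {2..N} ==> card G \<le> r ==> fillable y (spine G)"
  using assms by (auto simp: partial_cone_def)

lemma partial_cone_in: "partial_cone r N y ==> B \<in> cone_faces r N ==> y B \<in> K (card B - 1)"
  using coherentD(3)[OF partial_coneD(2)] .

lemma lface_partial_cone:
  "partial_cone r N y ==> B \<in> cone_faces r N ==> 2 \<le> card B ==> v \<in> B ==> lface B v (y B) = y (B - {v})"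
  using coherentD(5)[OF partial_coneD(2)] .

lemma base_partial_cone:
  assumes y: "partial_cone r N y" and v: "v \<in> {1..N}"
  shows "base (y {v}) = y {0}"
proof (cases "v = 1")
  case False
  then have v2: "1 < v" and card: "card {1, v} = 2" using v by auto
  have B: "{1, v} \<in> cone_faces r N" using v by (intro cone_faces_avoiding_0) auto
  have edge: "{1, v} - {v} = {1}" "{1, v} - {1} = {v}" using v2 by auto
  have "lface {1, v} v (y {1, v}) = y ({1, v} - {v})" "lface {1, v} 1 (y {1, v}) = y ({1, v} - {1})"
    using lface_partial_cone[OF y B] card by auto
  then have "d 1 1 (y {1, v}) = y {1}" "d 1 0 (y {1, v}) = y {v}"
    unfolding edge using lface_doubleton[OF v2] by simp_all
  moreover have "y {1, v} \<in> K 1" using partial_cone_in[OF y B] card by simp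
  ultimately show ?thesis using base_const[of "y {1, v}"] partial_coneD(4)[OF y] by simp
qed (use partial_coneD(4)[OF y] in simp)

subsection \<open>Extending a partial cone\<close>

definition spine_filler :: "nat => (nat set => 's) => nat set => 's" where
  "spine_filler r y H = (SOME t. t \<in> K (Suc r) \<and> (\<forall>v\<in>spine H. lface (spine H) v t = y (spine H - {v})))"

lemma spine_filler:
  assumes "partial_cone r N y" "H \<subseteq> {2..N}" "card H = r"
  shows "spine_filler r y H \<in> K (Suc r)"
    "v \<in> spine H ==> lface (spine H) v (spine_filler r y H) = y (spine H - {v})"
proof -
  have "fillable y (spine H)" using partial_coneD(5)[OF assms(1,2)] assms(3) by simp
  then have "\<exists>t. t \<in> K (Suc r) \<and> (\<forall>v\<in>spine H. lface (spine H) v t = y (spine H - {v}))"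
    using card_spine[OF assms(2)] assms(3) unfolding fillable_def by auto
  from someI_ex[OF this] show "spine_filler r y H \<in> K (Suc r)"
    "v \<in> spine H ==> lface (spine H) v (spine_filler r y H) = y (spine H - {v})"
    unfolding spine_filler_def by blast+
qed

lemma parallel_spine_filler_iff:
  assumes "partial_cone r N y" "H \<subseteq> {2..N}" "card H = r"
  shows "parallel (Suc r) t (spine_filler r y H) \<longleftrightarrow>
    t \<in> K (Suc r) \<and> (\<forall>v\<in>spine H. lface (spine H) v t = y (spine H - {v}))"
  unfolding parallel_lface[OF finite_spine[OF assms(2)] card_spine[OF assms(2), unfolded assms(3)]]
  using spine_filler[OF assms] by auto

definition spine_fillers :: "nat => (nat set => 's) => nat set => 's set" where
  "spine_fillers r y H = class_reps (Suc r) (spine_filler r y H)"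

definition admissible :: "nat => nat => (nat set => 's) => (nat set => 's) => bool" where
  "admissible r N y c \<longleftrightarrow> (\<forall>H. H \<subseteq> {2..N} --> card H = r --> c H \<in> spine_fillers r y H)"

lemma admissibleD:
  assumes "admissible r N y c" "H \<subseteq> {2..N}" "card H = r"
  shows "parallel (Suc r) (c H) (spine_filler r y H)" "class_rep (Suc r) (c H) = c H"
  using assms class_repsD[of "c H" "Suc r" "spine_filler r y H"] by (auto simp: admissible_def spine_fillers_def)

definition horn_face :: "(nat set => 's) => (nat set => 's) => nat set => nat => 's" where
  "horn_face y c G b = (if b = 0 then y (insert 1 G) else c (G - {b}))"

definition horn_filler :: "(nat set => 's) => (nat set => 's) => nat set => 's => bool" where
  "horn_filler y c G t \<longleftrightarrow> t \<in> K (Suc (card G)) \<and> (\<forall>b\<in>insert 0 G. lface (spine G) b t = horn_face y c G b)"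

lemma horn_face:
  assumes y: "partial_cone r N y" and c: "admissible r N y c" and G: "G \<subseteq> {2..N}" "card G = Suc r"
    and b: "b \<in> insert 0 G"
  shows "horn_face y c G b \<in> K (Suc r)"
    "v \<in> spine G - {b} ==> lface (spine G - {b}) v (horn_face y c G b) = y (spine G - {b} - {v})"
proof -
  have "horn_face y c G b \<in> K (Suc r) \<and>
    (\<forall>v\<in>spine G - {b}. lface (spine G - {b}) v (horn_face y c G b) = y (spine G - {b} - {v}))"
  proof (cases "b = 0")
    case True
    note facet = insert_1_in_cone_faces[OF G(1) partial_coneD(1)[OF y]] and card = card_insert_1[OF G(1), unfolded G(2)]
    show ?thesis
      using partial_cone_in[OF y facet] lface_partial_cone[OF y facet] card
      unfolding horn_face_def True spine_Diff_0[OF G(1)] by simp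
  next
    case False
    then have "b \<in> G" using b by simp
    then have H: "G - {b} \<subseteq> {2..N}" "card (G - {b}) = r" using G by auto
    then show ?thesis
      using admissibleD(1)[OF c H] False unfolding parallel_spine_filler_iff[OF y H] spine_Diff[OF G(1) \<open>b \<in> G\<close>]
      by (simp add: horn_face_def)
  qed
  then show "horn_face y c G b \<in> K (Suc r)"
    "v \<in> spine G - {b} ==> lface (spine G - {b}) v (horn_face y c G b) = y (spine G - {b} - {v})"
    by blast+
qed

lemma horn_filler_exists:
  assumes y: "partial_cone r N y" and c: "admissible r N y c" and G: "G \<subseteq> {2..N}" "card G = Suc r"
  shows "\<exists>t. horn_filler y c G t"
proof -
  note V = finite_spine[OF G(1)] card_spine[OF G(1), unfolded G(2)]
  have old: "b \<in> insert 0 G" if "b \<in> spine G" "b \<noteq> 1" for b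
    using that by (auto simp: spine_def)
  have "\<exists>t\<in>K (card (spine G) - 1). \<forall>b\<in>spine G. b \<noteq> 1 --> lface (spine G) b t = horn_face y c G b"
  proof (rule horn_labelled)
    show "finite (spine G)" "3 \<le> card (spine G)" "1 \<in> spine G" using V by (simp_all add: spine_def)
    show "horn_face y c G b \<in> K (card (spine G) - 2)" if "b \<in> spine G" "b \<noteq> 1" for b
      using horn_face(1)[OF y c G old[OF that]] V(2) by simp
    show "lface (spine G - {b}) v (horn_face y c G b) = lface (spine G - {v}) b (horn_face y c G v)"
      if "b \<in> spine G" "v \<in> spine G" "b \<noteq> 1" "v \<noteq> 1" "b \<noteq> v" for b v
      using horn_face(2)[OF y c G old[OF that(1,3)], of v] horn_face(2)[OF y c G old[OF that(2,4)], of b] that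
      by (simp add: Diff_insert2[symmetric] insert_commute)
  qed
  then obtain t where "t \<in> K (card (spine G) - 1)" "\<And>b. b \<in> spine G ==> b \<noteq> 1 ==> lface (spine G) b t = horn_face y c G b"
    by blast
  then have "horn_filler y c G t" using V(2) G by (auto simp: horn_filler_def spine_def)
  then show ?thesis by blast
qed

lemma horn_filler_facet:
  assumes y: "partial_cone r N y" and c: "admissible r N y c" and G: "G \<subseteq> {2..N}" "card G = Suc r"
    and t: "horn_filler y c G t"
  shows "lface (spine G) 1 t \<in> K (Suc r)"
    "v \<in> insert 0 G ==> lface (insert 0 G) v (lface (spine G) 1 t) = y (insert 0 G - {v})"
proof -
  note V = finite_spine[OF G(1)] card_spine[OF G(1), unfolded G(2)]
  have t_in: "t \<in> K (Suc (Suc r))" using t G(2) by (simp add: horn_filler_def)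
  show "lface (spine G) 1 t \<in> K (Suc r)" using lface_in[of "spine G" 1 t] V t_in by (simp add: mem_spine)
  assume v: "v \<in> insert 0 G"
  have v_spine: "v \<in> spine G" "v \<noteq> 1" "1 \<in> spine G - {v}" using v G(1) by (auto simp: spine_def)
  have "lface (insert 0 G) v (lface (spine G) 1 t) = lface (spine G - {v}) 1 (lface (spine G) v t)"
    using lface_commute[OF V(1) _ v_spine(1), of 1 t] V(2) v_spine t_in by (simp add: mem_spine spine_Diff_1[OF G(1), simplified])
  also have "lface (spine G) v t = horn_face y c G v" using t v by (auto simp: horn_filler_def)
  also have "lface (spine G - {v}) 1 (horn_face y c G v) = y (spine G - {v} - {1})"
    using horn_face(2)[OF y c G v v_spine(3)] .
  also have "spine G - {v} - {1} = insert 0 G - {v}" using spine_Diff_1[OF G(1)] by blast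
  finally show "lface (insert 0 G) v (lface (spine G) 1 t) = y (insert 0 G - {v})" .
qed

definition extend_cone :: "nat => nat => (nat set => 's) => (nat set => 's) => nat set => 's" where
  "extend_cone r N y c B = (if B \<in> cone_faces r N then y B else if B \<in> cone_faces (Suc r) N then
    (if 1 \<in> B then c (B - {0, 1}) else
      class_rep (Suc r) (lface (insert 1 B) 1 (SOME t. horn_filler y c (B - {0}) t))) else undefined)"

lemma extend_cone_old: "B \<in> cone_faces r N ==> extend_cone r N y c B = y B"
  by (simp add: extend_cone_def)

lemma extend_cone_spine:
  assumes "H \<subseteq> {2..N}" "card H = r" "1 \<le> N"
  shows "extend_cone r N y c (spine H) = c H"
proof -
  have "spine H - {0, 1} = H" using assms(1) by (auto simp: spine_def)
  moreover have "1 \<in> spine H" by (simp add: spine_def)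
  ultimately show ?thesis using spine_new_cone_face[OF assms] by (simp add: extend_cone_def)
qed

lemma extend_cone_facet:
  assumes G: "G \<subseteq> {2..N}" "card G = Suc r" and t: "horn_filler y c G t"
  shows "extend_cone r N y c (insert 0 G) = class_rep (Suc r) (lface (spine G) 1 t)"
proof -
  have filler: "horn_filler y c G (SOME t. horn_filler y c G t)" using t by (rule someI)
  have "homotopic (Suc r) (lface (spine G) 1 (SOME t. horn_filler y c G t)) (lface (spine G) 1 t)"
  proof (rule homotopic_lfaceI[OF finite_spine[OF G(1)] card_spine[OF G(1), unfolded G(2)]])
    show "lface (spine G) w (SOME t. horn_filler y c G t) = lface (spine G) w t" if "w \<in> spine G" "w \<noteq> 1" for w
      using filler t that by (auto simp: horn_filler_def spine_def)
  qed (use filler t G(2) in \<open>auto simp: horn_filler_def spine_def\<close>)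
  then have "class_rep (Suc r) (lface (spine G) 1 (SOME t. horn_filler y c G t)) = class_rep (Suc r) (lface (spine G) 1 t)"
    by (rule class_rep_eq) simp
  moreover have "1 \<notin> insert 0 G" "insert 0 G - {0} = G" "insert 1 (insert 0 G) = spine G"
    using G(1) by (auto simp: spine_def)
  ultimately show ?thesis
    unfolding extend_cone_def using insert_0_new_cone_face[OF G] by (simp only: if_True if_False)
qed

lemma extend_cone_horn_face:
  assumes "1 \<le> N" and G: "G \<subseteq> {2..N}" "card G = Suc r" and b: "b \<in> insert 0 G"
  shows "extend_cone r N y c (spine G - {b}) = horn_face y c G b"
proof (cases "b = 0")
  case True
  then show ?thesis
    using extend_cone_old[OF insert_1_in_cone_faces[OF G(1) assms(1)]] by (simp add: spine_Diff_0[OF G(1)] horn_face_def)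
next
  case False
  then have "b \<in> G" "G - {b} \<subseteq> {2..N}" "card (G - {b}) = r" using b G by auto
  then show ?thesis using False extend_cone_spine assms(1) by (simp add: spine_Diff[OF G(1)] horn_face_def)
qed

lemma extend_cone_new:
  assumes y: "partial_cone r N y" and c: "admissible r N y c"
    and B: "B \<in> cone_faces (Suc r) N" "B \<notin> cone_faces r N"
  shows "extend_cone r N y c B \<in> K (Suc r)" "class_rep (Suc r) (extend_cone r N y c B) = extend_cone r N y c B"
    "v \<in> B ==> lface B v (extend_cone r N y c B) = y (B - {v})"
proof -
  have "extend_cone r N y c B \<in> K (Suc r) \<and> class_rep (Suc r) (extend_cone r N y c B) = extend_cone r N y c B \<and>
    (\<forall>v\<in>B. lface B v (extend_cone r N y c B) = y (B - {v}))"
    using B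
  proof (cases rule: new_cone_face_cases)
    case (spine H)
    then show ?thesis
      using admissibleD[OF c spine(1,2)] extend_cone_spine[OF spine(1,2) partial_coneD(1)[OF y]]
      unfolding parallel_spine_filler_iff[OF y spine(1,2)] by simp
  next
    case (facet G)
    obtain t where t: "horn_filler y c G t" using horn_filler_exists[OF y c facet(1,2)] by blast
    define u where "u = lface (spine G) 1 t"
    note u = horn_filler_facet[OF y c facet(1,2) t, folded u_def]
    have par: "parallel (Suc r) u (class_rep (Suc r) u)" using u(1) by (intro parallel_class_rep) auto
    then have "lface B v (class_rep (Suc r) u) = y (B - {v})" if "v \<in> B" for v
      using that u(2)[of v] facet(3) unfolding parallel_lface[OF new_cone_face(3,2)[OF B]] by auto
    moreover have "extend_cone r N y c B = class_rep (Suc r) u"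
      using extend_cone_facet[OF facet(1,2) t] unfolding facet(3) u_def .
    ultimately show ?thesis using par class_rep_idem[OF u(1)] by (simp add: parallel_def)
  qed
  then show "extend_cone r N y c B \<in> K (Suc r)" "class_rep (Suc r) (extend_cone r N y c B) = extend_cone r N y c B"
    "v \<in> B ==> lface B v (extend_cone r N y c B) = y (B - {v})"
    by blast+
qed

lemma fillable_extend_cone:
  assumes y: "partial_cone r N y" and c: "admissible r N y c" and G: "G \<subseteq> {2..N}" "card G = Suc r"
  shows "fillable (extend_cone r N y c) (spine G)"
proof -
  obtain t where t: "horn_filler y c G t" using horn_filler_exists[OF y c G] by blast
  note V = finite_spine[OF G(1)] card_spine[OF G(1), unfolded G(2)]
  have t_in: "t \<in> K (Suc (Suc r))" using t G(2) by (simp add: horn_filler_def)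
  have "1 \<in> spine G" "1 \<le> Suc r" "homotopic (Suc r) (lface (spine G) 1 t) (class_rep (Suc r) (lface (spine G) 1 t))"
    using horn_filler_facet(1)[OF y c G t] by (auto simp: mem_spine intro: homotopic_class_rep)
  from homotopic_replace_lface[OF V this t_in refl] obtain t' where t': "t' \<in> K (Suc (Suc r))" "lface (spine G) 1 t' = class_rep (Suc r) (lface (spine G) 1 t)"
    "\<And>w. w \<in> spine G ==> w \<noteq> 1 ==> lface (spine G) w t' = lface (spine G) w t"
    by blast
  have "lface (spine G) v t' = extend_cone r N y c (spine G - {v})" if v: "v \<in> spine G" for v
  proof (cases "v = 1")
    case True
    then show ?thesis using t'(2) extend_cone_facet[OF G t] spine_Diff_1[OF G(1)] by simp
  next
    case False
    then have "v \<in> insert 0 G" using v by (auto simp: spine_def)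
    then show ?thesis
      using t'(3)[OF v False] t extend_cone_horn_face[OF partial_coneD(1)[OF y] G] by (auto simp: horn_filler_def)
  qed
  then show ?thesis unfolding fillable_def using t'(1) V(2) by auto
qed

lemma coherent_extend_cone:
  assumes y: "partial_cone r N y" and c: "admissible r N y c"
  shows "coherent (cone_faces (Suc r) N) (extend_cone r N y c)"
  unfolding coherent_def
proof (intro ballI conjI impI)
  let ?y = "extend_cone r N y c"
  fix B assume B: "B \<in> cone_faces (Suc r) N"
  show "finite B" "B \<noteq> {}" using B finite_cone_face[OF B] by (simp_all add: cone_faces_def)
  show "?y B \<in> K (card B - 1)"
    using partial_cone_in[OF y, of B] extend_cone_new(1)[OF y c B] new_cone_face[OF B]
    by (cases "B \<in> cone_faces r N") (auto simp: extend_cone_old)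
  fix v assume v: "2 \<le> card B" "v \<in> B"
  show "B - {v} \<in> cone_faces (Suc r) N"
    using cone_face_Diff[OF B v(1)] .
  show "lface B v (?y B) = ?y (B - {v})"
  proof (cases "B \<in> cone_faces r N")
    case True
    then show ?thesis
      using lface_partial_cone[OF y True v] cone_face_Diff[OF True v(1)] by (simp add: extend_cone_old)
  next
    case False
    then show ?thesis
      using extend_cone_new(3)[OF y c B False v(2)] cone_face_new_Diff[OF B False v(2)] by (simp add: extend_cone_old)
  qed
qed

lemma partial_cone_extend_cone:
  assumes y: "partial_cone r N y" and c: "admissible r N y c"
  shows "partial_cone (Suc r) N (extend_cone r N y c)"
  unfolding partial_cone_def
proof (intro conjI allI impI)
  let ?y = "extend_cone r N y c"
  show N: "1 \<le> N"
    using partial_coneD(1)[OF y] .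
  show "coherent (cone_faces (Suc r) N) ?y"
    using coherent_extend_cone[OF assms] .
  show "?y B = undefined" if "B \<notin> cone_faces (Suc r) N" for B
    using that cone_faces_mono[of r "Suc r" N] by (auto simp: extend_cone_def)
  have "{1} \<in> cone_faces r N" "{0} \<in> cone_faces r N" using N by (auto simp: cone_faces_def)
  then show "base (?y {1}) = ?y {0}" using partial_coneD(4)[OF y] by (simp add: extend_cone_old)
  show "fillable ?y (spine G)" if G: "G \<subseteq> {2..N}" "card G \<le> Suc r" for G
  proof (cases "card G \<le> r")
    case True
    then show ?thesis
      using spine_Diff_in_cone_faces[OF G(1) True N]
      by (intro fillable_cong[OF partial_coneD(5)[OF y G(1) True]] extend_cone_old)
  next
    case False
    then show ?thesis using G by (intro fillable_extend_cone[OF y c]) auto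
  qed
qed

lemma horn_fillerI:
  assumes y': "partial_cone (Suc r) N y'" and agree: "\<And>B. B \<in> cone_faces r N ==> y' B = y B"
    and c: "\<And>H. H \<subseteq> {2..N} ==> card H = r ==> c H = y' (spine H)" and G: "G \<subseteq> {2..N}" "card G = Suc r"
  obtains t where "horn_filler y c G t" "lface (spine G) 1 t = y' (insert 0 G)"
proof -
  note N = partial_coneD(1)[OF y']
  have "fillable y' (spine G)" using partial_coneD(5)[OF y' G(1)] G(2) by simp
  then obtain t where t: "t \<in> K (Suc (card G))" "\<And>v. v \<in> spine G ==> lface (spine G) v t = y' (spine G - {v})"
    unfolding fillable_def using card_spine[OF G(1)] by auto
  have "y' (spine G - {b}) = horn_face y c G b" if "b \<in> insert 0 G" for b
  proof (cases "b = 0")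
    case True
    then show ?thesis
      using agree[OF insert_1_in_cone_faces[OF G(1) N]] by (simp add: spine_Diff_0[OF G(1)] horn_face_def)
  next
    case False
    then have "b \<in> G" "G - {b} \<subseteq> {2..N}" "card (G - {b}) = r" using that G by auto
    then show ?thesis using False c by (simp add: spine_Diff[OF G(1)] horn_face_def)
  qed
  then have "horn_filler y c G t" using t by (auto simp: horn_filler_def mem_spine)
  then show thesis using that t(2)[of 1] spine_Diff_1[OF G(1)] by (simp add: mem_spine)
qed

lemma extend_cone_unique:
  assumes y: "partial_cone r N y" and y': "partial_cone (Suc r) N y'"
    and agree: "\<And>B. B \<in> cone_faces r N ==> y' B = y B"
    and rep: "\<And>B. B \<in> cone_faces (Suc r) N ==> B \<notin> cone_faces r N ==> class_rep (Suc r) (y' B) = y' B"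
    and c: "\<And>H. H \<subseteq> {2..N} ==> card H = r ==> c H = y' (spine H)"
  shows "extend_cone r N y c = y'"
proof
  fix B
  consider "B \<in> cone_faces r N" | "B \<in> cone_faces (Suc r) N" "B \<notin> cone_faces r N" | "B \<notin> cone_faces (Suc r) N"
    by blast
  then show "extend_cone r N y c B = y' B"
  proof cases
    case 2
    then show ?thesis
    proof (cases rule: new_cone_face_cases)
      case (spine H)
      then show ?thesis
        using extend_cone_spine[OF spine(1,2) partial_coneD(1)[OF y], of y c] c[OF spine(1,2)] by simp
    next
      case (facet G)
      obtain t where "horn_filler y c G t" "lface (spine G) 1 t = y' (insert 0 G)"
        using horn_fillerI[OF y' agree c facet(1,2)] by blast
      then show ?thesis using extend_cone_facet[OF facet(1,2)] rep[OF 2] facet(3) by simp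
    qed
  next
    case 3
    then show ?thesis
      using cone_faces_mono[of r "Suc r" N] partial_coneD(3)[OF y' 3] by (auto simp: extend_cone_def)
  qed (simp add: agree extend_cone_old)
qed

subsection \<open>Faces of partial cones\<close>

definition pull :: "nat => (nat set => 's) => nat set => 's" where
  "pull v y B = y (skip v ` B)"

lemma fillable_facet:
  assumes y: "partial_cone r N y" and G: "G \<subseteq> {2..N}" "G \<noteq> {}" "card G \<le> Suc r"
  shows "fillable y (insert 0 G)"
proof -
  note V = finite_spine[OF G(1)] card_spine[OF G(1)] and N = partial_coneD(1)[OF y]
  have cG: "1 \<le> card G" using G finite_subset[OF G(1)] by (simp add: Suc_le_eq card_gt_0_iff)
  have "fillable y (spine G - {1})"
  proof (rule fillable_last_facet)
    show "finite (spine G)" "3 \<le> card (spine G)" "1 \<in> spine G" using V cG by (auto simp: mem_spine)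
    have "spine G \<subseteq> {..N}" using G(1) N by (auto simp: spine_def)
    then have "skeleton (spine G) \<subseteq> cone_faces r N"
      using V(2) G(3) by (auto simp: skeleton_def cone_faces_def)
    then show "coherent (skeleton (spine G)) y"
      using coherent_subset[OF partial_coneD(2)[OF y]] skeleton_down by blast
    show "fillable y (spine G - {b})" if b: "b \<in> spine G" "b \<noteq> 1" for b
    proof (cases "b = 0")
      case True
      then show ?thesis
        using fillable_coherent[OF partial_coneD(2)[OF y] insert_1_in_cone_faces[OF G(1) N]] cG
        by (simp add: spine_Diff_0[OF G(1)] card_insert_1[OF G(1), simplified])
    next
      case False
      then have "b \<in> G" using b by (simp add: mem_spine)
      moreover have "G - {b} \<subseteq> {2..N}" "card (G - {b}) \<le> r" using G \<open>b \<in> G\<close> by auto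
      ultimately show ?thesis using partial_coneD(5)[OF y] by (simp add: spine_Diff[OF G(1)])
    qed
  qed
  then show ?thesis by (simp only: spine_Diff_1[OF G(1)])
qed

lemma partial_cone_pull:
  assumes y: "partial_cone r (Suc N) y" and N: "1 \<le> N" and v: "1 \<le> v" "v \<le> Suc N"
  shows "partial_cone r N (pull v y)"
  unfolding partial_cone_def
proof (intro conjI allI impI)
  show "coherent (cone_faces r N) (pull v y)"
    unfolding pull_def[abs_def] by (rule coherent_image[OF strict_mono_skip partial_coneD(2)[OF y]])
      (auto simp: skip_image_in_cone_faces[OF v] cone_face_Diff)
  show "pull v y B = undefined" if "B \<notin> cone_faces r N" for B
    using that skip_image_in_cone_faces[OF v] partial_coneD(3)[OF y] by (simp add: pull_def)
  have "skip v 1 \<in> {1..Suc N}" "skip v 0 = 0" using N v by (auto simp: skip_def)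
  then show "base (pull v y {1}) = pull v y {0}"
    using base_partial_cone[OF y, of "skip v 1"] by (simp add: pull_def)
  fix G assume G: "G \<subseteq> {2..N}" "card G \<le> r"
  note skip = skip_image_spine[OF G(1)]
  have "fillable y (skip v ` spine G)"
  proof (cases "v = 1")
    case True
    have "insert 2 (skip 1 ` G) \<subseteq> {2..Suc N}" "card (insert 2 (skip 1 ` G)) \<le> Suc r"
      using skip(4) skip(5)[of 1] N G(2) card_insert_le_m1[of "Suc r" "skip 1 ` G" 2] by fastforce+
    then show ?thesis unfolding True skip(3) by (intro fillable_facet[OF y]) auto
  next
    case False
    then show ?thesis using skip(1,2,5)[of v] G(2) v(1) by (simp add: partial_coneD(5)[OF y])
  qed
  then show "fillable (pull v y) (spine G)"
    unfolding pull_def[abs_def] by (rule fillable_image[OF strict_mono_skip])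
qed (rule N)

lemma pull_extend_cone:
  assumes y: "partial_cone r (Suc N) y" and N: "1 \<le> N" and v: "1 \<le> v" "v \<le> Suc N"
    and c: "admissible r (Suc N) y c"
    and c': "\<And>H. H \<subseteq> {2..N} ==> card H = r ==> c' H = extend_cone r (Suc N) y c (skip v ` spine H)"
  shows "extend_cone r N (pull v y) c' = pull v (extend_cone r (Suc N) y c)"
proof (rule extend_cone_unique[OF partial_cone_pull[OF y N v]])
  show "partial_cone (Suc r) N (pull v (extend_cone r (Suc N) y c))"
    using partial_cone_extend_cone[OF y c] N v by (intro partial_cone_pull)
  show "pull v (extend_cone r (Suc N) y c) B = pull v y B" if "B \<in> cone_faces r N" for B
    using that skip_image_in_cone_faces[OF v] by (simp add: pull_def extend_cone_old)
  show "class_rep (Suc r) (pull v (extend_cone r (Suc N) y c) B) = pull v (extend_cone r (Suc N) y c) B"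
    if "B \<in> cone_faces (Suc r) N" "B \<notin> cone_faces r N" for B
    using extend_cone_new(2)[OF y c, of "skip v ` B"] that skip_image_in_cone_faces[OF v] by (simp add: pull_def)
qed (simp add: c' pull_def)

lemma parallel_pull_iff:
  assumes y: "partial_cone r (Suc N) y" and N: "1 \<le> N" and v: "1 \<le> v" "v \<le> Suc N"
    and H: "H \<subseteq> {2..N}" "card H = r"
  shows "parallel (Suc r) t (spine_filler r (pull v y) H) \<longleftrightarrow> t \<in> K (Suc r) \<and>
    (\<forall>b\<in>skip v ` spine H. lface (skip v ` spine H) b t = y (skip v ` spine H - {b}))"
  unfolding parallel_spine_filler_iff[OF partial_cone_pull[OF y N v] H]
  by (simp add: pull_def lface_image[OF strict_mono_skip] image_Diff_singleton[OF inj_skip])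

subsection \<open>Random extensions\<close>

definition cone_coords :: "nat => nat => nat set list" where
  "cone_coords r N = k_subsets r [2..<Suc N]"

lemma set_cone_coords: "set (cone_coords r N) = {H. H \<subseteq> {2..N} \<and> card H = r}"
  by (simp add: cone_coords_def set_k_subsets atLeastLessThanSuc_atLeastAtMost del: upt_Suc)

lemma distinct_cone_coords: "distinct (cone_coords r N)"
  by (simp add: cone_coords_def distinct_k_subsets del: upt_Suc)

lemma map_skip_cone_coords:
  assumes "2 \<le> v" "v \<le> Suc N"
  shows "map ((`) (skip v)) (cone_coords r N) = filter (\<lambda>H. v \<notin> H) (cone_coords r (Suc N))"
  unfolding cone_coords_def map_k_subsets[OF inj_skip] filter_k_subsets map_skip_upt[OF assms] ..

lemma cone_coords_Suc:
  assumes "1 \<le> N"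
  obtains xs where "cone_coords r (Suc N) = xs @ map ((`) (skip 1)) (cone_coords r N)"
proof -
  have "[2..<Suc (Suc N)] = 2 # [3..<Suc (Suc N)]"
    using upt_conv_Cons[of 2 "Suc (Suc N)"] assms by (simp del: upt_Suc add: numeral_3_eq_3 numeral_2_eq_2)
  moreover have "map (skip 1) [2..<Suc N] = map Suc [2..<Suc N]"
    by (rule map_cong) (simp_all add: skip_def del: upt_Suc)
  then have "map (skip 1) [2..<Suc N] = [3..<Suc (Suc N)]"
    by (simp add: map_Suc_upt del: upt_Suc add: numeral_3_eq_3 numeral_2_eq_2)
  ultimately show thesis
    using that k_subsets_Cons[of r 2 "[3..<Suc (Suc N)]"] unfolding cone_coords_def map_k_subsets[OF inj_skip] by metis
qed

definition filler_mean :: "nat => (nat set => 's) => nat set => ('s => real) => real" where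
  "filler_mean r y H = mu (Suc r) (spine_filler r y H)"

lemma base_spine_filler:
  assumes y: "partial_cone 0 N y" and x: "parallel 1 x (spine_filler 0 y {})"
  shows "base (d 1 1 x) = d 1 1 x"
proof -
  have "spine {} = {0, 1}" "{0, 1} - {1} = {0 :: nat}" "{0, 1} - {0} = {1 :: nat}" by (auto simp: spine_def)
  then have "d 1 1 (spine_filler 0 y {}) = y {0}" "d 1 0 (spine_filler 0 y {}) = y {1}"
    using spine_filler(2)[OF y, of "{}" 0] spine_filler(2)[OF y, of "{}" 1] lface_doubleton[of 0 1] by simp_all
  then show ?thesis
    using base_const[of "spine_filler 0 y {}"] spine_filler(1)[OF y, of "{}"] partial_coneD(4)[OF y] x
    by (simp add: parallel_def)
qed

lemma mean_filler_mean:
  assumes y: "partial_cone r N y" and H: "H \<in> set (cone_coords r N)"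
  shows "mean (spine_fillers r y H) (filler_mean r y H)"
  unfolding filler_mean_def spine_fillers_def
proof (rule mu_mean)
  have H': "H \<subseteq> {2..N}" "card H = r" using H by (simp_all add: set_cone_coords)
  show filler: "spine_filler r y H \<in> K (Suc r)"
    using spine_filler(1)[OF y H'] .
  assume "Suc r = 1"
  then have "r = 0" "H = {}" using H' finite_subset[OF H'(1)] by auto
  then show "base (d 1 1 (spine_filler r y H)) = d 1 1 (spine_filler r y H)"
    using base_spine_filler y filler parallel_refl by simp
qed simp

lemma admissible_PiE: "c \<in> Pi\<^sub>E (set (cone_coords r N)) (spine_fillers r y) ==> admissible r N y c"
  by (auto simp: admissible_def set_cone_coords PiE_def)

definition extension_mean :: "nat => nat => (nat set => 's) => ((nat set => 's) => real) => real" where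
  "extension_mean r N y f = (if partial_cone r N y
    then prod_mean (cone_coords r N) (filler_mean r y) (\<lambda>c. f (extend_cone r N y c)) else 0)"

definition cone_extensions :: "nat => nat => nat => (nat set => 's) => (nat set => 's) set" where
  "cone_extensions r r' N y = {y'. partial_cone r' N y' \<and> (\<forall>B\<in>cone_faces r N. y' B = y B)}"

lemma mean_coords_mean:
  assumes "partial_cone r N y"
  shows "mean (Pi\<^sub>E (set (cone_coords r N)) (spine_fillers r y)) (prod_mean (cone_coords r N) (filler_mean r y))"
  using mean_filler_mean[OF assms] by (rule mean_prod_mean)

lemma mean_extension_mean:
  assumes y: "partial_cone r N y"
  shows "mean (cone_extensions r (Suc r) N y) (extension_mean r N y)"
proof -
  have "mean (cone_extensions r (Suc r) N y)
      (\<lambda>f. prod_mean (cone_coords r N) (filler_mean r y) (\<lambda>c. f (extend_cone r N y c)))"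
    using mean_coords_mean[OF y] by (rule mean_map)
      (use partial_cone_extend_cone[OF y admissible_PiE] in \<open>simp add: cone_extensions_def extend_cone_old\<close>)
  then show ?thesis using y by (simp add: extension_mean_def[abs_def])
qed

lemma bdd_fun_extension_mean:
  assumes f: "bdd_fun f"
  shows "bdd_fun (\<lambda>y. extension_mean r N y f)"
proof -
  obtain B where B: "0 \<le> B" "\<And>x. \<bar>f x\<bar> \<le> B" using bdd_funE[OF f] by blast
  have "\<bar>extension_mean r N y f\<bar> \<le> B" for y
  proof (cases "partial_cone r N y")
    case True
    then show ?thesis using mean_bound[OF mean_extension_mean f B(2)] by blast
  qed (use B(1) in \<open>simp add: extension_mean_def\<close>)
  then show ?thesis by (rule bdd_funI)
qed

lemma filler_mean_pull_ge2:
  assumes y: "partial_cone r (Suc N) y" and N: "1 \<le> N" and v: "2 \<le> v" "v \<le> Suc N" and H: "H \<in> set (cone_coords r N)"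
  shows "filler_mean r y (skip v ` H) = filler_mean r (pull v y) H"
proof -
  have v_pos: "1 \<le> v" using v by simp
  have H': "H \<subseteq> {2..N}" "card H = r" "skip v ` H \<subseteq> {2..Suc N}" "card (skip v ` H) = r"
    using H skip_image_spine(2,5)[of H N v] v(1) by (simp_all add: set_cone_coords)
  have "parallel (Suc r) (spine_filler r y (skip v ` H)) (spine_filler r (pull v y) H)"
    unfolding parallel_pull_iff[OF y N v_pos v(2) H'(1,2)] skip_image_spine(1)[OF H'(1) v(1)]
    using spine_filler[OF y H'(3,4)] by blast
  then show ?thesis unfolding filler_mean_def by (intro mu_parallel) auto
qed

lemma extension_mean_pull_ge2:
  assumes y: "partial_cone r (Suc N) y" and N: "1 \<le> N" and v: "2 \<le> v" "v \<le> Suc N" and f: "bdd_fun f"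
  shows "extension_mean r (Suc N) y (\<lambda>y'. f (pull v y')) = extension_mean r N (pull v y) f"
proof -
  have v_pos: "1 \<le> v" using v by simp
  let ?gs = "cone_coords r (Suc N)" and ?hs = "cone_coords r N"
  define F where "F c = f (extend_cone r N (pull v y) c)" for c
  have F: "bdd_fun F" unfolding F_def[abs_def] by (rule bdd_fun_compose[OF f])
  have "f (pull v (extend_cone r (Suc N) y c)) = F (\<lambda>H\<in>set ?hs. c (skip v ` H))"
    if c: "c \<in> Pi\<^sub>E (set ?gs) (spine_fillers r y)" for c
  proof -
    have "extend_cone r N (pull v y) (\<lambda>H\<in>set ?hs. c (skip v ` H)) = pull v (extend_cone r (Suc N) y c)"
    proof (rule pull_extend_cone[OF y N v_pos v(2) admissible_PiE[OF c]])
      fix H assume H: "H \<subseteq> {2..N}" "card H = r"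
      then show "(\<lambda>H\<in>set ?hs. c (skip v ` H)) H = extend_cone r (Suc N) y c (skip v ` spine H)"
        using extend_cone_spine[of "skip v ` H" "Suc N" r y c] skip_image_spine(1,2,5)[OF H(1), of v] v(1)
        by (simp add: set_cone_coords)
    qed
    then show ?thesis by (simp add: F_def)
  qed
  then have "prod_mean ?gs (filler_mean r y) (\<lambda>c. f (pull v (extend_cone r (Suc N) y c))) =
      prod_mean ?gs (filler_mean r y) (\<lambda>c. F (\<lambda>H\<in>set ?hs. c (skip v ` H)))"
    by (rule mean_cong[OF mean_coords_mean[OF y] bdd_fun_compose[OF f] bdd_fun_compose[OF F]])
  then have "extension_mean r (Suc N) y (\<lambda>y'. f (pull v y')) =
      prod_mean ?gs (filler_mean r y) (\<lambda>c. F (\<lambda>H\<in>set ?hs. c (skip v ` H)))"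
    using y by (simp add: extension_mean_def)
  also have "... = prod_mean ?hs (\<lambda>H. filler_mean r y (skip v ` H)) F"
    by (rule prod_mean_reindex[OF mean_filler_mean[OF y] F distinct_cone_coords map_skip_cone_coords[OF v]])
  also have "... = prod_mean ?hs (filler_mean r (pull v y)) F"
    using filler_mean_pull_ge2[OF y N v] by (rule prod_mean_cong)
  also have "... = extension_mean r N (pull v y) f"
    using partial_cone_pull[OF y N v_pos v(2)] by (simp add: extension_mean_def F_def[abs_def])
  finally show ?thesis .
qed

lemma lface_spine_2:
  assumes G: "G \<subseteq> {2..N}" "card G = Suc r" "2 \<in> G"
  shows "lface (spine G) 1 t = d (Suc (Suc r)) 1 t" "lface (spine G) 2 t = d (Suc (Suc r)) 2 t"
  using pos_spine[OF G(1)] card_spine[OF G(1)] G(2,3) by (simp_all add: lface_def)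

lemma extend_cone_transport:
  assumes y: "partial_cone r N y" and c: "admissible r N y c" and G: "G \<subseteq> {2..N}" "card G = Suc r" "2 \<in> G"
    and D: "horn_filler y c' G D" and agree: "\<And>b. b \<in> G ==> b \<noteq> 2 ==> c' (G - {b}) = c (G - {b})"
  shows "extend_cone r N y c (insert 0 G) = transport (Suc r) D (c (G - {2}))"
proof -
  obtain t where t: "horn_filler y c G t" using horn_filler_exists[OF y c G(1,2)] by blast
  note V = finite_spine[OF G(1)] card_spine[OF G(1), unfolded G(2)]
  have "0 \<notin> G" using G(1) by auto
  then have faces: "lface (spine G) b t = lface (spine G) b D" if "b \<in> spine G" "b \<noteq> 2" "b \<noteq> 1" for b
    using t D that agree by (auto simp: horn_filler_def horn_face_def mem_spine)
  have t_in: "t \<in> K (Suc (Suc r))" using t G(2) by (simp add: horn_filler_def)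
  have "1 \<in> spine G" "2 \<in> spine G" using G(3) by (auto simp: mem_spine)
  then have "transports (Suc r) (pos (spine G) 2) (pos (spine G) 1) D (lface (spine G) 2 t) (lface (spine G) 1 t)"
    unfolding transports_pos[OF V \<open>2 \<in> spine G\<close> \<open>1 \<in> spine G\<close>] using faces t_in by blast
  moreover have "lface (spine G) 2 t = c (G - {2})" using t G(3) by (simp add: horn_filler_def horn_face_def)
  ultimately have "transports (Suc r) 2 1 D (c (G - {2})) (lface (spine G) 1 t)"
    by (simp only: pos_spine[OF G(1)] pos_spine(2)[OF G(1,3)])
  then show ?thesis using extend_cone_facet[OF G(1,2) t] transport_eq[of "Suc r"] by simp
qed

lemma filler_mean_pull_1:
  assumes y: "partial_cone r (Suc N) y" and N: "1 \<le> N" and c: "admissible r (Suc N) y c"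
    and H: "H \<subseteq> {2..N}" "card H = r" and D: "horn_filler y c (insert 2 (skip 1 ` H)) D" and g: "bdd_fun g"
  shows "filler_mean r (pull 1 y) H g = filler_mean r y (skip 1 ` H) (\<lambda>z. g (transport (Suc r) D z))"
proof -
  define G where "G = insert 2 (skip 1 ` H)"
  have H': "skip 1 ` H \<subseteq> {2..Suc N}" "card (skip 1 ` H) = r" "finite (skip 1 ` H)" "2 \<notin> skip 1 ` H"
    using skip_image_spine(4)[OF H(1)] skip_image_spine(5)[OF H(1), of 1] H(2) finite_subset[OF H(1)] by fastforce+
  have G: "G \<subseteq> {2..Suc N}" "card G = Suc r" "2 \<in> G" "G - {2} = skip 1 ` H"
    using H' N by (auto simp: G_def)
  note D = D[folded G_def]
  have DK: "D \<in> K (Suc (Suc r))" and d2: "d (Suc (Suc r)) 2 D = c (skip 1 ` H)"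
    using D G lface_spine_2(2)[OF G(1-3), of D] by (auto simp: horn_filler_def horn_face_def)
  have p2: "parallel (Suc r) (d (Suc (Suc r)) 2 D) (spine_filler r y (skip 1 ` H))"
    using admissibleD(1)[OF c H'(1,2)] d2 by simp
  have "parallel (Suc r) (lface (spine G) 1 D) (spine_filler r (pull 1 y) H)"
    unfolding parallel_pull_iff[OF y N order_refl le_add1[of 1 N, unfolded plus_1_eq_Suc] H] skip_image_spine(3)[OF H(1)]
    using horn_filler_facet[OF y c G(1,2) D] by (simp add: G_def)
  then have p1: "parallel (Suc r) (d (Suc (Suc r)) 1 D) (spine_filler r (pull 1 y) H)"
    unfolding lface_spine_2(1)[OF G(1-3)] .
  have "mu (Suc r) (d (Suc (Suc r)) 1 D) g = mu (Suc r) (d (Suc (Suc r)) 2 D) (\<lambda>z. g (transport (Suc r) D z))"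
  proof (rule mu_transport[OF _ DK _ g])
    assume "Suc r = 1"
    then have "r = 0" "H = {}" using H finite_subset[OF H(1)] by auto
    then show "base (d 1 1 (d 2 2 D)) = d 1 1 (d 2 2 D)"
      using base_spine_filler[of "Suc N" y] y p2 by (simp add: numeral_2_eq_2)
  qed simp
  then show ?thesis using mu_parallel[OF _ p1] mu_parallel[OF _ p2] by (simp add: filler_mean_def)
qed

definition complete_fillers :: "nat => (nat set => 's) => nat set set => (nat set => 's) => nat set => 's" where
  "complete_fillers r y S c g = (if g \<in> S then c g else class_rep (Suc r) (spine_filler r y g))"

lemma admissible_complete_fillers:
  assumes y: "partial_cone r N y" and c: "\<And>g. g \<in> S ==> c g \<in> spine_fillers r y g"
  shows "admissible r N y (complete_fillers r y S c)"
  unfolding admissible_def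
proof (intro allI impI)
  fix H assume "H \<subseteq> {2..N}" "card H = r"
  then show "complete_fillers r y S c H \<in> spine_fillers r y H"
    using c spine_filler(1)[OF y] class_repsI[OF parallel_refl] by (simp add: complete_fillers_def spine_fillers_def)
qed

lemma insert_2_skip_image:
  assumes H: "H \<subseteq> {2..N}" "card H = r" and N: "1 \<le> N"
  shows "2 \<notin> skip 1 ` H" "insert 2 (skip 1 ` H) \<subseteq> {2..Suc N}" "card (insert 2 (skip 1 ` H)) = Suc r"
    "insert 2 (skip 1 ` H) - {2} = skip 1 ` H" "skip 1 ` spine H = insert 0 (insert 2 (skip 1 ` H))"
proof -
  show notin: "2 \<notin> skip 1 ` H" using skip_image_spine(4)[OF H(1)] by fastforce
  have "finite (skip 1 ` H)" using finite_subset[OF H(1)] by simp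
  then show "insert 2 (skip 1 ` H) \<subseteq> {2..Suc N}" "card (insert 2 (skip 1 ` H)) = Suc r"
    "insert 2 (skip 1 ` H) - {2} = skip 1 ` H" "skip 1 ` spine H = insert 0 (insert 2 (skip 1 ` H))"
    using skip_image_spine(3,4)[OF H(1)] skip_image_spine(5)[OF H(1), of 1] notin N H(2) by auto
qed

lemma facet_transports:
  assumes y: "partial_cone r (Suc N) y" and N: "1 \<le> N"
    and split: "cone_coords r (Suc N) = xs @ map ((`) (skip 1)) (cone_coords r N)"
  obtains T where "\<And>c c'. (\<And>g. g \<in> set xs ==> c g = c' g) ==> T c = T c'"
    "\<And>c H. admissible r (Suc N) y c ==> H \<in> set (cone_coords r N) ==>
      extend_cone r (Suc N) y c (skip 1 ` spine H) = T c H (c (skip 1 ` H))"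
    "\<And>c H g. (\<And>g. g \<in> set xs ==> c g \<in> spine_fillers r y g) ==> H \<in> set (cone_coords r N) ==> bdd_fun g ==>
      filler_mean r (pull 1 y) H g = filler_mean r y (skip 1 ` H) (\<lambda>z. g (T c H z))"
proof -
  let ?complete = "complete_fillers r y (set xs)"
  define D where "D c H = (SOME t. horn_filler y (?complete c) (insert 2 (skip 1 ` H)) t)" for c H
  have coords: "{H. H \<subseteq> {2..Suc N} \<and> card H = r} = set xs \<union> (`) (skip 1) ` set (cone_coords r N)"
    using arg_cong[OF split, of set] by (simp add: set_cone_coords)
  have H: "H \<subseteq> {2..N}" "card H = r" if "H \<in> set (cone_coords r N)" for H
    using that by (simp_all add: set_cone_coords)
  note G = insert_2_skip_image[OF H N]
  have in_xs: "g \<in> set xs" if "g \<subseteq> {2..Suc N}" "card g = r" "2 \<in> g" for g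
    using that coords G(1) by blast
  have D: "horn_filler y (?complete c) (insert 2 (skip 1 ` H)) (D c H)"
    if "\<And>g. g \<in> set xs ==> c g \<in> spine_fillers r y g" "H \<in> set (cone_coords r N)" for c H
    unfolding D_def
    using horn_filler_exists[OF y admissible_complete_fillers[OF y that(1)] G(2,3)[OF that(2,2)]] by (rule someI_ex)
  show thesis
  proof (rule that[of "\<lambda>c H. transport (Suc r) (D c H)"])
    show "(\<lambda>H. transport (Suc r) (D c H)) = (\<lambda>H. transport (Suc r) (D c' H))"
      if "\<And>g. g \<in> set xs ==> c g = c' g" for c c'
    proof -
      have "?complete c = ?complete c'" using that by (auto simp: complete_fillers_def)
      then show ?thesis by (simp add: D_def)
    qed
    show "extend_cone r (Suc N) y c (skip 1 ` spine H) = transport (Suc r) (D c H) (c (skip 1 ` H))"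
      if c: "admissible r (Suc N) y c" and H: "H \<in> set (cone_coords r N)" for c H
    proof -
      let ?G = "insert 2 (skip 1 ` H)"
      have "c g \<in> spine_fillers r y g" if "g \<in> set xs" for g
        using c that coords unfolding admissible_def by blast
      moreover have "?complete c (?G - {b}) = c (?G - {b})" if "b \<in> ?G" "b \<noteq> 2" for b
      proof -
        have "?G - {b} \<subseteq> {2..Suc N}" "2 \<in> ?G - {b}" using G(2)[OF H H] that by blast+
        moreover have "card (?G - {b}) = r"
          using G(3)[OF H H] that(1) by (simp only: card_Diff_singleton diff_Suc_1)
        ultimately show ?thesis using in_xs by (simp only: complete_fillers_def if_True)
      qed
      ultimately show ?thesis
        using extend_cone_transport[OF y c G(2,3)[OF H H] insertI1 D] H G(4,5)[OF H H] by simp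
    qed
    show "filler_mean r (pull 1 y) H g = filler_mean r y (skip 1 ` H) (\<lambda>z. g (transport (Suc r) (D c H) z))"
      if c: "\<And>g. g \<in> set xs ==> c g \<in> spine_fillers r y g" and coord: "H \<in> set (cone_coords r N)" and g: "bdd_fun g"
      for c H g
      using filler_mean_pull_1[OF y N admissible_complete_fillers[OF y c] H[OF coord] D[OF c coord] g] .
  qed
qed

lemma extension_mean_pull_1:
  assumes y: "partial_cone r (Suc N) y" and N: "1 \<le> N" and f: "bdd_fun f"
  shows "extension_mean r (Suc N) y (\<lambda>y'. f (pull 1 y')) = extension_mean r N (pull 1 y) f"
proof -
  have one: "1 \<le> (1::nat)" "1 \<le> Suc N" by simp_all
  let ?gs = "cone_coords r (Suc N)" and ?hs = "cone_coords r N" and ?\<mu> = "filler_mean r y"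
  obtain xs where gs: "?gs = xs @ map ((`) (skip 1)) ?hs" using cone_coords_Suc[OF N] by blast
  obtain T where T_cong: "\<And>c c'. (\<And>g. g \<in> set xs ==> c g = c' g) ==> T c = T c'"
    and T_extend: "\<And>c H. admissible r (Suc N) y c ==> H \<in> set ?hs ==>
      extend_cone r (Suc N) y c (skip 1 ` spine H) = T c H (c (skip 1 ` H))"
    and T_mean: "\<And>c H g. (\<And>g. g \<in> set xs ==> c g \<in> spine_fillers r y g) ==> H \<in> set ?hs ==> bdd_fun g ==>
      filler_mean r (pull 1 y) H g = ?\<mu> (skip 1 ` H) (\<lambda>z. g (T c H z))"
    using facet_transports[OF y N gs] by blast
  define F where "F c = f (extend_cone r N (pull 1 y) c)" for c
  have F: "bdd_fun F" unfolding F_def[abs_def] by (rule bdd_fun_compose[OF f])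
  define coords where "coords c = (\<lambda>H\<in>set ?hs. T c H (c (skip 1 ` H)))" for c
  have "f (pull 1 (extend_cone r (Suc N) y c)) = F (coords c)" if c: "c \<in> Pi\<^sub>E (set ?gs) (spine_fillers r y)" for c
  proof -
    have "extend_cone r N (pull 1 y) (coords c) = pull 1 (extend_cone r (Suc N) y c)"
      using T_extend[OF admissible_PiE[OF c]]
      by (intro pull_extend_cone[OF y N one admissible_PiE[OF c]]) (simp add: coords_def set_cone_coords)
    then show ?thesis by (simp add: F_def)
  qed
  then have "prod_mean ?gs ?\<mu> (\<lambda>c. f (pull 1 (extend_cone r (Suc N) y c))) = prod_mean ?gs ?\<mu> (\<lambda>c. F (coords c))"
    by (rule mean_cong[OF mean_coords_mean[OF y] bdd_fun_compose[OF f] bdd_fun_compose[OF F]])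
  then have "extension_mean r (Suc N) y (\<lambda>y'. f (pull 1 y')) = prod_mean ?gs ?\<mu> (\<lambda>c. F (coords c))"
    using y by (simp add: extension_mean_def)
  also have "... = prod_mean ?hs (filler_mean r (pull 1 y)) F"
    unfolding gs coords_def
    by (rule prod_mean_transport_tail[OF mean_filler_mean[OF y, unfolded gs] mean_filler_mean[OF partial_cone_pull[OF y N one]]
          F distinct_cone_coords[of r "Suc N", unfolded gs] T_cong T_mean])
  also have "... = extension_mean r N (pull 1 y) f"
    using partial_cone_pull[OF y N one] by (simp add: extension_mean_def F_def[abs_def])
  finally show ?thesis .
qed

lemma extension_mean_pull:
  assumes "partial_cone r (Suc N) y" "1 \<le> N" "1 \<le> v" "v \<le> Suc N" "bdd_fun f"
  shows "extension_mean r (Suc N) y (\<lambda>y'. f (pull v y')) = extension_mean r N (pull v y) f"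
proof (cases "v = 1")
  case True
  then show ?thesis using extension_mean_pull_1[OF assms(1,2,5)] by simp
next
  case False
  then show ?thesis using assms by (intro extension_mean_pull_ge2) auto
qed

primrec stage_mean :: "nat => nat => (nat set => 's) => ((nat set => 's) => real) => real" where
  "stage_mean 0 N y f = f y"
| "stage_mean (Suc r) N y f = stage_mean r N y (\<lambda>y'. extension_mean r N y' f)"

lemma mean_stage_mean:
  assumes y: "partial_cone 0 N y"
  shows "mean (cone_extensions 0 r N y) (stage_mean r N y)"
proof (induction r)
  case 0
  have "mean (cone_extensions 0 0 N y) (\<lambda>f. f y)"
    using y by (intro mean_point) (simp add: cone_extensions_def)
  then show ?case
    by (rule mean_if_eq) simp
next
  case (Suc r)
  have "mean (cone_extensions 0 (Suc r) N y) (\<lambda>f. stage_mean r N y (\<lambda>y'. extension_mean r N y' f))"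
  proof (rule mean_bind[OF Suc _ bdd_fun_extension_mean])
    fix y' assume y': "y' \<in> cone_extensions 0 r N y"
    have "mean (cone_extensions 0 (Suc r) N y) (\<lambda>f. extension_mean r N y' (\<lambda>x. f x))"
      using y' cone_faces_mono[of 0 r N] unfolding cone_extensions_def
      by (intro mean_map[OF mean_extension_mean]) (auto simp: cone_extensions_def)
    then show "mean (cone_extensions 0 (Suc r) N y) (extension_mean r N y')" .
  qed
  then show ?case
    by (rule mean_if_eq) simp
qed

lemma stage_mean_pull:
  assumes y: "partial_cone 0 (Suc N) y" "1 \<le> N" and v: "1 \<le> v" "v \<le> Suc N" and f: "bdd_fun f"
  shows "stage_mean r (Suc N) y (\<lambda>y'. f (pull v y')) = stage_mean r N (pull v y) f"
  using f
proof (induction r arbitrary: f)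
  case (Suc r)
  note bounded = bdd_fun_extension_mean[OF Suc.prems, of r N]
  have "stage_mean r (Suc N) y (\<lambda>y'. extension_mean r (Suc N) y' (\<lambda>y'. f (pull v y'))) =
      stage_mean r (Suc N) y (\<lambda>y'. extension_mean r N (pull v y') f)"
    using extension_mean_pull[OF _ y(2) v Suc.prems]
    by (intro mean_cong[OF mean_stage_mean[OF y(1)] bdd_fun_extension_mean[OF bdd_fun_compose[OF Suc.prems]]
          bdd_fun_compose[OF bounded]]) (simp add: cone_extensions_def)
  also have "... = stage_mean r N (pull v y) (\<lambda>y'. extension_mean r N y' f)"
    using Suc.IH[OF bounded] .
  finally show ?case
    by simp
qed simp

lemma extension_mean_complete:
  assumes y: "partial_cone N N y"
  shows "extension_mean N N y f = f y"
proof -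
  have "card H \<noteq> N" if "H \<subseteq> {2..N}" for H
    using card_mono[OF _ that] partial_coneD(1)[OF y] by simp
  then have "set (cone_coords N N) = {}" unfolding set_cone_coords by blast
  then have coords: "cone_coords N N = []" by simp
  have "card B \<le> Suc N" if "B \<subseteq> {..N}" for B
    using card_mono[OF _ that] by simp
  then have "cone_faces (Suc N) N = cone_faces N N" by (auto simp: cone_faces_def le_SucI)
  then have "extend_cone N N y c = y" for c
    using partial_coneD(3)[OF y] by (auto simp: extend_cone_def)
  then show ?thesis using y coords by (simp add: extension_mean_def)
qed

lemma stage_mean_complete:
  assumes y: "partial_cone 0 N y" and f: "bdd_fun f"
  shows "stage_mean (Suc N) N y f = stage_mean N N y f"
  unfolding stage_mean.simps using extension_mean_complete
  by (intro mean_cong[OF mean_stage_mean[OF y] bdd_fun_extension_mean[OF f] f]) (simp add: cone_extensions_def)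

subsection \<open>The mean of all cones over a simplex\<close>

definition base_cone :: "nat => 's => nat set => 's" where
  "base_cone N x B = (if B = {0} then base (subface {1..N} x {1})
    else if B \<subseteq> {1..N} \<and> B \<noteq> {} then subface {1..N} x B else undefined)"

lemma partial_cone_base_cone:
  assumes N: "1 \<le> N" and x: "x \<in> K (N - 1)"
  shows "partial_cone 0 N (base_cone N x)"
  unfolding partial_cone_def
proof (intro conjI allI impI)
  let ?y = "base_cone N x"
  have sub: "coherent (Pow {1..N} - {{}}) (subface {1..N} x)" using x by (intro coherent_subface) auto
  have vertex: "?y {1} = subface {1..N} x {1}" using N by (simp add: base_cone_def)
  then have "?y {1} \<in> K 0" using coherent_Pow_in[OF sub, of "{1}"] N by simp
  then obtain e where e: "e \<in> K 1" "d 1 1 e = ?y {0}" "d 1 0 e = ?y {1}"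
    using base_edge vertex by (auto simp: base_cone_def)
  have "coherent {{0}} ?y" using face_in[of e 0 1] e by (auto simp: coherent_def)
  moreover have "coherent (Pow {1..N} - {{}}) ?y" using sub by (rule coherent_cong) (auto simp: base_cone_def)
  ultimately have "coherent ({{0}} \<union> (Pow {1..N} - {{}})) ?y" by (rule coherent_Un)
  moreover have "cone_faces 0 N = {{0}} \<union> (Pow {1..N} - {{}})" using cone_faces_0 by auto
  ultimately show "coherent (cone_faces 0 N) ?y" by simp
  show "?y B = undefined" if "B \<notin> cone_faces 0 N" for B
    using that unfolding cone_faces_0 base_cone_def by auto
  show "base (?y {1}) = ?y {0}" unfolding vertex by (simp add: base_cone_def)
  fix G assume "G \<subseteq> {2..N}" "card G \<le> 0"
  then have "spine G = {0, 1}" using finite_subset[of G "{2..N}"] by (auto simp: spine_def)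
  moreover have "fillable ?y {0, 1}"
  proof -
    have "{0, 1} - {1} = {0 :: nat}" "{0, 1} - {0} = {1 :: nat}" by auto
    then show ?thesis unfolding fillable_def using e lface_doubleton[of 0 1 e] by (intro bexI[of _ e]) auto
  qed
  ultimately show "fillable ?y (spine G)" by simp
qed (rule N)

lemma base_cone_unique:
  assumes y: "partial_cone 0 N y"
  shows "y = base_cone N (y {1..N})"
proof
  fix B
  note N = partial_coneD(1)[OF y]
  have top: "{1..N} \<in> cone_faces 0 N" using N by (intro cone_faces_avoiding_0) auto
  have "y B = subface {1..N} (y {1..N}) B" if "B \<subseteq> {1..N}" "B \<noteq> {}" for B
    using coherent_eq_subface[OF partial_coneD(2)[OF y] top that] .
  moreover from this[of "{1}"] have "y {0} = base (subface {1..N} (y {1..N}) {1})"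
    using partial_coneD(4)[OF y] N by simp
  ultimately show "y B = base_cone N (y {1..N}) B"
    using partial_coneD(3)[OF y, of B] unfolding cone_faces_0 base_cone_def by auto
qed

definition cone_mean :: "nat => 's => ('s => real) => real" where
  "cone_mean n x f = stage_mean (Suc n) (Suc n) (base_cone (Suc n) x) (\<lambda>y. f (y {..Suc n}))"

lemma base_cone_top: "base_cone (Suc n) x {1..Suc n} = x"
  by (auto simp: base_cone_def)

lemma cone_top: "{..Suc n} \<in> cone_faces (Suc n) (Suc n)"
  by (auto simp: cone_faces_def)

lemma mean_cone_mean:
  assumes x: "x \<in> K n"
  shows "mean {t \<in> K (Suc n). d (Suc n) 0 t = x} (cone_mean n x)"
proof -
  have cone: "partial_cone 0 (Suc n) (base_cone (Suc n) x)" using x by (intro partial_cone_base_cone) auto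
  have "mean {t \<in> K (Suc n). d (Suc n) 0 t = x}
      (\<lambda>f. stage_mean (Suc n) (Suc n) (base_cone (Suc n) x) (\<lambda>y. f (y {..Suc n})))"
  proof (rule mean_map[OF mean_stage_mean[OF cone]])
    fix y assume "y \<in> cone_extensions 0 (Suc n) (Suc n) (base_cone (Suc n) x)"
    then have y: "partial_cone (Suc n) (Suc n) y" "\<And>B. B \<in> cone_faces 0 (Suc n) ==> y B = base_cone (Suc n) x B"
      by (auto simp: cone_extensions_def)
    have "{..Suc n} - {0} = {1..Suc n}" by auto
    moreover have "{1..Suc n} \<in> cone_faces 0 (Suc n)" by (rule cone_faces_avoiding_0) auto
    ultimately have "d (Suc n) 0 (y {..Suc n}) = x"
      using lface_partial_cone[OF y(1) cone_top, of 0] y(2) base_cone_top[of n x] by (simp add: lface_atMost)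
    then show "y {..Suc n} \<in> {t \<in> K (Suc n). d (Suc n) 0 t = x}"
      using partial_cone_in[OF y(1) cone_top] by simp
  qed
  then show ?thesis by (simp add: cone_mean_def[abs_def])
qed

lemma lface_atLeastAtMost_1:
  assumes "1 \<le> v" "v \<le> Suc N"
  shows "lface {1..Suc N} v t = d N (v - 1) t"
proof -
  have "{b \<in> {1..Suc N}. b < v} = {1..<v}" using assms by auto
  then show ?thesis by (simp add: lface_def pos_def)
qed

lemma pull_base_cone:
  assumes x: "x \<in> K (Suc n)" and j: "j \<le> Suc n"
  shows "pull (Suc j) (base_cone (Suc (Suc n)) x) = base_cone (Suc n) (d (Suc n) j x)"
proof -
  let ?y = "base_cone (Suc (Suc n)) x"
  have y: "partial_cone 0 (Suc (Suc n)) ?y" using x by (intro partial_cone_base_cone) auto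
  have v: "1 \<le> Suc j" "Suc j \<le> Suc (Suc n)" using j by auto
  have "{1..Suc (Suc n)} \<in> cone_faces 0 (Suc (Suc n))" by (rule cone_faces_avoiding_0) auto
  then have "lface {1..Suc (Suc n)} (Suc j) (?y {1..Suc (Suc n)}) = ?y ({1..Suc (Suc n)} - {Suc j})"
    using v by (intro lface_partial_cone[OF y]) auto
  then have "pull (Suc j) ?y {1..Suc n} = d (Suc n) j x"
    unfolding base_cone_top lface_atLeastAtMost_1[OF v] pull_def skip_image_atLeastAtMost[OF v] by simp
  then show ?thesis using base_cone_unique[OF partial_cone_pull[OF y _ v]] by simp
qed

lemma cone_mean_face:
  assumes x: "x \<in> K (Suc n)" and j: "j \<le> Suc n" and f: "bdd_fun f"
  shows "cone_mean (Suc n) x (\<lambda>t. f (d (Suc (Suc n)) (Suc j) t)) = cone_mean n (d (Suc n) j x) f"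
proof -
  let ?y = "base_cone (Suc (Suc n)) x"
  have y: "partial_cone 0 (Suc (Suc n)) ?y" using x by (intro partial_cone_base_cone) auto
  have v: "1 \<le> Suc j" "Suc j \<le> Suc (Suc n)" and N: "1 \<le> Suc n" using j by auto
  define g where "g y' = f (y' {..Suc n})" for y' :: "nat set => 's"
  have g: "bdd_fun g" unfolding g_def[abs_def] by (rule bdd_fun_compose[OF f])
  have "f (d (Suc (Suc n)) (Suc j) (y' {..Suc (Suc n)})) = g (pull (Suc j) y')"
    if "y' \<in> cone_extensions 0 (Suc (Suc n)) (Suc (Suc n)) ?y" for y'
    using lface_partial_cone[OF _ cone_top, of "Suc n" y' "Suc j"] that v
    unfolding g_def pull_def skip_image_atMost[OF v] by (simp add: cone_extensions_def lface_atMost)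
  then have "cone_mean (Suc n) x (\<lambda>t. f (d (Suc (Suc n)) (Suc j) t)) =
      stage_mean (Suc (Suc n)) (Suc (Suc n)) ?y (\<lambda>y'. g (pull (Suc j) y'))"
    unfolding cone_mean_def
    by (rule mean_cong[OF mean_stage_mean[OF y] bdd_fun_compose[OF f] bdd_fun_compose[OF g]])
  also have "... = stage_mean (Suc (Suc n)) (Suc n) (pull (Suc j) ?y) g" by (rule stage_mean_pull[OF y N v g])
  also have "... = stage_mean (Suc n) (Suc n) (pull (Suc j) ?y) g"
    by (rule stage_mean_complete[OF partial_cone_pull[OF y N v] g])
  also have "... = cone_mean n (d (Suc n) j x) f"
    unfolding pull_base_cone[OF x j] cone_mean_def g_def[abs_def] ..
  finally show ?thesis .
qed

end

subsection \<open>Means transported from invariant means\<close>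

context kan_complex begin

definition round_trip_mean :: "nat => 's => (('s => real) => real) => bool" where
  "round_trip_mean m x M \<longleftrightarrow> mean (class_reps m x) M \<and>
    (\<forall>h\<in>round_trips m x 1. \<forall>g. bdd_fun g --> M (\<lambda>z. g (h z)) = M g)"

lemma round_trip_mean_exists:
  assumes m: "2 \<le> m" and x: "x \<in> K m"
  obtains M where "round_trip_mean m x M"
proof -
  interpret commuting_maps "class_reps m x" "round_trips m x 1"
    using class_repsI[OF parallel_refl[OF x]] round_trips_closed round_trips_commute_pointwise[OF m]
    by unfold_locales blast+
  show thesis using invariant_mean_exists that unfolding round_trip_mean_def by metis
qed

lemma transport_round_trip:
  assumes m: "1 \<le> m" and K: "D1 \<in> K (Suc m)" "D2 \<in> K (Suc m)" "D \<in> K (Suc m)"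
    and start: "parallel m (d (Suc m) 2 D1) x" "parallel m (d (Suc m) 2 D2) x"
    and path: "parallel m (d (Suc m) 1 D1) (d (Suc m) 2 D)" "parallel m (d (Suc m) 1 D) (d (Suc m) 1 D2)"
  obtains h where "h \<in> round_trips m x 1"
    "\<And>z. z \<in> class_reps m x ==> transport m D2 (h z) = transport m D (transport m D1 z)"
proof -
  obtain D3 where D3: "D3 \<in> K (Suc m)" "parallel m (d (Suc m) 2 D3) (d (Suc m) 2 D1)"
    "parallel m (d (Suc m) 1 D3) (d (Suc m) 1 D)"
    "\<And>z. parallel m z (d (Suc m) 2 D1) ==> transport m D3 z = transport m D (transport m D1 z)"
    using transport_compose[OF m K(1,3) path(1)] by blast
  have data: "round_trip_data m x 1 D3 D2"
    unfolding round_trip_data_def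
    using m D3(1) K(2) start(2) parallel_trans[OF D3(2) start(1)] parallel_trans[OF D3(3) path(2)]
    by (simp add: numeral_2_eq_2)
  obtain h where h: "\<And>z. z \<in> class_reps m x ==> h z \<in> class_reps m x \<and> round_trip m 1 D3 D2 z (h z)"
    using round_trip_function[OF m data] by blast
  show thesis
  proof (rule that[of h])
    show "h \<in> round_trips m x 1" using data h by (auto simp: round_trips_def)
    fix z assume z: "z \<in> class_reps m x"
    obtain u where "transports m 2 1 D3 z u" "transports m 2 1 D2 (h z) u"
      using h[OF z] by (auto simp: round_trip_def numeral_2_eq_2)
    then have "transport m D2 (h z) = transport m D3 z" using transport_eq[OF m] by simp
    also have "... = transport m D (transport m D1 z)"
      using D3(4) parallel_trans[OF class_repsD(1)[OF z m] parallel_sym[OF start(1)]] .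
    finally show "transport m D2 (h z) = transport m D (transport m D1 z)" .
  qed
qed

end

text \<open>The means on fillers are transported from one chosen boundary for each fixed first face; for
  this to be consistent the chosen mean only has to be invariant under round trips of transports.\<close>

locale kan_amenable = kan_complex K d for K :: "nat => 's set" and d :: "nat => nat => 's => 's" +
  fixes base :: "'s => 's"
  assumes base_edge: "x \<in> K 0 ==> \<exists>e\<in>K 1. d 1 1 e = base x \<and> d 1 0 e = x"
    and base_const: "e \<in> K 1 ==> base (d 1 1 e) = base (d 1 0 e)"
    and amenable: "s \<in> K 0 ==> base s = s ==> \<exists>x\<in>K 1. d 1 1 x = s \<and> (\<exists>M. round_trip_mean 1 x M)"
begin

definition based :: "nat => 's => bool" where
  "based m x \<longleftrightarrow> 1 \<le> m \<and> x \<in> K m \<and> (m = 1 --> base (d 1 1 x) = d 1 1 x)"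

definition anchor :: "nat => 's => 's \<times> (('s => real) => real)" where
  "anchor m s = (SOME (x, M). x \<in> K m \<and> d m 1 x = s \<and> round_trip_mean m x M)"

lemma anchor:
  assumes x: "based m x"
  obtains X M where "anchor m (d m 1 x) = (X, M)" "X \<in> K m" "d m 1 X = d m 1 x" "round_trip_mean m X M"
proof -
  have "\<exists>p. case p of (X, M) => X \<in> K m \<and> d m 1 X = d m 1 x \<and> round_trip_mean m X M"
  proof (cases "m = 1")
    case True
    then have "d 1 1 x \<in> K 0" "base (d 1 1 x) = d 1 1 x" using x face_in[of x 0 1] by (auto simp: based_def)
    then show ?thesis using amenable[of "d 1 1 x"] True by auto
  next
    case False
    then have m: "2 \<le> m" and xK: "x \<in> K m" using x by (auto simp: based_def)
    obtain M where "round_trip_mean m x M"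
      using round_trip_mean_exists[OF m xK] .
    then show ?thesis using xK by auto
  qed
  then have "case anchor m (d m 1 x) of (X, M) => X \<in> K m \<and> d m 1 X = d m 1 x \<and> round_trip_mean m X M"
    unfolding anchor_def by (rule someI_ex)
  then show thesis using that by (cases "anchor m (d m 1 x)") auto
qed

definition cylinder :: "nat => 's => 's" where
  "cylinder m x = (SOME D. D \<in> K (Suc m) \<and> parallel m (d (Suc m) 2 D) (fst (anchor m (d m 1 x))) \<and>
    parallel m (d (Suc m) 1 D) x)"

definition mu :: "nat => 's => ('s => real) => real" where
  "mu m x f = snd (anchor m (d m 1 x)) (\<lambda>z. f (transport m (cylinder m x) z))"

lemma cylinder:
  assumes x: "based m x"
  shows "cylinder m x \<in> K (Suc m)" "parallel m (d (Suc m) 2 (cylinder m x)) (fst (anchor m (d m 1 x)))"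
    "parallel m (d (Suc m) 1 (cylinder m x)) x"
proof -
  obtain X M where X: "anchor m (d m 1 x) = (X, M)" "X \<in> K m" "d m 1 X = d m 1 x"
    using anchor[OF x] .
  have m: "1 \<le> m" "x \<in> K m" using x by (auto simp: based_def)
  obtain D where "D \<in> K (Suc m)" "d (Suc m) 2 D = X" "d (Suc m) 1 D = x"
    using join_along_last_faces[OF m(1) X(2) m(2) X(3)] .
  then have "\<exists>D. D \<in> K (Suc m) \<and> parallel m (d (Suc m) 2 D) (fst (anchor m (d m 1 x))) \<and> parallel m (d (Suc m) 1 D) x"
    using parallel_refl[OF X(2)] parallel_refl[OF m(2)] X(1) by (intro exI[of _ D]) simp
  from someI_ex[OF this] show "cylinder m x \<in> K (Suc m)"
    "parallel m (d (Suc m) 2 (cylinder m x)) (fst (anchor m (d m 1 x)))" "parallel m (d (Suc m) 1 (cylinder m x)) x"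
    unfolding cylinder_def by blast+
qed

lemma mean_mu:
  assumes x: "based m x"
  shows "mean (class_reps m x) (mu m x)"
proof -
  obtain X M where X: "anchor m (d m 1 x) = (X, M)" "round_trip_mean m X M"
    using anchor[OF x] .
  have m: "1 \<le> m" using x by (auto simp: based_def)
  note cyl = cylinder[OF x, unfolded X(1) fst_conv]
  have "mean (class_reps m x) (\<lambda>f. M (\<lambda>z. f (transport m (cylinder m x) z)))"
  proof (rule mean_map[of "class_reps m X" M])
    show "mean (class_reps m X) M" using X(2) by (simp add: round_trip_mean_def)
    fix z assume "z \<in> class_reps m X"
    then have "parallel m z (d (Suc m) 2 (cylinder m x))"
      using parallel_trans[OF class_repsD(1)[OF _ m] parallel_sym[OF cyl(2)]] by blast
    then show "transport m (cylinder m x) z \<in> class_reps m x"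
      using transport_in_class_reps[OF m cyl(1)] class_reps_cong[OF cyl(3)] by simp
  qed
  then show ?thesis
    unfolding mu_def[abs_def] X(1) snd_conv .
qed

lemma mu_parallel:
  assumes m: "1 \<le> m" and par: "parallel m x x'"
  shows "mu m x = mu m x'"
proof -
  have last: "d m 1 x = d m 1 x'" using assms by (simp add: parallel_def)
  have "parallel m z x \<longleftrightarrow> parallel m z x'" for z
    using parallel_trans[OF _ par] parallel_trans[OF _ parallel_sym[OF par]] by blast
  then have "cylinder m x = cylinder m x'" unfolding cylinder_def last by simp
  then show ?thesis unfolding mu_def[abs_def] last by simp
qed

lemma mu_transport:
  assumes m: "1 \<le> m" and D: "D \<in> K (Suc m)" and base: "m = 1 ==> base (d 1 1 (d 2 2 D)) = d 1 1 (d 2 2 D)"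
    and f: "bdd_fun f"
  shows "mu m (d (Suc m) 1 D) f = mu m (d (Suc m) 2 D) (\<lambda>z. f (transport m D z))"
proof -
  let ?x = "d (Suc m) 2 D" and ?y = "d (Suc m) 1 D"
  obtain p where p: "m = Suc p" using m by (cases m) auto
  have last: "d m 1 ?x = d m 1 ?y" using face_face[of D p 1 2] D p by simp
  have x: "based m ?x" and y: "based m ?y"
    using base face_in[OF D, of 2] face_in[OF D, of 1] m last by (auto simp: based_def numeral_2_eq_2)
  obtain X M where X: "anchor m (d m 1 ?x) = (X, M)" "round_trip_mean m X M"
    using anchor[OF x] .
  note cyl_x = cylinder[OF x, unfolded X(1) fst_conv] and cyl_y = cylinder[OF y, folded last, unfolded X(1) fst_conv]
  obtain h where h: "h \<in> round_trips m X 1"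
    "\<And>z. z \<in> class_reps m X ==> transport m (cylinder m ?y) (h z) = transport m D (transport m (cylinder m ?x) z)"
    using transport_round_trip[OF m cyl_x(1) cyl_y(1) D cyl_x(2) cyl_y(2) cyl_x(3) parallel_sym[OF cyl_y(3)]]
    by blast
  have "M (\<lambda>z. g (h z)) = M g" if "bdd_fun g" for g
    using X(2) h(1) that unfolding round_trip_mean_def by blast
  from this[OF bdd_fun_compose[OF f, of "transport m (cylinder m ?y)"], symmetric]
  have "M (\<lambda>z. f (transport m (cylinder m ?y) z)) = M (\<lambda>z. f (transport m (cylinder m ?y) (h z)))" .
  also have "... = M (\<lambda>z. f (transport m D (transport m (cylinder m ?x) z)))"
    using X(2) h(2) unfolding round_trip_mean_def
    by (intro mean_cong[of "class_reps m X" M] bdd_fun_compose[OF f] arg_cong[of _ _ f]) blast+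
  finally show ?thesis
    unfolding mu_def last[symmetric] X(1) snd_conv .
qed

sublocale kan_mean K d base mu
proof
  show "mean (class_reps m x) (mu m x)" if "1 \<le> m" "x \<in> K m" "m = 1 ==> base (d 1 1 x) = d 1 1 x" for m x
    using that by (intro mean_mu) (auto simp: based_def)
qed (use base_edge base_const mu_parallel mu_transport in auto)

end

section \<open>Chains of finite norm\<close>

definition l1 :: "('s => real) => bool" where
  "l1 c \<longleftrightarrow> (\<lambda>s. \<bar>c s\<bar>) summable_on UNIV"

definition l1_norm :: "('s => real) => real" where
  "l1_norm c = (\<Sum>\<^sub>\<infinity>s. \<bar>c s\<bar>)"

definition pairing :: "('s => real) => ('s => real) => real" where
  "pairing f c = (\<Sum>\<^sub>\<infinity>s. f s * c s)"

lemma l1_norm_nonneg: "0 \<le> l1_norm c"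
  unfolding l1_norm_def by (rule infsum_nonneg) simp

lemma l1_mono: "l1 c ==> (\<And>s. \<bar>c' s\<bar> \<le> \<bar>c s\<bar>) ==> l1 c'"
  unfolding l1_def by (rule summable_on_comparison_test) auto

lemma l1_summable_on:
  assumes "l1 c"
  shows "(\<lambda>s. \<bar>c s\<bar>) summable_on A" "c summable_on A"
proof -
  show abs: "(\<lambda>s. \<bar>c s\<bar>) summable_on A"
    using assms unfolding l1_def by (rule summable_on_subset_banach) simp
  show "c summable_on A" using abs_summable_summable[of c A] abs by simp
qed

lemma
  assumes c: "l1 c" "l1 c'"
  shows l1_add: "l1 (\<lambda>s. c s + c' s)" and l1_norm_add: "l1_norm (\<lambda>s. c s + c' s) \<le> l1_norm c + l1_norm c'"
proof -
  have sum: "(\<lambda>s. \<bar>c s\<bar> + \<bar>c' s\<bar>) summable_on UNIV"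
    using c unfolding l1_def by (rule summable_on_add)
  show add: "l1 (\<lambda>s. c s + c' s)"
    unfolding l1_def by (rule summable_on_comparison_test[OF sum]) (auto intro: abs_triangle_ineq)
  have "l1_norm (\<lambda>s. c s + c' s) \<le> (\<Sum>\<^sub>\<infinity>s. \<bar>c s\<bar> + \<bar>c' s\<bar>)"
    unfolding l1_norm_def using add sum by (intro infsum_mono) (auto simp: l1_def intro: abs_triangle_ineq)
  also have "... = l1_norm c + l1_norm c'" unfolding l1_norm_def using c by (intro infsum_add) (auto simp: l1_def)
  finally show "l1_norm (\<lambda>s. c s + c' s) \<le> l1_norm c + l1_norm c'" .
qed

lemma l1_scale: "l1 c ==> l1 (\<lambda>s. k * c s)"
  using summable_on_cmult_right[where f = "\<lambda>s. \<bar>c s\<bar>" and A = UNIV and c = "\<bar>k\<bar>"] by (simp add: l1_def abs_mult)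

lemma l1_norm_scale: "l1_norm (\<lambda>s. k * c s) = \<bar>k\<bar> * l1_norm c"
  by (simp add: l1_norm_def abs_mult infsum_cmult_right')

lemma l1_zero [simp]: "l1 (\<lambda>_. 0)" and l1_norm_zero [simp]: "l1_norm (\<lambda>_. 0) = 0"
  by (simp_all add: l1_def l1_norm_def)

lemma l1_diff: "l1 c ==> l1 c' ==> l1 (\<lambda>s. c s - c' s)"
  using l1_add[OF _ l1_scale[of c' "-1"], of c] by simp

lemma l1_norm_diff: "l1 c ==> l1 c' ==> l1_norm (\<lambda>s. c s - c' s) \<le> l1_norm c + l1_norm c'"
  using l1_norm_add[OF _ l1_scale[of c' "-1"], of c] l1_norm_scale[of "-1" c'] by simp

lemma l1_sum: "(\<And>i. i \<in> I ==> l1 (f i)) ==> l1 (\<lambda>s. \<Sum>i\<in>I. f i s)"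
  by (induction I rule: infinite_finite_induct) (auto intro: l1_add)

lemma l1_norm_sum: "(\<And>i. i \<in> I ==> l1 (f i)) ==> l1_norm (\<lambda>s. \<Sum>i\<in>I. f i s) \<le> (\<Sum>i\<in>I. l1_norm (f i))"
proof (induction I rule: infinite_finite_induct)
  case (insert i I)
  then show ?case
    using l1_norm_add[OF _ l1_sum, of "f i" I f] by fastforce
qed auto

lemma l1_finite: "finite {s. c s \<noteq> 0} ==> l1 c"
  unfolding l1_def by (rule finite_nonzero_values_imp_summable_on) simp

lemma abs_le_l1_norm:
  assumes "l1 c"
  shows "\<bar>c s\<bar> \<le> l1_norm c"
proof -
  have "(\<Sum>\<^sub>\<infinity>t\<in>{s}. \<bar>c t\<bar>) \<le> l1_norm c"
    unfolding l1_norm_def using assms l1_summable_on(1)[OF assms, of "{s}"]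
    by (intro infsum_mono_neutral) (auto simp: l1_def)
  then show ?thesis by simp
qed

lemma l1_norm_eq_0: "l1 c ==> l1_norm c = 0 ==> c = (\<lambda>_. 0)"
  using abs_le_l1_norm[of c] by (auto simp: fun_eq_iff)

lemma l1_mult:
  assumes c: "l1 c" and f: "\<And>s. \<bar>f s\<bar> \<le> B"
  shows "l1 (\<lambda>s. f s * c s)" "l1_norm (\<lambda>s. f s * c s) \<le> B * l1_norm c"
proof -
  have B: "0 \<le> B" using f[of undefined] by linarith
  have scaled: "\<bar>f s * c s\<bar> \<le> \<bar>B * c s\<bar>" for s
    using f[of s] B by (simp add: abs_mult mult_right_mono)
  show mult: "l1 (\<lambda>s. f s * c s)" by (rule l1_mono[OF l1_scale[OF c, of B] scaled])
  have "l1_norm (\<lambda>s. f s * c s) \<le> l1_norm (\<lambda>s. B * c s)"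
    unfolding l1_norm_def using mult l1_scale[OF c, of B] scaled by (intro infsum_mono) (auto simp: l1_def)
  then show "l1_norm (\<lambda>s. f s * c s) \<le> B * l1_norm c" using l1_norm_scale[of B c] B by simp
qed

lemma l1_tail:
  assumes c: "l1 c" and e: "0 < e"
  obtains F where "finite F" "l1_norm (\<lambda>s. if s \<in> F then 0 else c s) < e"
proof -
  have "((\<lambda>s. \<bar>c s\<bar>) has_sum l1_norm c) UNIV"
    using c unfolding l1_norm_def l1_def by (rule has_sum_infsum)
  then have "(sum (\<lambda>s. \<bar>c s\<bar>) \<longlongrightarrow> l1_norm c) (finite_subsets_at_top UNIV)"
    by (simp add: has_sum_def)
  from tendstoD[OF this e] obtain F where F: "finite F" "dist (sum (\<lambda>s. \<bar>c s\<bar>) F) (l1_norm c) < e"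
    unfolding eventually_finite_subsets_at_top by blast
  have tail: "l1 (\<lambda>s. if s \<in> F then 0 else c s)" and head: "l1 (\<lambda>s. if s \<in> F then c s else 0)"
    by (rule l1_mono[OF c]; simp)+
  have "l1_norm c = (\<Sum>\<^sub>\<infinity>s. \<bar>if s \<in> F then 0 else c s\<bar> + \<bar>if s \<in> F then c s else 0\<bar>)"
    unfolding l1_norm_def by (intro infsum_cong) auto
  also have "... = l1_norm (\<lambda>s. if s \<in> F then 0 else c s) + l1_norm (\<lambda>s. if s \<in> F then c s else 0)"
    using tail head unfolding l1_norm_def l1_def by (rule infsum_add)
  also have "l1_norm (\<lambda>s. if s \<in> F then c s else 0) = (\<Sum>\<^sub>\<infinity>s\<in>F. \<bar>c s\<bar>)"
    unfolding l1_norm_def by (rule infsum_cong_neutral) auto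
  finally show thesis using that[OF F(1)] F by (simp add: dist_real_def)
qed

subsection \<open>Pairing with bounded functions\<close>

lemma pairing_bound:
  assumes c: "l1 c" and f: "\<And>s. \<bar>f s\<bar> \<le> B"
  shows "\<bar>pairing f c\<bar> \<le> B * l1_norm c"
proof -
  note mult = l1_mult[OF c, of f, OF f]
  have "\<bar>pairing f c\<bar> \<le> l1_norm (\<lambda>s. f s * c s)"
    unfolding pairing_def l1_norm_def using norm_infsum_bound[of "\<lambda>s. f s * c s" UNIV] mult(1) by (simp add: l1_def)
  then show ?thesis using mult(2) by simp
qed

lemma pairing_summable: "l1 c ==> bdd_fun f ==> (\<lambda>s. f s * c s) summable_on A"
  by (elim bdd_funE) (rule l1_summable_on(2)[OF l1_mult(1)])

lemma pairing_add: "l1 c ==> bdd_fun f ==> bdd_fun g ==> pairing (\<lambda>s. f s + g s) c = pairing f c + pairing g c"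
  unfolding pairing_def by (simp add: distrib_right infsum_add pairing_summable)

lemma pairing_add_right: "l1 c ==> l1 c' ==> bdd_fun f ==> pairing f (\<lambda>s. c s + c' s) = pairing f c + pairing f c'"
  unfolding pairing_def by (simp add: distrib_left infsum_add pairing_summable)

lemma pairing_scale: "pairing (\<lambda>s. k * f s) c = k * pairing f c"
  unfolding pairing_def by (simp add: mult.assoc infsum_cmult_right')

lemma pairing_scale_right: "pairing f (\<lambda>s. k * c s) = k * pairing f c"
  unfolding pairing_def by (simp add: mult.left_commute infsum_cmult_right')

lemma pairing_cong: "(\<And>s. c s \<noteq> 0 ==> f s = g s) ==> pairing f c = pairing g c"
  unfolding pairing_def by (intro infsum_cong) auto

lemma pairing_sum:
  assumes "l1 c" "\<And>i. i \<in> I ==> bdd_fun (f i)"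
  shows "pairing (\<lambda>s. \<Sum>i\<in>I. f i s) c = (\<Sum>i\<in>I. pairing (f i) c)"
  using assms(2)
proof (induction I rule: infinite_finite_induct)
  case (insert i I)
  then show ?case
    using pairing_add[OF assms(1), of "f i" "\<lambda>s. \<Sum>i\<in>I. f i s"] bdd_fun_sum[of I f] by simp
qed (simp_all add: pairing_def)

lemma pairing_sum_right:
  assumes "\<And>i. i \<in> I ==> l1 (c i)" "bdd_fun f"
  shows "pairing f (\<lambda>s. \<Sum>i\<in>I. c i s) = (\<Sum>i\<in>I. pairing f (c i))"
  using assms(1)
proof (induction I rule: infinite_finite_induct)
  case (insert i I)
  then show ?case
    using pairing_add_right[OF _ l1_sum assms(2), of "c i" I c] by simp
qed (simp_all add: pairing_def)

definition delta :: "'s => 's => real" where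
  "delta s t = (if t = s then 1 else 0)"

lemma l1_delta: "l1 (delta s)"
  by (rule l1_finite) (rule finite_subset[of _ "{s}"], auto simp: delta_def split: if_splits)

lemma pairing_delta: "pairing f (delta s) = f s"
proof -
  have "pairing f (delta s) = (\<Sum>\<^sub>\<infinity>t\<in>{s}. f t * delta s t)"
    unfolding pairing_def by (rule infsum_cong_neutral) (auto simp: delta_def)
  then show ?thesis by (simp add: delta_def)
qed

lemma l1_norm_delta: "l1_norm (delta s) = 1"
  using pairing_delta[of "\<lambda>_. 1" s] by (simp add: l1_norm_def pairing_def delta_def)

definition pushforward :: "('s => 't) => ('s => real) => 't => real" where
  "pushforward h c t = (\<Sum>\<^sub>\<infinity>s\<in>{s. h s = t}. c s)"

lemma
  assumes "l1 c"
  shows infsum_pushforward: "(\<Sum>\<^sub>\<infinity>t. pushforward h c t) = (\<Sum>\<^sub>\<infinity>s. c s)"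
    and pushforward_summable: "pushforward h c summable_on UNIV"
proof -
  let ?S = "Sigma UNIV (\<lambda>t. {s. h s = t})"
  have bij: "bij_betw snd ?S UNIV" by (rule bij_betw_byWitness[where f' = "\<lambda>s. (h s, s)"]) auto
  have summable: "(\<lambda>(t, s). c s) summable_on ?S"
    using summable_on_reindex_bij_betw[OF bij, of c] l1_summable_on(2)[OF assms] by (simp add: case_prod_unfold)
  show "(\<Sum>\<^sub>\<infinity>t. pushforward h c t) = (\<Sum>\<^sub>\<infinity>s. c s)"
    unfolding pushforward_def
    using infsum_Sigma'_banach[OF summable] infsum_reindex_bij_betw[OF bij, of c] by (simp add: case_prod_unfold)
  show "pushforward h c summable_on UNIV"
    unfolding pushforward_def[abs_def] using summable_on_Sigma_banach[OF summable] by simp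
qed

lemma
  assumes c: "l1 c"
  shows l1_pushforward: "l1 (pushforward h c)" and l1_norm_pushforward: "l1_norm (pushforward h c) \<le> l1_norm c"
proof -
  have abs: "l1 (\<lambda>s. \<bar>c s\<bar>)" using c by (simp add: l1_def)
  have abs_le: "\<bar>pushforward h c t\<bar> \<le> pushforward h (\<lambda>s. \<bar>c s\<bar>) t" for t
    unfolding pushforward_def using norm_infsum_bound[of c "{s. h s = t}"] l1_summable_on(1)[OF c] by simp
  show push: "l1 (pushforward h c)"
    unfolding l1_def by (rule summable_on_comparison_test[OF pushforward_summable[OF abs]]) (use abs_le in auto)
  have "l1_norm (pushforward h c) \<le> (\<Sum>\<^sub>\<infinity>t. pushforward h (\<lambda>s. \<bar>c s\<bar>) t)"
    unfolding l1_norm_def using push abs_le pushforward_summable[OF abs] by (intro infsum_mono) (auto simp: l1_def)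
  then show "l1_norm (pushforward h c) \<le> l1_norm c"
    using infsum_pushforward[OF abs, of h] by (simp add: l1_norm_def)
qed

lemma pairing_pushforward:
  assumes c: "l1 c" and f: "bdd_fun f"
  shows "pairing f (pushforward h c) = pairing (\<lambda>s. f (h s)) c"
proof -
  obtain B where "\<And>s. \<bar>f s\<bar> \<le> B" using bdd_funE[OF f] by blast
  then have mult: "l1 (\<lambda>s. f (h s) * c s)" by (intro l1_mult(1)[OF c])
  have "f t * pushforward h c t = pushforward h (\<lambda>s. f (h s) * c s) t" for t
  proof -
    have "f t * pushforward h c t = (\<Sum>\<^sub>\<infinity>s\<in>{s. h s = t}. f t * c s)"
      unfolding pushforward_def by (simp add: infsum_cmult_right')
    then show ?thesis unfolding pushforward_def by (auto intro: infsum_cong)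
  qed
  then show ?thesis using infsum_pushforward[OF mult, of h] by (simp add: pairing_def)
qed

lemma pushforward_add: "l1 c ==> l1 c' ==> pushforward h (\<lambda>s. c s + c' s) t = pushforward h c t + pushforward h c' t"
  unfolding pushforward_def by (intro infsum_add l1_summable_on)

lemma pushforward_scale: "pushforward h (\<lambda>s. k * c s) t = k * pushforward h c t"
  unfolding pushforward_def by (rule infsum_cmult_right')

lemma pushforward_support:
  assumes "pushforward h c t \<noteq> 0"
  obtains s where "h s = t" "c s \<noteq> 0"
  using assms unfolding pushforward_def by (metis (mono_tags, lifting) infsum_0 mem_Collect_eq)

subsection \<open>The boundary operator\<close>

lemma simplical_face_commute:
  "i < k ==> simplical_face k (simplical_face i x) = simplical_face i (simplical_face (k - 1) x)"
  by (auto simp: simplical_face_def fun_eq_iff)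

lemma simplical_face_in: "k \<le> Suc p ==> x \<in> standard_simplex p ==> simplical_face k x \<in> standard_simplex (Suc p)"
  using simplical_face_in_standard_simplex[of "Suc p" k x] by simp

lemma singular_face_commute:
  assumes "i < k" "k \<le> Suc (Suc p)"
  shows "singular_face (Suc p) i (singular_face (Suc (Suc p)) k s) =
    singular_face (Suc p) (k - 1) (singular_face (Suc (Suc p)) i s)" (is "?L = ?R")
proof
  fix x
  show "?L x = ?R x"
  proof (cases "x \<in> standard_simplex p")
    case True
    have "simplical_face i x \<in> standard_simplex (Suc p)" "simplical_face (k - 1) x \<in> standard_simplex (Suc p)"
      using True assms by (auto intro!: simplical_face_in)
    then show ?thesis using True simplical_face_commute[OF assms(1), of x] by (simp add: singular_face_def)
  qed (simp add: singular_face_def)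
qed

lemma rchain_boundary_Suc:
  "rchain_boundary (Suc p) c = (\<lambda>t. \<Sum>k\<le>Suc p. (-1) ^ k * pushforward (singular_face (Suc p) k) c t)"
  by (simp add: rchain_boundary_def pushforward_def)

lemma boundary_add:
  "l1 c ==> l1 c' ==>
    rchain_boundary (Suc p) (\<lambda>s. c s + c' s) = (\<lambda>t. rchain_boundary (Suc p) c t + rchain_boundary (Suc p) c' t)"
  unfolding rchain_boundary_Suc by (simp add: pushforward_add sum.distrib algebra_simps del: sum.atMost_Suc)

lemma boundary_scale: "rchain_boundary (Suc p) (\<lambda>s. k * c s) = (\<lambda>t. k * rchain_boundary (Suc p) c t)"
  unfolding rchain_boundary_Suc by (simp add: pushforward_scale sum_distrib_left algebra_simps del: sum.atMost_Suc)

lemma boundary_diff: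
  "l1 c ==> l1 c' ==>
    rchain_boundary (Suc p) (\<lambda>s. c s - c' s) = (\<lambda>t. rchain_boundary (Suc p) c t - rchain_boundary (Suc p) c' t)"
  using boundary_add[OF _ l1_scale[of c' "-1"], of c p] boundary_scale[of p "-1" c'] by simp

lemma boundary_zero: "rchain_boundary p (\<lambda>_. 0) = (\<lambda>_. 0)"
  by (simp add: rchain_boundary_def fun_eq_iff)

lemma boundary_sum:
  "(\<And>i. i \<in> I ==> l1 (f i)) ==>
    rchain_boundary (Suc p) (\<lambda>s. \<Sum>i\<in>I. f i s) = (\<lambda>t. \<Sum>i\<in>I. rchain_boundary (Suc p) (f i) t)"
  by (induction I rule: infinite_finite_induct) (auto simp: boundary_zero boundary_add l1_sum)

lemma
  assumes c: "l1 c"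
  shows l1_boundary: "l1 (rchain_boundary (Suc p) c)"
    and l1_norm_boundary: "l1_norm (rchain_boundary (Suc p) c) \<le> real (Suc (Suc p)) * l1_norm c"
proof -
  have face: "l1 (\<lambda>t. (-1) ^ k * pushforward (singular_face (Suc p) k) c t)" for k
    by (intro l1_scale l1_pushforward c)
  then show "l1 (rchain_boundary (Suc p) c)" unfolding rchain_boundary_Suc by (rule l1_sum)
  have "l1_norm (rchain_boundary (Suc p) c) \<le>
      (\<Sum>k\<le>Suc p. l1_norm (\<lambda>t. (-1) ^ k * pushforward (singular_face (Suc p) k) c t))"
    unfolding rchain_boundary_Suc by (rule l1_norm_sum[OF face])
  also have "... \<le> (\<Sum>k\<le>Suc p. l1_norm c)"
    using l1_norm_pushforward[OF c] by (intro sum_mono) (simp add: l1_norm_scale power_abs)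
  finally show "l1_norm (rchain_boundary (Suc p) c) \<le> real (Suc (Suc p)) * l1_norm c" by simp
qed

definition coboundary ::
  "nat => (((nat => real) => 'a) => real) => ((nat => real) => 'a) => real" where
  "coboundary p f s = (\<Sum>k\<le>Suc p. (-1) ^ k * f (singular_face (Suc p) k s))"

lemma bdd_fun_coboundary: "bdd_fun f ==> bdd_fun (coboundary p f)"
  unfolding coboundary_def[abs_def] by (rule bdd_fun_sum, rule bdd_fun_scale, rule bdd_fun_compose[of f])

lemma pairing_boundary:
  assumes c: "l1 c" and f: "bdd_fun f"
  shows "pairing f (rchain_boundary (Suc p) c) = pairing (coboundary p f) c"
proof -
  have "pairing f (rchain_boundary (Suc p) c) =
      (\<Sum>k\<le>Suc p. pairing f (\<lambda>t. (-1) ^ k * pushforward (singular_face (Suc p) k) c t))"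
    unfolding rchain_boundary_Suc by (rule pairing_sum_right[OF l1_scale[OF l1_pushforward[OF c]] f])
  also have "... = (\<Sum>k\<le>Suc p. (-1) ^ k * pairing f (pushforward (singular_face (Suc p) k) c))"
    by (simp only: pairing_scale_right)
  also have "... = (\<Sum>k\<le>Suc p. pairing (\<lambda>s. (-1) ^ k * f (singular_face (Suc p) k s)) c)"
    by (simp only: pairing_pushforward[OF c f] pairing_scale)
  also have "... = pairing (coboundary p f) c"
    unfolding coboundary_def[abs_def]
    by (rule pairing_sum[OF c, symmetric]) (rule bdd_fun_scale, rule bdd_fun_compose[OF f])
  finally show ?thesis .
qed

definition is_cycle :: "nat => 'a rchain => bool" where
  "is_cycle m z \<longleftrightarrow> rchain_boundary m z = (\<lambda>_. 0)"

subsection \<open>Chains supported on a set of simplices\<close>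

definition l1_chains :: "'s set => ('s => real) set" where
  "l1_chains K = {w. l1 w \<and> (\<forall>s. w s \<noteq> 0 --> s \<in> K)}"

lemma l1_chains_l1: "w \<in> l1_chains K ==> l1 w"
  by (simp add: l1_chains_def)

lemma l1_chains_support: "w \<in> l1_chains K ==> w s \<noteq> 0 ==> s \<in> K"
  by (simp add: l1_chains_def)

lemma l1_chains_zero: "(\<lambda>_. 0) \<in> l1_chains K"
  by (simp add: l1_chains_def)

lemma l1_chains_add:
  assumes "w \<in> l1_chains K" "w' \<in> l1_chains K"
  shows "(\<lambda>s. w s + w' s) \<in> l1_chains K"
proof -
  have "s \<in> K" if "w s + w' s \<noteq> 0" for s
    using that assms by (cases "w s = 0") (auto simp: l1_chains_def)
  then show ?thesis using assms by (simp add: l1_chains_def l1_add)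
qed

lemma l1_chains_scale: "w \<in> l1_chains K ==> (\<lambda>s. c * w s) \<in> l1_chains K"
  by (auto simp: l1_chains_def l1_scale)

lemma l1_chains_diff: "w \<in> l1_chains K ==> w' \<in> l1_chains K ==> (\<lambda>s. w s - w' s) \<in> l1_chains K"
  using l1_chains_add[OF _ l1_chains_scale[of w' K "-1"], of w] by simp

lemma l1_chains_sum: "(\<And>i. i \<in> I ==> f i \<in> l1_chains K) ==> (\<lambda>s. \<Sum>i\<in>I. f i s) \<in> l1_chains K"
  by (induction I rule: infinite_finite_induct) (auto intro: l1_chains_add l1_chains_zero)

lemma l1_chains_delta: "s \<in> K ==> delta s \<in> l1_chains K"
  by (auto simp: l1_chains_def l1_delta) (simp add: delta_def split: if_splits)

lemma fun_subspace_l1_chains: "fun_subspace (l1_chains K)"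
  by (simp add: fun_subspace_def l1_chains_zero l1_chains_add l1_chains_scale)

lemma l1_chains_boundary:
  assumes c: "c \<in> l1_chains K'" and face: "\<And>s k. s \<in> K' ==> k \<le> Suc m ==> singular_face (Suc m) k s \<in> K"
  shows "rchain_boundary (Suc m) c \<in> l1_chains K"
proof -
  have "t \<in> K" if "rchain_boundary (Suc m) c t \<noteq> 0" for t
  proof -
    obtain k where k: "k \<le> Suc m" "pushforward (singular_face (Suc m) k) c t \<noteq> 0"
    proof (rule ccontr)
      assume "\<not> thesis"
      then have "rchain_boundary (Suc m) c t = 0"
        unfolding rchain_boundary_Suc using that by (intro sum.neutral) auto
      then show False
        using \<open>rchain_boundary (Suc m) c t \<noteq> 0\<close> by blast
    qed
    obtain s where "singular_face (Suc m) k s = t" "c s \<noteq> 0"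
      using pushforward_support[OF k(2)] .
    then show ?thesis using face k(1) l1_chains_support[OF c] by blast
  qed
  then show ?thesis using l1_boundary[OF l1_chains_l1[OF c]] by (simp add: l1_chains_def)
qed

lemma alternating_double_sum:
  fixes g :: "nat => nat => real"
  assumes g: "\<And>i k. i < k ==> k \<le> Suc n ==> g i k = g (k - 1) i"
  shows "(\<Sum>k\<le>Suc n. (-1) ^ k * (\<Sum>i\<le>n. (-1) ^ i * g i k)) = 0"
proof -
  let ?h = "\<lambda>(k, i). (-1) ^ k * ((-1) ^ i * g i k)"
  let ?A = "{(k, i). i < k \<and> k \<le> Suc n}" and ?B = "{(k, i). k \<le> i \<and> i \<le> n}"
  have fin: "finite ?A" "finite ?B" by (rule finite_subset[of _ "{..Suc n} \<times> {..Suc n}"]; auto)+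
  have "(\<Sum>k\<le>Suc n. (-1) ^ k * (\<Sum>i\<le>n. (-1) ^ i * g i k)) = sum ?h ({..Suc n} \<times> {..n})"
    by (simp add: sum_distrib_left sum.cartesian_product del: sum.atMost_Suc)
  also have "{..Suc n} \<times> {..n} = ?A \<union> ?B" by auto
  also have "sum ?h (?A \<union> ?B) = sum ?h ?A + sum ?h ?B" by (rule sum.union_disjoint[OF fin]) auto
  also have "sum ?h ?A = sum (\<lambda>p. - ?h p) ?B"
  proof (rule sum.reindex_bij_witness[where i = "\<lambda>(k, i). (Suc i, k)" and j = "\<lambda>(k, i). (i, k - 1)"])
    fix a assume "a \<in> ?A"
    then obtain k i where a: "a = (Suc k, i)" "i \<le> k" "k \<le> n" by (cases a; cases "fst a") auto
    then show "- ?h (case a of (k, i) => (i, k - 1)) = ?h a" using g[of i "Suc k"] by simp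
  qed auto
  finally show ?thesis by (simp add: sum_negf)
qed

lemma coboundary_coboundary: "coboundary (Suc p) (coboundary p f) s = 0"
  unfolding coboundary_def by (intro alternating_double_sum) (metis singular_face_commute)

lemma boundary_boundary:
  fixes c :: "'a rchain"
  assumes c: "l1 c"
  shows "is_cycle (Suc p) (rchain_boundary (Suc (Suc p)) c)"
  unfolding is_cycle_def
proof
  fix t :: "(nat => real) => 'a"
  let ?b = "rchain_boundary (Suc p) (rchain_boundary (Suc (Suc p)) c)"
  have bounded: "bdd_fun (delta t)" by (rule bdd_funI[of _ 1]) (simp add: delta_def)
  have "?b t = pairing (delta t) ?b" using pairing_delta[of ?b t] by (simp add: pairing_def mult.commute)
  also have "... = pairing (coboundary (Suc p) (coboundary p (delta t))) c"
    using c by (simp add: pairing_boundary l1_boundary bounded bdd_fun_coboundary)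
  finally show "?b t = 0" by (simp add: coboundary_coboundary pairing_def)
qed

subsection \<open>Functionals on chains\<close>

definition functional_kernel :: "'s set => (('s => real) => real) => 's => real" where
  "functional_kernel K L s = (if s \<in> K then L (delta s) else 0)"

lemma functional_kernel_bound:
  assumes bound: "\<And>w. w \<in> l1_chains K ==> \<bar>L w\<bar> \<le> C * l1_norm w"
  shows "\<bar>functional_kernel K L s\<bar> \<le> \<bar>C\<bar>"
  using bound[OF l1_chains_delta, of s] by (auto simp: functional_kernel_def l1_norm_delta)

lemma functional_finite:
  assumes L: "linear_functional (l1_chains K) L" and F: "finite F" "F \<subseteq> K"
  shows "L (\<lambda>t. \<Sum>s\<in>F. w s * delta s t) = (\<Sum>s\<in>F. w s * functional_kernel K L s)"
  using F
proof (induction F rule: finite_induct)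
  case empty
  then show ?case
    using linear_functionalD(2)[OF L l1_chains_zero, of 0] by simp
next
  case (insert s F)
  have chains: "(\<lambda>t. w s * delta s t) \<in> l1_chains K" "(\<lambda>t. \<Sum>s\<in>F. w s * delta s t) \<in> l1_chains K"
    using insert.prems by (auto intro!: l1_chains_sum l1_chains_scale l1_chains_delta)
  have "L (\<lambda>t. w s * delta s t) = w s * functional_kernel K L s"
    using insert.prems linear_functionalD(2)[OF L l1_chains_delta] by (simp add: functional_kernel_def)
  then show ?case
    using linear_functionalD(1)[OF L chains] insert by simp
qed

lemma functional_eq_pairing:
  assumes L: "linear_functional (l1_chains K) L" and bound: "\<And>w. w \<in> l1_chains K ==> \<bar>L w\<bar> \<le> C * l1_norm w"
    and w: "w \<in> l1_chains K"
  shows "L w = pairing (functional_kernel K L) w"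
proof -
  let ?f = "functional_kernel K L"
  note f_bound = functional_kernel_bound[OF bound]
  have "\<bar>L w - pairing ?f w\<bar> \<le> 0 + e" if e: "0 < e" for e
  proof -
    define q where "q = 2 * \<bar>C\<bar> + 1"
    have q: "0 < q" "2 * \<bar>C\<bar> \<le> q" by (simp_all add: q_def)
    obtain F where F: "finite F" "l1_norm (\<lambda>s. if s \<in> F then 0 else w s) < e / q"
      using l1_tail[OF l1_chains_l1[OF w], of "e / q"] e q(1) by auto
    define tail where "tail s = (if s \<in> F then 0 else w s)" for s
    define head where "head t = (\<Sum>s\<in>F \<inter> K. w s * delta s t)" for t
    have head: "head t = (if t \<in> F then w t else 0)" for t
    proof -
      have "head t = (\<Sum>s\<in>F \<inter> K. if s = t then w t else 0)"
        unfolding head_def by (rule sum.cong) (auto simp: delta_def)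
      then show ?thesis using F(1) l1_chains_support[OF w, of t] by auto
    qed
    have chains: "tail \<in> l1_chains K" "head \<in> l1_chains K"
      using w l1_mono[of w tail] l1_mono[of w head] by (auto simp: l1_chains_def tail_def head split: if_splits)
    have split: "w = (\<lambda>s. tail s + head s)" by (simp add: fun_eq_iff tail_def head)
    have "L head = (\<Sum>s\<in>F \<inter> K. w s * ?f s)"
      unfolding head_def[abs_def] using F(1) by (intro functional_finite[OF L]) auto
    also have "... = (\<Sum>s\<in>F \<inter> K. pairing ?f (\<lambda>t. w s * delta s t))"
      by (simp only: pairing_scale_right pairing_delta)
    also have "... = pairing ?f head"
      unfolding head_def[abs_def] by (intro pairing_sum_right[symmetric] l1_scale l1_delta bdd_funI[OF f_bound])
    finally have "L w - pairing ?f w = L tail - pairing ?f tail"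
      using linear_functionalD(1)[OF L chains] chains[THEN l1_chains_l1] bdd_funI[of ?f, OF f_bound]
      unfolding split by (simp add: pairing_add_right)
    then have "\<bar>L w - pairing ?f w\<bar> \<le> \<bar>L tail\<bar> + \<bar>pairing ?f tail\<bar>" by linarith
    also have "... \<le> C * l1_norm tail + \<bar>C\<bar> * l1_norm tail"
      using bound[OF chains(1)] pairing_bound[OF l1_chains_l1[OF chains(1)] f_bound] by (rule add_mono)
    also have "... \<le> q * l1_norm tail"
      using l1_norm_nonneg[of tail] by (simp add: q_def mult_right_mono flip: distrib_right)
    also have "... \<le> q * (e / q)" using F(2) q(1) unfolding tail_def[abs_def] by (intro mult_left_mono) auto
    finally show ?thesis using q(1) by simp
  qed
  then have "\<bar>L w - pairing ?f w\<bar> \<le> 0" by (rule field_le_epsilon)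
  then show ?thesis by simp
qed

subsection \<open>Filling cycles\<close>

definition filling_cost :: "nat => 'a rchain => 'a rchain => real" where
  "filling_cost m c w = l1_norm c + 4 * l1_norm (\<lambda>s. w s - rchain_boundary (Suc m) c s)"

definition filling_norm :: "nat => ((nat => real) => 'a) set => 'a rchain => real" where
  "filling_norm m K' w = (INF c\<in>l1_chains K'. filling_cost m c w)"

lemma filling_cost_nonneg: "0 \<le> filling_cost m c w"
  by (simp add: filling_cost_def l1_norm_nonneg)

lemma filling_cost_bdd_below: "bdd_below ((\<lambda>c. filling_cost m c w) ` C)"
  using filling_cost_nonneg by (intro bdd_belowI2)

lemma filling_norm_le: "c \<in> l1_chains K' ==> filling_norm m K' w \<le> filling_cost m c w"
  unfolding filling_norm_def by (rule cINF_lower[OF filling_cost_bdd_below])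

lemma filling_cost_add:
  assumes "l1 c" "l1 c'" "l1 w" "l1 w'"
  shows "filling_cost m (\<lambda>s. c s + c' s) (\<lambda>s. w s + w' s) \<le> filling_cost m c w + filling_cost m c' w'"
proof -
  have "(\<lambda>s. w s + w' s - rchain_boundary (Suc m) (\<lambda>s. c s + c' s) s) =
      (\<lambda>s. (w s - rchain_boundary (Suc m) c s) + (w' s - rchain_boundary (Suc m) c' s))"
    using boundary_add[OF assms(1,2)] by (auto simp: fun_eq_iff)
  then show ?thesis
    using l1_norm_add[OF assms(1,2)] l1_norm_add[OF l1_diff[OF assms(3) l1_boundary[OF assms(1)]]
        l1_diff[OF assms(4) l1_boundary[OF assms(2)]], of m m]
    by (simp add: filling_cost_def)
qed

lemma filling_cost_scale: "0 < a ==> filling_cost m (\<lambda>s. a * c s) (\<lambda>s. a * w s) = a * filling_cost m c w"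
  using l1_norm_scale[of a c] l1_norm_scale[of a "\<lambda>s. w s - rchain_boundary (Suc m) c s"]
  by (simp add: filling_cost_def boundary_scale algebra_simps)

lemma sublinear_filling_norm: "sublinear_on (l1_chains K) (filling_norm m K')"
  unfolding filling_norm_def[abs_def]
proof (rule sublinear_INF[OF fun_subspace_l1_chains _ filling_cost_bdd_below])
  show "l1_chains K' \<noteq> {}" using l1_chains_zero by blast
  show "\<exists>b\<in>l1_chains K'. filling_cost m b (\<lambda>s. w s + w' s) \<le> filling_cost m c w + filling_cost m c' w'"
    if "c \<in> l1_chains K'" "c' \<in> l1_chains K'" "w \<in> l1_chains K" "w' \<in> l1_chains K" for c c' w w'
    using that l1_chains_add[of c K' c'] l1_chains_l1 by (blast intro: filling_cost_add)
  show "\<exists>b\<in>l1_chains K'. filling_cost m b (\<lambda>s. a * w s) \<le> a * filling_cost m c w"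
    if "c \<in> l1_chains K'" "0 < a" for c w and a :: real
    using that l1_chains_scale[of c K' a] filling_cost_scale[of a m c w] by (intro bexI[of _ "\<lambda>s. a * c s"]) auto
qed

lemma filling_functional:
  assumes face: "\<And>s k. s \<in> K' ==> k \<le> Suc m ==> singular_face (Suc m) k s \<in> K" and z: "z \<in> l1_chains K"
  obtains f where "bdd_fun f" "\<And>s. s \<in> K' ==> \<bar>coboundary m f s\<bar> \<le> 1" "filling_norm m K' z \<le> pairing f z"
proof -
  let ?D = "rchain_boundary (Suc m) :: 'a rchain => 'a rchain"
  obtain L where L: "linear_functional (l1_chains K) L" "\<And>w. w \<in> l1_chains K ==> L w \<le> filling_norm m K' w"
    "L z = filling_norm m K' z"
    using hahn_banach[OF fun_subspace_l1_chains sublinear_filling_norm z] by blast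
  have abs_L: "\<bar>L w\<bar> \<le> filling_cost m c w" if "w \<in> l1_chains K" "c \<in> l1_chains K'" for w c
  proof -
    have "L (\<lambda>s. -1 * w s) = - L w" using linear_functionalD(2)[OF L(1) that(1), of "-1"] by simp
    moreover have "filling_cost m (\<lambda>s. -1 * c s) (\<lambda>s. -1 * w s) = filling_cost m c w"
      using l1_norm_scale[of "-1" c] l1_norm_scale[of "-1" "\<lambda>s. w s - ?D c s"] boundary_scale[of m "-1" c]
      by (simp add: filling_cost_def)
    ultimately show ?thesis
      using L(2)[OF that(1)] filling_norm_le[OF that(2), of m w] L(2)[OF l1_chains_scale[OF that(1), of "-1"]]
        filling_norm_le[OF l1_chains_scale[OF that(2), of "-1"], of m "\<lambda>s. -1 * w s"] by linarith
  qed
  have bound: "\<bar>L w\<bar> \<le> 4 * l1_norm w" if "w \<in> l1_chains K" for w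
    using abs_L[OF that l1_chains_zero] by (simp add: filling_cost_def boundary_zero)
  define f where "f = functional_kernel K L"
  have f: "bdd_fun f" unfolding f_def by (rule bdd_funI, rule functional_kernel_bound[OF bound])
  have L_f: "L w = pairing f w" if "w \<in> l1_chains K" for w
    unfolding f_def by (rule functional_eq_pairing[OF L(1) bound that])
  have "\<bar>coboundary m f s\<bar> \<le> 1" if s: "s \<in> K'" for s
  proof -
    have chain: "?D (delta s) \<in> l1_chains K" by (rule l1_chains_boundary[OF l1_chains_delta[OF s] face])
    have "coboundary m f s = L (?D (delta s))"
      unfolding L_f[OF chain] pairing_boundary[OF l1_delta f] pairing_delta ..
    then show ?thesis using abs_L[OF chain l1_chains_delta[OF s]] by (simp add: filling_cost_def l1_norm_delta)
  qed
  then show thesis using that[OF f] L(3) L_f[OF z] by simp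
qed

text \<open>Hahn--Banach turns coercivity of the coboundary operator into an approximate solution of the boundary
  equation; iterating halves the error.\<close>

lemma approximate_filling:
  fixes z :: "'a rchain"
  assumes face: "\<And>s k. s \<in> K' ==> k \<le> Suc m ==> singular_face (Suc m) k s \<in> K" and z: "z \<in> l1_chains K"
    and coercive: "\<And>f. bdd_fun f ==> (\<And>s. s \<in> K' ==> \<bar>coboundary m f s\<bar> \<le> 1) ==> \<bar>pairing f z\<bar> \<le> l1_norm z"
  obtains c where "c \<in> l1_chains K'" "l1_norm c \<le> 2 * l1_norm z"
    "l1_norm (\<lambda>s. z s - rchain_boundary (Suc m) c s) \<le> l1_norm z / 2"
proof (cases "l1_norm z = 0")
  case True
  then show thesis using l1_norm_eq_0[OF l1_chains_l1[OF z]] that[OF l1_chains_zero] by (simp add: boundary_zero)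
next
  case False
  obtain f where "bdd_fun f" "\<And>s. s \<in> K' ==> \<bar>coboundary m f s\<bar> \<le> 1" "filling_norm m K' z \<le> pairing f z"
    using filling_functional[OF face z] by blast
  then have "filling_norm m K' z \<le> l1_norm z" using coercive[of f] by fastforce
  then have "filling_norm m K' z < 2 * l1_norm z" using False l1_norm_nonneg[of z] by linarith
  then obtain c where c: "c \<in> l1_chains K'" "filling_cost m c z < 2 * l1_norm z"
    unfolding filling_norm_def using cINF_less_iff[OF _ filling_cost_bdd_below] l1_chains_zero by blast
  then show thesis
    using that[OF c(1)] l1_norm_nonneg[of c] l1_norm_nonneg[of "\<lambda>s. z s - rchain_boundary (Suc m) c s"]
    by (simp add: filling_cost_def)
qed

lemma l1_series:
  assumes c: "\<And>i::nat. l1 (c i)" and norms: "summable (\<lambda>i. l1_norm (c i))"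
  shows "summable (\<lambda>i. c i s)" "l1 (\<lambda>s. suminf (\<lambda>i. c i s))" "l1_norm (\<lambda>s. suminf (\<lambda>i. c i s)) \<le> suminf (\<lambda>i. l1_norm (c i))"
proof -
  have abs: "summable (\<lambda>i. \<bar>c i s\<bar>)" for s
    by (rule summable_comparison_test[OF _ norms]) (use abs_le_l1_norm[OF c] in auto)
  show "summable (\<lambda>i. c i s)"
    using summable_rabs_cancel[OF abs] .
  have finite: "(\<Sum>s\<in>F. \<bar>suminf (\<lambda>i. c i s)\<bar>) \<le> suminf (\<lambda>i. l1_norm (c i))" if "finite F" for F
  proof -
    have "(\<Sum>s\<in>F. \<bar>suminf (\<lambda>i. c i s)\<bar>) \<le> (\<Sum>s\<in>F. suminf (\<lambda>i. \<bar>c i s\<bar>))"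
      by (intro sum_mono summable_rabs abs)
    also have "... = suminf (\<lambda>i. \<Sum>s\<in>F. \<bar>c i s\<bar>)" by (rule suminf_sum[symmetric]) (rule abs)
    also have "... \<le> suminf (\<lambda>i. l1_norm (c i))"
    proof (rule suminf_le[OF _ summable_sum[OF abs] norms])
      show "(\<Sum>s\<in>F. \<bar>c i s\<bar>) \<le> l1_norm (c i)" for i
        unfolding l1_norm_def by (rule finite_sum_le_infsum) (use c that in \<open>auto simp: l1_def\<close>)
    qed
    finally show ?thesis .
  qed
  show series: "l1 (\<lambda>s. suminf (\<lambda>i. c i s))"
    unfolding l1_def by (rule nonneg_bdd_above_summable_on) (use finite in \<open>auto intro!: bdd_aboveI\<close>)
  show "l1_norm (\<lambda>s. suminf (\<lambda>i. c i s)) \<le> suminf (\<lambda>i. l1_norm (c i))"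
    unfolding l1_norm_def[of "\<lambda>s. suminf (\<lambda>i. c i s)"]
    by (rule infsum_le_finite_sums) (use series finite in \<open>auto simp: l1_def\<close>)
qed

lemma boundary_series_tail:
  assumes c: "\<And>i. l1 (c i)" and norms: "summable (\<lambda>i. l1_norm (c i))"
  shows "l1_norm (\<lambda>s. rchain_boundary (Suc p) (\<lambda>s. suminf (\<lambda>i. c i s)) s - rchain_boundary (Suc p) (\<lambda>s. \<Sum>i<N. c i s) s) \<le>
    real (Suc (Suc p)) * suminf (\<lambda>i. l1_norm (c (i + N)))"
proof -
  note tail = l1_series(2,3)[of "\<lambda>i. c (i + N)", OF c summable_ignore_initial_segment[OF norms]]
  have "(\<lambda>s. suminf (\<lambda>i. c i s)) = (\<lambda>s. (\<Sum>i<N. c i s) + suminf (\<lambda>i. c (i + N) s))"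
    using suminf_split_initial_segment[OF l1_series(1)[OF c norms], of _ N] by (simp add: add.commute)
  then have "(\<lambda>s. rchain_boundary (Suc p) (\<lambda>s. suminf (\<lambda>i. c i s)) s - rchain_boundary (Suc p) (\<lambda>s. \<Sum>i<N. c i s) s) =
      rchain_boundary (Suc p) (\<lambda>s. suminf (\<lambda>i. c (i + N) s))"
    using boundary_add[OF l1_sum[where I = "{..<N}", OF c] tail(1)] by simp
  then show ?thesis using order_trans[OF l1_norm_boundary[OF tail(1), of p] mult_left_mono[OF tail(2)]] by simp
qed

lemma boundary_series_eqI:
  assumes c: "\<And>i. l1 (c i)" and norms: "summable (\<lambda>i. l1_norm (c i))" and z: "l1 z"
    and approx: "(\<lambda>N. l1_norm (\<lambda>s. z s - rchain_boundary (Suc p) (\<lambda>s. \<Sum>i<N. c i s) s)) \<longlonglongrightarrow> 0"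
  shows "rchain_boundary (Suc p) (\<lambda>s. suminf (\<lambda>i. c i s)) = z"
proof -
  let ?b = "rchain_boundary (Suc p) (\<lambda>s. suminf (\<lambda>i. c i s))" and ?bN = "\<lambda>N. rchain_boundary (Suc p) (\<lambda>s. \<Sum>i<N. c i s)"
  have b: "l1 ?b" "l1 (?bN N)" for N
    using l1_boundary[OF l1_series(2)[OF c norms]] l1_boundary[OF l1_sum[OF c]] by auto
  have residue_le: "l1_norm (\<lambda>s. z s - ?b s) \<le> l1_norm (\<lambda>s. z s - ?bN N s) + real (Suc (Suc p)) * suminf (\<lambda>i. l1_norm (c (i + N)))" for N
    using l1_norm_diff[OF l1_diff[OF z b(2)] l1_diff[OF b(1) b(2)], of N N] boundary_series_tail[OF c norms, of p N]
    by simp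
  have "(\<lambda>N. suminf (\<lambda>i. l1_norm (c (i + N)))) \<longlonglongrightarrow> 0"
    using suminf_exist_split2[OF norms] .
  then have "(\<lambda>N. l1_norm (\<lambda>s. z s - ?bN N s) + real (Suc (Suc p)) * suminf (\<lambda>i. l1_norm (c (i + N)))) \<longlonglongrightarrow> 0"
    using tendsto_add[OF approx tendsto_mult_right_zero] by fastforce
  then have "l1_norm (\<lambda>s. z s - ?b s) \<le> 0" using residue_le by (intro LIMSEQ_le_const) auto
  then have "(\<lambda>s. z s - ?b s) = (\<lambda>_. 0)"
    using l1_norm_eq_0[OF l1_diff[OF z b(1)]] l1_norm_nonneg[of "\<lambda>s. z s - ?b s"] by simp
  then show ?thesis by (simp add: fun_eq_iff)
qed

lemma halving_fillings_exist:
  assumes halve: "\<And>z. z \<in> Z ==> \<exists>c. c \<in> C \<and> l1_norm c \<le> 2 * l1_norm z \<and>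
      (\<lambda>s. z s - D c s) \<in> Z \<and> l1_norm (\<lambda>s. z s - D c s) \<le> l1_norm z / 2"
    and z: "z \<in> Z"
  obtains c r where "r 0 = z" "\<forall>i. r (Suc i) = (\<lambda>s. r i s - D (c i) s)"
    "\<forall>i. c i \<in> C \<and> l1_norm (c i) \<le> 2 * l1_norm z * (1 / 2) ^ i" "\<forall>i. l1_norm (r i) \<le> l1_norm z * (1 / 2) ^ i"
proof -
  from bchoice[OF ballI[OF halve]] obtain fill where fill: "\<forall>z\<in>Z. fill z \<in> C \<and> l1_norm (fill z) \<le> 2 * l1_norm z \<and>
      (\<lambda>s. z s - D (fill z) s) \<in> Z \<and> l1_norm (\<lambda>s. z s - D (fill z) s) \<le> l1_norm z / 2" ..
  define r where "r i = ((\<lambda>z s. z s - D (fill z) s) ^^ i) z" for i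
  have r: "r i \<in> Z \<and> l1_norm (r i) \<le> l1_norm z * (1 / 2) ^ i" for i
  proof (induction i)
    case (Suc i)
    then show ?case
      using bspec[OF fill, of "r i"] by (simp add: r_def)
  qed (simp add: r_def z)
  show thesis
  proof (rule that[of r "\<lambda>i. fill (r i)"])
    show "\<forall>i. fill (r i) \<in> C \<and> l1_norm (fill (r i)) \<le> 2 * l1_norm z * (1 / 2) ^ i"
    proof
      show "fill (r i) \<in> C \<and> l1_norm (fill (r i)) \<le> 2 * l1_norm z * (1 / 2) ^ i" for i
        using bspec[OF fill, of "r i"] r[of i] by auto
    qed
  qed (use r in \<open>simp_all add: r_def\<close>)
qed

lemma l1_chains_suminf:
  assumes c: "\<And>i. c i \<in> l1_chains K" and norms: "summable (\<lambda>i. l1_norm (c i))"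
  shows "(\<lambda>s. suminf (\<lambda>i. c i s)) \<in> l1_chains K"
proof -
  have "suminf (\<lambda>i. c i s) = 0" if "s \<notin> K" for s
  proof -
    have "c i s = 0" for i
      using l1_chains_support[OF c] that by blast
    then show ?thesis by simp
  qed
  then show ?thesis using l1_series(2)[OF l1_chains_l1[OF c] norms] by (auto simp: l1_chains_def)
qed

lemma l1_acyclic:
  fixes z :: "'a rchain"
  assumes face: "\<And>s k. s \<in> K' ==> k \<le> Suc (Suc p) ==> singular_face (Suc (Suc p)) k s \<in> K"
    and coercive: "\<And>f z. z \<in> l1_chains K ==> is_cycle (Suc p) z ==> bdd_fun f ==>
      (\<And>s. s \<in> K' ==> \<bar>coboundary (Suc p) f s\<bar> \<le> 1) ==> \<bar>pairing f z\<bar> \<le> l1_norm z"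
    and z: "z \<in> l1_chains K" "is_cycle (Suc p) z"
  obtains b where "b \<in> l1_chains K'" "rchain_boundary (Suc (Suc p)) b = z"
proof -
  let ?D = "rchain_boundary (Suc (Suc p)) :: 'a rchain => 'a rchain"
  let ?Z = "{z \<in> l1_chains K. is_cycle (Suc p) z}"
  obtain c r where r: "r 0 = z" "\<forall>i. r (Suc i) = (\<lambda>s. r i s - ?D (c i) s)" "\<forall>i. l1_norm (r i) \<le> l1_norm z * (1 / 2) ^ i"
    and c: "\<forall>i. c i \<in> l1_chains K' \<and> l1_norm (c i) \<le> 2 * l1_norm z * (1 / 2) ^ i"
  proof (rule halving_fillings_exist[of ?Z "l1_chains K'" ?D z])
    fix w assume "w \<in> ?Z"
    then have w: "w \<in> l1_chains K" "is_cycle (Suc p) w" by auto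
    obtain c where c: "c \<in> l1_chains K'" "l1_norm c \<le> 2 * l1_norm w" "l1_norm (\<lambda>s. w s - ?D c s) \<le> l1_norm w / 2"
      using approximate_filling[OF face w(1) coercive[OF w]] by blast
    have D: "?D c \<in> l1_chains K" using c(1) face by (rule l1_chains_boundary)
    have "is_cycle (Suc p) (\<lambda>s. w s - ?D c s)"
      using w(2) boundary_boundary[OF l1_chains_l1[OF c(1)]]
      by (simp add: is_cycle_def boundary_diff[OF l1_chains_l1[OF w(1)] l1_chains_l1[OF D]])
    then show "\<exists>c. c \<in> l1_chains K' \<and> l1_norm c \<le> 2 * l1_norm w \<and>
        (\<lambda>s. w s - ?D c s) \<in> ?Z \<and> l1_norm (\<lambda>s. w s - ?D c s) \<le> l1_norm w / 2"
      using c l1_chains_diff[OF w(1) D] by blast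
  qed (use z in simp, rule that)
  have c_l1: "l1 (c i)" for i
    using c l1_chains_l1 by blast
  have "summable (\<lambda>i. 2 * l1_norm z * (1 / 2) ^ i)" by (intro summable_mult summable_geometric) simp
  then have norms: "summable (\<lambda>i. l1_norm (c i))"
  proof (rule summable_comparison_test')
    show "norm (l1_norm (c i)) \<le> 2 * l1_norm z * (1 / 2) ^ i" for i
      using c l1_norm_nonneg[of "c i"] by simp
  qed
  have "r N = (\<lambda>s. z s - ?D (\<lambda>t. \<Sum>i<N. c i t) s)" for N
  proof (induction N)
    case (Suc N)
    then show ?case
      using r(2) boundary_add[OF l1_sum c_l1, of "{..<N}" c "Suc p" N, OF c_l1] by (simp add: fun_eq_iff)
  qed (simp add: r(1) boundary_zero)
  moreover have "(\<lambda>N. l1_norm (r N)) \<longlonglongrightarrow> 0"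
  proof (rule Lim_null_comparison)
    show "(\<lambda>N. l1_norm z * (1 / 2) ^ N) \<longlonglongrightarrow> 0"
      by (intro tendsto_mult_right_zero LIMSEQ_realpow_zero) auto
  qed (use r(3) in \<open>simp add: l1_norm_nonneg\<close>)
  ultimately have "?D (\<lambda>s. suminf (\<lambda>i. c i s)) = z"
    by (intro boundary_series_eqI[OF c_l1 norms l1_chains_l1[OF z(1)]]) simp
  then show thesis using that l1_chains_suminf[OF _ norms] c by blast
qed

subsection \<open>Averaging over cones makes complexes acyclic\<close>

locale singular_kan_mean = kan_mean K singular_face base mu
  for K :: "nat => ((nat => real) => 'a) set" and base mu
begin

lemma cone_mean_bound:
  assumes x: "x \<in> K n" and f: "bdd_fun f" "\<And>t. t \<in> K (Suc n) ==> \<bar>f t\<bar> \<le> B"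
  shows "\<bar>cone_mean n x f\<bar> \<le> B"
  by (rule mean_bound[OF mean_cone_mean[OF x] f(1)]) (use f(2) in auto)

lemma cone_mean_coboundary:
  assumes x: "x \<in> K (Suc p)" and f: "bdd_fun f"
  shows "cone_mean (Suc p) x (coboundary (Suc p) f) =
    f x - (\<Sum>j\<le>Suc p. (-1) ^ j * cone_mean p (singular_face (Suc p) j x) f)"
proof -
  let ?g = "\<lambda>k t. f (singular_face (Suc (Suc p)) k t)"
  have g: "bdd_fun (?g k)" for k
    by (rule bdd_fun_compose[OF f])
  note mean = mean_cone_mean[OF x]
  have "cone_mean (Suc p) x (coboundary (Suc p) f) = (\<Sum>k\<le>Suc (Suc p). cone_mean (Suc p) x (\<lambda>t. (-1) ^ k * ?g k t))"
    unfolding coboundary_def[abs_def] by (rule mean_sum[OF mean]) (intro bdd_fun_scale g)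
  also have "... = (\<Sum>k\<le>Suc (Suc p). (-1) ^ k * cone_mean (Suc p) x (?g k))"
    by (intro sum.cong refl mean_scale[OF mean] g)
  also have "... = cone_mean (Suc p) x (?g 0) + (\<Sum>j\<le>Suc p. (-1) ^ Suc j * cone_mean (Suc p) x (?g (Suc j)))"
    by (subst sum.atMost_Suc_shift) simp
  also have "cone_mean (Suc p) x (?g 0) = cone_mean (Suc p) x (\<lambda>t. f x)" by (rule mean_cong[OF mean g]) auto
  also have "cone_mean (Suc p) x (\<lambda>t. f x) = f x" by (rule mean_const[OF mean])
  also have "(\<Sum>j\<le>Suc p. (-1) ^ Suc j * cone_mean (Suc p) x (?g (Suc j))) =
      (\<Sum>j\<le>Suc p. - ((-1) ^ j * cone_mean p (singular_face (Suc p) j x) f))"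
    by (intro sum.cong refl) (use cone_mean_face[OF x _ f] in auto)
  finally show ?thesis by (simp only: sum_negf diff_conv_add_uminus)
qed

lemma pairing_le_l1_norm:
  assumes z: "z \<in> l1_chains (K (Suc p))" "is_cycle (Suc p) z" and f: "bdd_fun f"
    and small: "\<And>s. s \<in> K (Suc (Suc p)) ==> \<bar>coboundary (Suc p) f s\<bar> \<le> 1"
  shows "\<bar>pairing f z\<bar> \<le> l1_norm z"
proof -
  define avg where "avg s = (if s \<in> K (Suc p) then cone_mean (Suc p) s (coboundary (Suc p) f) else 0)" for s
  define g where "g s = (if s \<in> K p then cone_mean p s f else 0)" for s
  have avg: "\<bar>avg s\<bar> \<le> 1" for s
    using cone_mean_bound[OF _ bdd_fun_coboundary[OF f] small] by (simp add: avg_def)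
  obtain B where B: "0 \<le> B" "\<And>s. \<bar>f s\<bar> \<le> B" using bdd_funE[OF f] by blast
  then have "\<bar>g s\<bar> \<le> B" for s using cone_mean_bound[OF _ f] by (simp add: g_def)
  then have g: "bdd_fun g" by (rule bdd_funI)
  note z_l1 = l1_chains_l1[OF z(1)]
  have "pairing f z = pairing (\<lambda>s. avg s + coboundary p g s) z"
  proof (rule pairing_cong)
    fix s assume "z s \<noteq> 0"
    then have s: "s \<in> K (Suc p)" by (rule l1_chains_support[OF z(1)])
    have "coboundary p g s = (\<Sum>j\<le>Suc p. (-1) ^ j * cone_mean p (singular_face (Suc p) j s) f)"
      unfolding coboundary_def by (intro sum.cong refl) (use face_in[OF s] in \<open>auto simp: g_def\<close>)
    then show "f s = avg s + coboundary p g s" using cone_mean_coboundary[OF s f] s by (simp add: avg_def)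
  qed
  also have "... = pairing avg z + pairing g (rchain_boundary (Suc p) z)"
    unfolding pairing_boundary[OF z_l1 g] by (rule pairing_add[OF z_l1 bdd_funI[OF avg] bdd_fun_coboundary[OF g]])
  also have "pairing g (rchain_boundary (Suc p) z) = 0" using z(2) by (simp add: is_cycle_def pairing_def)
  finally show ?thesis using pairing_bound[OF z_l1 avg] by simp
qed

lemma cycle_bounds:
  assumes "z \<in> l1_chains (K (Suc p))" "is_cycle (Suc p) z"
  obtains b where "b \<in> l1_chains (K (Suc (Suc p)))" "rchain_boundary (Suc (Suc p)) b = z"
  by (rule l1_acyclic[OF face_in pairing_le_l1_norm assms])

end

section \<open>Saturated subcomplexes\<close>

lemma all_le_2: "(\<forall>l\<le>2. P l) \<longleftrightarrow> P (0::nat) \<and> P 1 \<and> P 2"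
  by (auto simp: numeral_2_eq_2 le_Suc_eq)

context kan_complex begin

lemma face_face_skip:
  assumes t: "t \<in> K (Suc (Suc p))" and j: "j \<le> Suc (Suc p)" and l: "l \<le> Suc p"
  obtains i where "i \<le> Suc p" "skip (skip j l) i = j"
    "d (Suc p) l (d (Suc (Suc p)) j t) = d (Suc p) i (d (Suc (Suc p)) (skip j l) t)"
proof (cases "l < j")
  case True
  then show thesis using that[of "j - 1"] face_face[OF t True j] j by (auto simp: skip_def)
next
  case False
  then show thesis using that[of j] face_face[OF t, of j "Suc l"] l by (auto simp: skip_def)
qed

text \<open>The values \<open>e i k\<close> play the role of the common face opposite to the vertices \<open>i\<close> and \<open>k\<close>.\<close>

lemma horn_boundary:
  assumes j: "j \<le> Suc (Suc p)" and sym: "\<And>i k. e i k = e k i"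
    and faces: "\<And>i. i \<le> Suc (Suc p) ==> i \<noteq> j ==> \<exists>t\<in>K (Suc p). \<forall>l\<le>Suc p. d (Suc p) l t = e i (skip i l)"
  shows "\<exists>t\<in>K (Suc p). \<forall>l\<le>Suc p. d (Suc p) l t = e j (skip j l)"
proof -
  define x where "x i = (SOME t. t \<in> K (Suc p) \<and> (\<forall>l\<le>Suc p. d (Suc p) l t = e i (skip i l)))" for i
  have x: "x i \<in> K (Suc p) \<and> (\<forall>l\<le>Suc p. d (Suc p) l (x i) = e i (skip i l))" if "i \<le> Suc (Suc p)" "i \<noteq> j" for i
    using faces[OF that] unfolding x_def Bex_def by (rule someI_ex)
  have "\<exists>t\<in>K (Suc (Suc p)). \<forall>i\<le>Suc (Suc p). i \<noteq> j --> d (Suc (Suc p)) i t = x i"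
  proof (rule horn[OF j])
    show "x i \<in> K (Suc p)" if "i \<le> Suc (Suc p)" "i \<noteq> j" for i
      using x[OF that] by blast
    show "d (Suc p) i (x k) = d (Suc p) (k - 1) (x i)" if "i < k" "k \<le> Suc (Suc p)" "i \<noteq> j" "k \<noteq> j" for i k
    proof -
      have "skip k i = i" "skip i (k - 1) = k" "i \<le> Suc p" "k - 1 \<le> Suc p" "i \<le> Suc (Suc p)"
        using that by (auto simp: skip_def)
      then show ?thesis using x[of i] x[of k] that sym[of i k] by simp
    qed
  qed
  then obtain t where t: "t \<in> K (Suc (Suc p))" "\<And>i. i \<le> Suc (Suc p) ==> i \<noteq> j ==> d (Suc (Suc p)) i t = x i"
    by blast
  have "d (Suc p) l (d (Suc (Suc p)) j t) = e j (skip j l)" if l: "l \<le> Suc p" for l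
  proof -
    obtain i where i: "i \<le> Suc p" "skip (skip j l) i = j"
      "d (Suc p) l (d (Suc (Suc p)) j t) = d (Suc p) i (d (Suc (Suc p)) (skip j l) t)"
      using face_face_skip[OF t(1) j l] .
    have "skip j l \<le> Suc (Suc p)" "skip j l \<noteq> j" using l by (auto simp: skip_def)
    then show ?thesis using i x[of "skip j l"] t(2)[of "skip j l"] sym[of j "skip j l"] by simp
  qed
  then show ?thesis using face_in[OF t(1) j] by blast
qed

lemma homotopic_replace_faces:
  assumes m: "1 \<le> m" and t: "t \<in> K (Suc m)" and J: "J \<subseteq> {..Suc m}"
    and q: "\<And>i. i \<in> J ==> homotopic m (d (Suc m) i t) (q i)"
  shows "\<exists>t'\<in>K (Suc m). \<forall>i\<le>Suc m. d (Suc m) i t' = (if i \<in> J then q i else d (Suc m) i t)"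
  using finite_subset[OF J finite_atMost] J q
proof (induction J rule: finite_induct)
  case (insert j J)
  then obtain t' where t': "t' \<in> K (Suc m)" "\<And>i. i \<le> Suc m ==> d (Suc m) i t' = (if i \<in> J then q i else d (Suc m) i t)"
    by auto
  have j: "j \<le> Suc m" "d (Suc m) j t' = d (Suc m) j t"
    using t'(2)[of j] insert.hyps insert.prems(1) by simp_all
  then obtain r where r: "r \<in> K (Suc m)" "d (Suc m) j r = q j" "\<And>i. i \<le> Suc m ==> i \<noteq> j ==> d (Suc m) i r = d (Suc m) i t'"
    using homotopic_replace[OF m insert.prems(2)[OF insertI1] t'(1) j] by blast
  have "d (Suc m) i r = (if i \<in> insert j J then q i else d (Suc m) i t)" if "i \<le> Suc m" for i
    using r(2,3) t'(2) that by (cases "i = j") simp_all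
  then show ?case
    using r(1) by blast
qed (use t in auto)

subsection \<open>Triangles of edges\<close>

text \<open>Up to homotopy \<open>c\<close> is the path \<open>a\<close> followed by \<open>b\<close>.\<close>

definition triangle :: "'s => 's => 's => bool" where
  "triangle a b c \<longleftrightarrow> (\<exists>t\<in>K 2. d 2 2 t = a \<and> d 2 0 t = b \<and> d 2 1 t = c)"

definition bounds_triangle :: "(nat => 's) => bool" where
  "bounds_triangle f \<longleftrightarrow> (\<exists>t\<in>K (Suc 1). \<forall>l\<le>Suc 1. d (Suc 1) l t = f l)"

lemma triangle_iff: "triangle (f 2) (f 0) (f 1) \<longleftrightarrow> bounds_triangle f"
  unfolding triangle_def bounds_triangle_def by (auto simp: all_le_2 Suc_1[unfolded One_nat_def])

definition triangle_edge :: "'s => 's => 's => nat => 's" where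
  "triangle_edge a b c l = (if l = 0 then b else if l = 1 then c else a)"

lemma triangle_eq: "triangle a b c \<longleftrightarrow> bounds_triangle (triangle_edge a b c)"
  using triangle_iff[of "triangle_edge a b c"] by (simp add: triangle_edge_def)

lemma triangle_edges:
  assumes "triangle a b c"
  shows "a \<in> K 1" "b \<in> K 1" "c \<in> K 1" "d 1 1 a = d 1 1 c" "d 1 0 a = d 1 1 b" "d 1 0 b = d 1 0 c"
proof -
  obtain t where t: "t \<in> K (Suc (Suc 0))" "d 2 2 t = a" "d 2 0 t = b" "d 2 1 t = c"
    using assms by (auto simp: triangle_def numeral_2_eq_2)
  show "a \<in> K 1" "b \<in> K 1" "c \<in> K 1"
    using face_in[OF t(1), of 2] face_in[OF t(1), of 0] face_in[OF t(1), of 1] t by (auto simp: numeral_2_eq_2)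
  show "d 1 1 a = d 1 1 c" "d 1 0 a = d 1 1 b" "d 1 0 b = d 1 0 c"
    using face_face[OF t(1), of 1 2] face_face[OF t(1), of 0 2] face_face[OF t(1), of 0 1] t
    by (auto simp: numeral_2_eq_2)
qed

lemma triangle_horn:
  fixes j :: nat
  assumes "j \<le> 2" "j \<noteq> 2 ==> a \<in> K 1" "j \<noteq> 0 ==> b \<in> K 1" "j \<noteq> 1 ==> c \<in> K 1"
    "j = 0 ==> d 1 1 a = d 1 1 c" "j = 1 ==> d 1 0 a = d 1 1 b" "j = 2 ==> d 1 0 b = d 1 0 c"
  obtains a' b' c' where "triangle a' b' c'" "j \<noteq> 2 ==> a' = a" "j \<noteq> 0 ==> b' = b" "j \<noteq> 1 ==> c' = c"
proof -
  let ?e = "triangle_edge a b c"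
  have "\<exists>t\<in>K (Suc (Suc 0)). \<forall>i\<le>Suc (Suc 0). i \<noteq> j --> d (Suc (Suc 0)) i t = ?e i"
  proof (rule horn)
    show "j \<le> Suc (Suc 0)" using assms(1) by simp
    show "?e i \<in> K (Suc 0)" if "i \<le> Suc (Suc 0)" "i \<noteq> j" for i
      using that assms(2-4) by (auto simp: le_Suc_eq triangle_edge_def)
    show "d (Suc 0) i (?e k) = d (Suc 0) (k - 1) (?e i)" if "i < k" "k \<le> Suc (Suc 0)" "i \<noteq> j" "k \<noteq> j" for i k
    proof -
      have "i = 0 \<and> k = 1 \<and> j = 2 \<or> i = 0 \<and> k = 2 \<and> j = 1 \<or> i = 1 \<and> k = 2 \<and> j = 0"
        using that assms(1) by linarith
      then show ?thesis using assms(5-7) by (auto simp: triangle_edge_def)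
    qed
  qed
  then obtain t where t: "t \<in> K 2" "\<And>i. i \<le> 2 ==> i \<noteq> j ==> d 2 i t = ?e i"
    unfolding numeral_2_eq_2 by blast
  have "triangle (d 2 2 t) (d 2 0 t) (d 2 1 t)" using t(1) by (auto simp: triangle_def)
  then show thesis by (rule that) (use t(2) in \<open>auto simp: triangle_edge_def\<close>)
qed

lemma triangle_exists_c:
  assumes "a \<in> K 1" "b \<in> K 1" "d 1 0 a = d 1 1 b"
  shows "\<exists>c. triangle a b c"
  by (rule triangle_horn[of 1 a b undefined]) (use assms in auto)

lemma triangle_exists_a:
  assumes "b \<in> K 1" "c \<in> K 1" "d 1 0 b = d 1 0 c"
  shows "\<exists>a. triangle a b c"
  by (rule triangle_horn[of 2 undefined b c]) (use assms in auto)

lemma triangle_exists_b: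
  assumes "a \<in> K 1" "c \<in> K 1" "d 1 1 a = d 1 1 c"
  shows "\<exists>b. triangle a b c"
  by (rule triangle_horn[of 0 a undefined c]) (use assms in auto)

definition tetrahedron_edge :: "'s => 's => 's => 's => 's => 's => nat => nat => 's" where
  "tetrahedron_edge e01 e02 e03 e12 e13 e23 i k =
    (if {i, k} = {0, 1} then e23 else if {i, k} = {0, 2} then e13 else if {i, k} = {0, 3} then e12
     else if {i, k} = {1, 2} then e03 else if {i, k} = {1, 3} then e02 else e01)"

lemma
  shows triangle_left: "triangle e02 e23 e03 ==> triangle e01 e13 e03 ==> triangle e01 e12 e02 ==> triangle e12 e23 e13"
    and triangle_assoc: "triangle e12 e23 e13 ==> triangle e02 e23 e03 ==> triangle e01 e12 e02 ==> triangle e01 e13 e03"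
    and triangle_right: "triangle e12 e23 e13 ==> triangle e02 e23 e03 ==> triangle e01 e13 e03 ==> triangle e01 e12 e02"
proof -
  define e where "e = tetrahedron_edge e01 e02 e03 e12 e13 e23"
  have sym: "e i k = e k i" for i k
    by (simp add: e_def tetrahedron_edge_def insert_commute)
  have face: "bounds_triangle (\<lambda>l. e 0 (skip 0 l)) \<longleftrightarrow> triangle e12 e23 e13"
    "bounds_triangle (\<lambda>l. e 1 (skip 1 l)) \<longleftrightarrow> triangle e02 e23 e03"
    "bounds_triangle (\<lambda>l. e 2 (skip 2 l)) \<longleftrightarrow> triangle e01 e13 e03"
    "bounds_triangle (\<lambda>l. e 3 (skip 3 l)) \<longleftrightarrow> triangle e01 e12 e02"
    by (simp_all add: triangle_iff[symmetric] e_def tetrahedron_edge_def skip_def doubleton_eq_iff)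
  have last: "bounds_triangle (\<lambda>l. e j (skip j l))"
    if "j \<le> 3" "\<And>i. i \<le> 3 ==> i \<noteq> j ==> bounds_triangle (\<lambda>l. e i (skip i l))" for j
    using horn_boundary[of j "Suc 0" e, OF _ sym] that
    unfolding bounds_triangle_def numeral_3_eq_3 One_nat_def by blast
  have cases: "i = 0 \<or> i = 1 \<or> i = 2 \<or> i = 3" if "i \<le> 3" for i :: nat
    using that by linarith
  show "triangle e02 e23 e03 ==> triangle e01 e13 e03 ==> triangle e01 e12 e02 ==> triangle e12 e23 e13"
    using last[of 0] cases face by auto
  show "triangle e12 e23 e13 ==> triangle e02 e23 e03 ==> triangle e01 e12 e02 ==> triangle e01 e13 e03"
    using last[of 2] cases face by auto
  show "triangle e12 e23 e13 ==> triangle e02 e23 e03 ==> triangle e01 e13 e03 ==> triangle e01 e12 e02"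
    using last[of 3] cases face by auto
qed

lemma bounds_triangle_homotopic:
  assumes f: "bounds_triangle f" and j: "j \<le> Suc 1" and others: "\<And>l. l \<le> Suc 1 ==> l \<noteq> j ==> g l = f l" and h: "homotopic 1 (f j) (g j)"
  shows "bounds_triangle g"
proof -
  obtain t where t: "t \<in> K (Suc 1)" "\<And>l. l \<le> Suc 1 ==> d (Suc 1) l t = f l"
    using f by (auto simp: bounds_triangle_def)
  obtain t' where t': "t' \<in> K (Suc 1)" "d (Suc 1) j t' = g j"
    "\<And>l. l \<le> Suc 1 ==> l \<noteq> j ==> d (Suc 1) l t' = d (Suc 1) l t"
    using homotopic_replace[OF order_refl h t(1) j t(2)[OF j]] by blast
  have "d (Suc 1) l t' = g l" if "l \<le> Suc 1" for l
    using t'(2,3) t(2) others that by (cases "l = j") auto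
  then show ?thesis unfolding bounds_triangle_def using t'(1) by blast
qed

lemma bounds_triangle_unique:
  assumes f: "bounds_triangle f" and g: "bounds_triangle g" and j: "j \<le> Suc 1" and others: "\<And>l. l \<le> Suc 1 ==> l \<noteq> j ==> f l = g l"
  shows "homotopic 1 (f j) (g j)"
proof -
  obtain t u where t: "t \<in> K (Suc 1)" "\<And>l. l \<le> Suc 1 ==> d (Suc 1) l t = f l"
    and u: "u \<in> K (Suc 1)" "\<And>l. l \<le> Suc 1 ==> d (Suc 1) l u = g l"
    using f g unfolding bounds_triangle_def by blast
  have "homotopic 1 (d (Suc 1) j t) (d (Suc 1) j u)"
    using t(1) u(1) j by (rule homotopicI[where t = t and t' = u]) (use t(2) u(2) others in auto)
  then show ?thesis using t(2)[of j] u(2)[of j] j by simp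
qed

lemma
  shows triangle_homotopic_a: "triangle a b c ==> homotopic 1 a a' ==> triangle a' b c"
    and triangle_homotopic_b: "triangle a b c ==> homotopic 1 b b' ==> triangle a b' c"
    and triangle_homotopic_c: "triangle a b c ==> homotopic 1 c c' ==> triangle a b c'"
    and triangle_unique_c: "triangle a b c ==> triangle a b c' ==> homotopic 1 c c'"
  unfolding triangle_eq
  using bounds_triangle_homotopic[of "triangle_edge a b c" 2 "triangle_edge a' b c"]
    bounds_triangle_homotopic[of "triangle_edge a b c" 0 "triangle_edge a b' c"]
    bounds_triangle_homotopic[of "triangle_edge a b c" 1 "triangle_edge a b c'"]
    bounds_triangle_unique[of "triangle_edge a b c" "triangle_edge a b c'" 1]
  by (auto simp: triangle_edge_def)

lemma transports_iff_triangle: "transports 1 2 1 D z u \<longleftrightarrow> triangle z (d 2 0 D) u"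
  unfolding transports_def triangle_def Suc_1 all_le_2 by auto

definition loops_at :: "'s => 's set" where
  "loops_at s = {q \<in> K 1. d 1 0 q = s \<and> d 1 1 q = s}"

lemma loops_atD: "q \<in> loops_at s ==> q \<in> K 1 \<and> d 1 0 q = s \<and> d 1 1 q = s"
  by (simp add: loops_at_def)

lemma triangle_loops_at:
  assumes "triangle a b c"
  shows "a \<in> loops_at s ==> b \<in> loops_at s ==> c \<in> loops_at s"
    "b \<in> loops_at s ==> c \<in> loops_at s ==> a \<in> loops_at s"
  using triangle_edges[OF assms] by (auto simp: loops_at_def)

lemma parallel_loops_at: "x \<in> loops_at s ==> y \<in> loops_at s ==> parallel 1 x y"
  unfolding parallel_def loops_at_def by (auto simp: le_Suc_eq)

text \<open>A right invariant mean on homotopy classes, for the composition of loops given by triangles.\<close>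

definition loop_mean :: "'s set => (('s => real) => real) => bool" where
  "loop_mean L M \<longleftrightarrow> mean L M \<and> (\<forall>g\<in>L. \<forall>R f. bdd_fun f --> (\<forall>q q'. homotopic 1 q q' --> f q = f q') -->
    (\<forall>q\<in>L. R q \<in> L \<and> triangle q g (R q)) --> M (\<lambda>q. f (R q)) = M f)"

lemma round_trips_triangle:
  assumes h: "h \<in> round_trips 1 x 1" and x: "x \<in> loops_at s"
  obtains g where "g \<in> loops_at s" "\<And>z. z \<in> class_reps 1 x ==> triangle z g (h z)"
proof -
  obtain D1 D2 where data: "round_trip_data 1 x 1 D1 D2"
    and trip: "\<And>z. z \<in> class_reps 1 x ==> round_trip 1 1 D1 D2 z (h z)"
    using h unfolding round_trips_def by blast
  have D: "D1 \<in> K 2" "D2 \<in> K 2" "parallel 1 (d 2 2 D1) x" "parallel 1 (d 2 2 D2) x" "parallel 1 (d 2 1 D1) (d 2 1 D2)"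
    using round_trip_dataD[OF data] unfolding Suc_1 by simp_all
  have "triangle (d 2 2 D1) (d 2 0 D1) (d 2 1 D1)" "triangle (d 2 2 D2) (d 2 0 D2) (d 2 1 D2)"
    using D(1,2) unfolding triangle_def by blast+
  note E = triangle_edges[OF this(1)] triangle_edges[OF this(2)]
  have s: "d 1 1 (d 2 0 D1) = s" "d 1 1 (d 2 0 D2) = s" "d 1 0 (d 2 0 D1) = d 1 0 (d 2 0 D2)"
    using E D(3-5) x unfolding parallel_def loops_at_def by auto
  obtain g where g: "triangle g (d 2 0 D2) (d 2 0 D1)"
    using triangle_exists_a[of "d 2 0 D2" "d 2 0 D1"] E s by auto
  show thesis
  proof (rule that[of g])
    show "g \<in> loops_at s" using triangle_edges[OF g] s by (auto simp: loops_at_def)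
    fix z assume "z \<in> class_reps 1 x"
    then obtain u where "triangle z (d 2 0 D1) u" "triangle (h z) (d 2 0 D2) u"
      using trip unfolding round_trip_def Suc_1 transports_iff_triangle by blast
    then show "triangle z g (h z)" by (rule triangle_right[OF g, rotated])
  qed
qed

end

subsection \<open>Saturation\<close>

text \<open>From degree two on, membership is a condition on the edges only.\<close>

primrec saturate :: "(nat => 's set) => (nat => nat => 's => 's) => (nat => 's set) => nat => 's set" where
  "saturate S d V 0 = V 0"
| "saturate S d V (Suc m) = (if m = 0 then {x. \<exists>q\<in>V 1. kan_complex.homotopic S d 1 x q}
    else {x \<in> S (Suc m). \<forall>k\<le>Suc m. d (Suc m) k x \<in> saturate S d V m})"

lemma saturate_mono:
  assumes "\<And>n. V n \<subseteq> V' n"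
  shows "saturate S d V n \<subseteq> saturate S d V' n"
proof (induction n)
  case 0
  then show ?case
    using assms by simp
next
  case (Suc n)
  then show ?case
    using assms[of 1] by auto
qed

locale kan_pair = S: kan_complex S d + V: kan_complex V d
  for S V :: "nat => 's set" and d :: "nat => nat => 's => 's" +
  assumes V_subset: "V n \<subseteq> S n"
    and constant_edge: "x \<in> V 0 ==> \<exists>e\<in>V 1. d 1 0 e = x \<and> d 1 1 e = x"
begin

abbreviation sat :: "nat => 's set" where
  "sat \<equiv> saturate S d V"

lemma sat_1_iff: "x \<in> sat 1 \<longleftrightarrow> (\<exists>q\<in>V 1. S.homotopic 1 x q)"
  by simp

lemma sat_subset: "sat n \<subseteq> S n"
proof -
  consider "n = 0" | "n = 1" | m where "n = Suc (Suc m)"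
    by (cases n; cases "n - 1") auto
  then show ?thesis
  proof cases
    case 2
    then show ?thesis using S.homotopic_in[of 1] by auto
  qed (use V_subset in auto)
qed

lemma homotopic_face: "S.homotopic 1 x q ==> k \<le> 1 ==> d 1 k x = d 1 k q"
  using S.homotopic_parallel[of 1 x q] by (simp add: S.parallel_def)

lemma subset_sat: "V n \<subseteq> sat n"
proof (induction n)
  case (Suc n)
  show ?case
  proof (cases "n = 0")
    case True
    then show ?thesis using V_subset[of 1] S.homotopic_refl[of _ 1] by auto
  next
    case False
    then show ?thesis using V_subset[of "Suc n"] Suc V.face_in[of _ n] by auto
  qed
qed simp

lemma sat_face:
  assumes x: "x \<in> sat (Suc p)" and k: "k \<le> Suc p"
  shows "d (Suc p) k x \<in> sat p"
proof (cases "p = 0")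
  case True
  then obtain q where q: "q \<in> V 1" "S.homotopic 1 x q" using x by auto
  then show ?thesis using True k homotopic_face[OF q(2), of k] V.face_in[of q 0 k] by auto
qed (use assms in auto)

lemma sat_last_edge:
  assumes t: "t \<in> S (Suc 1)" and j: "j \<le> Suc 1" and edges: "\<And>i. i \<le> Suc 1 ==> i \<noteq> j ==> d (Suc 1) i t \<in> sat 1"
  shows "d (Suc 1) j t \<in> sat 1"
proof -
  have "\<exists>q\<in>V 1. S.homotopic 1 (d (Suc 1) i t) q" if "i \<in> {..Suc 1} - {j}" for i
    using edges that unfolding sat_1_iff by blast
  then obtain q where q: "\<And>i. i \<in> {..Suc 1} - {j} ==> q i \<in> V 1 \<and> S.homotopic 1 (d (Suc 1) i t) (q i)"
    by metis
  then obtain t' where t': "t' \<in> S (Suc 1)"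
    "\<forall>i\<le>Suc 1. d (Suc 1) i t' = (if i \<in> {..Suc 1} - {j} then q i else d (Suc 1) i t)"
    using S.homotopic_replace_faces[OF order_refl t Diff_subset] by blast
  have faces: "d (Suc 1) i t' = q i" "q i \<in> V 1" if "i \<le> Suc 1" "i \<noteq> j" for i
    using t'(2) q that by auto
  have "\<exists>u\<in>V (Suc (Suc 0)). \<forall>i\<le>Suc (Suc 0). i \<noteq> j --> d (Suc (Suc 0)) i u = q i"
  proof (rule V.horn)
    show "d (Suc 0) i (q k) = d (Suc 0) (k - 1) (q i)" if "i < k" "k \<le> Suc (Suc 0)" "i \<noteq> j" "k \<noteq> j" for i k
      using S.face_face[of t' 0 i k] t'(1) that faces(1)[of i] faces(1)[of k] by simp
  qed (use j faces(2) in auto)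
  then obtain u where u: "u \<in> V (Suc 1)" "\<And>i. i \<le> Suc 1 ==> i \<noteq> j ==> d (Suc 1) i u = q i" by auto
  have "S.homotopic 1 (d (Suc 1) j t') (d (Suc 1) j u)"
    using t'(1) u V_subset[of "Suc 1"] faces(1) j by (intro S.homotopicI) auto
  moreover have "d (Suc 1) j t' = d (Suc 1) j t" using t'(2) j by simp
  ultimately show ?thesis using V.face_in[of u 1 j] u(1) j unfolding sat_1_iff by auto
qed

lemma sat_last_face:
  assumes t: "t \<in> S (Suc (Suc p))" and j: "j \<le> Suc (Suc p)"
    and faces: "\<And>i. i \<le> Suc (Suc p) ==> i \<noteq> j ==> d (Suc (Suc p)) i t \<in> sat (Suc p)"
  shows "d (Suc (Suc p)) j t \<in> sat (Suc p)"
proof (cases "p = 0")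
  case True
  then show ?thesis using sat_last_edge[of t j] t j faces by simp
next
  case False
  have "d (Suc p) l (d (Suc (Suc p)) j t) \<in> sat p" if l: "l \<le> Suc p" for l
  proof -
    obtain i where i: "i \<le> Suc p"
      "d (Suc p) l (d (Suc (Suc p)) j t) = d (Suc p) i (d (Suc (Suc p)) (skip j l) t)"
      using S.face_face_skip[OF t j l] .
    have "skip j l \<le> Suc (Suc p)" "skip j l \<noteq> j" using l by (auto simp: skip_def)
    then show ?thesis unfolding i(2) by (intro sat_face faces i(1))
  qed
  then show ?thesis using False S.face_in[OF t j] by simp
qed

sublocale K: kan_complex sat d
proof
  show "d (Suc p) k x \<in> sat p" if "x \<in> sat (Suc p)" "k \<le> Suc p" for p k x
    using sat_face[OF that] .
  show "d (Suc p) i (d (Suc (Suc p)) k x) = d (Suc p) (k - 1) (d (Suc (Suc p)) i x)"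
    if "x \<in> sat (Suc (Suc p))" "i < k" "k \<le> Suc (Suc p)" for p i k x
    using S.face_face[OF _ that(2,3)] that(1) sat_subset[of "Suc (Suc p)"] by blast
  fix p j x
  assume j: "j \<le> Suc (Suc p)" and x: "\<And>i. i \<le> Suc (Suc p) ==> i \<noteq> j ==> x i \<in> sat (Suc p)"
    and compat: "\<And>i k. i < k ==> k \<le> Suc (Suc p) ==> i \<noteq> j ==> k \<noteq> j ==> d (Suc p) i (x k) = d (Suc p) (k - 1) (x i)"
  have "\<exists>t\<in>S (Suc (Suc p)). \<forall>i\<le>Suc (Suc p). i \<noteq> j --> d (Suc (Suc p)) i t = x i"
    by (rule S.horn[OF j _ compat]) (use x sat_subset[of "Suc p"] in blast)
  then obtain t where t: "t \<in> S (Suc (Suc p))" "\<And>i. i \<le> Suc (Suc p) ==> i \<noteq> j ==> d (Suc (Suc p)) i t = x i"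
    by blast
  have "d (Suc (Suc p)) j t \<in> sat (Suc p)" using t x by (intro sat_last_face[OF t(1) j]) simp
  then have "d (Suc (Suc p)) i t \<in> sat (Suc p)" if "i \<le> Suc (Suc p)" for i
    using that t(2)[of i] x[of i] by (cases "i = j") auto
  then have "t \<in> sat (Suc (Suc p))" using t(1) by simp
  then show "\<exists>t\<in>sat (Suc (Suc p)). \<forall>i\<le>Suc (Suc p). i \<noteq> j --> d (Suc (Suc p)) i t = x i"
    using t(2) by blast
qed

lemma sat_2I: "t \<in> S 2 ==> d 2 0 t \<in> sat 1 ==> d 2 1 t \<in> sat 1 ==> d 2 2 t \<in> sat 1 ==> t \<in> sat 2"
  using all_le_2[of "\<lambda>k. d 2 k t \<in> sat 1"] by (simp add: numeral_2_eq_2)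

lemma triangle_satI: "S.triangle a b c ==> a \<in> sat 1 ==> b \<in> sat 1 ==> c \<in> sat 1 ==> K.triangle a b c"
  using sat_2I unfolding S.triangle_def K.triangle_def by metis

lemma triangle_satD: "K.triangle a b c ==> S.triangle a b c"
  using sat_subset[of 2] unfolding S.triangle_def K.triangle_def by blast

definition connected_vertices :: "'s => 's => bool" where
  "connected_vertices x y \<longleftrightarrow> (\<exists>e\<in>sat 1. d 1 1 e = x \<and> d 1 0 e = y)"

definition base :: "'s => 's" where
  "base x = (SOME y. connected_vertices y x)"

lemma connected_vertices_refl: "x \<in> sat 0 ==> connected_vertices x x"
  using constant_edge[of x] subset_sat[of 1] unfolding connected_vertices_def saturate.simps(1) by blast

lemma connected_vertices_trans:
  assumes "connected_vertices x y" "connected_vertices y z"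
  shows "connected_vertices x z"
proof -
  obtain a b where ab: "a \<in> sat 1" "b \<in> sat 1" "d 1 1 a = x" "d 1 0 a = y" "d 1 1 b = y" "d 1 0 b = z"
    using assms unfolding connected_vertices_def by blast
  then obtain c where "K.triangle a b c" using K.triangle_exists_c[of a b] by auto
  then show ?thesis using K.triangle_edges[of a b c] ab unfolding connected_vertices_def by metis
qed

lemma connected_vertices_sym:
  assumes "connected_vertices x y"
  shows "connected_vertices y x"
proof -
  obtain a where a: "a \<in> sat 1" "d 1 1 a = x" "d 1 0 a = y"
    using assms unfolding connected_vertices_def by blast
  then have "x \<in> sat 0" using K.face_in[of a 0 1] by auto
  then obtain c where c: "c \<in> sat 1" "d 1 1 c = x" "d 1 0 c = x"
    using connected_vertices_refl unfolding connected_vertices_def by blast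
  obtain b where "K.triangle a b c" using K.triangle_exists_b[of a c] a c by auto
  then show ?thesis using K.triangle_edges[of a b c] a c unfolding connected_vertices_def by metis
qed

lemma base_edge: "x \<in> sat 0 ==> \<exists>e\<in>sat 1. d 1 1 e = base x \<and> d 1 0 e = x"
  using someI[of "\<lambda>y. connected_vertices y x", OF connected_vertices_refl]
  unfolding base_def connected_vertices_def by blast

lemma base_const:
  assumes "e \<in> sat 1"
  shows "base (d 1 1 e) = base (d 1 0 e)"
proof -
  have "connected_vertices (d 1 1 e) (d 1 0 e)" using assms unfolding connected_vertices_def by blast
  then have "connected_vertices y (d 1 1 e) \<longleftrightarrow> connected_vertices y (d 1 0 e)" for y
    using connected_vertices_trans connected_vertices_sym by blast
  then show ?thesis unfolding base_def by simp
qed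

end

subsection \<open>Invariant means on saturations\<close>

locale kan_triple = kan_pair S V d + W: kan_complex W d
  for S V W :: "nat => 's set" and d :: "nat => nat => 's => 's" +
  assumes V_subset_W: "V n \<subseteq> W n" and W_subset: "W n \<subseteq> S n"
    and loop_mean_exists: "s \<in> V 0 ==> \<exists>M. S.loop_mean (W.loops_at s) M"
begin

lemma triangle_WD: "W.triangle a b c ==> S.triangle a b c"
  using W_subset[of 2] unfolding S.triangle_def W.triangle_def by blast

text \<open>A right invariant mean on the loops of \<open>W\<close> is pushed to the loops of the saturation by sending a loop to
  its coordinate with respect to a chosen representative of its coset; this replaces the inheritance of
  amenability by subgroups.\<close>

definition coset :: "'s => 's => 's set" where
  "coset s z = {c \<in> W 1. \<exists>h\<in>K.loops_at s. S.triangle c h z}"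

definition coset_coord :: "'s => 's => 's" where
  "coset_coord s z = (SOME h. h \<in> K.loops_at s \<and> S.triangle (SOME c. c \<in> coset s z) h z)"

lemma constant_loop:
  assumes "s \<in> V 0"
  obtains x where "x \<in> W.loops_at s" "x \<in> K.loops_at s"
  using constant_edge[OF assms] V_subset_W[of 1] subset_sat[of 1] that by (auto simp: W.loops_at_def K.loops_at_def)

lemma coset_nonempty:
  assumes s: "s \<in> V 0" and z: "z \<in> W.loops_at s"
  shows "\<exists>c. c \<in> coset s z"
proof -
  obtain x where x: "x \<in> W.loops_at s" "x \<in> K.loops_at s"
    using constant_loop[OF s] .
  obtain c where "W.triangle c x z"
    using W.triangle_exists_a[of x z] W.loops_atD[OF x(1)] W.loops_atD[OF z] by auto
  then show ?thesis using W.triangle_edges(1) triangle_WD x(2) unfolding coset_def by blast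
qed

lemma coset_coord:
  assumes "\<exists>c. c \<in> coset s z"
  shows "coset_coord s z \<in> K.loops_at s" "S.triangle (SOME c. c \<in> coset s z) (coset_coord s z) z"
proof -
  have "(SOME c. c \<in> coset s z) \<in> coset s z" using assms by (rule someI_ex)
  then have "\<exists>h. h \<in> K.loops_at s \<and> S.triangle (SOME c. c \<in> coset s z) h z"
    unfolding coset_def by blast
  from someI_ex[OF this] show "coset_coord s z \<in> K.loops_at s" "S.triangle (SOME c. c \<in> coset s z) (coset_coord s z) z"
    unfolding coset_coord_def by blast+
qed

lemma coset_triangle:
  assumes g: "g \<in> K.loops_at s" and z: "S.triangle z g z'"
  shows "coset s z = coset s z'"
proof (intro equalityI subsetI)
  fix c assume "c \<in> coset s z"
  then obtain h where h: "c \<in> W 1" "h \<in> K.loops_at s" "S.triangle c h z" unfolding coset_def by blast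
  obtain k where k: "K.triangle h g k"
    using K.triangle_exists_c[of h g] K.loops_atD[OF g] K.loops_atD[OF h(2)] by auto
  have "S.triangle c k z'"
    using S.triangle_assoc[OF triangle_satD[OF k] z h(3)] .
  then show "c \<in> coset s z'" using h(1) K.triangle_loops_at(1)[OF k h(2) g] unfolding coset_def by blast
next
  fix c assume "c \<in> coset s z'"
  then obtain h where h: "c \<in> W 1" "h \<in> K.loops_at s" "S.triangle c h z'" unfolding coset_def by blast
  obtain k where k: "K.triangle k g h"
    using K.triangle_exists_a[of g h] K.loops_atD[OF g] K.loops_atD[OF h(2)] by auto
  have "S.triangle c k z"
    using S.triangle_right[OF triangle_satD[OF k] z h(3)] .
  then show "c \<in> coset s z" using h(1) K.triangle_loops_at(2)[OF k g h(2)] unfolding coset_def by blast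
qed

lemma coset_coord_triangle:
  assumes g: "g \<in> K.loops_at s" and z: "S.triangle z g z'" and nonempty: "\<exists>c. c \<in> coset s z"
  shows "K.triangle (coset_coord s z) g (coset_coord s z')"
proof -
  note coset = coset_triangle[OF g z]
  note coord = coset_coord[OF nonempty] coset_coord[OF nonempty[unfolded coset]]
  have "S.triangle (coset_coord s z) g (coset_coord s z')"
    using S.triangle_left[OF z coord(4)[folded coset] coord(2)] .
  then show ?thesis
    using K.loops_atD[OF coord(1)] K.loops_atD[OF coord(3)] K.loops_atD[OF g] by (intro triangle_satI) auto
qed

lemma coset_coord_homotopic:
  assumes "S.homotopic 1 z z'"
  shows "coset_coord s z = coset_coord s z'"
proof -
  have "S.triangle a b z \<longleftrightarrow> S.triangle a b z'" for a b
    using S.triangle_homotopic_c[OF _ assms] S.triangle_homotopic_c[OF _ S.homotopic_sym[OF assms]] by blast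
  then show ?thesis unfolding coset_coord_def coset_def by simp
qed

lemma loops_at_sat:
  assumes "g \<in> K.loops_at s"
  obtains q where "q \<in> W.loops_at s" "S.homotopic 1 g q"
proof -
  obtain q where q: "q \<in> V 1" "S.homotopic 1 g q" using K.loops_atD[OF assms] unfolding sat_1_iff by blast
  have "d 1 0 g = d 1 0 q" "d 1 1 g = d 1 1 q"
    using homotopic_face[OF q(2), of 0] homotopic_face[OF q(2), of 1] by auto
  then show thesis using that[of q] q K.loops_atD[OF assms] V_subset_W[of 1] by (auto simp: W.loops_at_def)
qed

lemma loop_mean_invariant:
  assumes s: "s \<in> V 0" and x: "x \<in> K.loops_at s" and M: "S.loop_mean (W.loops_at s) M"
    and h: "h \<in> K.round_trips 1 x 1" and f: "bdd_fun f"
  defines "r \<equiv> \<lambda>z. K.class_rep 1 (coset_coord s z)"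
  assumes r: "\<And>z. z \<in> W.loops_at s ==> r z \<in> K.class_reps 1 x"
  shows "M (\<lambda>z. f (h (r z))) = M (\<lambda>z. f (r z))"
proof -
  obtain g where g: "g \<in> K.loops_at s" "\<And>z. z \<in> K.class_reps 1 x ==> K.triangle z g (h z)"
    using K.round_trips_triangle[OF h x] by blast
  obtain q where q: "q \<in> W.loops_at s" "S.homotopic 1 g q"
    using loops_at_sat[OF g(1)] .
  define R where "R z = (SOME c. W.triangle z q c)" for z
  have triangle: "W.triangle z q (R z)" if "z \<in> W.loops_at s" for z
    unfolding R_def
    by (rule someI_ex[OF W.triangle_exists_c]) (use W.loops_atD[OF that] W.loops_atD[OF q(1)] in auto)
  have R: "R z \<in> W.loops_at s" if "z \<in> W.loops_at s" for z
    using W.triangle_loops_at(1)[OF triangle[OF that] that q(1)] .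
  have r_R: "r (R z) = h (r z)" if z: "z \<in> W.loops_at s" for z
  proof -
    have "S.triangle z g (R z)"
      by (rule S.triangle_homotopic_b[OF triangle_WD[OF triangle[OF z]] S.homotopic_sym[OF q(2)]])
    then have "K.triangle (coset_coord s z) g (coset_coord s (R z))"
      by (rule coset_coord_triangle[OF g(1) _ coset_nonempty[OF s z]])
    moreover have "K.homotopic 1 (coset_coord s y) (r y)" if "y \<in> W.loops_at s" for y
      unfolding r_def using K.loops_atD[OF coset_coord(1)[OF coset_nonempty[OF s that]]]
      by (intro K.homotopic_class_rep) auto
    ultimately have "K.triangle (r z) g (r (R z))"
      using K.triangle_homotopic_a K.triangle_homotopic_c z R[OF z] by blast
    then have "K.homotopic 1 (r (R z)) (h (r z))" by (rule K.triangle_unique_c[OF _ g(2)[OF r[OF z]]])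
    then show ?thesis by (rule K.class_reps_eqI[OF r[OF R[OF z]] K.round_trips_closed[OF h r[OF z]]]) simp
  qed
  have "mean (W.loops_at s) M" using M by (simp add: S.loop_mean_def)
  then have "M (\<lambda>z. f (h (r z))) = M (\<lambda>z. f (r (R z)))"
    by (rule mean_cong[OF _ bdd_fun_compose[OF f] bdd_fun_compose[OF f]]) (simp add: r_R)
  also have "... = M (\<lambda>z. f (r z))"
  proof -
    have "f (r a) = f (r b)" if "S.homotopic 1 a b" for a b
      unfolding r_def coset_coord_homotopic[OF that] ..
    moreover have "\<forall>z\<in>W.loops_at s. R z \<in> W.loops_at s \<and> S.triangle z q (R z)"
      using R triangle_WD[OF triangle] by blast
    ultimately show ?thesis using M q(1) bdd_fun_compose[OF f, of r] unfolding S.loop_mean_def by blast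
  qed
  finally show ?thesis .
qed

sublocale kan_amenable sat d base
proof
  fix s assume "s \<in> sat 0" "base s = s"
  then have s: "s \<in> V 0" by simp
  obtain x where x: "x \<in> K.loops_at s" using constant_loop[OF s] by blast
  obtain M where M: "S.loop_mean (W.loops_at s) M" using loop_mean_exists[OF s] by blast
  define r where "r z = K.class_rep 1 (coset_coord s z)" for z
  have r: "r z \<in> K.class_reps 1 x" if "z \<in> W.loops_at s" for z
    unfolding r_def
    by (rule K.class_repsI[OF K.parallel_loops_at[OF coset_coord(1)[OF coset_nonempty[OF s that]] x]])
  have "K.round_trip_mean 1 x (\<lambda>f. M (\<lambda>z. f (r z)))"
    unfolding K.round_trip_mean_def
  proof (intro conjI ballI allI impI)
    show "mean (K.class_reps 1 x) (\<lambda>f. M (\<lambda>z. f (r z)))"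
      by (rule mean_map[of "W.loops_at s" M, OF _ r]) (use M in \<open>simp only: S.loop_mean_def\<close>)
    show "M (\<lambda>z. f (h (r z))) = M (\<lambda>z. f (r z))" if "h \<in> K.round_trips 1 x 1" "bdd_fun f" for h f
      unfolding r_def using r[unfolded r_def] by (rule loop_mean_invariant[OF s x M that])
  qed
  then show "\<exists>x\<in>sat 1. d 1 1 x = s \<and> (\<exists>M. K.round_trip_mean 1 x M)"
    using K.loops_atD[OF x] by blast
qed (use base_edge base_const in auto)

end

section \<open>Singular simplices and loops\<close>

subsection \<open>Horns of singular simplices\<close>

abbreviation Sing :: "'a topology => nat => ((nat => real) => 'a) set" where
  "Sing X n \<equiv> singular_simplex_set n X"

abbreviation simplex_top :: "nat => (nat => real) topology" where
  "simplex_top n \<equiv> subtopology (powertop_real UNIV) (standard_simplex n)"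

definition unface :: "nat => (nat => real) => nat => real" where
  "unface i x = (\<lambda>k. if k < i then x k else x (Suc k))"

lemma simplical_face_unface: "x i = 0 ==> simplical_face i (unface i x) = x"
  by (auto simp: simplical_face_def unface_def fun_eq_iff)

lemma unface_simplical_face: "unface i (simplical_face i x) = x"
  by (auto simp: simplical_face_def unface_def fun_eq_iff)

lemma standard_simplexI:
  assumes "\<And>k. 0 \<le> x k" "\<And>k. p < k ==> x k = 0" "(\<Sum>k\<le>p. x k) = 1"
  shows "x \<in> standard_simplex p"
proof -
  have "x k \<le> 1" for k
  proof (cases "k \<le> p")
    case True
    then have "x k \<le> (\<Sum>k\<le>p. x k)" using assms(1) by (intro member_le_sum) auto
    then show ?thesis using assms(3) by simp
  qed (use assms(2) in auto)
  then show ?thesis using assms by (simp add: standard_simplex_def)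
qed

lemma unface_in_standard_simplex:
  assumes x: "x \<in> standard_simplex (Suc p)" and i: "i \<le> Suc p" "x i = 0"
  shows "unface i x \<in> standard_simplex p"
proof (rule standard_simplexI)
  show "0 \<le> unface i x k" for k
    using x by (simp add: unface_def standard_simplex_def)
  show "unface i x k = 0" if "p < k" for k
    using x i that by (simp add: unface_def standard_simplex_def)
  have "bij_betw (\<lambda>k. if k < i then k else Suc k) {..p} ({..Suc p} - {i})"
    by (rule bij_betw_byWitness[where f' = "\<lambda>k. if k < i then k else k - 1"]) (use i in auto)
  then have "(\<Sum>k\<le>p. x (if k < i then k else Suc k)) = sum x ({..Suc p} - {i})" by (rule sum.reindex_bij_betw)
  also have "... = sum x {..Suc p}" using i by (simp add: sum_diff1 del: sum.atMost_Suc)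
  also have "... = 1" using x by (simp add: standard_simplex_def del: sum.atMost_Suc)
  finally show "(\<Sum>k\<le>p. unface i x k) = 1" by (simp add: unface_def if_distrib)
qed

lemma continuous_map_coordinate: "continuous_map (powertop_real UNIV) euclideanreal (\<lambda>x. x k)"
  by (rule continuous_map_product_projection) simp

text \<open>On the region where, among the coordinates other than \<open>j\<close>, the coordinate \<open>i\<close> is minimal, subtracting that
  coordinate retracts the simplex onto the \<open>i\<close>-th face of the horn.\<close>

definition horn_region :: "nat => nat => nat => (nat => real) set" where
  "horn_region N j i = {x \<in> standard_simplex N. \<forall>k\<in>{..N} - {j}. x i \<le> x k}"

definition horn_retract :: "nat => nat => nat => (nat => real) => nat => real" where
  "horn_retract N j i x = (\<lambda>k. if N < k then 0 else if k = j then x j + real N * x i else x k - x i)"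

lemma horn_retract_in_standard_simplex:
  assumes x: "x \<in> horn_region N j i" and j: "j \<le> N" and i: "i \<le> N" "i \<noteq> j"
  shows "horn_retract N j i x \<in> standard_simplex N"
proof (rule standard_simplexI)
  have x': "x \<in> standard_simplex N" "\<And>k. k \<le> N ==> k \<noteq> j ==> x i \<le> x k"
    using x by (auto simp: horn_region_def)
  then have nonneg: "0 \<le> x k" for k
    by (simp add: standard_simplex_def)
  show "0 \<le> horn_retract N j i x k" for k
    using x'(2)[of k] nonneg[of j] nonneg[of i] by (auto simp: horn_retract_def)
  have "(\<Sum>k\<le>N. horn_retract N j i x k) = (x j + real N * x i) + (\<Sum>k\<in>{..N} - {j}. x k - x i)"
    unfolding horn_retract_def using j by (subst sum.remove[of _ j]) (auto intro!: sum.cong)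
  also have "(\<Sum>k\<in>{..N} - {j}. x k - x i) = (\<Sum>k\<in>{..N} - {j}. x k) - real N * x i"
    using j by (simp add: sum_subtractf)
  also have "(\<Sum>k\<in>{..N} - {j}. x k) = (\<Sum>k\<le>N. x k) - x j" using j by (simp add: sum_diff1)
  also have "(\<Sum>k\<le>N. x k) = 1" using x'(1) by (simp add: standard_simplex_def)
  finally show "(\<Sum>k\<le>N. horn_retract N j i x k) = 1" by simp
qed (simp add: horn_retract_def)

lemma horn_retract_zero: "i \<noteq> j ==> horn_retract N j i x i = 0"
  by (simp add: horn_retract_def)

lemma horn_retract_id: "x \<in> standard_simplex N ==> x i = 0 ==> horn_retract N j i x = x"
  by (auto simp: horn_retract_def standard_simplex_def fun_eq_iff)

lemma closedin_horn_region:
  assumes "j \<le> Suc (Suc p)"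
  shows "closedin (simplex_top (Suc (Suc p))) (horn_region (Suc (Suc p)) j i)"
proof -
  let ?N = "Suc (Suc p)"
  have nonempty: "{..?N} - {j} \<noteq> {}" by (cases "j = 0") auto
  have "horn_region ?N j i = (\<Inter>k\<in>{..?N} - {j}. {x \<in> topspace (simplex_top ?N). x k - x i \<in> {0..}})"
    using nonempty by (auto simp: horn_region_def)
  moreover have "closedin (simplex_top ?N) {x \<in> topspace (simplex_top ?N). x k - x i \<in> {0..}}" for k
  proof (rule closedin_continuous_map_preimage)
    show "continuous_map (simplex_top ?N) euclideanreal (\<lambda>x. x k - x i)"
      by (intro continuous_map_from_subtopology continuous_map_diff continuous_map_coordinate)
  qed auto
  ultimately show ?thesis using nonempty by (simp only:) (intro closedin_INT, auto)
qed

lemma horn_regions_cover: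
  assumes "x \<in> standard_simplex (Suc (Suc p))"
  obtains i where "i \<in> {..Suc (Suc p)} - {j}" "x \<in> horn_region (Suc (Suc p)) j i"
proof -
  let ?A = "{..Suc (Suc p)} - {j}"
  have "finite ?A" "?A \<noteq> {}" by simp (cases "j = 0", auto)
  then have "arg_min_on x ?A \<in> ?A" "\<And>k. k \<in> ?A ==> x (arg_min_on x ?A) \<le> x k"
    using arg_min_if_finite[of ?A x] by (auto simp: not_less)
  then show thesis using that assms by (auto simp: horn_region_def)
qed

lemma continuous_map_horn_face:
  assumes "j \<le> Suc p" "i \<in> {..Suc p} - {j}"
  shows "continuous_map (subtopology (simplex_top (Suc p)) (horn_region (Suc p) j i)) (simplex_top p)
    (\<lambda>x. unface i (horn_retract (Suc p) j i x))"
  unfolding continuous_map_in_subtopology continuous_map_componentwise_UNIV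
proof (intro conjI allI)
  fix k
  have "continuous_map (powertop_real UNIV) euclideanreal (\<lambda>x. unface i (horn_retract (Suc p) j i x) k)"
    unfolding unface_def horn_retract_def
    by (auto intro!: continuous_map_diff continuous_map_add continuous_map_real_mult continuous_map_coordinate)
  then show "continuous_map (subtopology (simplex_top (Suc p)) (horn_region (Suc p) j i)) euclideanreal
      (\<lambda>x. unface i (horn_retract (Suc p) j i x) k)"
    by (intro continuous_map_from_subtopology)
next
  show "(\<lambda>x. unface i (horn_retract (Suc p) j i x)) \<in>
      topspace (subtopology (simplex_top (Suc p)) (horn_region (Suc p) j i)) \<rightarrow> standard_simplex p"
    using assms by (auto intro!: unface_in_standard_simplex horn_retract_in_standard_simplex horn_retract_zero)
qed

lemma horn_faces_agree:
  assumes j: "j \<le> Suc (Suc p)" and ik: "i < k" "i \<in> {..Suc (Suc p)} - {j}" "k \<in> {..Suc (Suc p)} - {j}"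
    and compat: "singular_face (Suc p) i (y k) = singular_face (Suc p) (k - 1) (y i)"
    and x: "x \<in> horn_region (Suc (Suc p)) j i" "x \<in> horn_region (Suc (Suc p)) j k"
  shows "y i (unface i (horn_retract (Suc (Suc p)) j i x)) = y k (unface k (horn_retract (Suc (Suc p)) j k x))"
proof -
  define z where "z = horn_retract (Suc (Suc p)) j i x"
  have "x i = x k" using ik x by (auto simp: horn_region_def intro!: antisym)
  then have retract_k: "horn_retract (Suc (Suc p)) j k x = z" unfolding z_def horn_retract_def by (intro ext) simp
  have z: "z \<in> standard_simplex (Suc (Suc p))" "z i = 0" "z k = 0"
    using horn_retract_in_standard_simplex[OF x(1) j] horn_retract_zero[of i j]
      horn_retract_zero[of k j "Suc (Suc p)" x, unfolded retract_k] ik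
    by (auto simp: z_def)
  let ?w = "unface i (unface k z)"
  have "unface k z \<in> standard_simplex (Suc p)" using z ik by (intro unface_in_standard_simplex) auto
  then have w: "?w \<in> standard_simplex p"
    using ik z by (intro unface_in_standard_simplex) (auto simp: unface_def)
  have face_i: "simplical_face i ?w = unface k z"
    using z ik by (intro simplical_face_unface) (auto simp: unface_def)
  have "?w = unface (k - 1) (unface i z)" using ik(1) by (auto simp: unface_def fun_eq_iff)
  moreover have "unface i z (k - 1) = 0" using z ik(1) by (simp add: unface_def)
  ultimately have face_k: "simplical_face (k - 1) ?w = unface i z" by (simp add: simplical_face_unface)
  have "y k (unface k z) = y i (unface i z)"
    using fun_cong[OF compat, of ?w] w face_i face_k by (simp add: singular_face_def)
  then show ?thesis by (simp add: retract_k z_def)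
qed

lemma horn_map_exists:
  assumes j: "j \<le> Suc (Suc p)"
    and y: "\<And>i. i \<le> Suc (Suc p) ==> i \<noteq> j ==> singular_simplex (Suc p) X (y i)"
    and compat: "\<And>i k. i < k ==> k \<le> Suc (Suc p) ==> i \<noteq> j ==> k \<noteq> j ==>
      singular_face (Suc p) i (y k) = singular_face (Suc p) (k - 1) (y i)"
  obtains g where "continuous_map (simplex_top (Suc (Suc p))) X g"
    "\<And>x i. i \<le> Suc (Suc p) ==> i \<noteq> j ==> x \<in> horn_region (Suc (Suc p)) j i ==>
      g x = y i (unface i (horn_retract (Suc (Suc p)) j i x))"
proof -
  let ?N = "Suc (Suc p)" and ?A = "{..Suc (Suc p)} - {j}"
  define f where "f i x = y i (unface i (horn_retract ?N j i x))" for i x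
  obtain g where g: "continuous_map (simplex_top ?N) X g"
    "\<And>x i. i \<in> ?A ==> x \<in> topspace (simplex_top ?N) \<inter> horn_region ?N j i ==> g x = f i x"
  proof (rule pasting_lemma_exists_closed[of ?A "simplex_top ?N" "horn_region ?N j" X f])
    show "topspace (simplex_top ?N) \<subseteq> \<Union> (horn_region ?N j ` ?A)"
    proof
      fix x assume "x \<in> topspace (simplex_top ?N)"
      then have "x \<in> standard_simplex ?N" by simp
      then obtain i where "i \<in> ?A" "x \<in> horn_region ?N j i" by (rule horn_regions_cover)
      then show "x \<in> \<Union> (horn_region ?N j ` ?A)" by (rule UN_I)
    qed
    show "continuous_map (subtopology (simplex_top ?N) (horn_region ?N j i)) X (f i)" if i: "i \<in> ?A" for i
    proof -
      have "continuous_map (simplex_top (Suc p)) X (y i)" using y[of i] i by (auto simp: singular_simplex_def)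
      then have "continuous_map (subtopology (simplex_top ?N) (horn_region ?N j i)) X
          (y i \<circ> (\<lambda>x. unface i (horn_retract ?N j i x)))"
        using continuous_map_horn_face[OF j i] by (rule continuous_map_compose[rotated])
      then show ?thesis by (simp add: f_def[abs_def] o_def)
    qed
    have agree: "f i x = f k x" if "i < k" "i \<in> ?A" "k \<in> ?A" "x \<in> horn_region ?N j i" "x \<in> horn_region ?N j k" for i k x
      unfolding f_def using that compat[of i k] by (intro horn_faces_agree[OF j]) auto
    show "f i x = f k x"
      if "i \<in> ?A" "k \<in> ?A" "x \<in> topspace (simplex_top ?N) \<inter> horn_region ?N j i \<inter> horn_region ?N j k" for i k x
    proof (cases i k rule: linorder_cases)
      case less
      show ?thesis by (rule agree[OF less]) (use that in blast)+
    next
      case greater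
      show ?thesis by (rule agree[OF greater, symmetric]) (use that in blast)+
    qed simp
  qed (use closedin_horn_region[OF j] in blast)+
  have "horn_region ?N j i \<subseteq> topspace (simplex_top ?N)" for i
    by (auto simp: horn_region_def)
  then show thesis using that[OF g(1)] g(2) unfolding f_def by blast
qed

lemma Sing_horn:
  assumes j: "j \<le> Suc (Suc p)"
    and y: "\<And>i. i \<le> Suc (Suc p) ==> i \<noteq> j ==> singular_simplex (Suc p) X (y i)"
    and compat: "\<And>i k. i < k ==> k \<le> Suc (Suc p) ==> i \<noteq> j ==> k \<noteq> j ==>
      singular_face (Suc p) i (y k) = singular_face (Suc p) (k - 1) (y i)"
  shows "\<exists>t. singular_simplex (Suc (Suc p)) X t \<and> (\<forall>i\<le>Suc (Suc p). i \<noteq> j --> singular_face (Suc (Suc p)) i t = y i)"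
proof -
  let ?N = "Suc (Suc p)"
  obtain g where g: "continuous_map (simplex_top ?N) X g"
    "\<And>x i. i \<le> ?N ==> i \<noteq> j ==> x \<in> horn_region ?N j i ==> g x = y i (unface i (horn_retract ?N j i x))"
    using horn_map_exists[OF j y compat] by blast
  let ?t = "restrict g (standard_simplex ?N)"
  have "singular_simplex ?N X ?t" using continuous_map_eq[OF g(1), of ?t] by (auto simp: singular_simplex_def)
  moreover have "singular_face ?N i ?t = y i" if i: "i \<le> ?N" "i \<noteq> j" for i
  proof
    fix x
    show "singular_face ?N i ?t x = y i x"
    proof (cases "x \<in> standard_simplex (Suc p)")
      case True
      let ?z = "simplical_face i x"
      have z: "?z \<in> standard_simplex ?N" "?z i = 0"
        using simplical_face_in[OF _ True, of i] i by (simp_all add: simplical_face_def)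
      then have "?z \<in> horn_region ?N j i" by (auto simp: horn_region_def standard_simplex_def)
      then have "g ?z = y i x" using g(2)[OF i] horn_retract_id[OF z] by (simp add: unface_simplical_face)
      then show ?thesis using True z(1) by (simp add: singular_face_def)
    next
      case False
      then show ?thesis using y[OF i] by (auto simp: singular_face_def singular_simplex_def extensional_def)
    qed
  qed
  ultimately show ?thesis by blast
qed

lemma kan_complex_Sing: "kan_complex (Sing X) singular_face"
proof
  show "singular_face (Suc p) k x \<in> Sing X p" if "x \<in> Sing X (Suc p)" "k \<le> Suc p" for p k x
    using singular_simplex_singular_face[of "Suc p" X x k] that by simp
  show "\<exists>t\<in>Sing X (Suc (Suc p)). \<forall>i\<le>Suc (Suc p). i \<noteq> j --> singular_face (Suc (Suc p)) i t = x i"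
    if "j \<le> Suc (Suc p)" "\<And>i. i \<le> Suc (Suc p) ==> i \<noteq> j ==> x i \<in> Sing X (Suc p)"
      "\<And>i k. i < k ==> k \<le> Suc (Suc p) ==> i \<noteq> j ==> k \<noteq> j ==>
        singular_face (Suc p) i (x k) = singular_face (Suc p) (k - 1) (x i)"
    for p j x
    using Sing_horn[of j p X x] that by auto
qed (rule singular_face_commute)

subsection \<open>Edges and paths\<close>

abbreviation unit_interval :: "real topology" where
  "unit_interval \<equiv> top_of_set {0..1}"

definition edge_point :: "real => nat => real" where
  "edge_point \<tau> = (\<lambda>k. if k = 0 then 1 - \<tau> else if k = 1 then \<tau> else 0)"

definition path_edge :: "(real => 'a) => (nat => real) => 'a" where
  "path_edge p = restrict (\<lambda>x. p (x 1)) (standard_simplex 1)"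

definition edge_path :: "((nat => real) => 'a) => real => 'a" where
  "edge_path e \<tau> = e (edge_point \<tau>)"

definition vertex :: "'a => (nat => real) => 'a" where
  "vertex a = restrict (\<lambda>x. a) (standard_simplex 0)"

lemma edge_point_in: "\<tau> \<in> {0..1} ==> edge_point \<tau> \<in> standard_simplex 1"
  by (auto simp: edge_point_def standard_simplex_def)

lemma edge_point_eq: "x \<in> standard_simplex 1 ==> edge_point (x 1) = x"
  by (auto simp: edge_point_def standard_simplex_def fun_eq_iff)

lemma standard_simplex_coordinate: "x \<in> standard_simplex n ==> x k \<in> {0..1}"
  by (auto simp: standard_simplex_def)

lemma continuous_map_coordinate_unit_interval: "continuous_map (simplex_top n) unit_interval (\<lambda>x. x k)"
  unfolding continuous_map_in_subtopology
  using standard_simplex_coordinate[of _ n k]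
  by (auto simp del: atLeastAtMost_iff intro!: continuous_map_from_subtopology continuous_map_coordinate)

lemma singular_simplex_path_edge:
  assumes "continuous_map unit_interval Y p"
  shows "singular_simplex 1 Y (path_edge p)"
proof -
  have "continuous_map (simplex_top 1) Y (p \<circ> (\<lambda>x. x 1))"
    by (rule continuous_map_compose[OF continuous_map_coordinate_unit_interval assms])
  then have "continuous_map (simplex_top 1) Y (path_edge p)" by (rule continuous_map_eq) (simp add: path_edge_def)
  then show ?thesis by (simp add: singular_simplex_def path_edge_def)
qed

lemma continuous_map_edge_path:
  assumes "singular_simplex 1 Y e"
  shows "continuous_map unit_interval Y (edge_path e)"
proof -
  have "continuous_map unit_interval (simplex_top 1) edge_point"
    unfolding continuous_map_in_subtopology continuous_map_componentwise_UNIV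
  proof (intro conjI allI)
    show "continuous_map unit_interval euclideanreal (\<lambda>\<tau>. edge_point \<tau> k)" for k
      unfolding edge_point_def by (cases "k = 0"; cases "k = 1") (auto intro!: continuous_intros)
  qed (use edge_point_in in auto)
  then have "continuous_map unit_interval Y (e \<circ> edge_point)"
    by (rule continuous_map_compose) (use assms in \<open>simp add: singular_simplex_def\<close>)
  then show ?thesis by (simp add: o_def edge_path_def[abs_def])
qed

lemma path_edge_edge_path:
  assumes "singular_simplex 1 Y e"
  shows "path_edge (edge_path e) = e"
proof
  fix x
  show "path_edge (edge_path e) x = e x"
    using assms edge_point_eq[of x]
    by (cases "x \<in> standard_simplex 1") (auto simp: path_edge_def edge_path_def singular_simplex_def extensional_def)
qed

lemma edge_path_path_edge: "\<tau> \<in> {0..1} ==> edge_path (path_edge p) \<tau> = p \<tau>"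
  using edge_point_in[of \<tau>] by (simp add: edge_path_def path_edge_def) (simp add: edge_point_def)

lemma path_edge_cong: "(\<And>\<tau>. \<tau> \<in> {0..1} ==> p \<tau> = q \<tau>) ==> path_edge p = path_edge q"
  unfolding path_edge_def by (rule restrict_ext) (use standard_simplex_coordinate in blast)

lemma in_standard_simplex_0: "x \<in> standard_simplex 0 ==> x = (\<lambda>j. if j = 0 then 1 else 0)"
  by (simp add: standard_simplex_0)

lemma singular_face_path_edge:
  "singular_face 1 0 (path_edge p) = vertex (p 1)" "singular_face 1 1 (path_edge p) = vertex (p 0)"
proof -
  have "path_edge p (simplical_face k x) = p (if k = 0 then 1 else 0)" if "x \<in> standard_simplex 0" "k \<le> 1" for k x
  proof -
    have "simplical_face k x \<in> standard_simplex 1" using simplical_face_in[of k 0 x] that by simp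
    moreover have "simplical_face k x 1 = (if k = 0 then 1 else 0)"
      using in_standard_simplex_0[OF that(1)] that(2) by (auto simp: simplical_face_def)
    ultimately show ?thesis by (simp add: path_edge_def)
  qed
  then show "singular_face 1 0 (path_edge p) = vertex (p 1)" "singular_face 1 1 (path_edge p) = vertex (p 0)"
    by (auto simp: singular_face_def vertex_def fun_eq_iff)
qed

lemma vertex_eq_iff: "vertex a = vertex b \<longleftrightarrow> a = b"
proof
  assume "vertex a = vertex b"
  then have "vertex a (\<lambda>j. if j = 0 then 1 else 0) = vertex b (\<lambda>j. if j = 0 then 1 else 0)" by simp
  then show "a = b" by (simp add: vertex_def standard_simplex_0)
qed simp

lemma singular_simplex_0E:
  assumes "singular_simplex 0 Y s"
  obtains a where "a \<in> topspace Y" "s = vertex a"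
proof -
  let ?v = "\<lambda>j. if j = 0 then 1 else 0 :: real"
  have "s = vertex (s ?v)"
  proof
    fix x
    show "s x = vertex (s ?v) x"
      using assms in_standard_simplex_0[of x]
      by (cases "x \<in> standard_simplex 0") (auto simp: vertex_def singular_simplex_def extensional_def)
  qed
  moreover have "s ?v \<in> topspace Y"
    using assms continuous_map_image_subset_topspace[of "simplex_top 0" Y s]
    by (auto simp: singular_simplex_def standard_simplex_0)
  ultimately show thesis using that by blast
qed

lemma constant_edge_exists:
  assumes "singular_simplex 0 Y s"
  shows "\<exists>e\<in>Sing Y 1. singular_face 1 0 e = s \<and> singular_face 1 1 e = s"
proof -
  obtain a where a: "a \<in> topspace Y" "s = vertex a"
    using singular_simplex_0E[OF assms] .
  have "singular_simplex 1 Y (path_edge (\<lambda>_. a))" by (rule singular_simplex_path_edge) (use a in auto)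
  then show ?thesis using singular_face_path_edge[of "\<lambda>_. a"] a(2) by blast
qed

lemma edge_path_in_loops:
  assumes e: "singular_simplex 1 Y e" and ends: "singular_face 1 0 e = vertex a" "singular_face 1 1 e = vertex a"
  shows "edge_path e \<in> loops Y a"
proof -
  have "vertex (edge_path e 1) = vertex a" "vertex (edge_path e 0) = vertex a"
    using singular_face_path_edge[of "edge_path e"] ends unfolding path_edge_edge_path[OF e] by auto
  then show ?thesis using continuous_map_edge_path[OF e] unfolding loops_def vertex_eq_iff by blast
qed

lemma path_edge_loop:
  assumes "p \<in> loops Y a"
  shows "singular_simplex 1 Y (path_edge p)" "singular_face 1 0 (path_edge p) = vertex a"
    "singular_face 1 1 (path_edge p) = vertex a"
  using assms singular_simplex_path_edge[of Y p] singular_face_path_edge[of p] by (auto simp: loops_def)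

subsection \<open>Triangles and homotopies of loops\<close>

lemma singular_face_2:
  assumes "k \<le> 2"
  shows "singular_face 2 k (restrict F (standard_simplex 2)) = path_edge (\<lambda>\<tau>. F (simplical_face k (edge_point \<tau>)))"
    (is "?L = ?R")
proof
  fix x
  show "?L x = ?R x"
  proof (cases "x \<in> standard_simplex 1")
    case True
    then have "simplical_face k x \<in> standard_simplex 2"
      using simplical_face_in[of k 1 x] assms by (simp add: numeral_2_eq_2)
    then show ?thesis using True edge_point_eq[OF True] by (simp add: singular_face_def path_edge_def)
  qed (simp add: singular_face_def path_edge_def)
qed

lemma triangleI:
  assumes F: "continuous_map (simplex_top 2) X F"
    and edges: "\<And>\<tau>. \<tau> \<in> {0..1} ==> F (simplical_face 2 (edge_point \<tau>)) = a \<tau>"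
      "\<And>\<tau>. \<tau> \<in> {0..1} ==> F (simplical_face 0 (edge_point \<tau>)) = b \<tau>"
      "\<And>\<tau>. \<tau> \<in> {0..1} ==> F (simplical_face 1 (edge_point \<tau>)) = c \<tau>"
  shows "kan_complex.triangle (Sing X) singular_face (path_edge a) (path_edge b) (path_edge c)"
proof -
  let ?t = "restrict F (standard_simplex 2)"
  have "singular_simplex 2 X ?t" using continuous_map_eq[OF F, of ?t] by (auto simp: singular_simplex_def)
  moreover have "singular_face 2 2 ?t = path_edge a" "singular_face 2 0 ?t = path_edge b"
    "singular_face 2 1 ?t = path_edge c"
    using singular_face_2[of 2 F] singular_face_2[of 0 F] singular_face_2[of 1 F]
      path_edge_cong[OF edges(1)] path_edge_cong[OF edges(2)] path_edge_cong[OF edges(3)] by simp_all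
  ultimately show ?thesis unfolding kan_complex.triangle_def[OF kan_complex_Sing] by blast
qed

lemma continuous_map_sum_coordinate: "continuous_map (simplex_top 2) unit_interval (\<lambda>x. x 1 + x 2)"
proof -
  have "x 1 + x 2 \<in> {0..1}" if "x \<in> standard_simplex 2" for x :: "nat => real"
  proof -
    have "(\<Sum>k\<le>2. x k) = x 0 + x 1 + x 2" by (simp add: numeral_2_eq_2)
    moreover have "0 \<le> x 0" "0 \<le> x 1" "0 \<le> x 2" "(\<Sum>k\<le>2. x k) = 1"
      using that by (simp_all add: standard_simplex_def)
    ultimately show ?thesis by simp
  qed
  then show ?thesis unfolding continuous_map_in_subtopology by (auto simp del: atLeastAtMost_iff
        intro!: continuous_map_from_subtopology continuous_map_add continuous_map_coordinate)
qed

text \<open>The square of the homotopy is cut along its diagonal \<open>e\<close>.\<close>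

lemma homotopic_path_edges:
  assumes "loop_homotopic X x0 p p'"
  shows "kan_complex.homotopic (Sing X) singular_face 1 (path_edge p) (path_edge p')"
proof -
  interpret S: kan_complex "Sing X" singular_face
    by (rule kan_complex_Sing)
  obtain h where h: "continuous_map (prod_topology unit_interval unit_interval) X h"
    "\<And>x. h (0, x) = p x" "\<And>x. h (1, x) = p' x" "\<And>t. t \<in> {0..1} ==> h (t, 0) = x0 \<and> h (t, 1) = x0"
    using assms unfolding loop_homotopic_def homotopic_with_def by auto
  have paths: "continuous_map unit_interval X p" "continuous_map unit_interval X p'"
    using homotopic_with_imp_continuous_maps[OF assms[unfolded loop_homotopic_def]] by auto
  have ends: "p 0 = x0" "p 1 = x0" "p' 0 = x0" "p' 1 = x0"
    using h(2)[of 0] h(2)[of 1] h(3)[of 0] h(3)[of 1] h(4)[of 0] h(4)[of 1] by auto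
  define c where "c = path_edge (\<lambda>_::real. x0)"
  define e where "e = path_edge (\<lambda>\<tau>. h (\<tau>, \<tau>))"
  have h_pair: "continuous_map (simplex_top 2) X (\<lambda>x. h (f x, g x))"
    if "continuous_map (simplex_top 2) unit_interval f" "continuous_map (simplex_top 2) unit_interval g" for f g
    using continuous_map_compose[OF continuous_map_pairedI[OF that] h(1)] by (simp add: o_def)
  note coord = continuous_map_coordinate_unit_interval[of 2 2] and sum_coord = continuous_map_sum_coordinate
  have "S.triangle (path_edge p) c e"
    unfolding c_def e_def
    by (rule triangleI[OF h_pair[OF coord sum_coord]]) (use h in \<open>auto simp: simplical_face_def edge_point_def\<close>)
  moreover have "S.triangle (path_edge p) c (path_edge p)"
    unfolding c_def by (rule triangleI[OF continuous_map_compose[OF sum_coord paths(1)]])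
      (use ends in \<open>auto simp: simplical_face_def edge_point_def\<close>)
  moreover have "S.triangle c (path_edge p') e"
    unfolding c_def e_def
    by (rule triangleI[OF h_pair[OF sum_coord coord]]) (use h in \<open>auto simp: simplical_face_def edge_point_def\<close>)
  moreover have "S.triangle c (path_edge p') (path_edge p')"
    unfolding c_def by (rule triangleI[OF continuous_map_compose[OF coord paths(2)]])
      (use ends in \<open>auto simp: simplical_face_def edge_point_def\<close>)
  ultimately show ?thesis using S.homotopic_trans[OF S.triangle_unique_c S.triangle_unique_c] by blast
qed

text \<open>The straight-line homotopy from the path along the edges \<open>01\<close> and \<open>12\<close> of the triangle to the edge \<open>02\<close>.\<close>

definition triangle_sweep :: "real \<times> real => nat => real" where
  "triangle_sweep z = (\<lambda>k. (1 - fst z) * (if k = 0 then max 0 (1 - 2 * snd z)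
      else if k = 1 then 1 - \<bar>1 - 2 * snd z\<bar> else if k = 2 then max 0 (2 * snd z - 1) else 0) +
    fst z * (if k = 0 then 1 - snd z else if k = 2 then snd z else 0))"

lemma triangle_sweep_in_standard_simplex:
  assumes "z \<in> {0..1} \<times> {0..1}"
  shows "triangle_sweep z \<in> standard_simplex 2"
proof (rule standard_simplexI)
  have z: "0 \<le> fst z" "fst z \<le> 1" "0 \<le> snd z" "snd z \<le> 1" using assms by auto
  then have "\<bar>1 - 2 * snd z\<bar> \<le> 1" by auto
  then show "0 \<le> triangle_sweep z k" for k
    using z by (auto simp: triangle_sweep_def)
  have "max 0 (1 - 2 * snd z) + (1 - \<bar>1 - 2 * snd z\<bar>) + max 0 (2 * snd z - 1) = 1"
    by (auto simp: max_def abs_if)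
  then have "(1 - fst z) * (max 0 (1 - 2 * snd z) + (1 - \<bar>1 - 2 * snd z\<bar>) + max 0 (2 * snd z - 1)) = 1 - fst z"
    by simp
  then show "(\<Sum>k\<le>2. triangle_sweep z k) = 1" by (simp add: triangle_sweep_def numeral_2_eq_2 algebra_simps)
qed (auto simp: triangle_sweep_def)

lemma continuous_map_triangle_sweep:
  "continuous_map (prod_topology unit_interval unit_interval) (simplex_top 2) triangle_sweep"
  unfolding continuous_map_in_subtopology continuous_map_componentwise_UNIV
proof (intro conjI allI)
  have proj: "continuous_map (prod_topology unit_interval unit_interval) euclideanreal fst"
    "continuous_map (prod_topology unit_interval unit_interval) euclideanreal snd"
    using continuous_map_fst[of unit_interval unit_interval] continuous_map_snd[of unit_interval unit_interval]
    unfolding continuous_map_in_subtopology by blast+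
  show "continuous_map (prod_topology unit_interval unit_interval) euclideanreal (\<lambda>z. triangle_sweep z k)" for k
    unfolding triangle_sweep_def by (cases "k = 0"; cases "k = 1"; cases "k = 2"; (simp only: if_True if_False)?)
      (auto intro!: continuous_map_diff continuous_map_add continuous_map_real_mult continuous_map_real_max
        continuous_map_real_abs proj continuous_intros)
qed (use triangle_sweep_in_standard_simplex in auto)

lemma triangle_sweep_boundary:
  "0 \<le> \<tau> ==> \<tau> \<le> 1 / 2 ==> triangle_sweep (0, \<tau>) = simplical_face 2 (edge_point (2 * \<tau>))"
  "1 / 2 < \<tau> ==> triangle_sweep (0, \<tau>) = simplical_face 0 (edge_point (2 * \<tau> - 1))"
  "triangle_sweep (1, \<tau>) = simplical_face 1 (edge_point \<tau>)"
  "triangle_sweep (u, 0) = simplical_face 1 (edge_point 0)" "triangle_sweep (u, 1) = simplical_face 1 (edge_point 1)"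
  by (auto simp: triangle_sweep_def simplical_face_def edge_point_def fun_eq_iff)

lemma loop_homotopic_triangle:
  assumes t: "kan_complex.triangle (Sing X) singular_face a b c"
    and ends: "singular_face 1 0 a = vertex x0" "singular_face 1 1 a = vertex x0" "singular_face 1 0 b = vertex x0"
  shows "loop_homotopic X x0 (loop_concat (edge_path a) (edge_path b)) (edge_path c)"
proof -
  interpret S: kan_complex "Sing X" singular_face
    by (rule kan_complex_Sing)
  obtain F where F: "singular_simplex 2 X F" "singular_face 2 2 F = a" "singular_face 2 0 F = b" "singular_face 2 1 F = c"
    using t unfolding S.triangle_def by auto
  have face: "F (simplical_face k (edge_point \<tau>)) = edge_path (singular_face 2 k F) \<tau>" if "\<tau> \<in> {0..1}" for k \<tau>
    using edge_point_in[OF that] by (simp add: singular_face_def edge_path_def)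
  have c: "edge_path c 0 = x0" "edge_path c 1 = x0"
    using edge_path_in_loops[of X c x0] S.triangle_edges[OF t] ends by (auto simp: loops_def)
  show ?thesis
    unfolding loop_homotopic_def
  proof (subst homotopic_with, simp, intro exI conjI ballI)
    show "continuous_map (prod_topology unit_interval unit_interval) X (F \<circ> triangle_sweep)"
      using F(1) by (intro continuous_map_compose[OF continuous_map_triangle_sweep]) (simp add: singular_simplex_def)
    fix \<tau> :: real assume "\<tau> \<in> topspace unit_interval"
    then have \<tau>: "\<tau> \<in> {0..1}" by simp
    show "(F \<circ> triangle_sweep) (0, \<tau>) = loop_concat (edge_path a) (edge_path b) \<tau>"
    proof (cases "\<tau> \<le> 1 / 2")
      case True
      then show ?thesis
        using \<tau> face[of "2 * \<tau>" 2] F(2) triangle_sweep_boundary(1)[of \<tau>] by (simp add: loop_concat_def)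
    next
      case False
      then show ?thesis
        using \<tau> face[of "2 * \<tau> - 1" 0] F(3) triangle_sweep_boundary(2)[of \<tau>] by (simp add: loop_concat_def)
    qed
    show "(F \<circ> triangle_sweep) (1, \<tau>) = edge_path c \<tau>"
      using face[OF \<tau>, of 1] F(4) triangle_sweep_boundary(3)[of \<tau>] by simp
  next
    fix u :: real
    show "(F \<circ> triangle_sweep) (u, 0) = x0" "(F \<circ> triangle_sweep) (u, 1) = x0"
      using face[of 0 1] face[of 1 1] F(4) c triangle_sweep_boundary(4,5)[of u] by simp_all
  qed
qed

subsection \<open>Invariant means on loops\<close>

lemma amenable_group_right_invariant_mean:
  assumes "amenable_group G"
  obtains m where "mean (carrier G) m"
    "\<And>g f. g \<in> carrier G ==> bdd_fun f ==> m (\<lambda>C. f (C \<otimes>\<^bsub>G\<^esub> g)) = m f"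
proof -
  interpret G: group G
    using assms by (simp add: amenable_group_def)
  obtain \<mu> where \<mu>: "\<forall>A. A \<subseteq> carrier G --> 0 \<le> \<mu> A" "\<mu> (carrier G) = (1 :: real)"
    "\<forall>A B. A \<subseteq> carrier G --> B \<subseteq> carrier G --> A \<inter> B = {} --> \<mu> (A \<union> B) = \<mu> A + \<mu> B"
    "\<forall>g\<in>carrier G. \<forall>A. A \<subseteq> carrier G --> \<mu> ((\<lambda>x. g \<otimes>\<^bsub>G\<^esub> x) ` A) = \<mu> A"
    using assms unfolding amenable_group_def by (elim conjE exE) (rule that)
  interpret fa_probability "carrier G" \<mu>
    by unfold_locales (use \<mu>(1-3) in blast)+
  obtain m where m: "mean (carrier G) m"
    "\<And>h f. bij_betw h (carrier G) (carrier G) ==> (\<And>A. A \<subseteq> carrier G ==> \<mu> (h ` A) = \<mu> A) ==> bdd_fun f ==>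
      m (\<lambda>x. f (h x)) = m f"
    using invariant_mean_of_measure by blast
  show thesis
  proof (rule that)
    show "mean (carrier G) (\<lambda>f. m (\<lambda>C. f (inv\<^bsub>G\<^esub> C)))" by (rule mean_map[OF m(1)]) simp
    fix g and f :: "'a => real" assume g: "g \<in> carrier G" and f: "bdd_fun f"
    let ?h = "\<lambda>C. inv\<^bsub>G\<^esub> g \<otimes>\<^bsub>G\<^esub> C"
    have bij: "bij_betw ?h (carrier G) (carrier G)"
      by (rule bij_betw_byWitness[where f' = "\<lambda>C. g \<otimes>\<^bsub>G\<^esub> C"]) (use g in \<open>auto simp: G.m_assoc[symmetric]\<close>)
    have "m (\<lambda>C. f (inv\<^bsub>G\<^esub> C \<otimes>\<^bsub>G\<^esub> g)) = m (\<lambda>C. f (inv\<^bsub>G\<^esub> (?h C)))"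
      by (rule mean_cong[OF m(1) bdd_fun_compose[OF f] bdd_fun_compose[OF f]])
        (use g in \<open>simp add: G.inv_mult_group\<close>)
    also have "... = m (\<lambda>C. f (inv\<^bsub>G\<^esub> C))"
      by (rule m(2)[OF bij, of "\<lambda>C. f (inv\<^bsub>G\<^esub> C)"]) (use \<mu>(4) g bdd_fun_compose[OF f] in auto)
    finally show "m (\<lambda>C. f (inv\<^bsub>G\<^esub> C \<otimes>\<^bsub>G\<^esub> g)) = m (\<lambda>C. f (inv\<^bsub>G\<^esub> C))" .
  qed
qed

context
  fixes X :: "'a topology" and U :: "'a set" and x0 :: 'a
begin

definition class_loop :: "(real => 'a) set => real => 'a" where
  "class_loop C = (SOME p. p \<in> loops (subtopology X U) x0 \<and> loop_class X x0 p = C)"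

lemma class_loop:
  assumes "C \<in> carrier (fundamental_group_image X U x0)"
  shows "class_loop C \<in> loops (subtopology X U) x0" "loop_class X x0 (class_loop C) = C"
proof -
  have "\<exists>p. p \<in> loops (subtopology X U) x0 \<and> loop_class X x0 p = C"
    using assms unfolding fundamental_group_image_def by auto
  from someI_ex[OF this] show "class_loop C \<in> loops (subtopology X U) x0" "loop_class X x0 (class_loop C) = C"
    unfolding class_loop_def by blast+
qed

lemma loops_subtopology: "p \<in> loops (subtopology X U) x0 ==> p \<in> loops X x0"
  by (auto simp: loops_def continuous_map_in_subtopology)

lemma loop_in_loop_class: "p \<in> loops X x0 ==> p \<in> loop_class X x0 p"
  by (auto simp: loop_class_def loop_homotopic_def loops_def)

lemma edge_path_in_loop_class:
  assumes p: "p \<in> loops X x0"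
  shows "edge_path (path_edge p) \<in> loop_class X x0 p"
proof -
  have loop: "edge_path (path_edge p) \<in> loops X x0" using path_edge_loop[OF p] by (rule edge_path_in_loops)
  moreover have "homotopic_with (\<lambda>h. h 0 = x0 \<and> h 1 = x0) unit_interval X p (edge_path (path_edge p))"
    by (rule homotopic_with_equal) (use p loop edge_path_path_edge[of _ p] in \<open>auto simp: loops_def\<close>)
  ultimately show ?thesis by (simp add: loop_class_def loop_homotopic_def)
qed

lemma homotopic_class_loop_mult:
  fixes g R
  assumes G: "group (fundamental_group_image X U x0)" and C: "C \<in> carrier (fundamental_group_image X U x0)"
    and g: "g \<in> kan_complex.loops_at (Sing (subtopology X U)) singular_face (vertex x0)"
    and R: "R \<in> kan_complex.loops_at (Sing (subtopology X U)) singular_face (vertex x0)"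
    and triangle: "kan_complex.triangle (Sing X) singular_face (path_edge (class_loop C)) g R"
  shows "kan_complex.homotopic (Sing X) singular_face 1
    (path_edge (class_loop (C \<otimes>\<^bsub>fundamental_group_image X U x0\<^esub> loop_class X x0 (edge_path g)))) R"
proof -
  let ?G = "fundamental_group_image X U x0" and ?g = "loop_class X x0 (edge_path g)"
  interpret W: kan_complex "Sing (subtopology X U)" singular_face
    by (rule kan_complex_Sing)
  have g_loop: "edge_path g \<in> loops (subtopology X U) x0"
    using W.loops_atD[OF g] by (intro edge_path_in_loops) auto
  then have "?g \<in> carrier ?G" unfolding fundamental_group_image_def by simp
  then have D: "C \<otimes>\<^bsub>?G\<^esub> ?g \<in> carrier ?G"
    using group.is_monoid[OF G] C by (intro monoid.m_closed)
  have R_loop: "edge_path R \<in> loops X x0"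
    using W.loops_atD[OF R] by (intro loops_subtopology edge_path_in_loops) auto
  have in_class: "edge_path (path_edge (class_loop C)) \<in> C"
    using edge_path_in_loop_class[OF loops_subtopology[OF class_loop(1)[OF C]]] class_loop(2)[OF C] by simp
  have "loop_homotopic X x0 (loop_concat (edge_path (path_edge (class_loop C))) (edge_path g)) (edge_path R)"
    using path_edge_loop[OF class_loop(1)[OF C]] W.loops_atD[OF g] by (intro loop_homotopic_triangle[OF triangle]) auto
  then have "edge_path R \<in> C \<otimes>\<^bsub>?G\<^esub> ?g"
    using in_class loop_in_loop_class[OF loops_subtopology[OF g_loop]] R_loop
    unfolding fundamental_group_image_def fundamental_group_def by auto
  then have "loop_homotopic X x0 (class_loop (C \<otimes>\<^bsub>?G\<^esub> ?g)) (edge_path R)"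
    using class_loop(2)[OF D] by (auto simp: loop_class_def)
  then show ?thesis
    using homotopic_path_edges path_edge_edge_path[of "subtopology X U" R] W.loops_atD[OF R] by fastforce
qed

lemma loop_mean_amenable:
  assumes amenable: "amenable_in X U" and x0: "x0 \<in> U"
  shows "\<exists>M. kan_complex.loop_mean (Sing X) singular_face
    (kan_complex.loops_at (Sing (subtopology X U)) singular_face (vertex x0)) M"
proof -
  let ?G = "fundamental_group_image X U x0"
  interpret S: kan_complex "Sing X" singular_face
    by (rule kan_complex_Sing)
  interpret W: kan_complex "Sing (subtopology X U)" singular_face
    by (rule kan_complex_Sing)
  have G: "amenable_group ?G" using amenable x0 by (auto simp: amenable_in_def)
  obtain m where m: "mean (carrier ?G) m" "\<And>g f. g \<in> carrier ?G ==> bdd_fun f ==> m (\<lambda>C. f (C \<otimes>\<^bsub>?G\<^esub> g)) = m f"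
    using amenable_group_right_invariant_mean[OF G] by blast
  define q where "q C = path_edge (class_loop C)" for C
  have q: "q C \<in> W.loops_at (vertex x0)" if "C \<in> carrier ?G" for C
    using path_edge_loop[OF class_loop(1)[OF that]] by (simp add: q_def W.loops_at_def)
  have "S.loop_mean (W.loops_at (vertex x0)) (\<lambda>f. m (\<lambda>C. f (q C)))"
    unfolding S.loop_mean_def
  proof (intro conjI ballI allI impI)
    show "mean (W.loops_at (vertex x0)) (\<lambda>f. m (\<lambda>C. f (q C)))" using m(1) q by (rule mean_map)
    fix g R f
    assume g: "g \<in> W.loops_at (vertex x0)" and f: "bdd_fun f" "\<forall>q q'. S.homotopic 1 q q' --> f q = f q'"
      and R: "\<forall>q\<in>W.loops_at (vertex x0). R q \<in> W.loops_at (vertex x0) \<and> S.triangle q g (R q)"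
    let ?g = "loop_class X x0 (edge_path g)"
    have "edge_path g \<in> loops (subtopology X U) x0" using W.loops_atD[OF g] by (intro edge_path_in_loops) auto
    then have g_class: "?g \<in> carrier ?G" unfolding fundamental_group_image_def by simp
    have "f (R (q C)) = f (q (C \<otimes>\<^bsub>?G\<^esub> ?g))" if C: "C \<in> carrier ?G" for C
    proof -
      have "S.homotopic 1 (q (C \<otimes>\<^bsub>?G\<^esub> ?g)) (R (q C))"
        unfolding q_def using G R q[OF C] C g
        by (intro homotopic_class_loop_mult) (auto simp: amenable_group_def q_def)
      then show ?thesis using f(2) by simp
    qed
    then have "m (\<lambda>C. f (R (q C))) = m (\<lambda>C. f (q (C \<otimes>\<^bsub>?G\<^esub> ?g)))"
      by (rule mean_cong[OF m(1) bdd_fun_compose[OF f(1)] bdd_fun_compose[OF f(1)]])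
    also have "... = m (\<lambda>C. f (q C))" by (rule m(2)[OF g_class bdd_fun_compose[OF f(1), of q]])
    finally show "m (\<lambda>C. f (R (q C))) = m (\<lambda>C. f (q C))" .
  qed
  then show ?thesis by blast
qed

end

section \<open>The Cech zigzag\<close>

definition saturated :: "'a topology => 'a set => nat => ((nat => real) => 'a) set" where
  "saturated X V = saturate (Sing X) singular_face (Sing (subtopology X V))"

lemma Sing_subtopology: "Sing (subtopology X V) n \<subseteq> Sing X n"
  by (auto simp: singular_simplex_subtopology)

lemma kan_pair_Sing: "kan_pair (Sing X) (Sing (subtopology X V)) singular_face"
proof (intro kan_pair.intro kan_pair_axioms.intro kan_complex_Sing)
  show "Sing (subtopology X V) n \<subseteq> Sing X n" for n
    by (rule Sing_subtopology)
  show "\<exists>e\<in>Sing (subtopology X V) 1. singular_face 1 0 e = x \<and> singular_face 1 1 e = x"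
    if "x \<in> Sing (subtopology X V) 0" for x
    using that by (intro constant_edge_exists) simp
qed

lemma saturated_mono: "V \<subseteq> V' ==> saturated X V n \<subseteq> saturated X V' n"
  unfolding saturated_def by (rule saturate_mono) (use singular_simplex_mono in blast)

lemma Sing_subset_saturated: "Sing (subtopology X V) n \<subseteq> saturated X V n"
  unfolding saturated_def by (rule kan_pair.subset_sat[OF kan_pair_Sing])

lemma saturated_subset_Sing: "saturated X V n \<subseteq> Sing X n"
  unfolding saturated_def by (rule kan_pair.sat_subset[OF kan_pair_Sing])

lemma kan_triple_Sing:
  assumes U: "amenable_in X U" and V: "V \<subseteq> U"
  shows "kan_triple (Sing X) (Sing (subtopology X V)) (Sing (subtopology X U)) singular_face"
proof (intro kan_triple.intro kan_triple_axioms.intro kan_complex_Sing kan_pair_Sing)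
  show "Sing (subtopology X V) n \<subseteq> Sing (subtopology X U) n" for n
    using singular_simplex_mono[OF _ V] by blast
  show "Sing (subtopology X U) n \<subseteq> Sing X n" for n
    by (rule Sing_subtopology)
  fix s assume "s \<in> Sing (subtopology X V) 0"
  then obtain a where "a \<in> topspace (subtopology X V)" and s: "s = vertex a"
    using singular_simplex_0E[of "subtopology X V" s] by blast
  then have "a \<in> U" using V by auto
  then show "\<exists>M. kan_complex.loop_mean (Sing X) singular_face
      (kan_complex.loops_at (Sing (subtopology X U)) singular_face s) M"
    unfolding s by (rule loop_mean_amenable[OF U])
qed

lemma saturated_cycle_bounds:
  assumes "amenable_in X U" "V \<subseteq> U" and z: "z \<in> l1_chains (saturated X V (Suc p))" "is_cycle (Suc p) z"
  obtains b where "b \<in> l1_chains (saturated X V (Suc (Suc p)))" "rchain_boundary (Suc (Suc p)) b = z"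
proof -
  interpret kan_triple "Sing X" "Sing (subtopology X V)" "Sing (subtopology X U)" singular_face
    using assms(1,2) by (rule kan_triple_Sing)
  interpret singular_kan_mean sat base mu
    by (intro singular_kan_mean.intro kan_mean_axioms)
  show thesis
    using cycle_bounds[OF z[unfolded saturated_def]] that unfolding saturated_def .
qed

subsection \<open>The Cech differential and its contraction\<close>

definition cech_sign :: "nat => nat set => real" where
  "cech_sign i J = (-1) ^ card {j \<in> J. j < i}"

definition cech_delta :: "nat => (nat set => 's => real) => nat set => 's => real" where
  "cech_delta N a J s = (\<Sum>i\<in>{..<N} - J. cech_sign i J * a (insert i J) s)"

definition cech_contraction :: "('s => nat) => (nat set => 's => real) => nat set => 's => real" where
  "cech_contraction c a J s = (if c s \<in> J then cech_sign (c s) (J - {c s}) * a (J - {c s}) s else 0)"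

lemma cech_sign_square: "cech_sign i J * cech_sign i J = 1"
  by (simp add: cech_sign_def flip: power_add mult_2)

lemma cech_sign_insert:
  assumes "finite J" "k \<notin> J"
  shows "cech_sign i (insert k J) = (if k < i then - cech_sign i J else cech_sign i J)"
proof -
  have "{j \<in> insert k J. j < i} = (if k < i then insert k {j \<in> J. j < i} else {j \<in> J. j < i})" by auto
  then show ?thesis using assms by (simp add: cech_sign_def)
qed

lemma cech_sign_swap:
  assumes "finite J" "i \<notin> J" "k \<notin> J" "i \<noteq> k"
  shows "cech_sign i J * cech_sign k (insert i J) = - (cech_sign k J * cech_sign i (insert k J))"
  using assms by (simp add: cech_sign_insert)

lemma cech_delta_cong:
  "(\<And>i. i < N ==> a (insert i J) s = b (insert i J) s) ==> cech_delta N a J s = cech_delta N b J s"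
  unfolding cech_delta_def by (intro sum.cong) auto

lemma cech_delta_diff:
  "cech_delta N (\<lambda>J s. a J s - b J s) J s = cech_delta N a J s - cech_delta N b J s"
  by (simp add: cech_delta_def right_diff_distrib sum_subtractf)

lemma cech_delta_square:
  assumes J: "finite J"
  shows "cech_delta N (cech_delta N a) J s = 0"
proof -
  let ?A = "{..<N} - J"
  let ?g = "\<lambda>(i, k). cech_sign i J * (cech_sign k (insert i J) * a (insert k (insert i J)) s)"
  let ?S = "Sigma ?A (\<lambda>i. ?A - {i})"
  have "cech_delta N (cech_delta N a) J s = (\<Sum>i\<in>?A. \<Sum>k\<in>?A - {i}. ?g (i, k))"
    unfolding cech_delta_def sum_distrib_left by (intro sum.cong) auto
  also have "... = (\<Sum>p\<in>?S. ?g p)" by (subst sum.Sigma) (auto intro: sum.cong)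
  finally have double: "cech_delta N (cech_delta N a) J s = (\<Sum>p\<in>?S. ?g p)" .
  also have "... = (\<Sum>p\<in>?S. ?g (prod.swap p))"
    by (rule sum.reindex_bij_witness[where i = prod.swap and j = prod.swap]) auto
  also have "... = (\<Sum>p\<in>?S. - ?g p)"
  proof (rule sum.cong[OF refl])
    fix p assume "p \<in> ?S"
    then obtain i k where p: "p = (i, k)" "i \<notin> J" "k \<notin> J" "k \<noteq> i" by auto
    then show "?g (prod.swap p) = - ?g p"
      using cech_sign_swap[OF J p(3,2,4)] by (simp add: insert_commute mult.assoc[symmetric])
  qed
  finally show ?thesis using double by (simp add: sum_negf)
qed

lemma cech_homotopy_outside:
  assumes "c s \<notin> J" and "a J s \<noteq> 0 ==> c s < N"
  shows "cech_delta N (cech_contraction c a) J s = a J s"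
proof -
  have "cech_delta N (cech_contraction c a) J s = (\<Sum>i\<in>{..<N} - J. if i = c s then a J s else 0)"
    unfolding cech_delta_def
  proof (rule sum.cong[OF refl])
    fix i assume "i \<in> {..<N} - J"
    then show "cech_sign i J * cech_contraction c a (insert i J) s = (if i = c s then a J s else 0)"
      using assms(1) cech_sign_square[of i J]
      by (cases "i = c s") (auto simp: cech_contraction_def mult.assoc[symmetric])
  qed
  also have "... = a J s" using assms by auto
  finally show ?thesis .
qed

lemma cech_homotopy_inside:
  assumes J: "J \<subseteq> {..<N}" and c: "c s \<in> J"
  shows "cech_delta N (cech_contraction c a) J s + cech_contraction c (cech_delta N a) J s = a J s"
proof -
  define L where "L = J - {c s}"
  have L: "J = insert (c s) L" "c s \<notin> L" "finite L" using c J finite_subset by (auto simp: L_def)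
  let ?g = "\<lambda>i. cech_sign (c s) L * cech_sign i L * a (insert i L) s"
  have indices: "{..<N} - L = insert (c s) ({..<N} - J)" using c J L by auto
  have "cech_contraction c (cech_delta N a) J s = (\<Sum>i\<in>{..<N} - L. ?g i)"
    using c by (simp add: cech_contraction_def cech_delta_def L_def[symmetric] sum_distrib_left mult.assoc)
  also have "... = ?g (c s) + (\<Sum>i\<in>{..<N} - J. ?g i)" unfolding indices using c by simp
  also have "?g (c s) = a J s" by (simp add: cech_sign_square L(1)[symmetric])
  finally have "cech_contraction c (cech_delta N a) J s = a J s + (\<Sum>i\<in>{..<N} - J. ?g i)" .
  moreover have "cech_delta N (cech_contraction c a) J s = (\<Sum>i\<in>{..<N} - J. - ?g i)"
    unfolding cech_delta_def
  proof (rule sum.cong[OF refl])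
    fix i assume "i \<in> {..<N} - J"
    then have i: "i \<noteq> c s" "i \<notin> L" using L(1) by auto
    then have "insert i J - {c s} = insert i L" using L by auto
    then have "cech_contraction c a (insert i J) s = cech_sign (c s) (insert i L) * a (insert i L) s"
      using c by (simp add: cech_contraction_def)
    moreover have "cech_sign i J * cech_sign (c s) (insert i L) = - (cech_sign (c s) L * cech_sign i L)"
      using i L by (simp add: cech_sign_insert)
    ultimately show "cech_sign i J * cech_contraction c a (insert i J) s = - ?g i"
      by (simp add: mult.assoc[symmetric])
  qed
  ultimately show ?thesis by (simp add: sum_negf)
qed

lemma cech_homotopy:
  assumes "J \<subseteq> {..<N}" and "a J s \<noteq> 0 ==> c s < N"
  shows "cech_delta N (cech_contraction c a) J s + cech_contraction c (cech_delta N a) J s = a J s"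
proof (cases "c s \<in> J")
  case True
  then show ?thesis by (rule cech_homotopy_inside[OF assms(1)])
next
  case False
  then show ?thesis using cech_homotopy_outside[of c s J a N] assms(2) by (simp add: cech_contraction_def)
qed

lemma l1_chains_cech_delta:
  assumes "\<And>i. i < N ==> a (insert i J) \<in> l1_chains K"
  shows "cech_delta N a J \<in> l1_chains K"
  unfolding cech_delta_def[abs_def] by (rule l1_chains_sum, rule l1_chains_scale) (use assms in auto)

lemma boundary_cech_delta:
  assumes "\<And>i. i < N ==> l1 (a (insert i J))"
  shows "rchain_boundary (Suc p) (cech_delta N a J) = cech_delta N (\<lambda>J. rchain_boundary (Suc p) (a J)) J"
proof -
  have "rchain_boundary (Suc p) (cech_delta N a J) =
      (\<lambda>t. \<Sum>i\<in>{..<N} - J. rchain_boundary (Suc p) (\<lambda>s. cech_sign i J * a (insert i J) s) t)"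
    unfolding cech_delta_def[abs_def] by (rule boundary_sum, rule l1_scale) (use assms in auto)
  then show ?thesis by (simp add: boundary_scale cech_delta_def[abs_def])
qed

lemma l1_cech_contraction:
  assumes J: "finite J" and a: "\<And>i. i \<in> J ==> l1 (a (J - {i}))"
  shows "l1 (cech_contraction c a J)"
proof (rule l1_mono)
  show "l1 (\<lambda>s. \<Sum>i\<in>J. \<bar>a (J - {i}) s\<bar>)"
    by (rule l1_sum) (use a in \<open>simp add: l1_def\<close>)
  show "\<bar>cech_contraction c a J s\<bar> \<le> \<bar>\<Sum>i\<in>J. \<bar>a (J - {i}) s\<bar>\<bar>" for s
  proof (cases "c s \<in> J")
    case True
    then have "\<bar>cech_contraction c a J s\<bar> = \<bar>a (J - {c s}) s\<bar>"
      by (simp add: cech_contraction_def cech_sign_def abs_mult power_abs)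
    also have "... \<le> (\<Sum>i\<in>J. \<bar>a (J - {i}) s\<bar>)"
      using J True by (intro member_le_sum[of "c s" J "\<lambda>i. \<bar>a (J - {i}) s\<bar>"]) auto
    finally show ?thesis by simp
  qed (simp add: cech_contraction_def)
qed

subsection \<open>The zigzag of a small cycle\<close>

lemma singular_face_image:
  "k \<le> Suc p ==> singular_face (Suc p) k s ` standard_simplex p \<subseteq> s ` standard_simplex (Suc p)"
  using simplical_face_in[of k p] by (auto simp: singular_face_def)

lemma l1_chains_mono: "A \<subseteq> B ==> w \<in> l1_chains A ==> w \<in> l1_chains B"
  by (auto simp: l1_chains_def)

locale amenable_cover =
  fixes X :: "'a topology" and W :: "nat => 'a set" and N k :: nat
  assumes amenable: "i < N ==> amenable_in X (W i)"
    and multiplicity: "J \<subseteq> {..<N} ==> topspace X \<inter> \<Inter> (W ` J) \<noteq> {} ==> card J \<le> k"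
begin

definition small_in :: "nat set => nat => ((nat => real) => 'a) set" where
  "small_in J p = {s \<in> Sing X p. s ` standard_simplex p \<subseteq> \<Inter> (W ` J) \<and> (\<exists>i<N. s ` standard_simplex p \<subseteq> W i)}"

definition chosen :: "nat => ((nat => real) => 'a) => nat" where
  "chosen p s = (SOME i. i < N \<and> s ` standard_simplex p \<subseteq> W i)"

lemma chosen: "s \<in> small_in J p ==> chosen p s < N \<and> s ` standard_simplex p \<subseteq> W (chosen p s)"
  unfolding chosen_def by (rule someI_ex) (auto simp: small_in_def)

lemma small_in_face:
  assumes s: "s \<in> small_in J (Suc p)" and i: "i \<le> Suc p"
  shows "singular_face (Suc p) i s \<in> small_in J p"
proof -
  have "singular_simplex p X (singular_face (Suc p) i s)"
    using singular_simplex_singular_face[where p = "Suc p" and f = s and X = X and k = i] s i by (simp add: small_in_def)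
  then show ?thesis using s order_trans[OF singular_face_image[OF i, of s]] unfolding small_in_def by blast
qed

lemma small_in_subset_saturated: "small_in J p \<subseteq> saturated X (\<Inter> (W ` J)) p"
  using Sing_subset_saturated[where X = X and V = "\<Inter> (W ` J)" and n = p] by (auto simp: small_in_def singular_simplex_subtopology)

lemma card_le_multiplicity:
  assumes J: "J \<subseteq> {..<N}" and s: "s \<in> small_in J p"
  shows "card J \<le> k"
proof -
  obtain x where x: "x \<in> standard_simplex p" using nonempty_standard_simplex[of p] by blast
  have "s x \<in> topspace X"
    using s x continuous_map_image_subset_topspace[of "simplex_top p" X s]
    by (auto simp: small_in_def singular_simplex_def)
  moreover have "s x \<in> \<Inter> (W ` J)" using s x by (auto simp: small_in_def)
  ultimately show ?thesis using multiplicity[OF J] by blast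
qed

lemma cech_contraction_small_in:
  assumes J: "finite J" and a: "\<And>i. i \<in> J ==> a (J - {i}) \<in> l1_chains (small_in (J - {i}) p)"
  shows "cech_contraction (chosen p) a J \<in> l1_chains (small_in J p)"
proof -
  have "s \<in> small_in J p" if "cech_contraction (chosen p) a J s \<noteq> 0" for s
  proof -
    have c: "chosen p s \<in> J" "a (J - {chosen p s}) s \<noteq> 0"
      using that by (auto simp: cech_contraction_def split: if_splits)
    have s: "s \<in> small_in (J - {chosen p s}) p" by (rule l1_chains_support[OF a[OF c(1)]]) (rule c(2))
    have "s ` standard_simplex p \<subseteq> W j" if "j \<in> J" for j
      using chosen[OF s] s that by (cases "j = chosen p s") (auto simp: small_in_def)
    then show ?thesis using s by (auto simp: small_in_def)
  qed
  moreover have "l1 (cech_contraction (chosen p) a J)"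
    using l1_chains_l1[OF a] by (intro l1_cech_contraction[OF J]) auto
  ultimately show ?thesis by (simp add: l1_chains_def)
qed

end

locale small_cycle = amenable_cover X W N k
  for X :: "'a topology" and W :: "nat => 'a set" and N k :: nat +
  fixes n :: nat and z :: "'a rchain"
  assumes multiplicity_le: "k \<le> n" and z: "z \<in> l1_chains (small_in {} n)" and z_cycle: "is_cycle n z"
begin

primrec residue :: "nat => nat set => 'a rchain" where
  "residue 0 = (\<lambda>J. if J = {} then z else (\<lambda>_. 0))"
| "residue (Suc q) = (\<lambda>J. rchain_boundary (n - q) (cech_contraction (chosen (n - q)) (residue q) J))"

definition zigzag :: "nat => nat set => 'a rchain" where
  "zigzag q = cech_contraction (chosen (n - q)) (residue q)"

lemma residue_Suc: "residue (Suc q) J = rchain_boundary (n - q) (zigzag q J)"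
  by (simp add: zigzag_def)

lemma residue_small_in: "q \<le> n ==> finite J ==> residue q J \<in> l1_chains (small_in J (n - q))"
proof (induction q arbitrary: J)
  case 0
  then show ?case
    using z by (simp add: l1_chains_zero)
next
  case (Suc q)
  then have degree: "n - q = Suc (n - Suc q)" by simp
  have "zigzag q J \<in> l1_chains (small_in J (n - q))"
    unfolding zigzag_def by (rule cech_contraction_small_in) (use Suc in auto)
  then show ?case
    unfolding residue_Suc degree by (rule l1_chains_boundary) (rule small_in_face)
qed

lemma zigzag_small_in: "q \<le> n ==> finite J ==> zigzag q J \<in> l1_chains (small_in J (n - q))"
  unfolding zigzag_def by (intro cech_contraction_small_in residue_small_in) auto

lemma residue_eq_0: "finite J ==> card J \<noteq> q ==> residue q J = (\<lambda>_. 0)"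
proof (induction q arbitrary: J)
  case (Suc q)
  then have "residue q (J - {i}) = (\<lambda>_. 0)" if "i \<in> J" for i
    using that card_Suc_Diff1[of J i] by (intro Suc.IH) auto
  then have "cech_contraction (chosen (n - q)) (residue q) J = (\<lambda>_. 0)"
    by (auto simp: cech_contraction_def fun_eq_iff)
  then show ?case
    by (simp add: boundary_zero)
qed simp

lemma is_cycle_residue:
  assumes q: "q \<le> n" and J: "finite J"
  shows "is_cycle (n - q) (residue q J)"
proof -
  consider "q = 0" | "n - q = 0" | r p where "q = Suc r" "n - Suc r = Suc p"
    by (cases q; cases "n - q") auto
  then show ?thesis
  proof cases
    case 1
    then show ?thesis using z_cycle by (simp add: is_cycle_def boundary_zero)
  next
    case 2
    then show ?thesis by (simp add: is_cycle_def rchain_boundary_def)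
  next
    case 3
    then have degree: "n - r = Suc (Suc p)" by arith
    have "l1 (zigzag r J)" using l1_chains_l1[OF zigzag_small_in[of r J]] q J 3(1) by simp
    then show ?thesis unfolding 3(1) residue_Suc 3(2) degree by (rule boundary_boundary)
  qed
qed

lemma cech_delta_zigzag_if_residue:
  assumes q: "q \<le> n" and J: "J \<subseteq> {..<N}"
    and residue: "\<And>L. L \<subseteq> {..<N} ==> cech_delta N (residue q) L = (\<lambda>_. 0)"
  shows "cech_delta N (zigzag q) J = residue q J"
proof
  fix s
  have "chosen (n - q) s < N" if "residue q J s \<noteq> 0"
    using chosen[OF l1_chains_support[OF residue_small_in[OF q finite_subset[OF J]]]] that by simp
  then have "cech_delta N (zigzag q) J s + cech_contraction (chosen (n - q)) (cech_delta N (residue q)) J s =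
      residue q J s"
    using cech_homotopy[OF J, of "residue q" s "chosen (n - q)"] by (simp add: zigzag_def)
  moreover have "cech_delta N (residue q) (J - {chosen (n - q) s}) = (\<lambda>_. 0)"
    by (rule residue) (use J in blast)
  ultimately show "cech_delta N (zigzag q) J s = residue q J s" by (simp add: cech_contraction_def split: if_splits)
qed

lemma cech_delta_residue: "q \<le> n ==> J \<subseteq> {..<N} ==> cech_delta N (residue q) J = (\<lambda>_. 0)"
proof (induction q arbitrary: J)
  case 0
  then show ?case
    by (simp add: cech_delta_def fun_eq_iff)
next
  case (Suc q)
  then have q: "q \<le> n" and degree: "n - q = Suc (n - Suc q)" and J: "finite J" using finite_subset by auto
  have "l1 (zigzag q (insert i J))" for i
    using l1_chains_l1[OF zigzag_small_in[OF q]] J by blast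
  then have "cech_delta N (residue (Suc q)) J = rchain_boundary (n - q) (cech_delta N (zigzag q) J)"
    unfolding residue_Suc[abs_def] degree by (intro boundary_cech_delta[symmetric])
  also have "... = rchain_boundary (n - q) (residue q J)"
    using cech_delta_zigzag_if_residue[OF q Suc.prems(2) Suc.IH[OF q]] by simp
  finally show ?case
    using is_cycle_residue[OF q J] by (simp add: is_cycle_def)
qed

lemma cech_delta_zigzag: "q \<le> n ==> J \<subseteq> {..<N} ==> cech_delta N (zigzag q) J = residue q J"
  by (intro cech_delta_zigzag_if_residue cech_delta_residue)

lemma zigzag_multiplicity:
  assumes J: "J \<subseteq> {..<N}"
  shows "zigzag k J = (\<lambda>_. 0)"
proof (rule ccontr)
  have fin: "finite J" using J finite_subset by blast
  assume "zigzag k J \<noteq> (\<lambda>_. 0)"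
  then obtain s where s: "zigzag k J s \<noteq> 0" by auto
  then have "card J \<le> k"
    using card_le_multiplicity[OF J] l1_chains_support[OF zigzag_small_in[OF multiplicity_le fin]] by blast
  moreover have "chosen (n - k) s \<in> J" "residue k (J - {chosen (n - k) s}) s \<noteq> 0"
    using s by (auto simp: zigzag_def cech_contraction_def split: if_splits)
  moreover from this(2) have "card (J - {chosen (n - k) s}) = k"
    using residue_eq_0[of "J - {chosen (n - k) s}" k] fin by fastforce
  ultimately show False
    using card_Suc_Diff1[OF fin, of "chosen (n - k) s"] by simp
qed

definition splitting :: "nat => (nat set => 'a rchain) => (nat set => 'a rchain) => bool" where
  "splitting q b r \<longleftrightarrow>
    (\<forall>J. J \<subseteq> {..<N} --> J \<noteq> {} --> b J \<in> l1_chains (saturated X (\<Inter> (W ` J)) (Suc (n - q))) \<and>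
      zigzag q J = (\<lambda>s. rchain_boundary (Suc (n - q)) (b J) s + r J s)) \<and>
    (\<forall>J. J \<subseteq> {..<N} --> cech_delta N r J = (\<lambda>_. 0))"

lemma splittingD:
  assumes "splitting q b r" "J \<subseteq> {..<N}"
  shows "J \<noteq> {} ==> b J \<in> l1_chains (saturated X (\<Inter> (W ` J)) (Suc (n - q)))"
    "J \<noteq> {} ==> zigzag q J = (\<lambda>s. rchain_boundary (Suc (n - q)) (b J) s + r J s)"
    "cech_delta N r J = (\<lambda>_. 0)"
  using assms unfolding splitting_def by blast+

lemma splitting_multiplicity: "splitting k (\<lambda>_ _. 0) (\<lambda>_ _. 0)"
  by (simp add: splitting_def l1_chains_zero zigzag_multiplicity boundary_zero cech_delta_def fun_eq_iff)

lemma splitting_insert: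
  assumes split: "splitting q b r" and J: "J \<subseteq> {..<N}" and i: "i < N"
  shows "b (insert i J) \<in> l1_chains (saturated X (\<Inter> (W ` J)) (Suc (n - q)))"
proof (rule l1_chains_mono[OF saturated_mono])
  show "b (insert i J) \<in> l1_chains (saturated X (\<Inter> (W ` insert i J)) (Suc (n - q)))"
    by (rule splittingD(1)[OF split]) (use J i in auto)
qed auto

lemma boundary_splitting:
  assumes split: "splitting q b r" and q: "q \<le> n" and J: "J \<subseteq> {..<N}"
  shows "rchain_boundary (Suc (n - q)) (cech_delta N b J) = residue q J"
proof
  fix s
  have "rchain_boundary (Suc (n - q)) (cech_delta N b J) s =
      cech_delta N (\<lambda>J. rchain_boundary (Suc (n - q)) (b J)) J s"
    by (subst boundary_cech_delta) (use l1_chains_l1[OF splitting_insert[OF split J]] in auto)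
  also have "... = cech_delta N (\<lambda>J s. zigzag q J s - r J s) J s"
  proof (rule cech_delta_cong)
    show "rchain_boundary (Suc (n - q)) (b (insert i J)) s = zigzag q (insert i J) s - r (insert i J) s" if "i < N" for i
      using splittingD(2)[OF split, of "insert i J"] that J by simp
  qed
  also have "... = residue q J s"
    using cech_delta_zigzag[OF q J] splittingD(3)[OF split J] by (simp add: cech_delta_diff)
  finally show "rchain_boundary (Suc (n - q)) (cech_delta N b J) s = residue q J s" .
qed

lemma zigzag_splits:
  assumes split: "splitting (Suc q) b r" and q: "Suc q \<le> n" and J: "J \<subseteq> {..<N}" "J \<noteq> {}"
  shows "\<exists>b'. b' \<in> l1_chains (saturated X (\<Inter> (W ` J)) (Suc (n - q))) \<and>
    zigzag q J = (\<lambda>s. rchain_boundary (Suc (n - q)) b' s + cech_delta N b J s)"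
proof -
  define p where "p = n - Suc q"
  have degree: "n - Suc q = p" "n - q = Suc p" using q by (auto simp: p_def)
  let ?K = "saturated X (\<Inter> (W ` J))"
  have b: "cech_delta N b J \<in> l1_chains (?K (Suc p))"
    using splitting_insert[OF split J(1)] unfolding degree by (rule l1_chains_cech_delta)
  have "zigzag q J \<in> l1_chains (small_in J (Suc p))"
    using zigzag_small_in[of q J] q finite_subset[OF J(1)] degree by simp
  then have zigzag: "zigzag q J \<in> l1_chains (?K (Suc p))" by (rule l1_chains_mono[OF small_in_subset_saturated])
  have "rchain_boundary (Suc p) (cech_delta N b J) = rchain_boundary (Suc p) (zigzag q J)"
    using boundary_splitting[OF split q J(1)] unfolding residue_Suc degree .
  then have cycle: "is_cycle (Suc p) (\<lambda>s. zigzag q J s - cech_delta N b J s)"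
    by (simp add: is_cycle_def boundary_diff[OF l1_chains_l1[OF zigzag] l1_chains_l1[OF b]])
  obtain i where i: "i \<in> J" "i < N" using J by auto
  then have "\<Inter> (W ` J) \<subseteq> W i" by blast
  then obtain b' where "b' \<in> l1_chains (?K (Suc (Suc p)))"
    "rchain_boundary (Suc (Suc p)) b' = (\<lambda>s. zigzag q J s - cech_delta N b J s)"
    using saturated_cycle_bounds[OF amenable[OF i(2)] _ l1_chains_diff[OF zigzag b] cycle] by blast
  then show ?thesis unfolding degree by (intro exI[of _ b']) simp
qed

lemma splitting_step:
  assumes split: "splitting (Suc q) b r" and q: "Suc q \<le> n"
  obtains b' where "splitting q b' (cech_delta N b)"
proof -
  define b' where "b' J = (SOME b'. b' \<in> l1_chains (saturated X (\<Inter> (W ` J)) (Suc (n - q))) \<and>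
    zigzag q J = (\<lambda>s. rchain_boundary (Suc (n - q)) b' s + cech_delta N b J s))" for J
  have "cech_delta N (cech_delta N b) J = (\<lambda>_. 0)" if "J \<subseteq> {..<N}" for J
    using cech_delta_square[of J N b] finite_subset[OF that] by auto
  moreover have "b' J \<in> l1_chains (saturated X (\<Inter> (W ` J)) (Suc (n - q))) \<and>
    zigzag q J = (\<lambda>s. rchain_boundary (Suc (n - q)) (b' J) s + cech_delta N b J s)"
    if "J \<subseteq> {..<N}" "J \<noteq> {}" for J
    unfolding b'_def by (rule someI_ex[OF zigzag_splits[OF split q that]])
  ultimately have "splitting q b' (cech_delta N b)" unfolding splitting_def by blast
  then show thesis by (rule that)
qed

lemma small_cycle_bounds:
  obtains b where "b \<in> l1_chains (Sing X (Suc n))" "rchain_boundary (Suc n) b = z"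
proof -
  have "\<exists>b r. splitting q b r" if "q \<le> k" for q
    using that
  proof (induction rule: inc_induct)
    case base
    then show ?case
      using splitting_multiplicity by blast
  next
    case (step q)
    then obtain b r where "splitting (Suc q) b r" by blast
    then show ?case
      using splitting_step[of q b r] step.hyps multiplicity_le by (metis le_trans Suc_leI)
  qed
  then obtain b r where split: "splitting 0 b r" by blast
  show thesis
  proof (rule that)
    show "rchain_boundary (Suc n) (cech_delta N b {}) = z" using boundary_splitting[OF split] by simp
    show "cech_delta N b {} \<in> l1_chains (Sing X (Suc n))"
      using splitting_insert[OF split, of "{}"]
      by (intro l1_chains_cech_delta l1_chains_mono[OF saturated_subset_Sing]) auto
  qed
qed

end

section \<open>Small simplices\<close>

definition real_of_chain :: "'a chain => 'a rchain" where
  "real_of_chain c s = real_of_int (Poly_Mapping.lookup c s)"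

lemma real_of_chain_diff: "real_of_chain (a - b) = (\<lambda>s. real_of_chain a s - real_of_chain b s)"
  and real_of_chain_add: "real_of_chain (a + b) = (\<lambda>s. real_of_chain a s + real_of_chain b s)"
  and real_of_chain_zero: "real_of_chain 0 = (\<lambda>_. 0)"
  and real_of_chain_cmul: "real_of_chain (frag_cmul k a) = (\<lambda>s. real_of_int k * real_of_chain a s)"
  by (simp_all add: real_of_chain_def[abs_def] lookup_minus lookup_add)

lemma real_of_chain_frag_of: "real_of_chain (frag_of s) = delta s"
  by (auto simp: real_of_chain_def delta_def fun_eq_iff)

lemma real_of_chain_sum: "real_of_chain (sum f I) = (\<lambda>s. \<Sum>i\<in>I. real_of_chain (f i) s)"
  by (induction I rule: infinite_finite_induct) (auto simp: real_of_chain_zero real_of_chain_add)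

lemma real_of_chain_keys: "real_of_chain c s \<noteq> 0 \<longleftrightarrow> s \<in> Poly_Mapping.keys c"
  by (simp add: real_of_chain_def in_keys_iff)

lemma l1_real_of_chain: "l1 (real_of_chain c)"
  by (rule l1_finite) (simp add: real_of_chain_keys)

lemma real_of_chain_in_l1_chains: "singular_chain p X c ==> real_of_chain c \<in> l1_chains (Sing X p)"
  by (auto simp: l1_chains_def l1_real_of_chain real_of_chain_keys singular_chain_def)

lemma pushforward_delta: "pushforward h (delta s) = delta (h s)"
proof
  fix t
  have "pushforward h (delta s) t = (\<Sum>\<^sub>\<infinity>r. of_bool (h r = t) * delta s r)"
    unfolding pushforward_def by (rule infsum_cong_neutral) auto
  also have "... = of_bool (h s = t)"
    using pairing_delta[of "\<lambda>r. of_bool (h r = t)" s] by (simp add: pairing_def)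
  finally show "pushforward h (delta s) t = delta (h s) t" by (auto simp: delta_def)
qed

lemma boundary_real_of_chain:
  fixes c :: "'a chain"
  shows "rchain_boundary (Suc p) (real_of_chain c) = real_of_chain (chain_boundary (Suc p) c)"
proof (rule frag_induction[of c UNIV])
  fix s :: "(nat => real) => 'a"
  have "rchain_boundary (Suc p) (real_of_chain (frag_of s)) = (\<lambda>t. \<Sum>k\<le>Suc p. (-1) ^ k * delta (singular_face (Suc p) k s) t)"
    unfolding real_of_chain_frag_of rchain_boundary_Suc pushforward_delta ..
  then show "rchain_boundary (Suc p) (real_of_chain (frag_of s)) = real_of_chain (chain_boundary (Suc p) (frag_of s))"
    unfolding chain_boundary_of
    by (simp add: real_of_chain_sum real_of_chain_cmul real_of_chain_frag_of del: sum.atMost_Suc)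
qed (simp_all add: real_of_chain_diff real_of_chain_zero chain_boundary_diff boundary_diff l1_real_of_chain boundary_zero)

subsection \<open>Chain homotopies of finite real cycles\<close>

definition linear_extension :: "(((nat => real) => 'a) => 'a chain) => 'a rchain => 'a rchain" where
  "linear_extension H z t = (\<Sum>s | z s \<noteq> 0. z s * real_of_chain (H s) t)"

lemma linear_extension_support:
  assumes "linear_extension H z t \<noteq> 0"
  obtains s where "z s \<noteq> 0" "t \<in> Poly_Mapping.keys (H s)"
proof -
  obtain s where "s \<in> {s. z s \<noteq> 0}" "z s * real_of_chain (H s) t \<noteq> 0"
    using assms unfolding linear_extension_def by (rule sum.not_neutral_contains_not_neutral)
  then show thesis using that real_of_chain_keys by auto
qed

lemma finite_linear_extension:
  assumes "finite {s. z s \<noteq> 0}"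
  shows "finite {t. linear_extension H z t \<noteq> 0}"
proof (rule finite_subset)
  show "{t. linear_extension H z t \<noteq> 0} \<subseteq> (\<Union>s\<in>{s. z s \<noteq> 0}. Poly_Mapping.keys (H s))"
    by (auto elim: linear_extension_support)
qed (use assms in simp)

lemma linear_extension_in_l1_chains:
  assumes "\<And>s. z s \<noteq> 0 ==> singular_chain p X (H s)"
  shows "linear_extension H z \<in> l1_chains (Sing X p)"
  unfolding linear_extension_def[abs_def]
  by (rule l1_chains_sum, rule l1_chains_scale, rule real_of_chain_in_l1_chains) (use assms in simp)

lemma linear_extension_frag_of:
  assumes "finite {s. z s \<noteq> 0}"
  shows "linear_extension frag_of z = z"
proof
  fix t
  have "linear_extension frag_of z t = (\<Sum>s | z s \<noteq> 0. if s = t then z t else 0)"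
    unfolding linear_extension_def real_of_chain_frag_of by (rule sum.cong) (auto simp: delta_def)
  then show "linear_extension frag_of z t = z t" using assms by simp
qed

lemma boundary_linear_extension:
  "rchain_boundary (Suc p) (linear_extension H z) = linear_extension (\<lambda>s. chain_boundary (Suc p) (H s)) z"
  unfolding linear_extension_def[abs_def]
  by (subst boundary_sum) (simp_all add: l1_scale l1_real_of_chain boundary_scale boundary_real_of_chain)

lemma sum_coboundary_cycle:
  fixes f :: "((nat => real) => 'a) => real"
  assumes fin: "finite {s. z s \<noteq> 0}" and z: "is_cycle (Suc m) z"
  shows "(\<Sum>s | z s \<noteq> 0. z s * coboundary m f s) = 0"
proof -
  let ?E = "(\<lambda>(s, k). singular_face (Suc m) k s) ` ({s. z s \<noteq> 0} \<times> {..Suc m})"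
  define g where "g t = (if t \<in> ?E then f t else 0)" for t
  have "finite ?E" using fin by simp
  then have "\<bar>g t\<bar> \<le> (\<Sum>t\<in>?E. \<bar>f t\<bar>)" for t
    using member_le_sum[of t ?E "\<lambda>t. \<bar>f t\<bar>"] by (auto simp: g_def sum_nonneg)
  then have g: "bdd_fun g" by (rule bdd_funI)
  have "coboundary m f s = coboundary m g s" if "z s \<noteq> 0" for s
    unfolding coboundary_def
  proof (intro sum.cong refl)
    fix k assume "k \<in> {..Suc m}"
    then have "singular_face (Suc m) k s \<in> ?E" using that by force
    then show "(-1) ^ k * f (singular_face (Suc m) k s) = (-1) ^ k * g (singular_face (Suc m) k s)"
      by (simp add: g_def)
  qed
  then have "(\<Sum>s | z s \<noteq> 0. z s * coboundary m f s) = (\<Sum>\<^sub>\<infinity>s | z s \<noteq> 0. coboundary m g s * z s)"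
    using fin by (auto intro: sum.cong simp: mult.commute)
  also have "... = pairing (coboundary m g) z" unfolding pairing_def by (rule infsum_cong_neutral) auto
  also have "... = pairing g (rchain_boundary (Suc m) z)"
    by (rule pairing_boundary[OF l1_finite[OF fin] g, symmetric])
  also have "... = 0" using z by (simp add: is_cycle_def pairing_def)
  finally show ?thesis .
qed

lemma real_of_chain_additive_boundary:
  assumes h: "\<And>c c'. h (c - c') = h c - h c'"
  shows "real_of_chain (h (chain_boundary (Suc m) (frag_of s))) t =
    coboundary m (\<lambda>r. real_of_chain (h (frag_of r)) t) s"
proof -
  have zero: "h 0 = 0" using h[of 0 0] by simp
  have minus: "h (- c) = - h c" for c
    using h[of 0 c] zero by simp
  have add: "h (c + c') = h c + h c'" for c c'
    using h[of c "- c'"] minus by simp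
  have sum: "h (sum f I) = (\<Sum>i\<in>I. h (f i))" for f and I :: "nat set"
    by (induction I rule: infinite_finite_induct) (auto simp: zero add)
  have "real_of_chain (h (frag_cmul ((-1) ^ k) c)) t = (-1) ^ k * real_of_chain (h c) t" for k c
    by (cases "even k") (auto simp: minus real_of_chain_def)
  then show ?thesis
    unfolding chain_boundary_of coboundary_def by (simp add: sum real_of_chain_sum del: sum.atMost_Suc)
qed

lemma boundary_chain_homotopy:
  assumes fin: "finite {s. z s \<noteq> 0}" and z: "is_cycle (Suc m) z" and h: "\<And>c c'. h (c - c') = h c - h c'"
    and homotopy: "\<And>s. z s \<noteq> 0 ==>
      chain_boundary (Suc (Suc m)) (g s) + h (chain_boundary (Suc m) (frag_of s)) = D s - frag_of s"
  shows "rchain_boundary (Suc (Suc m)) (linear_extension g z) = (\<lambda>t. linear_extension D z t - z t)"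
proof
  fix t
  let ?f = "\<lambda>r. real_of_chain (h (frag_of r)) t"
  have "real_of_chain (chain_boundary (Suc (Suc m)) (g s)) t =
      real_of_chain (D s) t - real_of_chain (frag_of s) t - coboundary m ?f s" if "z s \<noteq> 0" for s
  proof -
    have "chain_boundary (Suc (Suc m)) (g s) = D s - frag_of s - h (chain_boundary (Suc m) (frag_of s))"
      using homotopy[OF that] by (simp add: eq_diff_eq)
    then show ?thesis by (simp only: real_of_chain_diff real_of_chain_additive_boundary[OF h])
  qed
  then have "rchain_boundary (Suc (Suc m)) (linear_extension g z) t =
      (\<Sum>s | z s \<noteq> 0. z s * (real_of_chain (D s) t - real_of_chain (frag_of s) t - coboundary m ?f s))"
    unfolding boundary_linear_extension linear_extension_def by (intro sum.cong) auto
  also have "... = linear_extension D z t - linear_extension frag_of z t - (\<Sum>s | z s \<noteq> 0. z s * coboundary m ?f s)"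
    unfolding linear_extension_def by (simp only: right_diff_distrib sum_subtractf)
  also have "... = linear_extension D z t - z t"
    by (simp only: linear_extension_frag_of[OF fin] sum_coboundary_cycle[OF fin z] diff_zero)
  finally show "rchain_boundary (Suc (Suc m)) (linear_extension g z) t = linear_extension D z t - z t" .
qed

lemma uniform_subdivision_exists:
  assumes cover: "\<And>V. V \<in> C ==> openin X V" "topspace X \<subseteq> \<Union> C"
    and F: "finite F" "\<And>s. s \<in> F ==> singular_simplex p X s"
  obtains M where "\<forall>s\<in>F. \<forall>f\<in>Poly_Mapping.keys ((singular_subdivision p ^^ M) (frag_of s)).
    \<exists>V\<in>C. f ` standard_simplex p \<subseteq> V"
proof -
  let ?fine = "\<lambda>s M. \<forall>f\<in>Poly_Mapping.keys ((singular_subdivision p ^^ M) (frag_of s)). \<exists>V\<in>C. f ` standard_simplex p \<subseteq> V"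
  have "\<forall>\<^sub>F M in sequentially. ?fine s M" if "s \<in> F" for s
  proof -
    have "singular_chain p X (frag_of s)" using F(2)[OF that] by (simp add: singular_chain_of)
    then obtain n where "\<And>M f. n \<le> M ==> f \<in> Poly_Mapping.keys ((singular_subdivision p ^^ M) (frag_of s)) ==>
        \<exists>V\<in>C. f \<in> standard_simplex p \<rightarrow> V"
      using sufficient_iterated_singular_subdivision_exists[OF cover] by blast
    then show ?thesis unfolding eventually_sequentially image_subset_iff_funcset by blast
  qed
  then have "\<forall>\<^sub>F M in sequentially. \<forall>s\<in>F. ?fine s M"
    using F(1) by (simp add: eventually_ball_finite)
  from eventually_happens'[OF sequentially_bot this] obtain M where "\<forall>s\<in>F. ?fine s M" ..
  then show thesis by (rule that)
qed

lemma small_homologous_cycle_exists: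
  assumes cover: "\<And>V. V \<in> C ==> openin X V" "topspace X \<subseteq> \<Union> C"
    and z: "real_chain (Suc m) X z" "is_cycle (Suc m) z"
  obtains z' c where "finite {s. z' s \<noteq> 0}" "is_cycle (Suc m) z'"
    "\<And>s. z' s \<noteq> 0 ==> singular_simplex (Suc m) X s \<and> (\<exists>V\<in>C. s ` standard_simplex (Suc m) \<subseteq> V)"
    "c \<in> l1_chains (Sing X (Suc (Suc m)))" "rchain_boundary (Suc (Suc m)) c = (\<lambda>s. z' s - z s)"
proof -
  have fin: "finite {s. z s \<noteq> 0}" and z_simplex: "\<And>s. z s \<noteq> 0 ==> singular_simplex (Suc m) X s"
    using z(1) by (auto simp: real_chain_def)
  obtain M where M: "\<forall>s\<in>{s. z s \<noteq> 0}. \<forall>f\<in>Poly_Mapping.keys ((singular_subdivision (Suc m) ^^ M) (frag_of s)).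
      \<exists>V\<in>C. f ` standard_simplex (Suc m) \<subseteq> V"
  proof (rule uniform_subdivision_exists[OF cover fin])
    show "singular_simplex (Suc m) X s" if "s \<in> {s. z s \<noteq> 0}" for s using that z_simplex by simp
  qed (assumption, rule that)
  obtain h :: "nat => 'a chain => 'a chain" where h: "\<And>p c c'. h p (c - c') = h p c - h p c'"
    "\<And>p X c. singular_chain p X c ==> singular_chain (Suc p) X (h p c)"
    "\<And>p X c. singular_chain p X c ==>
      chain_boundary (Suc p) (h p c) + h (p - Suc 0) (chain_boundary p c) = (singular_subdivision p ^^ M) c - c"
    by (rule chain_homotopic_iterated_singular_subdivision[of M]) (rule that)
  let ?D = "\<lambda>s. (singular_subdivision (Suc m) ^^ M) (frag_of s)"
  define z' where "z' = linear_extension ?D z"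
  define c where "c = linear_extension (\<lambda>s. h (Suc m) (frag_of s)) z"
  have chain: "singular_chain (Suc m) X (frag_of s)" if "z s \<noteq> 0" for s
    using z_simplex[OF that] by (simp add: singular_chain_of)
  have subdivided: "singular_chain (Suc m) X ((singular_subdivision (Suc m) ^^ l) (frag_of s))" if "z s \<noteq> 0" for s l
    by (induction l) (auto simp: singular_chain_singular_subdivision chain[OF that])
  have c: "c \<in> l1_chains (Sing X (Suc (Suc m)))"
    unfolding c_def by (intro linear_extension_in_l1_chains h(2) chain)
  have boundary: "rchain_boundary (Suc (Suc m)) c = (\<lambda>s. z' s - z s)"
    unfolding c_def z'_def by (rule boundary_chain_homotopy[OF fin z(2) h(1)]) (use h(3)[OF chain] in simp)
  have z': "finite {s. z' s \<noteq> 0}" unfolding z'_def by (rule finite_linear_extension[OF fin])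
  have "is_cycle (Suc m) (\<lambda>s. z' s - z s)"
    unfolding boundary[symmetric] by (rule boundary_boundary[OF l1_chains_l1[OF c]])
  then have "is_cycle (Suc m) z'"
    using z(2) by (simp add: is_cycle_def boundary_diff[OF l1_finite[OF z'] l1_finite[OF fin]])
  moreover have "singular_simplex (Suc m) X s \<and> (\<exists>V\<in>C. s ` standard_simplex (Suc m) \<subseteq> V)" if nonzero: "z' s \<noteq> 0" for s
  proof -
    obtain r where r: "z r \<noteq> 0" "s \<in> Poly_Mapping.keys (?D r)"
      using nonzero unfolding z'_def by (rule linear_extension_support)
    then show ?thesis using M r subdivided[OF r(1), of M] by (auto simp: singular_chain_def)
  qed
  ultimately show thesis using that z' c boundary by blast
qed

lemma finite_choice_enumeration:
  assumes F: "finite F" and P: "\<And>s. s \<in> F ==> \<exists>i\<in>I. P s i"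
  obtains e :: "nat => 'i" and N where "inj_on e {..<N}" "e ` {..<N} \<subseteq> I" "\<And>s. s \<in> F ==> \<exists>j<N. P s (e j)"
proof -
  obtain i where i: "\<And>s. s \<in> F ==> i s \<in> I" "\<And>s. s \<in> F ==> P s (i s)"
    using bchoice[of F "\<lambda>s i. i \<in> I \<and> P s i"] P by blast
  obtain e :: "nat => 'i" where e: "bij_betw e {0..<card (i ` F)} (i ` F)"
    using ex_bij_betw_nat_finite[of "i ` F"] F by blast
  show thesis
  proof (rule that)
    show "inj_on e {..<card (i ` F)}" using e by (simp add: bij_betw_def atLeast0LessThan)
    have image: "e ` {..<card (i ` F)} = i ` F" using e by (simp add: bij_betw_def atLeast0LessThan)
    then show "e ` {..<card (i ` F)} \<subseteq> I" using i(1) by auto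
    show "\<exists>j<card (i ` F). P s (e j)" if "s \<in> F" for s
    proof -
      have "i s \<in> e ` {..<card (i ` F)}" using that unfolding image by simp
      then show ?thesis using i(2)[OF that] by auto
    qed
  qed
qed

lemma small_real_cycle_bounds:
  fixes U :: "'i => 'a set"
  assumes amenable: "\<And>i. i \<in> I ==> amenable_in X (U i)"
    and card: "\<And>J. J \<subseteq> I ==> topspace X \<inter> \<Inter> (U ` J) \<noteq> {} ==> card J \<le> k" and "k \<le> n"
    and fin: "finite {s. z s \<noteq> 0}" and cycle: "is_cycle n z"
    and small: "\<And>s. z s \<noteq> 0 ==> singular_simplex n X s \<and> (\<exists>i\<in>I. s ` standard_simplex n \<subseteq> U i)"
  obtains b where "b \<in> l1_chains (Sing X (Suc n))" "rchain_boundary (Suc n) b = z"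
proof -
  obtain e :: "nat => 'i" and N where e: "inj_on e {..<N}" "e ` {..<N} \<subseteq> I"
    "\<And>s. s \<in> {s. z s \<noteq> 0} ==> \<exists>j<N. s ` standard_simplex n \<subseteq> U (e j)"
    using finite_choice_enumeration[OF fin, of I "\<lambda>s i. s ` standard_simplex n \<subseteq> U i"] small by blast
  interpret amenable_cover X "U \<circ> e" N k
  proof
    show "amenable_in X ((U \<circ> e) j)" if "j < N" for j
      using amenable e(2) that by auto
    show "card J \<le> k" if J: "J \<subseteq> {..<N}" "topspace X \<inter> \<Inter> ((U \<circ> e) ` J) \<noteq> {}" for J
    proof -
      have "card (e ` J) \<le> k" using J e(2) by (intro card) (auto simp: image_comp)
      then show ?thesis using card_image[OF inj_on_subset[OF e(1) J(1)]] by simp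
    qed
  qed
  have "z \<in> l1_chains (small_in {} n)"
    using l1_finite[OF fin] small e(3) by (auto simp: l1_chains_def small_in_def)
  then interpret small_cycle X "U \<circ> e" N k n z
    by unfold_locales (use \<open>k \<le> n\<close> cycle in auto)
  show thesis
    using small_cycle_bounds that .
qed

lemma card_le_cover_multiplicity:
  "cover_multiplicity X I U k ==> J \<subseteq> I ==> topspace X \<inter> \<Inter> (U ` J) \<noteq> {} ==> card J \<le> k"
  by (simp add: cover_multiplicity_def)

lemma cover_multiplicity_pos:
  assumes cover: "(\<Union>i\<in>I. U i) = topspace X" and mult: "cover_multiplicity X I U k"
  shows "0 < k"
proof -
  obtain J where "topspace X \<inter> \<Inter> (U ` J) \<noteq> {}"
    using mult unfolding cover_multiplicity_def by blast
  then obtain x i where "x \<in> topspace X" "i \<in> I" "x \<in> U i" unfolding cover[symmetric] by blast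
  then have "card {i} \<le> k" by (intro card_le_cover_multiplicity[OF mult]) auto
  then show ?thesis by simp
qed

theorem theorem2:
  fixes X :: "'a topology" and I :: "'i set" and U :: "'i \<Rightarrow> 'a set"
    and k n :: nat and z :: "'a rchain"
  assumes open_cover: "\<forall>i\<in>I. openin X (U i)" "(\<Union>i\<in>I. U i) = topspace X"
    and amenable: "\<forall>i\<in>I. amenable_in X (U i)"
    and mult: "cover_multiplicity X I U k"
    and "n \<ge> k"
    and cycle: "real_chain n X z" "rchain_boundary n z = (\<lambda>_. 0)"
  shows "\<exists>b. l1_chain (Suc n) X b \<and> rchain_boundary (Suc n) b = z"
proof -
  obtain m where n: "n = Suc m"
    using cover_multiplicity_pos[OF open_cover(2) mult] \<open>n \<ge> k\<close> by (cases n) auto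
  obtain z' c where z': "finite {s. z' s \<noteq> 0}" "is_cycle n z'"
    "\<And>s. z' s \<noteq> 0 \<Longrightarrow> singular_simplex n X s \<and> (\<exists>V\<in>U ` I. s ` standard_simplex n \<subseteq> V)"
    and c: "c \<in> l1_chains (Sing X (Suc n))" "rchain_boundary (Suc n) c = (\<lambda>s. z' s - z s)"
    by (rule small_homologous_cycle_exists[of "U ` I" X m z, folded n is_cycle_def])
      (use open_cover cycle in \<open>auto simp: is_cycle_def\<close>)
  obtain b where b: "b \<in> l1_chains (Sing X (Suc n))" "rchain_boundary (Suc n) b = z'"
    by (rule small_real_cycle_bounds[OF _ card_le_cover_multiplicity[OF mult] \<open>n \<ge> k\<close> z'(1,2)])
      (use amenable z'(3) in auto)
  have "rchain_boundary (Suc n) (\<lambda>s. b s - c s) = z"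
    by (simp add: boundary_diff l1_chains_l1[OF b(1)] l1_chains_l1[OF c(1)] b(2) c(2))
  moreover have "l1_chain (Suc n) X (\<lambda>s. b s - c s)"
    using l1_chains_diff[OF b(1) c(1)] by (auto simp: l1_chains_def l1_chain_def l1_def)
  ultimately show ?thesis by blast
qed

end
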